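(* There exists $T>0$ depending only on $\mathring f^\pm$, $R_x$, $R_v$ and $d$ such that for all $B\in W^{1,\infty}([0,T]\times\Omega_x;\mathbb{R}^{d_B})$ there exists a unique strong solution $f=(f^-,f^+)$ with $f^\pm\in W^{1,\infty}([0,T]\times\mathbb{R}^D)$ of the Vlasov--Poisson system $$\partial_t f^\pm+\mu_x^\pm v\cdot\partial_x f^\pm+\mu_v^\pm\big(E_f+\mu_x^\pm v\otimes B\big)\cdot\partial_v f^\pm=0,\qquad f^\pm|_{t=0}=\mathring f^\pm,$$ to the initial data $\mathring f$ with $\operatorname{supp} f^\pm(t)\subset\overline\Omega$ for all $t\in[0,T]$.
   Context: Dimensions: $d=(d_x,d_v)\in\{(1,2),(2,2),(2,3)\}$ is fixed, $D=d_x+d_v$, $x\in\mathbb{R}^{d_x}$ is position, $v\in\mathbb{R}^{d_v}$ is velocity. $d_B=1$ if $d_v=2$ and $d_B=3$ if $d_v=3$. For fixed radii $R_x,R_v>0$, $\Omega_x$ and $\Omega_v$ are the open balls of radius $R_x$ in $\mathbb{R}^{d_x}$ and of radius $R_v$ in $\mathbb{R}^{d_v}$ centered at $0$, and $\Omega=\Omega_x\times\Omega_v$. Scaling parameters: $\mu_x^-=1$, $\mu_v^-=-1$, and $\mu_x^+,\mu_v^+>0$ are fixed constants. Initial data: $\mathring f=(\mathring f^-,\mathring f^+)$ with $\mathring f^\pm\in C^1_c(\mathbb{R}^D;[0,\infty))$, $\operatorname{supp}\mathring f^\pm\subset\Omega$, and $\int_{\mathbb{R}^D}(\mathring f^+-\mathring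 f^-)\,\mathrm dv\,\mathrm dx=0$. Notation: $\partial_x=\nabla_x$, $\partial_v=\nabla_v$. In sums and scalar products of vectors of different length the shorter vector is filled up by zeros. $F\otimes G=F\times G$ (cross product) if $F,G\in\mathbb{R}^3$, and $F\otimes G=(F_2,-F_1)^TG$ if $F\in\mathbb{R}^2$, $G\in\mathbb{R}$. Charge density and field: $\rho_f(t,x)=\int_{\mathbb{R}^{d_v}}(f^+-f^-)(t,x,v)\,\mathrm dv$; $E_f(t,x)=\int_{-\infty}^x\rho_f(t,y)\,\mathrm dy$ if $d_x=1$, and $E_f(t,x)=\frac1{2\pi}\int_{\mathbb{R}^2}\frac{x-y}{|x-y|^2}\rho_f(t,y)\,\mathrm dy$ if $d_x=2$. The field $B$ needs to be defined only on $[0,T]\times\Omega_x$ (and, being Lipschitz, extends continuously to $[0,T]\times\overline{\Omega_x}$), since $f^\pm(t)$ is supported in $\overline\Omega$. A strong solution is a pair $f=(f^-,f^+)$ with $f^\pm\in W^{1,\infty}([0,T]\times\mathbb{R}^D)$ (hence continuous) satisfying the Vlasov equations almost everywhere in $[0,T]\times\mathbb{R}^D$ and the initial condition. *)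

theory Defs
  imports "HOL-Analysis.Analysis"
begin

section \<open>Coordinates of vectors of different length\<close>

text \<open>
  The dimensions enter as cardinalities of linearly ordered finite index types. The rank
  \<open>card {..i}\<close> of an index \<open>i\<close> runs through \<open>1, \<dots>, n\<close>, so \<open>coord k x\<close> is the usual \<open>x\<^sub>k\<close>,
  and it is \<open>0\<close> if \<open>k\<close> exceeds the length of \<open>x\<close>. Pitfall: for the numeral index types the
  order starts with \<open>0\<close>, so the coordinates of \<open>x :: real ^ 2\<close> are enumerated as
  \<open>x $ 0 = x $ 2\<close>, then \<open>x $ 1\<close>.
\<close>

definition coord :: "nat \<Rightarrow> real ^ 'n::{finite,linorder} \<Rightarrow> real" where
  "coord k x = (\<Sum>i | card {..i} = k. x $ i)"

definition vec_of :: "(nat \<Rightarrow> real) \<Rightarrow> real ^ 'n::{finite,linorder}" where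
  "vec_of a = (\<chi> i. a (card {..i}))"

definition zpad :: "real ^ 'n::{finite,linorder} \<Rightarrow> real ^ 'm::{finite,linorder}" where
  "zpad x = vec_of (\<lambda>k. coord k x)"

text \<open>
  \<open>(F\<^sub>2, -F\<^sub>1) G\<close> for \<open>F \<in> \<real>\<^sup>2\<close> and scalar \<open>G\<close>, and the cross product for \<open>F, G \<in> \<real>\<^sup>3\<close>.
\<close>

definition otimes :: "real ^ 'v::{finite,linorder} \<Rightarrow> real ^ 'b::{finite,linorder} \<Rightarrow> real ^ 'v::{finite,linorder}"
    (infixl "\<otimes>" 70) where
  "F \<otimes> G =
    (if CARD('v::{finite,linorder}) = 2 then
       vec_of (\<lambda>k. if k = 1 then coord 2 F * coord 1 G
                   else - coord 1 F * coord 1 G)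
     else
       vec_of (\<lambda>k. if k = 1 then coord 2 F * coord 3 G - coord 3 F * coord 2 G
                   else if k = 2 then coord 3 F * coord 1 G - coord 1 F * coord 3 G
                   else coord 1 F * coord 2 G - coord 2 F * coord 1 G))"


section \<open>Function spaces\<close>

definition supp :: "('a::topological_space \<Rightarrow> real) \<Rightarrow> 'a set" where
  "supp f = closure {z. f z \<noteq> 0}"

definition C1 :: "('a::euclidean_space \<Rightarrow> real) \<Rightarrow> bool" where
  "C1 f \<longleftrightarrow> (\<exists>G. continuous_on UNIV G \<and> (\<forall>z. (f has_derivative (\<lambda>h. G z \<bullet> h)) (at z)))"

text \<open>Iterated directional derivatives; a function is smooth if all of them exist.\<close>

primrec iter_deriv :: "'a list \<Rightarrow> ('a::euclidean_space \<Rightarrow> real) \<Rightarrow> 'a \<Rightarrow> real" where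
  "iter_deriv [] f = f"
| "iter_deriv (e # es) f = (\<lambda>z. frechet_derivative (iter_deriv es f) (at z) e)"

definition smooth :: "('a::euclidean_space \<Rightarrow> real) \<Rightarrow> bool" where
  "smooth f \<longleftrightarrow> (\<forall>es z. iter_deriv es f differentiable (at z))"

definition test_functions :: "'a::euclidean_space set \<Rightarrow> ('a \<Rightarrow> real) set" where
  "test_functions U = {\<phi>. smooth \<phi> \<and> compact (supp \<phi>) \<and> supp \<phi> \<subseteq> U}"

definition Linfty :: "'a::euclidean_space set \<Rightarrow> ('a \<Rightarrow> 'b::euclidean_space) \<Rightarrow> bool" where
  "Linfty U f \<longleftrightarrow> f \<in> borel_measurable (lebesgue_on U) \<and>
     (\<exists>C. AE z in lebesgue_on U. norm (f z) \<le> C)"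

text \<open>
  On an open set \<open>U\<close>: \<open>f\<close> is in \<open>W\<^sup>1\<^sup>,\<^sup>\<infinity>(U)\<close> with weak gradient \<open>G\<close>.
\<close>

definition has_W1inf_gradient ::
    "'a::euclidean_space set \<Rightarrow> ('a \<Rightarrow> real) \<Rightarrow> ('a \<Rightarrow> 'a) \<Rightarrow> bool" where
  "has_W1inf_gradient U f G \<longleftrightarrow> Linfty U f \<and> Linfty U G \<and>
     (\<forall>\<phi>\<in>test_functions U. \<forall>e\<in>Basis.
        (LINT z|lebesgue_on U. f z * frechet_derivative \<phi> (at z) e) =
        - (LINT z|lebesgue_on U. (G z \<bullet> e) * \<phi> z))"

definition W1inf :: "'a::euclidean_space set \<Rightarrow> ('a \<Rightarrow> real) \<Rightarrow> bool" where
  "W1inf U f \<longleftrightarrow> (\<exists>G. has_W1inf_gradient U f G)"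


section \<open>The Vlasov--Poisson system\<close>

datatype species = Minus | Plus

definition phase_domain :: "real \<Rightarrow> real \<Rightarrow> ((real ^ 'dx) \<times> (real ^ 'dv)) set" where
  "phase_domain Rx Rv = ball 0 Rx \<times> ball 0 Rv"

text \<open>Phase space functions take arguments \<open>(t, x, v)\<close>.\<close>

definition charge_density ::
    "(species \<Rightarrow> real \<times> (real ^ 'dx) \<times> (real ^ 'dv) \<Rightarrow> real) \<Rightarrow> real \<Rightarrow> (real ^ 'dx) \<Rightarrow> real" where
  "charge_density f t x = (LINT v|lborel. f Plus (t, x, v) - f Minus (t, x, v))"

text \<open>In dimension one \<open>i\<close> is the only index, and the domain of integration is \<open>(-\<infinity>, x]\<close>.\<close>

definition efield ::
    "(species \<Rightarrow> real \<times> (real ^ 'dx) \<times> (real ^ 'dv) \<Rightarrow> real) \<Rightarrow> real \<Rightarrow> (real ^ 'dx) \<Rightarrow> (real ^ 'dx)" where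
  "efield f t x =
    (if CARD('dx) = 1 then
       (\<chi> i. LINT y|lebesgue_on {y. y $ i \<le> x $ i}. charge_density f t y)
     else
       (1 / (2 * pi)) *\<^sub>R
         (LINT y|lborel. (charge_density f t y / (norm (x - y))\<^sup>2) *\<^sub>R (x - y)))"

text \<open>
  \<open>W\<^sup>1\<^sup>,\<^sup>\<infinity>\<close> functions \<open>f\<close> on \<open>[0,T] \<times> \<real>\<^sup>D\<close> are represented by their continuous representative; weak
  derivatives live on the interior, and the components of the weak gradient \<open>G\<close> are
  \<open>(\<partial>\<^sub>t f, \<partial>\<^sub>x f, \<partial>\<^sub>v f)\<close>. The values of the total function \<open>B\<close> outside \<open>[0,T] \<times> \<Omega>\<^sub>x\<close> are
  irrelevant for solutions supported in the closure of \<open>\<Omega>\<close>: they are multiplied by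
  \<open>\<partial>\<^sub>v f\<close>, which vanishes almost everywhere there.
\<close>

definition strong_solution ::
    "(species \<Rightarrow> real) \<Rightarrow> (species \<Rightarrow> real) \<Rightarrow>
     (species \<Rightarrow> (real ^ 'dx::{finite,linorder}) \<times> (real ^ 'dv::{finite,linorder}) \<Rightarrow> real) \<Rightarrow>
     real \<Rightarrow> (real \<times> (real ^ 'dx::{finite,linorder}) \<Rightarrow> (real ^ 'db::{finite,linorder})) \<Rightarrow>
     (species \<Rightarrow> real \<times> (real ^ 'dx::{finite,linorder}) \<times> (real ^ 'dv::{finite,linorder}) \<Rightarrow> real) \<Rightarrow> bool" where
  "strong_solution mu_x mu_v f0 T B f \<longleftrightarrow>
    (\<forall>s. continuous_on ({0..T} \<times> UNIV) (f s) \<and>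
         (\<forall>x v. f s (0, x, v) = f0 s (x, v)) \<and>
         (\<exists>G. has_W1inf_gradient ({0<..<T} \<times> UNIV) (f s) G \<and>
           (AE z in lebesgue_on ({0..T} \<times> UNIV). case (z, G z) of ((t, x, v), (dt_f, dx_f, dv_f)) \<Rightarrow>
              dt_f + mu_x s * (v \<bullet> zpad dx_f)
              + mu_v s * ((zpad (efield f t x) + mu_x s *\<^sub>R (v \<otimes> B (t, x))) \<bullet> dv_f) = 0)))"

end

theory Submission
  imports Defs
begin

text \<open>
  The solution is constructed from a fixed point of \<open>E \<mapsto> f \<mapsto> E\<^sub>f\<close>, where \<open>f\<close> is the initial datum
  transported backward along the characteristics of a given field \<open>E\<close>. The magnetic part of the force
  does no work and \<open>|E|\<close> is controlled by the support and the supremum of the initial datum, so the time for which the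
  support stays inside \<open>\<Omega>\<close> does not depend on \<open>B\<close>. The set of admissible fields is preserved for
  all times because the Lipschitz constant of \<open>E\<^sub>f\<close> depends only logarithmically on that of \<open>f\<close>, while
  the latter grows exponentially with the integral of the Lipschitz constant of \<open>E\<close>: the two estimates
  close as a linear Gronwall inequality, with the bound \<open>H exp (H t)\<close>. The map contracts in a norm with
  exponential weight in time. The equation then holds at every point of differentiability of \<open>f\<close>, hence
  almost everywhere by Rademacher's theorem, since \<open>f\<close> is constant along characteristics.

  For uniqueness, \<open>W\<^sup>1\<^sup>,\<^sup>\<infinity>\<close> solutions are Lipschitz, and the difference of two of them is estimated in a
  time-weighted \<open>L\<^sup>2\<close> norm: the transport terms integrate to zero and the interaction term is bounded by Schur's test.
\<close>

section \<open>Smooth test functions\<close>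

text \<open>Hypothesis and conclusion speak of weak derivatives, the transport argument of pointwise
  ones. The bridge is the difference quotient with steps \<open>1 / 2 ^ n\<close>: for Lipschitz
  functions it converges almost everywhere, and translation invariance of Lebesgue measure moves it
  to the other factor of an integral. Rademacher's theorem, the identification of weak gradients
  with \<open>grad\<close>, and the integration by parts against a drift that is only measurable
  rest on this.

  Since \<open>T\<close> must not see \<open>B\<close>, only the sizes of the support, of the datum
  and of the electric field enter its choice. Every constant that involves \<open>B\<close> goes
  into the exponents of weights in time, whose rates are free. Characteristics are those of a
  bounded field on the whole space, with a Lipschitz representative of \<open>B\<close> and
  truncated velocities; the constructed solution does not feel this, because its support keeps a
  positive distance from the boundary of the domain. In the uniqueness proof only the gradient of
  one of the two solutions appears as a coefficient, and it is bounded.\<close>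

definition exp_inv :: "nat \<Rightarrow> real \<Rightarrow> real" where
  "exp_inv n t = (if t \<le> 0 then 0 else exp (- (1 / t)) / t ^ n)"

lemma exp_inv_tendsto_0: "((exp_inv n) \<longlongrightarrow> 0) (at 0)"
proof -
  have "((\<lambda>x. x ^ n / exp x) \<longlongrightarrow> 0) (at_top :: real filter)"
    by (rule tendsto_power_div_exp_0)
  moreover have "filterlim (\<lambda>t::real. inverse t) at_top (at_right 0)"
    by (rule filterlim_inverse_at_top_right)
  ultimately have "((\<lambda>t. (inverse t) ^ n / exp (inverse t)) \<longlongrightarrow> 0) (at_right (0::real))"
    by (rule filterlim_compose)
  moreover have "\<forall>\<^sub>F t in at_right (0::real). (inverse t) ^ n / exp (inverse t) = exp_inv n t"
    unfolding eventually_at_filter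
    by (rule eventually_mono[OF eventually_True]) (auto simp: exp_inv_def exp_minus field_simps)
  ultimately have r: "(exp_inv n \<longlongrightarrow> 0) (at_right 0)"
    using tendsto_cong by fastforce
  have "\<forall>\<^sub>F t in at_left (0::real). 0 = exp_inv n t"
    unfolding eventually_at_filter
    by (rule eventually_mono[OF eventually_True]) (auto simp: exp_inv_def)
  then have "(exp_inv n \<longlongrightarrow> 0) (at_left 0)"
    using tendsto_cong tendsto_const by fastforce
  with r show ?thesis by (simp add: filterlim_split_at)
qed

text \<open>Differentiating exp (-1/t) produces the factor 1/t^2, so only the family with all powers
  in the denominator is closed under differentiation up to linear combinations. At 0 the difference
  quotient of \<open>exp_inv n\<close> is \<open>exp_inv (n + 1)\<close>, which tends to 0.\<close>

lemma exp_inv_deriv: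
  "(exp_inv n has_real_derivative (exp_inv (n+2) t - real n * exp_inv (n+1) t)) (at t)"
proof -
  consider "t > 0" | "t < 0" | "t = 0" by linarith
  then show ?thesis
  proof cases
    case 1
    have d: "((\<lambda>t. exp (- (1 / t)) * inverse (t ^ n)) has_real_derivative
        exp (-(1/t)) * (1/t^2) * inverse (t^n) + exp (-(1/t)) * (- (real n * t^(n-1)) * inverse (t^n) * inverse (t^n))) (at t)"
      using 1 by (auto intro!: derivative_eq_intros simp: power2_eq_square field_simps)
    have e: "exp (-(1/t)) * (1/t^2) * inverse (t^n) + exp (-(1/t)) * (- (real n * t^(n-1)) * inverse (t^n) * inverse (t^n))
        = exp_inv (n+2) t - real n * exp_inv (n+1) t"
      using 1 by (cases n) (auto simp: exp_inv_def power2_eq_square field_simps)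
    show ?thesis
      by (rule has_field_derivative_transform_within_open[OF d[unfolded e], of "{0<..}"])
         (use 1 in \<open>auto simp: exp_inv_def field_simps\<close>)
  next
    case 2
    have z: "((\<lambda>t. 0) has_real_derivative 0) (at t)" by simp
    have "(exp_inv n has_real_derivative 0) (at t)"
      by (rule has_field_derivative_transform_within_open[OF z, of "{..<0}"])
         (use 2 in \<open>auto simp: exp_inv_def\<close>)
    then show ?thesis using 2 by (simp add: exp_inv_def)
  next
    case 3
    have "((\<lambda>y. (exp_inv n y - exp_inv n 0) / (y - 0)) \<longlongrightarrow> 0) (at 0)"
      by (rule Lim_transform_eventually[OF exp_inv_tendsto_0[of "n+1"]])
         (auto simp: eventually_at_filter exp_inv_def field_simps)
    then show ?thesis using 3 by (simp add: has_field_derivative_iff exp_inv_def)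
  qed
qed

lemma exp_inv_nonneg: "0 \<le> exp_inv n t" by (simp add: exp_inv_def)

lemma exp_inv_0_le_1: "exp_inv 0 t \<le> 1" by (simp add: exp_inv_def)

lemma exp_inv_eq_0_iff: "exp_inv n t = 0 \<longleftrightarrow> t \<le> 0"
  by (auto simp: exp_inv_def)

text \<open>
  Closed under directional derivatives, hence made of smooth functions.
\<close>

inductive_set smooth_algebra :: "('a::euclidean_space \<Rightarrow> real) set" where
  const: "(\<lambda>z. c) \<in> smooth_algebra"
| exp_inv: "(\<lambda>z. exp_inv n (w \<bullet> z + c)) \<in> smooth_algebra"
| add: "f \<in> smooth_algebra \<Longrightarrow> g \<in> smooth_algebra \<Longrightarrow> (\<lambda>z. f z + g z) \<in> smooth_algebra"
| mult: "f \<in> smooth_algebra \<Longrightarrow> g \<in> smooth_algebra \<Longrightarrow> (\<lambda>z. f z * g z) \<in> smooth_algebra"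

lemma smooth_algebra_has_derivative:
  assumes "f \<in> smooth_algebra"
  shows "\<exists>D. (\<forall>z. (f has_derivative D z) (at z)) \<and> (\<forall>e. (\<lambda>z. D z e) \<in> smooth_algebra)"
  using assms
proof induction
  case (const c)
  show ?case by (rule exI[of _ "\<lambda>z h. 0"]) (auto intro: smooth_algebra.const)
next
  case (exp_inv n w c)
  have d: "((\<lambda>z. exp_inv n (w \<bullet> z + c)) has_derivative
     (\<lambda>h. (w \<bullet> h) * (exp_inv (n+2) (w \<bullet> z + c) - real n * exp_inv (n+1) (w \<bullet> z + c)))) (at z)" for z
    by (rule DERIV_compose_FDERIV[OF exp_inv_deriv]) (auto intro!: derivative_eq_intros)
  have m: "(\<lambda>z. (w \<bullet> e) * (exp_inv (n+2) (w \<bullet> z + c) - real n * exp_inv (n+1) (w \<bullet> z + c))) \<in> smooth_algebra" for e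
    using smooth_algebra.mult[OF smooth_algebra.const[of "w \<bullet> e"] smooth_algebra.add[OF smooth_algebra.exp_inv[of "n+2" w c]
      smooth_algebra.mult[OF smooth_algebra.const[of "- real n"] smooth_algebra.exp_inv[of "n+1" w c]]]] by simp
  show ?case using d m by (intro exI[of _ "\<lambda>z h. (w \<bullet> h) * (exp_inv (n+2) (w \<bullet> z + c) - real n * exp_inv (n+1) (w \<bullet> z + c))"]) blast
next
  case (add f g)
  then obtain D1 D2 where "\<forall>z. (f has_derivative D1 z) (at z)" "\<forall>e. (\<lambda>z. D1 z e) \<in> smooth_algebra"
    "\<forall>z. (g has_derivative D2 z) (at z)" "\<forall>e. (\<lambda>z. D2 z e) \<in> smooth_algebra" by blast
  then show ?case
    by (intro exI[of _ "\<lambda>z h. D1 z h + D2 z h"]) (auto intro!: derivative_intros smooth_algebra.add)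
next
  case (mult f g)
  then obtain D1 D2 where "\<forall>z. (f has_derivative D1 z) (at z)" "\<forall>e. (\<lambda>z. D1 z e) \<in> smooth_algebra"
    "\<forall>z. (g has_derivative D2 z) (at z)" "\<forall>e. (\<lambda>z. D2 z e) \<in> smooth_algebra" by blast
  then show ?case using mult(1,2)
    by (intro exI[of _ "\<lambda>z h. f z * D2 z h + D1 z h * g z"])
       (auto intro!: derivative_intros smooth_algebra.add smooth_algebra.mult)
qed

lemma smooth_algebra_smooth:
  assumes "f \<in> smooth_algebra" shows "smooth f"
proof -
  have "iter_deriv es f \<in> smooth_algebra" for es
  proof (induction es)
    case (Cons e es)
    obtain D where D: "\<forall>z. (iter_deriv es f has_derivative D z) (at z)" "\<forall>e. (\<lambda>z. D z e) \<in> smooth_algebra"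
      using smooth_algebra_has_derivative[OF Cons] by blast
    then have "frechet_derivative (iter_deriv es f) (at z) = D z" for z
      by (metis frechet_derivative_at)
    then show ?case using D(2) by simp
  qed (use assms in simp)
  then show ?thesis
    unfolding smooth_def differentiable_def using smooth_algebra_has_derivative by blast
qed

lemma smooth_algebra_prod:
  assumes "finite I" "\<And>i. i \<in> I \<Longrightarrow> f i \<in> smooth_algebra"
  shows "(\<lambda>z. \<Prod>i\<in>I. f i z) \<in> smooth_algebra"
  using assms by (induction I rule: finite_induct) (auto intro: smooth_algebra.const smooth_algebra.mult)

section \<open>Bump functions of boxes and the fundamental lemma of the calculus of
  variations\<close>

definition box_bump :: "'a \<Rightarrow> 'a \<Rightarrow> nat \<Rightarrow> 'a::euclidean_space \<Rightarrow> real" where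
  "box_bump a b k z = (\<Prod>i\<in>Basis. exp_inv 0 (real (Suc k) * ((z - a) \<bullet> i)) * exp_inv 0 (real (Suc k) * ((b - z) \<bullet> i)))"

lemma box_bump_smooth_algebra: "box_bump a b k \<in> smooth_algebra"
proof -
  have "(\<lambda>z. exp_inv 0 (real (Suc k) * ((z - a) \<bullet> i))) = (\<lambda>z. exp_inv 0 ((real (Suc k) *\<^sub>R i) \<bullet> z + (- real (Suc k) * (a \<bullet> i))))"
    "(\<lambda>z. exp_inv 0 (real (Suc k) * ((b - z) \<bullet> i))) = (\<lambda>z. exp_inv 0 ((- real (Suc k) *\<^sub>R i) \<bullet> z + (real (Suc k) * (b \<bullet> i))))" for i :: 'a
    by (simp_all add: algebra_simps inner_commute)
  then have "(\<lambda>z. exp_inv 0 (real (Suc k) * ((z - a) \<bullet> i))) \<in> smooth_algebra"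
    "(\<lambda>z. exp_inv 0 (real (Suc k) * ((b - z) \<bullet> i))) \<in> smooth_algebra" for i :: 'a
    by (simp_all only: smooth_algebra.exp_inv)
  then show ?thesis
    unfolding box_bump_def by (intro smooth_algebra_prod smooth_algebra.mult) auto
qed

lemma box_bump_bounds: "0 \<le> box_bump a b k z" "box_bump a b k z \<le> 1"
  unfolding box_bump_def
  by (auto intro!: prod_nonneg prod_le_1 mult_nonneg_nonneg mult_le_one exp_inv_nonneg exp_inv_0_le_1)

lemma box_bump_eq_0_iff: "box_bump a b k z = 0 \<longleftrightarrow> z \<notin> box a b"
  by (force simp: box_bump_def exp_inv_eq_0_iff mem_box mult_le_0_iff inner_diff_left)

lemma box_bump_test:
  assumes "cbox a b \<subseteq> U" shows "box_bump a b k \<in> test_functions U"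
proof -
  have "supp (box_bump a b k) = closure (box a b)"
    by (simp add: supp_def box_bump_eq_0_iff)
  moreover have "closure (box a b) \<subseteq> cbox a b"
    by (rule closure_minimal[OF box_subset_cbox closed_cbox])
  moreover have "compact (closure (box a b))"
    by (simp add: bounded_box)
  ultimately show ?thesis
    using assms smooth_algebra_smooth[OF box_bump_smooth_algebra] by (auto simp: test_functions_def)
qed

text \<open>The factor \<open>Suc k\<close> in the definition serves this limit: it drives the
  exponents of all factors to 0 inside the box, while the zero set stays the same for all k.\<close>

lemma box_bump_tendsto: "(\<lambda>k. box_bump a b k z) \<longlonglongrightarrow> indicator (box a b) z"
proof (cases "z \<in> box a b")
  case True
  have lim: "(\<lambda>k. exp_inv 0 (real (Suc k) * c)) \<longlonglongrightarrow> 1" if "c > 0" for c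
  proof -
    have "(\<lambda>k. inverse (real (Suc k))) \<longlonglongrightarrow> 0" by (rule LIMSEQ_inverse_real_of_nat)
    then have "(\<lambda>k. exp (- (inverse c * inverse (real (Suc k))))) \<longlonglongrightarrow> exp (- (inverse c * 0))"
      by (intro tendsto_intros)
    moreover have "exp_inv 0 (real (Suc k) * c) = exp (- (inverse c * inverse (real (Suc k))))" for k
    proof -
      have "real (Suc k) * c > 0" using that by simp
      then show ?thesis using that by (auto simp: exp_inv_def field_simps)
    qed
    ultimately show ?thesis by simp
  qed
  have "(\<lambda>k. box_bump a b k z) \<longlonglongrightarrow> (\<Prod>i\<in>(Basis::'a set). 1 * 1)"
    unfolding box_bump_def
    by (intro tendsto_prod tendsto_mult lim) (use True in \<open>auto simp: mem_box inner_diff_left\<close>)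
  then show ?thesis using True by simp
next
  case False
  then have "box_bump a b k z = 0" for k using box_bump_eq_0_iff by blast
  then show ?thesis using False by simp
qed

lemma smooth_algebra_continuous: "f \<in> smooth_algebra \<Longrightarrow> continuous_on S f"
  using smooth_algebra_has_derivative has_derivative_continuous continuous_at_imp_continuous_on by metis

text \<open>Dominated convergence turns the bumps into indicators, so the integrals over all boxes
  in U are nonnegative. Averages over shrinking cubes converge to the function almost everywhere,
  which makes the statement pointwise.\<close>

lemma box_bump_nonneg_imp_AE_nonneg:
  fixes u :: "'a::euclidean_space \<Rightarrow> real"
  assumes U: "open U" and u: "Linfty U u"
    and pos: "\<And>a b k. cbox a b \<subseteq> U \<Longrightarrow> (LINT z|lebesgue_on U. u z * box_bump a b k z) \<ge> 0"
  shows "AE z in lebesgue_on U. u z \<ge> 0"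
proof -
  have Ul: "U \<in> sets lebesgue" using U by (simp add: borel_open)
  from u obtain C where C: "AE z in lebesgue_on U. norm (u z) \<le> C"
    and um: "u \<in> borel_measurable (lebesgue_on U)" by (auto simp: Linfty_def)
  define w where "w z = (if z \<in> U \<and> \<bar>u z\<bar> \<le> \<bar>C\<bar> then u z else 0)" for z
  have wm1: "(\<lambda>z. if \<bar>u z\<bar> \<le> \<bar>C\<bar> then u z else 0) \<in> borel_measurable (lebesgue_on U)"
    using um by measurable
  have "(\<lambda>z. if z \<in> U then (if \<bar>u z\<bar> \<le> \<bar>C\<bar> then u z else 0) else 0) \<in> borel_measurable lebesgue"
    using borel_measurable_if_I[OF wm1 Ul] .
  moreover have "(\<lambda>z. if z \<in> U then (if \<bar>u z\<bar> \<le> \<bar>C\<bar> then u z else 0) else 0) = w"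
    by (auto simp: w_def)
  ultimately have wm: "w \<in> borel_measurable lebesgue" by simp
  have wb: "norm (w z) \<le> \<bar>C\<bar>" for z by (simp add: w_def)
  have weq: "AE z in lebesgue_on U. u z = w z"
    using C AE_space by eventually_elim (auto simp: w_def)
  have wint: "w absolutely_integrable_on S" if "S \<in> lmeasurable" for S
    by (rule measurable_bounded_by_integrable_imp_absolutely_integrable[where g="\<lambda>_. \<bar>C\<bar>"])
       (use that wm wb in \<open>auto intro: measurable_restrict_space1 integrable_on_const\<close>)
  have box: "integral (cbox a b) w \<ge> 0" if ab: "cbox a b \<subseteq> U" for a b
  proof -
    let ?\<phi> = "box_bump a b"
    have b1: "\<bar>?\<phi> k z\<bar> \<le> indicator (cbox a b) z" for k z
      using box_bump_bounds[of a b k z] box_bump_eq_0_iff[of a b k z] box_subset_cbox[of a b]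
      by (auto simp: indicator_def)
    have mb: "?\<phi> k \<in> borel_measurable lebesgue" for k
      by (metis borel_measurable_continuous_onI smooth_algebra_continuous box_bump_smooth_algebra measurable_completion measurable_lborel2)
    have "(\<lambda>k. LINT z|lebesgue. w z * ?\<phi> k z) \<longlonglongrightarrow> (LINT z|lebesgue. w z * indicator (box a b) z)"
    proof (rule integral_dominated_convergence[where w="\<lambda>z. \<bar>C\<bar> * indicator (cbox a b) z"])
      show "integrable lebesgue (\<lambda>z. \<bar>C\<bar> * indicator (cbox a b) z)"
        by (intro integrable_mult_right integrable_real_indicator) (auto simp: emeasure_lborel_cbox_eq)
      show "AE z in lebesgue. (\<lambda>k. w z * ?\<phi> k z) \<longlonglongrightarrow> w z * indicator (box a b) z"
        by (intro AE_I2 tendsto_mult tendsto_const box_bump_tendsto)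
      show "AE z in lebesgue. norm (w z * ?\<phi> k z) \<le> \<bar>C\<bar> * indicator (cbox a b) z" for k
        using b1 wb by (auto intro!: AE_I2 mult_mono simp: abs_mult)
    qed (use wm mb in \<open>auto intro!: borel_measurable_times borel_measurable_indicator simp: borel_open\<close>)
    moreover have "(LINT z|lebesgue. w z * ?\<phi> k z) \<ge> 0" for k
    proof -
      have "(LINT z|lebesgue. w z * ?\<phi> k z) = (LINT z|lebesgue. indicator U z *\<^sub>R (w z * ?\<phi> k z))"
        by (intro Bochner_Integration.integral_cong) (auto simp: w_def)
      also have "\<dots> = (LINT z|lebesgue_on U. w z * ?\<phi> k z)"
        using Ul by (simp add: integral_restrict_space)
      also have "\<dots> = (LINT z|lebesgue_on U. u z * ?\<phi> k z)"
        using weq wm um mb by (intro integral_cong_AE borel_measurable_times) (auto intro: measurable_restrict_space1)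
      also have "\<dots> \<ge> 0" by (rule pos[OF ab])
      finally show ?thesis .
    qed
    ultimately have "(LINT z|lebesgue. w z * indicator (box a b) z) \<ge> 0"
      by (intro LIMSEQ_le_const) auto
    also have "(LINT z|lebesgue. w z * indicator (box a b) z) = (LINT z:box a b|lebesgue. w z)"
      by (simp add: set_lebesgue_integral_def mult.commute)
    also have "\<dots> = integral (box a b) w"
      using wint[of "box a b"] by (intro set_lebesgue_integral_eq_integral) auto
    finally show ?thesis by (simp add: integral_open_interval)
  qed
  \<comment> \<open>Lebesgue's differentiation theorem, for cubes with lower corner x.\<close>
  obtain N where N: "negligible N"
     "\<And>x e. \<lbrakk>x \<notin> N; 0 < e\<rbrakk> \<Longrightarrow>
         \<exists>d>0. \<forall>h. 0 < h \<and> h < d \<longrightarrow> norm(integral (cbox x (x + h *\<^sub>R One)) w /\<^sub>R h ^ DIM('a) - w x) < e"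
    using integrable_ccontinuous_explicit[of w] wint set_lebesgue_integral_eq_integral(1) lmeasurable_cbox by metis
  have nonneg: "w x \<ge> 0" if xN: "x \<notin> N" and xU: "x \<in> U" for x
  proof (rule ccontr)
    assume neg: "\<not> w x \<ge> 0"
    obtain d where d: "d > 0" "\<And>h. 0 < h \<Longrightarrow> h < d \<Longrightarrow> norm(integral (cbox x (x + h *\<^sub>R One)) w /\<^sub>R h ^ DIM('a) - w x) < - w x"
      using N(2)[OF xN, of "- w x"] neg by auto
    obtain r where r: "r > 0" "cball x r \<subseteq> U" using U xU open_contains_cball by blast
    \<comment> \<open>A cube of side h has diameter \<open>h * norm One\<close>, so the second bound
      keeps it inside the ball of radius r and thereby inside U.\<close>
    define h where "h = min (d/2) (r / (norm (One::'a)))"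
    have op: "norm (One::'a) > 0" by simp
    have h: "0 < h" "h < d" "h * norm (One::'a) \<le> r" using d(1) r(1) op
      by (auto simp: h_def min_def field_simps)
    have "cbox x (x + h *\<^sub>R One) \<subseteq> cball x r"
    proof
      fix y assume y: "y \<in> cbox x (x + h *\<^sub>R One)"
      have "norm (y - x) \<le> norm (h *\<^sub>R (One::'a))"
        by (rule norm_le_componentwise) (use y h in \<open>auto simp: mem_box algebra_simps\<close>)
      then show "y \<in> cball x r" using h by (simp add: dist_norm norm_minus_commute)
    qed
    then have "integral (cbox x (x + h *\<^sub>R One)) w \<ge> 0" using box r by blast
    then have "integral (cbox x (x + h *\<^sub>R One)) w /\<^sub>R h ^ DIM('a) \<ge> 0" using h by simp
    with d(2)[OF h(1,2)] neg show False by auto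
  qed
  have "AE z in lebesgue. z \<notin> N" using N(1) 
    using AE_not_in negligible_iff_null_sets by blast
  then have "AE z in lebesgue. z \<in> U \<longrightarrow> z \<notin> N" by eventually_elim simp
  then have "AE z in lebesgue_on U. z \<notin> N" using Ul by (simp add: AE_restrict_space_iff)
  with weq AE_space[of "lebesgue_on U"] show ?thesis
    by eventually_elim (simp add: nonneg)
qed

lemma Linfty_uminus: "Linfty U u \<Longrightarrow> Linfty U (\<lambda>z. - u z)"
  by (auto simp: Linfty_def)

lemma Linfty_diff:
  assumes "Linfty U u" "Linfty U v" shows "Linfty U (\<lambda>z. u z - v z)"
proof -
  obtain C D where "AE z in lebesgue_on U. norm (u z) \<le> C" "AE z in lebesgue_on U. norm (v z) \<le> D"
    using assms by (auto simp: Linfty_def)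
  then have "AE z in lebesgue_on U. norm (u z - v z) \<le> C + D"
    by eventually_elim (meson norm_triangle_le_diff add_mono order_trans)
  then show ?thesis using assms by (auto simp: Linfty_def)
qed

lemma test_function_zero_imp_AE_zero:
  fixes u :: "'a::euclidean_space \<Rightarrow> real"
  assumes U: "open U" and u: "Linfty U u"
    and zero: "\<And>\<phi>. \<phi> \<in> test_functions U \<Longrightarrow> (LINT z|lebesgue_on U. u z * \<phi> z) = 0"
  shows "AE z in lebesgue_on U. u z = 0"
proof -
  have "AE z in lebesgue_on U. u z \<ge> 0"
    by (rule box_bump_nonneg_imp_AE_nonneg[OF U u]) (simp add: zero[OF box_bump_test])
  moreover have "AE z in lebesgue_on U. - u z \<ge> 0"
    by (rule box_bump_nonneg_imp_AE_nonneg[OF U Linfty_uminus[OF u]]) (simp add: zero[OF box_bump_test])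
  ultimately show ?thesis by eventually_elim auto
qed

section \<open>Derivatives of test functions\<close>

lemma test_function_has_derivative:
  "\<phi> \<in> test_functions U \<Longrightarrow> (\<phi> has_derivative frechet_derivative \<phi> (at z)) (at z)"
proof -
  assume "\<phi> \<in> test_functions U"
  then have "iter_deriv [] \<phi> differentiable (at z)"
    unfolding test_functions_def smooth_def by blast
  then show ?thesis by (simp add: frechet_derivative_works)
qed

lemma test_function_continuous: "\<phi> \<in> test_functions U \<Longrightarrow> continuous_on S \<phi>"
  using test_function_has_derivative has_derivative_continuous continuous_at_imp_continuous_on by metis

lemma test_function_deriv_continuous:
  assumes "\<phi> \<in> test_functions U"
  shows "continuous_on S (\<lambda>z. frechet_derivative \<phi> (at z) e)"
proof -
  have "iter_deriv [e] \<phi> differentiable (at z)" for z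
    using assms unfolding test_functions_def smooth_def by blast
  then have "(\<lambda>z. frechet_derivative \<phi> (at z) e) differentiable (at z)" for z
    by simp
  then show ?thesis
    by (intro continuous_at_imp_continuous_on ballI differentiable_imp_continuous_within)
qed

lemma test_function_outside:
  assumes "\<phi> \<in> test_functions U" "z \<notin> supp \<phi>"
  shows "\<phi> z = 0" "frechet_derivative \<phi> (at z) e = 0"
proof -
  have out: "\<phi> y = 0" if "y \<notin> supp \<phi>" for y
    using that closure_subset[of "{y. \<phi> y \<noteq> 0}"] by (auto simp: supp_def)
  then show "\<phi> z = 0" using assms by blast
  have "open (- supp \<phi>)" by (simp add: supp_def open_Compl)
  have "(\<phi> has_derivative (\<lambda>h. 0)) (at z)"
    by (rule has_derivative_transform_within_open[OF has_derivative_const \<open>open (- supp \<phi>)\<close>])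
       (use assms out in auto)
  then have "frechet_derivative \<phi> (at z) = (\<lambda>h. 0)" by (metis frechet_derivative_at)
  then show "frechet_derivative \<phi> (at z) e = 0" by simp
qed

lemma test_function_lipschitz:
  assumes \<phi>: "\<phi> \<in> test_functions U"
  obtains L where "L-lipschitz_on UNIV \<phi>" "\<And>z h. \<bar>frechet_derivative \<phi> (at z) h\<bar> \<le> L * norm h"
proof -
  have cs: "compact (supp \<phi>)" using \<phi> by (simp add: test_functions_def)
  have "\<exists>C. \<forall>z. \<bar>frechet_derivative \<phi> (at z) b\<bar> \<le> C" for b
  proof -
    have "compact ((\<lambda>z. frechet_derivative \<phi> (at z) b) ` supp \<phi>)"
      by (intro compact_continuous_image test_function_deriv_continuous[OF \<phi>] cs)
    then obtain C where "\<forall>z\<in>supp \<phi>. norm (frechet_derivative \<phi> (at z) b) \<le> C"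
      using compact_imp_bounded by (force simp: bounded_iff)
    then show ?thesis using test_function_outside(2)[OF \<phi>]
      by (intro exI[of _ "\<bar>C\<bar>"]) (metis abs_ge_self abs_ge_zero abs_zero order_trans real_norm_def)
  qed
  then obtain C where C: "\<And>z b. \<bar>frechet_derivative \<phi> (at z) b\<bar> \<le> C b" by metis
  define L where "L = (\<Sum>b\<in>Basis. C b)"
  have bd: "\<bar>frechet_derivative \<phi> (at z) h\<bar> \<le> L * norm h" for z h
  proof -
    interpret linear "frechet_derivative \<phi> (at z)"
      using test_function_has_derivative[OF \<phi>] has_derivative_linear by blast
    have "frechet_derivative \<phi> (at z) h = frechet_derivative \<phi> (at z) (\<Sum>b\<in>Basis. (h \<bullet> b) *\<^sub>R b)"
      by (simp add: euclidean_representation)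
    also have "\<dots> = (\<Sum>b\<in>Basis. (h \<bullet> b) * frechet_derivative \<phi> (at z) b)"
      by (simp add: sum scale)
    also have "\<bar>\<dots>\<bar> \<le> (\<Sum>b\<in>Basis. norm h * C b)"
      by (rule order_trans[OF sum_abs sum_mono]) (auto simp: abs_mult Basis_le_norm intro!: mult_mono C)
    finally show ?thesis by (simp add: L_def sum_distrib_left sum_distrib_right mult.commute)
  qed
  have L0: "L \<ge> 0" unfolding L_def by (rule sum_nonneg) (meson C abs_ge_zero order_trans)
  have "L-lipschitz_on UNIV \<phi>"
  proof (rule bounded_derivative_imp_lipschitz[OF _ convex_UNIV])
    show "(\<phi> has_derivative frechet_derivative \<phi> (at z)) (at z within UNIV)" for z
      using test_function_has_derivative[OF \<phi>] by simp
    show "onorm (frechet_derivative \<phi> (at z)) \<le> L" for z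
      by (rule onorm_bound[OF L0]) (simp add: bd)
  qed (use L0 in auto)
  then show ?thesis using that bd by blast
qed

section \<open>Rademacher's theorem\<close>

lemma emeasure_interval_measure_box:
  assumes "a \<le> b" and mono: "\<And>x y. x \<le> y \<Longrightarrow> F x \<le> F y" and cont: "continuous_on UNIV F"
  shows "emeasure (interval_measure F) {a<..<b} = ennreal (F b - F a)"
proof -
  have sing: "{x} \<in> null_sets (interval_measure F)" for x :: real
    using emeasure_interval_measure_Icc[of x x F, OF _ mono cont] by (auto simp: null_sets_def)
  have "{a<..<b} = {a..b} - ({a} \<union> {b})" by auto
  then have "emeasure (interval_measure F) {a<..<b} = emeasure (interval_measure F) {a..b}"
    using emeasure_Diff_null_set[OF null_sets.Un[OF sing sing]] by (metis atLeastAtMost_borel sets_interval_measure)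
  then show ?thesis using emeasure_interval_measure_Icc[OF assms] by simp
qed

text \<open>
  The measures with distribution functions \<open>(s + g s) / 2\<close> and \<open>(s - g s) / 2\<close> add up to
  Lebesgue measure, so the first one is absolutely continuous.
\<close>

lemma lipschitz1_real_AE_dyadic:
  fixes g :: "real \<Rightarrow> real"
  assumes g: "1-lipschitz_on UNIV g"
  shows "AE s in lborel. convergent (\<lambda>n. 2 ^ n * (g (s + 1 / 2 ^ n) - g s))"
proof -
  have gd: "\<bar>g x - g y\<bar> \<le> \<bar>x - y\<bar>" for x y
    using lipschitz_onD[OF g, of x y] by (simp add: dist_real_def)
  have gc: "continuous_on UNIV g" by (rule lipschitz_on_continuous_on[OF g])
  define F1 where "F1 s = (s + g s) / 2" for s
  define F2 where "F2 s = (s - g s) / 2" for s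
  have m1: "x \<le> y \<Longrightarrow> F1 x \<le> F1 y" for x y using gd[of x y] by (auto simp: F1_def)
  have m2: "x \<le> y \<Longrightarrow> F2 x \<le> F2 y" for x y using gd[of x y] by (auto simp: F2_def)
  have c1: "continuous_on UNIV F1" and c2: "continuous_on UNIV F2"
    unfolding F1_def F2_def by (intro continuous_intros gc; simp)+
  define \<mu>1 where "\<mu>1 = interval_measure F1"
  define \<mu>2 where "\<mu>2 = interval_measure F2"
  have s[simp]: "sets \<mu>1 = sets borel" "sets \<mu>2 = sets borel" by (auto simp: \<mu>1_def \<mu>2_def)
  have sp[simp]: "space \<mu>1 = UNIV" by (auto simp: \<mu>1_def)
  define M where "M = measure_of UNIV (sets (borel :: real measure)) (\<lambda>A. emeasure \<mu>1 A + emeasure \<mu>2 A)"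
  have sM: "sets M = sets borel"
    unfolding M_def by (metis sets.sets_measure_of_eq space_borel)
  have eM: "emeasure M A = emeasure \<mu>1 A + emeasure \<mu>2 A" if "A \<in> sets borel" for A
  proof (rule emeasure_measure_of[OF M_def])
    show "positive (sets M) (\<lambda>A. emeasure \<mu>1 A + emeasure \<mu>2 A)" by (simp add: positive_def)
    show "countably_additive (sets M) (\<lambda>A. emeasure \<mu>1 A + emeasure \<mu>2 A)"
      by (auto simp: countably_additive_def sM suminf_add[symmetric] suminf_emeasure)
  qed (use that sM in auto)
  have "lborel = M"
  proof (rule lborel_eqI)
    fix l u :: real assume lu: "\<And>b. b \<in> Basis \<Longrightarrow> l \<bullet> b \<le> u \<bullet> b"
    then have "l \<le> u" by simp
    then have "emeasure M (box l u) = ennreal (F1 u - F1 l) + ennreal (F2 u - F2 l)"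
      by (simp add: eM emeasure_interval_measure_box m1 m2 c1 c2 \<mu>1_def \<mu>2_def)
    also have "\<dots> = ennreal (u - l)"
      using m1[OF \<open>l \<le> u\<close>] m2[OF \<open>l \<le> u\<close>] by (subst ennreal_plus[symmetric]) (auto simp: F1_def F2_def field_simps)
    finally show "emeasure M (box l u) = (\<Prod>b\<in>Basis. (u - l) \<bullet> b)" by simp
  qed (simp add: sM)
  then have le: "emeasure \<mu>1 A \<le> emeasure lborel A" if "A \<in> sets borel" for A
    using eM[OF that] by (simp add: le_add_same_cancel1)
  have "absolutely_continuous lborel \<mu>1"
    unfolding absolutely_continuous_def using le by (force simp: null_sets_def)
  then obtain r where rm: "r \<in> borel_measurable lborel" and r: "density lborel r = \<mu>1"
    using sigma_finite_measure.Radon_Nikodym[OF sigma_finite_lborel, of \<mu>1] by auto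
  have nr: "(\<integral>\<^sup>+x\<in>{a..b}. r x \<partial>lborel) = ennreal (F1 b - F1 a)" if "a \<le> b" for a b
    using emeasure_density[OF rm, of "{a..b}"] r emeasure_interval_measure_Icc[OF that m1 c1]
    by (simp add: \<mu>1_def)
  \<comment> \<open>The mass of each interval [-n, n] is finite, so the density is infinite on a
    null set only and may be replaced by a real function.\<close>
  have rfin: "AE x in lborel. r x \<noteq> \<infinity>"
  proof -
    have "AE x in lborel. r x * indicator {- real n..real n} x \<noteq> \<infinity>" for n
      by (rule nn_integral_PInf_AE) (use rm nr[of "-real n" "real n"] in auto)
    then have "AE x in lborel. \<forall>n. r x * indicator {- real n..real n} x \<noteq> \<infinity>"
      by (simp add: AE_all_countable)
    then show ?thesis
    proof eventually_elim
      case (elim x)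
      obtain n where "\<bar>x\<bar> \<le> real n" using real_arch_simple by blast
      then have "x \<in> {- real n..real n}" by auto
      then show ?case using elim[rule_format, of n] by auto
    qed
  qed
  define h where "h x = enn2real (r x)" for x
  have hm: "h \<in> borel_measurable borel" using rm unfolding h_def by simp
  have h0: "h x \<ge> 0" for x by (simp add: h_def)
  have hI: "(h has_integral (F1 b - F1 a)) {a..b}" if "a \<le> b" for a b
  proof -
    have "(\<integral>\<^sup>+x. ennreal (indicator {a..b} x * h x) \<partial>lborel) = (\<integral>\<^sup>+x\<in>{a..b}. r x \<partial>lborel)"
      using rfin by (intro nn_integral_cong_AE, eventually_elim)
        (auto simp: h_def indicator_def ennreal_enn2real_if top.not_eq_extremum)
    then have "has_bochner_integral lborel (\<lambda>x. indicator {a..b} x * h x) (F1 b - F1 a)"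
      using hm nr[OF that] m1[OF that]
      by (intro has_bochner_integral_nn_integral borel_measurable_times) (auto simp: h0)
    then have "((\<lambda>x. indicator {a..b} x * h x) has_integral (F1 b - F1 a)) UNIV"
      using has_integral_integral_lborel has_bochner_integral_iff by metis
    moreover have "(\<lambda>x. indicator {a..b} x * h x) = (\<lambda>x. if x \<in> {a..b} then h x else 0)" by auto
    ultimately show ?thesis by (metis has_integral_restrict_UNIV)
  qed
  have hint: "h integrable_on cbox a b" for a b
    using hI[of a b] by (cases "a \<le> b") (auto simp: integrable_on_def)
  \<comment> \<open>Increments of \<open>F1\<close> are integrals of \<open>h\<close>, so Lebesgue
    differentiation gives the limit of the quotients of \<open>F1\<close>. The limit for
    \<open>g\<close> follows because g is 2 \<open>F1\<close> minus the identity.\<close>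
  obtain N where N: "negligible N"
     "\<And>x e. \<lbrakk>x \<notin> N; 0 < e\<rbrakk> \<Longrightarrow>
         \<exists>d>0. \<forall>t. 0 < t \<and> t < d \<longrightarrow> norm(integral (cbox x (x + t *\<^sub>R One)) h /\<^sub>R t ^ DIM(real) - h x) < e"
    using integrable_ccontinuous_explicit[of h, OF hint] by metis
  have lim: "(\<lambda>n. 2 ^ n * (F1 (x + 1 / 2 ^ n) - F1 x)) \<longlonglongrightarrow> h x" if "x \<notin> N" for x
  proof (rule LIMSEQ_I)
    fix e :: real assume "e > 0"
    then obtain d where d: "d > 0" "\<And>t. 0 < t \<Longrightarrow> t < d \<Longrightarrow> norm(integral {x..x + t} h / t - h x) < e"
      using N(2)[OF \<open>x \<notin> N\<close> \<open>e > 0\<close>] by (auto simp: divide_inverse mult.commute)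
    obtain n0 where n0: "(1/2) ^ n0 < d"
      using d(1) real_arch_pow_inv[of d "1/2"] by auto
    show "\<exists>n0. \<forall>n\<ge>n0. norm (2 ^ n * (F1 (x + 1 / 2 ^ n) - F1 x) - h x) < e"
    proof (intro exI[of _ n0] allI impI)
      fix n assume "n \<ge> n0"
      then have "(1/2) ^ n \<le> ((1/2) ^ n0 :: real)" by (intro power_decreasing) auto
      with n0 have "1 / 2 ^ n < d" by (simp add: power_one_over)
      moreover have "integral {x..x + 1/2^n} h = F1 (x + 1 / 2 ^ n) - F1 x"
        using hI[of x "x + 1/2^n"] by (simp add: integral_unique)
      ultimately show "norm (2 ^ n * (F1 (x + 1 / 2 ^ n) - F1 x) - h x) < e"
        using d(2)[of "1/2^n"] by (simp add: mult.commute)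
    qed
  qed
  have "AE x in lborel. x \<notin> N"
    using N(1) AE_not_in negligible_iff_null_sets AE_completion_iff by blast
  then show ?thesis
  proof eventually_elim
    case (elim x)
    have "(\<lambda>n. 2 * (2 ^ n * (F1 (x + 1 / 2 ^ n) - F1 x)) - 1) \<longlonglongrightarrow> 2 * h x - 1"
      by (intro tendsto_intros lim elim)
    moreover have "2 * (2 ^ n * (F1 (x + 1 / 2 ^ n) - F1 x)) - 1 = 2 ^ n * (g (x + 1 / 2 ^ n) - g x)" for n
      by (simp add: F1_def field_simps)
    ultimately show ?case by (auto simp: convergent_def)
  qed
qed

lemma lipschitz_real_AE_dyadic:
  fixes g :: "real \<Rightarrow> real"
  assumes g: "L-lipschitz_on UNIV g"
  shows "AE s in lborel. convergent (\<lambda>n. 2 ^ n * (g (s + 1 / 2 ^ n) - g s))"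
proof -
  have L0: "L \<ge> 0" using g lipschitz_on_nonneg by blast
  \<comment> \<open>The summand 1 avoids a division by 0 for constant functions.\<close>
  define c where "c = 1 / (L + 1)"
  have c: "c > 0" "c * L \<le> 1" using L0 by (auto simp: c_def)
  have "(c * L)-lipschitz_on UNIV (\<lambda>x. c *\<^sub>R g x)"
    using lipschitz_on_cmult[OF g, of c] c by simp
  then have "1-lipschitz_on UNIV (\<lambda>x. c * g x)"
    using lipschitz_on_le[OF _ c(2)] by simp
  from lipschitz1_real_AE_dyadic[OF this] show ?thesis
  proof eventually_elim
    case (elim s)
    then have "convergent (\<lambda>n. (1/c) * (2 ^ n * (c * g (s + 1 / 2 ^ n) - c * g s)))"
      by (rule convergent_mult[OF convergent_const])
    moreover have "(1/c) * (2 ^ n * (c * g (s + 1 / 2 ^ n) - c * g s)) = 2 ^ n * (g (s + 1 / 2 ^ n) - g s)" for n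
      using c by (simp add: field_simps)
    ultimately show ?case by simp
  qed
qed

text \<open>A fixed sequence of steps instead of all real steps keeps convergence sets and limits
  Borel measurable. Nothing is lost: an arbitrary small increment is w / 2^n for some n and some w
  with norm between 1/2 and 1, as used in \<open>rademacher\<close>.\<close>

definition dyadic_quot :: "('a::real_normed_vector \<Rightarrow> real) \<Rightarrow> 'a \<Rightarrow> nat \<Rightarrow> 'a \<Rightarrow> real" where
  "dyadic_quot f w n z = 2 ^ n * (f (z + w /\<^sub>R 2 ^ n) - f z)"

lemma dyadic_quot_bound:
  assumes "L-lipschitz_on UNIV f" shows "\<bar>dyadic_quot f w n z\<bar> \<le> L * norm w"
proof -
  have "\<bar>f (z + w /\<^sub>R 2 ^ n) - f z\<bar> \<le> L * (norm w / 2 ^ n)"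
    using lipschitz_onD[OF assms, of "z + w /\<^sub>R 2 ^ n" z] by (simp add: dist_norm dist_real_def divide_inverse mult.commute)
  then have "2 ^ n * \<bar>f (z + w /\<^sub>R 2 ^ n) - f z\<bar> \<le> 2 ^ n * (L * (norm w / 2 ^ n))"
    by (intro mult_left_mono) auto
  then show ?thesis by (simp add: dyadic_quot_def abs_mult)
qed

lemma dyadic_quot_tendsto:
  assumes "(f has_derivative f') (at z)" shows "(\<lambda>n. dyadic_quot f w n z) \<longlonglongrightarrow> f' w"
proof -
  have lin: "linear f'" using assms has_derivative_linear by blast
  have d: "((\<lambda>t. f (z + t *\<^sub>R w)) has_real_derivative f' w) (at 0)"
  proof -
    have "((\<lambda>t. z + t *\<^sub>R w) has_derivative (\<lambda>t. t *\<^sub>R w)) (at 0)"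
      by (auto intro!: derivative_eq_intros)
    moreover have "(f has_derivative f') (at (z + 0 *\<^sub>R w))" using assms by simp
    ultimately have "(f \<circ> (\<lambda>t. z + t *\<^sub>R w) has_derivative f' \<circ> (\<lambda>t. t *\<^sub>R w)) (at 0)"
      by (rule diff_chain_at)
    then show ?thesis
      by (simp add: o_def has_field_derivative_def linear_scale[OF lin] mult_commute_abs)
  qed
  have "filterlim (\<lambda>n. (1/2::real) ^ n) (at 0) sequentially"
    unfolding filterlim_at by (auto intro!: LIMSEQ_realpow_zero)
  moreover have "((\<lambda>t. (f (z + t *\<^sub>R w) - f z) / t) \<longlongrightarrow> f' w) (at 0)"
    using d by (simp add: has_field_derivative_iff)
  ultimately have "(\<lambda>n. (f (z + (1/2::real) ^ n *\<^sub>R w) - f z) / (1/2) ^ n) \<longlonglongrightarrow> f' w"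
    by (rule filterlim_compose[rotated])
  then show ?thesis by (simp add: dyadic_quot_def power_one_over field_simps)
qed

lemma dyadic_quot_measurable:
  fixes f :: "'a::euclidean_space \<Rightarrow> real"
  assumes "f \<in> borel_measurable borel" shows "dyadic_quot f w n \<in> borel_measurable borel"
  unfolding dyadic_quot_def by (intro borel_measurable_times borel_measurable_diff
      measurable_compose[OF _ assms] borel_measurable_const assms) measurable

text \<open>
  Translation invariance of Lebesgue measure spreads the exceptional null sets of the lines
  in direction \<open>w\<close> over the whole space.
\<close>

lemma lipschitz_AE_dyadic_quot_convergent:
  fixes f :: "'a::euclidean_space \<Rightarrow> real"
  assumes f: "L-lipschitz_on UNIV f"
  shows "AE z in lborel. convergent (\<lambda>n. dyadic_quot f w n z)"
proof -
  have fm: "f \<in> borel_measurable borel"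
    by (rule borel_measurable_continuous_onI[OF lipschitz_on_continuous_on[OF f]])
  \<comment> \<open>Divergence is expressed as failure of the Cauchy property, which is a Borel
    condition and does not mention the limit.\<close>
  define B where "B = {z. \<not> Cauchy (\<lambda>n. dyadic_quot f w n z)}"
  have "{z \<in> space borel. Cauchy (\<lambda>n. dyadic_quot f w n z)} \<in> sets borel"
    by (rule sets_Collect_Cauchy) (rule dyadic_quot_measurable[OF fm])
  then have Bm: "B \<in> sets borel"
    using sets.compl_sets[of "{z. Cauchy (\<lambda>n. dyadic_quot f w n z)}" borel] by (simp add: B_def set_diff_eq)
  define i :: "'a \<Rightarrow> ennreal" where "i = indicator B"
  have im: "i \<in> borel_measurable borel" using Bm by (simp add: i_def)
  have line: "(\<integral>\<^sup>+s. indicator {0..1} s * i (z + s *\<^sub>R w) \<partial>lborel) = 0" for z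
  proof -
    have "(L * norm w)-lipschitz_on UNIV (\<lambda>s. f (z + s *\<^sub>R w))"
    proof (rule lipschitz_onI)
      fix x y :: real
      show "dist (f (z + x *\<^sub>R w)) (f (z + y *\<^sub>R w)) \<le> L * norm w * dist x y"
        using lipschitz_onD[OF f, of "z + x *\<^sub>R w" "z + y *\<^sub>R w"]
        by (simp add: dist_norm scaleR_diff_left[symmetric] mult.commute mult.left_commute)
    qed (use lipschitz_on_nonneg[OF f] in simp)
    from lipschitz_real_AE_dyadic[OF this]
    have "AE s in lborel. indicator {0..1} s * i (z + s *\<^sub>R w) = 0"
    proof eventually_elim
      case (elim s)
      then have "convergent (\<lambda>n. dyadic_quot f w n (z + s *\<^sub>R w))"
        by (simp add: dyadic_quot_def scaleR_add_left add.assoc divide_inverse)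
      then have "Cauchy (\<lambda>n. dyadic_quot f w n (z + s *\<^sub>R w))" by (simp add: Cauchy_convergent_iff)
      then show ?case by (simp add: i_def B_def)
    qed
    then have "(\<integral>\<^sup>+s. indicator {0..1} s * i (z + s *\<^sub>R w) \<partial>lborel) = (\<integral>\<^sup>+(s::real). 0 \<partial>lborel)"
      by (rule nn_integral_cong_AE)
    then show ?thesis by simp
  qed
  have "emeasure lborel B = (\<integral>\<^sup>+z. i (z + s *\<^sub>R w) \<partial>lborel)" for s
  proof -
    have "emeasure lborel B = (\<integral>\<^sup>+z. i z \<partial>lborel)" using Bm by (simp add: i_def)
    also have "\<dots> = (\<integral>\<^sup>+z. i z \<partial>(distr lborel borel ((+) (s *\<^sub>R w))))" by (simp add: lborel_distr_plus)
    also have "\<dots> = (\<integral>\<^sup>+z. i (s *\<^sub>R w + z) \<partial>lborel)" using im by (subst nn_integral_distr) auto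
    finally show ?thesis by (simp add: add.commute)
  qed
  then have "(\<integral>\<^sup>+s. indicator {0..1::real} s * (\<integral>\<^sup>+z. i (z + s *\<^sub>R w) \<partial>lborel) \<partial>lborel)
      = (\<integral>\<^sup>+s. emeasure lborel B * indicator {0..1::real} s \<partial>lborel)"
    by (simp add: mult.commute)
  also have "\<dots> = emeasure lborel B" by (simp add: nn_integral_cmult)
  finally have "emeasure lborel B = (\<integral>\<^sup>+s. \<integral>\<^sup>+z. indicator {0..1::real} s * i (z + s *\<^sub>R w) \<partial>lborel \<partial>lborel)"
    using im by (subst nn_integral_cmult) auto
  also have "\<dots> = (\<integral>\<^sup>+z. \<integral>\<^sup>+s. indicator {0..1::real} s * i (z + s *\<^sub>R w) \<partial>lborel \<partial>lborel)"
  proof (rule lborel_pair.Fubini')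
    show "(\<lambda>(z, s). indicator {0..1::real} s * i (z + s *\<^sub>R w)) \<in> borel_measurable (lborel \<Otimes>\<^sub>M lborel)"
      unfolding case_prod_beta
      by (intro borel_measurable_times_ennreal measurable_compose[OF _ im]) measurable
  qed
  also have "\<dots> = 0" by (simp add: line)
  finally have "B \<in> null_sets lborel" using Bm by (auto simp: null_sets_def)
  from AE_not_in[OF this] show ?thesis
    by eventually_elim (simp add: B_def Cauchy_convergent_iff)
qed

text \<open>Where the quotients diverge, \<open>lim\<close> returns an unspecified value; this is
  harmless, since for Lipschitz f it concerns a null set and the function stays Borel
  measurable.\<close>

definition dyadic_deriv :: "('a::euclidean_space \<Rightarrow> real) \<Rightarrow> 'a \<Rightarrow> 'a \<Rightarrow> real" where
  "dyadic_deriv f w z = lim (\<lambda>n. dyadic_quot f w n z)"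

lemma dyadic_deriv_measurable:
  assumes "L-lipschitz_on UNIV f" shows "dyadic_deriv f w \<in> borel_measurable borel"
  unfolding dyadic_deriv_def
  by (intro borel_measurable_lim_metric dyadic_quot_measurable borel_measurable_continuous_onI[OF lipschitz_on_continuous_on[OF assms]])

lemma AE_dyadic_deriv:
  assumes "L-lipschitz_on UNIV f"
  shows "AE z in lborel. (\<lambda>n. dyadic_quot f w n z) \<longlonglongrightarrow> dyadic_deriv f w z \<and> \<bar>dyadic_deriv f w z\<bar> \<le> L * norm w"
  using lipschitz_AE_dyadic_quot_convergent[OF assms, of w]
proof eventually_elim
  case (elim z)
  then have l: "(\<lambda>n. dyadic_quot f w n z) \<longlonglongrightarrow> dyadic_deriv f w z" by (simp add: dyadic_deriv_def convergent_LIMSEQ_iff)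
  moreover have "\<bar>dyadic_deriv f w z\<bar> \<le> L * norm w"
    by (rule LIMSEQ_le_const2[OF tendsto_rabs[OF l]]) (use dyadic_quot_bound[OF assms] in blast)
  ultimately show ?case by blast
qed

section \<open>Integration by parts with difference quotients\<close>

lemma integral_lborel_translate:
  fixes f :: "'a::euclidean_space \<Rightarrow> real"
  assumes "f \<in> borel_measurable borel"
  shows "(LINT z|lborel. f (z + c)) = (LINT z|lborel. f z)"
proof -
  have "(LINT z|lborel. f z) = (LINT z|distr lborel borel ((+) c). f z)" by (simp add: lborel_distr_plus)
  also have "\<dots> = (LINT z|lborel. f (c + z))" using assms by (subst integral_distr) auto
  finally show ?thesis by (simp add: add.commute)
qed

lemma integrable_lborel_translate:
  fixes f :: "'a::euclidean_space \<Rightarrow> real"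
  assumes "integrable lborel f"
  shows "integrable lborel (\<lambda>z. f (z + c))"
proof -
  have "integrable (distr lborel borel ((+) c)) f" using assms by (simp add: lborel_distr_plus)
  then show ?thesis using assms by (subst (asm) integrable_distr_eq) (auto simp: add.commute)
qed

lemma integrable_continuous_compact_support:
  fixes f :: "'a::euclidean_space \<Rightarrow> real"
  assumes "continuous_on UNIV f" "compact S" "\<And>z. z \<notin> S \<Longrightarrow> f z = 0"
  shows "integrable lborel f"
proof -
  have "integrable lborel (\<lambda>x. indicator S x *\<^sub>R f x)"
    using assms by (intro borel_integrable_compact) (auto intro: continuous_on_subset)
  moreover have "indicator S x *\<^sub>R f x = f x" for x using assms(3)[of x] by (auto simp: indicator_def)
  ultimately show ?thesis by (simp only: cong: Bochner_Integration.integrable_cong)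
qed

text \<open>A translation of the variable moves the quotient from f to \<phi> and reverses its
  direction. Both sides then pass to the limit by dominated convergence: on the left the quotients
  of f are bounded by the Lipschitz constant, on the right those of \<phi>.\<close>

lemma integral_dyadic_deriv_test_function:
  fixes f :: "'a::euclidean_space \<Rightarrow> real"
  assumes f: "L-lipschitz_on UNIV f" and \<phi>: "\<phi> \<in> test_functions U"
  shows "(LINT z|lborel. dyadic_deriv f w z * \<phi> z) = - (LINT z|lborel. f z * frechet_derivative \<phi> (at z) w)"
    and "integrable lborel (\<lambda>z. dyadic_deriv f w z * \<phi> z)"
    and "integrable lborel (\<lambda>z. f z * frechet_derivative \<phi> (at z) w)"
proof -
  have fc: "continuous_on A f" for A using lipschitz_on_continuous_on[OF f] continuous_on_subset by blast
  have pc: "continuous_on A \<phi>" for A using test_function_continuous[OF \<phi>] .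
  have fm[measurable]: "f \<in> borel_measurable borel" and pm[measurable]: "\<phi> \<in> borel_measurable borel"
    using fc pc by (auto intro: borel_measurable_continuous_onI)
  have qm[measurable]: "dyadic_quot f w n \<in> borel_measurable borel" "dyadic_quot \<phi> w n \<in> borel_measurable borel" for w n
    by (auto intro: dyadic_quot_measurable)
  have dm[measurable]: "dyadic_deriv f w \<in> borel_measurable borel" by (rule dyadic_deriv_measurable[OF f])
  have cs: "compact (supp \<phi>)" using \<phi> by (simp add: test_functions_def)
  have sz: "\<phi> z = 0" if "z \<notin> supp \<phi>" for z using test_function_outside(1)[OF \<phi> that] .
  obtain K where K: "K-lipschitz_on UNIV \<phi>" by (rule test_function_lipschitz[OF \<phi>])
  have ip: "integrable lborel \<phi>" by (rule integrable_continuous_compact_support[OF pc cs sz])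
  have ifp: "integrable lborel (\<lambda>z. f z * \<phi> z)"
    by (rule integrable_continuous_compact_support[OF _ cs]) (auto intro!: continuous_intros fc pc simp: sz)
  \<comment> \<open>Contains the support of \<phi> and all its translates by t w with |t| \<le> 1,
    hence the supports of all quotients of \<phi> in the direction -w at once. This is the set on
    which the dominating function lives.\<close>
  define M where "M = {x + y | x y. x \<in> supp \<phi> \<and> y \<in> cball 0 (norm w)}"
  have cM: "compact M" unfolding M_def by (intro compact_sums cs compact_cball)
  have M1: "z \<in> M" if "z + t *\<^sub>R w \<in> supp \<phi>" "\<bar>t\<bar> \<le> 1" for z t
  proof -
    have "norm (- t *\<^sub>R w) \<le> norm w" using that(2) by (simp add: mult_left_le_one_le)
    then show ?thesis unfolding M_def using that(1)
      by (intro CollectI exI[of _ "z + t *\<^sub>R w"] exI[of _ "- t *\<^sub>R w"]) auto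
  qed
  have dqM: "dyadic_quot \<phi> (-w) n z = 0" if "z \<notin> M" for n z
  proof -
    have "\<phi> (z + (- (1 / 2^n)) *\<^sub>R w) = 0" using M1[of z "- (1/2^n)"] sz that by auto
    moreover have "\<phi> z = 0" using M1[of z 0] sz that by auto
    ultimately show ?thesis by (simp add: dyadic_quot_def divide_inverse)
  qed
  have dM: "frechet_derivative \<phi> (at z) w = 0" if "z \<notin> M" for z
    using test_function_outside(2)[OF \<phi>, of z] M1[of z 0] that by auto
  obtain C where C: "\<And>z. z \<in> M \<Longrightarrow> \<bar>f z\<bar> \<le> C"
    using compact_imp_bounded[OF compact_continuous_image[OF fc cM]] by (auto simp: bounded_iff)
  have lin: "linear (frechet_derivative \<phi> (at z))" for z
    using test_function_has_derivative[OF \<phi>] has_derivative_linear by blast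
  show i3: "integrable lborel (\<lambda>z. f z * frechet_derivative \<phi> (at z) w)"
    by (rule integrable_continuous_compact_support[OF _ cM])
      (auto intro!: continuous_intros fc test_function_deriv_continuous[OF \<phi>] simp: dM)
  have dom1: "integrable lborel (\<lambda>z. L * norm w * \<bar>\<phi> z\<bar>)" using ip by auto
  have ae1: "AE z in lborel. (\<lambda>n. dyadic_quot f w n z * \<phi> z) \<longlonglongrightarrow> dyadic_deriv f w z * \<phi> z"
    using AE_dyadic_deriv[OF f, of w] by eventually_elim (auto intro: tendsto_intros)
  have bd1: "AE z in lborel. norm (dyadic_quot f w n z * \<phi> z) \<le> L * norm w * \<bar>\<phi> z\<bar>" for n
    using dyadic_quot_bound[OF f] by (auto simp: abs_mult intro!: mult_right_mono)
  have L1: "(\<lambda>n. LINT z|lborel. dyadic_quot f w n z * \<phi> z) \<longlonglongrightarrow> (LINT z|lborel. dyadic_deriv f w z * \<phi> z)"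
    by (rule integral_dominated_convergence[OF _ _ dom1 ae1 bd1]) auto
  show "integrable lborel (\<lambda>z. dyadic_deriv f w z * \<phi> z)"
    by (rule integrable_dominated_convergence[OF _ _ dom1 ae1 bd1]) auto
  have shift: "(LINT z|lborel. dyadic_quot f w n z * \<phi> z) = (LINT z|lborel. f z * dyadic_quot \<phi> (-w) n z)" for n
  proof -
    define c where "c = w /\<^sub>R 2 ^ n"
    have t1: "integrable lborel (\<lambda>z. f z * \<phi> (z - c))"
      by (rule integrable_continuous_compact_support[where S="(\<lambda>z. z + c) ` supp \<phi>"])
        (auto intro!: continuous_intros fc continuous_on_compose2[OF pc] compact_continuous_image cs
          sz simp: image_iff Bex_def) 
    have t2: "integrable lborel (\<lambda>z. f (z + c) * \<phi> z)"
      using integrable_lborel_translate[OF t1, of c] by simp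
    have "(LINT z|lborel. dyadic_quot f w n z * \<phi> z) = (LINT z|lborel. 2^n * (f (z + c) * \<phi> z - f z * \<phi> z))"
      by (simp add: dyadic_quot_def c_def algebra_simps)
    also have "\<dots> = 2^n * ((LINT z|lborel. f (z + c) * \<phi> z) - (LINT z|lborel. f z * \<phi> z))"
      using t2 ifp by simp
    also have "(LINT z|lborel. f (z + c) * \<phi> z) = (LINT z|lborel. f z * \<phi> (z - c))"
      using integral_lborel_translate[of "\<lambda>z. f z * \<phi> (z - c)" c] by simp
    also have "2^n * ((LINT z|lborel. f z * \<phi> (z - c)) - (LINT z|lborel. f z * \<phi> z))
       = (LINT z|lborel. 2^n * (f z * \<phi> (z - c) - f z * \<phi> z))"
      using t1 ifp by simp
    also have "\<dots> = (LINT z|lborel. f z * dyadic_quot \<phi> (-w) n z)"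
      by (simp add: dyadic_quot_def c_def algebra_simps)
    finally show ?thesis .
  qed
  have fdm[measurable]: "(\<lambda>z. f z * frechet_derivative \<phi> (at z) v) \<in> borel_measurable borel" for v
    by (intro borel_measurable_continuous_onI continuous_on_mult fc test_function_deriv_continuous[OF \<phi>])
  have L2: "(\<lambda>n. LINT z|lborel. f z * dyadic_quot \<phi> (-w) n z) \<longlonglongrightarrow> (LINT z|lborel. f z * frechet_derivative \<phi> (at z) (-w))"
  proof (rule integral_dominated_convergence[where w="\<lambda>z. indicator M z *\<^sub>R (C * (K * norm w))"])
    show "integrable lborel (\<lambda>z. indicator M z *\<^sub>R (C * (K * norm w)))"
      by (intro borel_integrable_compact cM continuous_intros)
    show "AE z in lborel. (\<lambda>n. f z * dyadic_quot \<phi> (-w) n z) \<longlonglongrightarrow> f z * frechet_derivative \<phi> (at z) (-w)"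
      by (intro AE_I2 tendsto_intros dyadic_quot_tendsto test_function_has_derivative[OF \<phi>])
    show "AE z in lborel. norm (f z * dyadic_quot \<phi> (-w) n z) \<le> indicator M z *\<^sub>R (C * (K * norm w))" for n
    proof (rule AE_I2)
      fix z show "norm (f z * dyadic_quot \<phi> (-w) n z) \<le> indicator M z *\<^sub>R (C * (K * norm w))"
      proof (cases "z \<in> M")
        case True
        moreover have "C \<ge> 0" using C[OF True] by linarith
        ultimately show ?thesis using C[OF True] dyadic_quot_bound[OF K, of "-w" n z]
          by (auto simp: abs_mult intro!: mult_mono)
      qed (simp add: dqM)
    qed
  qed auto
  have "(LINT z|lborel. dyadic_deriv f w z * \<phi> z) = (LINT z|lborel. f z * frechet_derivative \<phi> (at z) (-w))"
    using LIMSEQ_unique[OF L1] L2 by (simp add: shift)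
  then show "(LINT z|lborel. dyadic_deriv f w z * \<phi> z) = - (LINT z|lborel. f z * frechet_derivative \<phi> (at z) w)"
    by (simp add: linear_neg[OF lin])
qed

lemma Linfty_UNIV_I:
  assumes "u \<in> borel_measurable borel" "AE z in lborel. norm (u z) \<le> C"
  shows "Linfty UNIV u"
proof -
  have "AE z in lebesgue_on UNIV. norm (u z) \<le> C"
    unfolding lebesgue_on_UNIV_eq AE_completion_iff by (fact assms(2))
  moreover have "u \<in> borel_measurable (lebesgue_on UNIV)"
    using assms(1) by (simp add: lebesgue_on_UNIV_eq measurable_completion)
  ultimately show ?thesis unfolding Linfty_def by blast
qed

text \<open>Built from limits of quotients instead of derivatives, hence total, and Borel measurable
  for Lipschitz functions. For these \<open>rademacher\<close> shows that it is the gradient almost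
  everywhere.\<close>

definition grad :: "('a::euclidean_space \<Rightarrow> real) \<Rightarrow> 'a \<Rightarrow> 'a" where
  "grad f z = (\<Sum>b\<in>Basis. dyadic_deriv f b z *\<^sub>R b)"

lemma grad_measurable:
  assumes "L-lipschitz_on UNIV f" shows "grad f \<in> borel_measurable borel"
  unfolding grad_def by (intro borel_measurable_sum borel_measurable_scaleR dyadic_deriv_measurable[OF assms]) auto

lemma grad_inner: "grad f z \<bullet> w = (\<Sum>b\<in>Basis. (w \<bullet> b) * dyadic_deriv f b z)"
  by (simp add: grad_def inner_sum_left inner_commute[of w] mult.commute)

lemma grad_inner_Basis: "b \<in> Basis \<Longrightarrow> grad f z \<bullet> b = dyadic_deriv f b z"
  by (simp add: grad_def inner_sum_left inner_Basis if_distrib cong: if_cong)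

text \<open>Linearity in the direction w is not visible for the limits themselves. After integration
  against \<phi> it is inherited from the derivative of \<phi>, and the fundamental lemma removes
  the test function.\<close>

lemma AE_dyadic_deriv_eq_grad:
  assumes f: "L-lipschitz_on UNIV (f :: 'a::euclidean_space \<Rightarrow> real)"
  shows "AE z in lborel. dyadic_deriv f w z = grad f z \<bullet> w"
proof -
  note [measurable] = dyadic_deriv_measurable[OF f]
  let ?u = "\<lambda>z. dyadic_deriv f w z - (\<Sum>b\<in>Basis. (w \<bullet> b) * dyadic_deriv f b z)"
  have um: "?u \<in> borel_measurable borel" by measurable
  have "AE z in lborel. \<forall>b\<in>Basis. \<bar>dyadic_deriv f b z\<bar> \<le> L * norm b"
  proof (rule AE_finite_allI[OF finite_Basis])
    show "AE z in lborel. \<bar>dyadic_deriv f b z\<bar> \<le> L * norm b" for b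
      using AE_dyadic_deriv[OF f, of b] by eventually_elim blast
  qed
  moreover have "AE z in lborel. \<bar>dyadic_deriv f w z\<bar> \<le> L * norm w" using AE_dyadic_deriv[OF f] by auto
  ultimately have "AE z in lborel. norm (?u z) \<le> L * norm w + (\<Sum>b\<in>Basis. \<bar>w \<bullet> b\<bar> * (L * norm b))"
  proof eventually_elim
    case (elim z)
    have "\<bar>\<Sum>b\<in>Basis. (w \<bullet> b) * dyadic_deriv f b z\<bar> \<le> (\<Sum>b\<in>Basis. \<bar>w \<bullet> b\<bar> * (L * norm b))"
      by (rule order_trans[OF sum_abs sum_mono]) (use elim in \<open>auto simp: abs_mult intro!: mult_left_mono\<close>)
    then show ?case using elim by (simp only: real_norm_def)
  qed
  then have Li: "Linfty UNIV ?u" by (rule Linfty_UNIV_I[OF um])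
  have "AE z in lebesgue_on UNIV. ?u z = 0"
  proof (rule test_function_zero_imp_AE_zero[OF open_UNIV Li])
    fix \<phi> :: "'a \<Rightarrow> real" assume \<phi>: "\<phi> \<in> test_functions UNIV"
    note [measurable] = borel_measurable_continuous_onI[OF test_function_continuous[OF \<phi>]]
    have lin: "linear (frechet_derivative \<phi> (at z))" for z
      using test_function_has_derivative[OF \<phi>] has_derivative_linear by blast
    have expand: "frechet_derivative \<phi> (at z) w = (\<Sum>b\<in>Basis. (w \<bullet> b) * frechet_derivative \<phi> (at z) b)" for z
      by (subst euclidean_representation[symmetric, of w], subst linear_sum[OF lin]) (simp add: linear_scale[OF lin])
    note I = integral_dyadic_deriv_test_function[OF f \<phi>]
    have "(LINT z|lebesgue_on UNIV. ?u z * \<phi> z) = (LINT z|lborel. ?u z * \<phi> z)"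
      unfolding lebesgue_on_UNIV_eq by (rule integral_completion) measurable
    also have "\<dots> = (LINT z|lborel. dyadic_deriv f w z * \<phi> z - (\<Sum>b\<in>Basis. (w \<bullet> b) * (dyadic_deriv f b z * \<phi> z)))"
      by (simp add: left_diff_distrib sum_distrib_right mult.assoc)
    also have "\<dots> = (LINT z|lborel. dyadic_deriv f w z * \<phi> z) - (\<Sum>b\<in>Basis. (w \<bullet> b) * (LINT z|lborel. dyadic_deriv f b z * \<phi> z))"
      using I(2) by (subst Bochner_Integration.integral_diff) (auto intro!: Bochner_Integration.integrable_sum simp: Bochner_Integration.integral_sum)
    also have "\<dots> = - (LINT z|lborel. f z * frechet_derivative \<phi> (at z) w)
        + (\<Sum>b\<in>Basis. (w \<bullet> b) * (LINT z|lborel. f z * frechet_derivative \<phi> (at z) b))"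
      by (simp add: I(1) sum_negf)
    also have "(\<Sum>b\<in>Basis. (w \<bullet> b) * (LINT z|lborel. f z * frechet_derivative \<phi> (at z) b))
        = (LINT z|lborel. (\<Sum>b\<in>Basis. (w \<bullet> b) * (f z * frechet_derivative \<phi> (at z) b)))"
      using I(3) by (subst Bochner_Integration.integral_sum) auto
    also have "\<dots> = (LINT z|lborel. f z * frechet_derivative \<phi> (at z) w)"
      by (simp add: expand sum_distrib_left mult.left_commute)
    finally show "(LINT z|lebesgue_on UNIV. ?u z * \<phi> z) = 0" by simp
  qed
  then show ?thesis
    unfolding lebesgue_on_UNIV_eq AE_completion_iff by eventually_elim (simp add: grad_inner)
qed

text \<open>Minimality of n yields both bounds. The lemma replaces arbitrary increments by dyadic
  ones, and later it sorts the points of the plane into dyadic shells.\<close>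

lemma dyadic_scale:
  assumes "0 < (y::real)" "y \<le> 1 / 2 ^ N"
  obtains n where "n \<ge> N" "y \<le> 1 / 2 ^ n" "1 / 2 ^ n < 2 * y"
proof -
  define P where "P n \<longleftrightarrow> 1 / 2 ^ n < 2 * y" for n
  obtain m where "(1/2) ^ m < 2 * y" using real_arch_pow_inv[of "2 * y" "1/2"] assms(1) by auto
  then have ex: "P m" by (simp add: P_def power_one_over)
  define n where "n = (LEAST n. n \<ge> N \<and> P n)"
  have "P (max m N)"
  proof -
    have "(1::real) / 2 ^ (max m N) \<le> 1 / 2 ^ m" by (simp add: frac_le)
    then show ?thesis using ex by (simp add: P_def)
  qed
  then have n: "n \<ge> N \<and> P n" unfolding n_def using LeastI[of "\<lambda>n. n \<ge> N \<and> P n" "max m N"] by simp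
  have "y \<le> 1 / 2 ^ n"
  proof (cases "n = N")
    case False
    then obtain k where k: "n = Suc k" "k \<ge> N" using n by (metis le_SucE not0_implies_Suc le_0_eq)
    have "\<not> P k" using not_less_Least[of k "\<lambda>n. n \<ge> N \<and> P n"] k by (auto simp: n_def)
    then show ?thesis using k by (simp add: P_def field_simps)
  qed (use assms in simp)
  then show ?thesis using that n by (auto simp: P_def)
qed

text \<open>Outside one null set the quotients converge to a linear function for countably many,
  dense directions. Equicontinuity in the direction makes the convergence uniform on the unit ball,
  and every increment is a dyadic multiple of a vector in this ball.\<close>

theorem rademacher:
  assumes f: "L-lipschitz_on UNIV (f :: 'a::euclidean_space \<Rightarrow> real)"
  shows "AE z in lborel. (f has_derivative (\<lambda>h. grad f z \<bullet> h)) (at z)"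
proof -
  obtain Q :: "'a set" where Q: "countable Q" "\<And>X. open X \<Longrightarrow> X \<noteq> {} \<Longrightarrow> \<exists>d\<in>Q. d \<in> X"
    by (rule countable_dense_setE) blast
  have L0: "L \<ge> 0" using f lipschitz_on_nonneg by blast
  have "AE z in lborel. \<forall>w\<in>Q. (\<lambda>n. dyadic_quot f w n z) \<longlonglongrightarrow> grad f z \<bullet> w"
  proof (rule AE_ball_countable'[OF _ Q(1)])
    show "AE z in lborel. (\<lambda>n. dyadic_quot f w n z) \<longlonglongrightarrow> grad f z \<bullet> w" for w
      using AE_dyadic_deriv[OF f, of w] AE_dyadic_deriv_eq_grad[OF f, of w] by eventually_elim simp
  qed
  then show ?thesis
  proof eventually_elim
    case (elim z)
    define g where "g = grad f z"
    \<comment> \<open>The quotients have the Lipschitz constant L in the direction for every n, so a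
      finite \<eta>-net of the unit ball taken from Q suffices. The three summands of the constant
      are the change of the quotient, the error at the net point and the change of the
      limit.\<close>
    have key: "\<exists>N. \<forall>n\<ge>N. \<forall>u. norm u \<le> 1 \<longrightarrow> \<bar>dyadic_quot f u n z - g \<bullet> u\<bar> \<le> (L + 1 + norm g) * \<eta>" if "\<eta> > 0" for \<eta> :: real
    proof -
      have "cball 0 1 \<subseteq> (\<Union>w\<in>Q. ball w \<eta>)"
      proof
        fix u :: 'a
        obtain d where "d \<in> Q" "d \<in> ball u \<eta>" using Q(2)[of "ball u \<eta>"] \<open>\<eta> > 0\<close> by auto
        then show "u \<in> (\<Union>w\<in>Q. ball w \<eta>)" by (auto simp: dist_commute)
      qed
      then obtain W where W: "W \<subseteq> Q" "finite W" "cball 0 1 \<subseteq> (\<Union>w\<in>W. ball w \<eta>)"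
        using compactE_image[OF compact_cball, of Q "\<lambda>w. ball w \<eta>" 0 1] by auto
      have "\<forall>w\<in>W. \<exists>N. \<forall>n\<ge>N. \<bar>dyadic_quot f w n z - g \<bullet> w\<bar> < \<eta>"
      proof
        fix w assume "w \<in> W"
        then have "(\<lambda>n. dyadic_quot f w n z) \<longlonglongrightarrow> g \<bullet> w" using elim W(1) by (auto simp: g_def)
        from LIMSEQ_D[OF this \<open>\<eta> > 0\<close>] show "\<exists>N. \<forall>n\<ge>N. \<bar>dyadic_quot f w n z - g \<bullet> w\<bar> < \<eta>" by simp
      qed
      then obtain N where N: "\<And>w n. w \<in> W \<Longrightarrow> n \<ge> N w \<Longrightarrow> \<bar>dyadic_quot f w n z - g \<bullet> w\<bar> < \<eta>"
        by metis
      show ?thesis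
      proof (intro exI[of _ "\<Sum>w\<in>W. N w"] allI impI)
        fix n u assume n: "(\<Sum>w\<in>W. N w) \<le> n" and u: "norm (u::'a) \<le> 1"
        obtain w where w: "w \<in> W" "dist w u < \<eta>" using W(3) u by force
        have "N w \<le> n" using member_le_sum[of w W N] n w W(2) by auto
        then have 1: "\<bar>dyadic_quot f w n z - g \<bullet> w\<bar> < \<eta>" using N w by blast
        have "\<bar>f (z + u /\<^sub>R 2 ^ n) - f (z + w /\<^sub>R 2 ^ n)\<bar> \<le> L * norm (u /\<^sub>R 2 ^ n - w /\<^sub>R 2 ^ n)"
          using lipschitz_onD[OF f, of "z + u /\<^sub>R 2 ^ n" "z + w /\<^sub>R 2 ^ n"] by (simp add: dist_norm)
        also have "norm (u /\<^sub>R 2 ^ n - w /\<^sub>R 2 ^ n) = norm (u - w) / 2 ^ n"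
          by (simp add: scaleR_diff_right[symmetric] divide_inverse mult.commute)
        finally have "2 ^ n * \<bar>f (z + u /\<^sub>R 2 ^ n) - f (z + w /\<^sub>R 2 ^ n)\<bar> \<le> L * norm (u - w)"
          by (simp add: field_simps)
        moreover have "dyadic_quot f u n z - dyadic_quot f w n z = 2 ^ n * (f (z + u /\<^sub>R 2 ^ n) - f (z + w /\<^sub>R 2 ^ n))"
          by (simp add: dyadic_quot_def algebra_simps)
        ultimately have 2: "\<bar>dyadic_quot f u n z - dyadic_quot f w n z\<bar> \<le> L * norm (u - w)" by (simp add: abs_mult)
        have 3: "\<bar>g \<bullet> w - g \<bullet> u\<bar> \<le> norm g * norm (u - w)"
          by (metis Cauchy_Schwarz_ineq2 inner_diff_right norm_minus_commute)
        have 4: "L * norm (u - w) \<le> L * \<eta>" "norm g * norm (u - w) \<le> norm g * \<eta>"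
          using w(2) L0 by (auto simp: dist_norm norm_minus_commute intro!: mult_left_mono)
        have "\<bar>dyadic_quot f u n z - g \<bullet> u\<bar> \<le> \<bar>dyadic_quot f u n z - dyadic_quot f w n z\<bar> + \<bar>dyadic_quot f w n z - g \<bullet> w\<bar> + \<bar>g \<bullet> w - g \<bullet> u\<bar>"
          by linarith
        also have "\<dots> \<le> L * \<eta> + \<eta> + norm g * \<eta>" using 1 2 3 4 by linarith
        finally show "\<bar>dyadic_quot f u n z - g \<bullet> u\<bar> \<le> (L + 1 + norm g) * \<eta>" by (simp add: algebra_simps)
      qed
    qed
    show ?case unfolding has_derivative_at_alt
    proof (intro conjI allI impI)
      show "bounded_linear (\<lambda>h. grad f z \<bullet> h)" by (rule bounded_linear_inner_right)
      fix e :: real assume "e > 0"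
      \<comment> \<open>The factor 2 pays for \<open>1 / 2 ^ n < 2 * norm (y - z)\<close>, which
        converts an error at the scale 1 / 2^n into a multiple of the increment.\<close>
      define \<eta> where "\<eta> = e / (2 * (L + 1 + norm g))"
      have pos: "L + 1 + norm g > 0" using L0 by (simp add: add_nonneg_pos add_pos_nonneg)
      have "\<eta> > 0" using \<open>e > 0\<close> pos by (simp add: \<eta>_def)
      have \<eta>e: "2 * ((L + 1 + norm g) * \<eta>) = e" using pos by (simp add: \<eta>_def field_simps)
      obtain N where N: "\<And>n u. n \<ge> N \<Longrightarrow> norm u \<le> 1 \<Longrightarrow> \<bar>dyadic_quot f u n z - g \<bullet> u\<bar> \<le> (L + 1 + norm g) * \<eta>"
        using key[OF \<open>\<eta> > 0\<close>] by blast
      show "\<exists>d>0. \<forall>y. norm (y - z) < d \<longrightarrow> norm (f y - f z - grad f z \<bullet> (y - z)) \<le> e * norm (y - z)"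
      proof (intro exI[of _ "1 / 2 ^ N"] conjI allI impI)
        fix y assume y: "norm (y - z) < 1 / 2 ^ N"
        show "norm (f y - f z - grad f z \<bullet> (y - z)) \<le> e * norm (y - z)"
        proof (cases "y = z")
          case False
          then obtain n where n: "n \<ge> N" "norm (y - z) \<le> 1 / 2 ^ n" "1 / 2 ^ n < 2 * norm (y - z)"
            using dyadic_scale[of "norm (y - z)" N] y by auto
          define u where "u = 2 ^ n *\<^sub>R (y - z)"
          have u: "norm u \<le> 1" using n(2) unfolding u_def norm_scaleR by (simp add: field_simps)
          have "dyadic_quot f u n z - g \<bullet> u = 2 ^ n * (f y - f z - g \<bullet> (y - z))"
            by (simp add: dyadic_quot_def u_def algebra_simps)
          then have "2 ^ n * \<bar>f y - f z - g \<bullet> (y - z)\<bar> \<le> (L + 1 + norm g) * \<eta>"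
            using N[OF n(1) u] by (simp add: abs_mult)
          then have "\<bar>f y - f z - g \<bullet> (y - z)\<bar> \<le> (L + 1 + norm g) * \<eta> * (1 / 2 ^ n)"
            by (simp add: field_simps)
          also have "\<dots> \<le> (L + 1 + norm g) * \<eta> * (2 * norm (y - z))"
            using n(3) pos \<open>\<eta> > 0\<close> by (intro mult_left_mono) auto
          also have "\<dots> = e * norm (y - z)" by (simp add: \<eta>e[symmetric])
          finally show ?thesis by (simp add: g_def)
        qed simp
      qed simp
    qed
  qed
qed

text \<open>Differentiating in the direction of the gradient itself gives the square of its norm,
  and the quotients are at most L times its norm. This is sharper than a bound by
  components.\<close>

lemma AE_grad_bound:
  assumes f: "L-lipschitz_on UNIV (f :: 'a::euclidean_space \<Rightarrow> real)"
  shows "AE z in lborel. norm (grad f z) \<le> L"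
  using rademacher[OF f]
proof eventually_elim
  case (elim z)
  have "\<bar>grad f z \<bullet> grad f z\<bar> \<le> L * norm (grad f z)"
    by (rule LIMSEQ_le_const2[OF tendsto_rabs[OF dyadic_quot_tendsto[OF elim]]]) (use dyadic_quot_bound[OF f] in blast)
  then have "norm (grad f z) * norm (grad f z) \<le> L * norm (grad f z)"
    by (simp add: power2_norm_eq_inner[symmetric] power2_eq_square)
  then show ?case using lipschitz_on_nonneg[OF f]
    by (cases "grad f z = 0") auto
qed

section \<open>Weak gradients of Lipschitz functions\<close>

text \<open>Exchanges a function measurable for the completed measure for a bounded Borel function,
  so that \<open>lborel\<close>, products of measures and translations can be used from here
  on.\<close>

lemma Linfty_borel_representative:
  fixes u :: "'a::euclidean_space \<Rightarrow> real"
  assumes U: "open U" and u: "Linfty U u"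
  obtains v C where "v \<in> borel_measurable borel" "\<And>z. \<bar>v z\<bar> \<le> C" "C \<ge> 0" "\<And>z. z \<notin> U \<Longrightarrow> v z = 0"
    "AE z in lebesgue_on U. u z = v z"
proof -
  have Ul: "U \<in> sets lebesgue" using U by (simp add: borel_open)
  from u obtain C where C: "AE z in lebesgue_on U. norm (u z) \<le> C"
    and um: "u \<in> borel_measurable (lebesgue_on U)" by (auto simp: Linfty_def)
  have "(\<lambda>z. if z \<in> U then u z else 0) \<in> borel_measurable lebesgue"
    using borel_measurable_if_I[OF um Ul] .
  then obtain g where g: "g \<in> borel_measurable borel" "AE z in lborel. (if z \<in> U then u z else 0) = g z"
    using completion_ex_borel_measurable_real[of _ lborel] by auto
  define v where "v z = (if z \<in> U \<and> \<bar>g z\<bar> \<le> \<bar>C\<bar> then g z else 0)" for z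
  have "Measurable.pred borel (\<lambda>z. z \<in> U)" using borel_open[OF U] by simp
  then have "v \<in> borel_measurable borel"
    unfolding v_def using g(1) by measurable
  moreover have "AE z in lebesgue. (if z \<in> U then u z else 0) = g z"
    using g(2) by (rule AE_completion)
  then have "AE z in lebesgue. z \<in> U \<longrightarrow> u z = g z" by eventually_elim auto
  then have "AE z in lebesgue_on U. u z = g z" using Ul by (simp add: AE_restrict_space_iff)
  with C AE_space[of "lebesgue_on U"] have "AE z in lebesgue_on U. u z = v z"
    by eventually_elim (auto simp: v_def)
  ultimately show ?thesis by (intro that[of v "\<bar>C\<bar>"]) (auto simp: v_def)
qed

lemma AE_lebesgue_on_iff_lborel:
  assumes "open U" shows "(AE z in lebesgue_on U. P z) \<longleftrightarrow> (AE z in lborel. z \<in> U \<longrightarrow> P z)"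
proof -
  have "U \<in> sets lebesgue" using assms by (simp add: borel_open)
  then show ?thesis by (simp add: AE_restrict_space_iff AE_completion_iff)
qed

lemma integral_lebesgue_on_eq_lborel:
  fixes u v \<phi> :: "'a::euclidean_space \<Rightarrow> real"
  assumes U: "open U" and ae: "AE z in lebesgue_on U. u z = v z"
    and um: "u \<in> borel_measurable (lebesgue_on U)" and vm: "v \<in> borel_measurable borel"
    and pm: "\<phi> \<in> borel_measurable borel" and p0: "\<And>z. z \<notin> U \<Longrightarrow> \<phi> z = 0"
  shows "(LINT z|lebesgue_on U. u z * \<phi> z) = (LINT z|lborel. v z * \<phi> z)"
proof -
  have Ul: "U \<in> sets lebesgue" using U by (simp add: borel_open)
  have vm': "v \<in> borel_measurable (lebesgue_on U)" and pm': "\<phi> \<in> borel_measurable (lebesgue_on U)"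
    using vm pm by (simp_all add: measurable_completion measurable_restrict_space1)
  have "(LINT z|lebesgue_on U. u z * \<phi> z) = (LINT z|lebesgue_on U. v z * \<phi> z)"
    using ae um vm' pm' by (intro integral_cong_AE borel_measurable_times) auto
  also have "\<dots> = (LINT z|lebesgue. indicator U z *\<^sub>R (v z * \<phi> z))"
    using Ul by (simp add: integral_restrict_space)
  also have "\<dots> = (LINT z|lebesgue. v z * \<phi> z)"
    by (intro Bochner_Integration.integral_cong) (auto simp: indicator_def p0)
  also have "\<dots> = (LINT z|lborel. v z * \<phi> z)"
    using vm pm by (intro integral_completion) simp
  finally show ?thesis .
qed

section \<open>From weak derivatives to Lipschitz bounds\<close>

lemma box_bump_translate: "box_bump a b k (z - c) = box_bump (a + c) (b + c) k z"
  by (simp add: box_bump_def algebra_simps)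

text \<open>McShane's extension: the lower envelope of the cones with slope M over the points of
  A.\<close>

lemma lipschitz_extension_real:
  fixes f :: "'a::metric_space \<Rightarrow> real"
  assumes M: "M \<ge> 0" and f: "\<And>x y. x \<in> A \<Longrightarrow> y \<in> A \<Longrightarrow> f x - f y \<le> M * dist x y"
  obtains g where "M-lipschitz_on UNIV g" "\<And>x. x \<in> A \<Longrightarrow> g x = f x"
proof (cases "A = {}")
  case True
  have "M-lipschitz_on UNIV (\<lambda>x::'a. 0::real)" using M by (auto intro!: lipschitz_onI)
  then show ?thesis using that[of "\<lambda>x. 0"] True by simp
next
  case False
  then obtain a where a: "a \<in> A" by blast
  define g where "g z = (INF y\<in>A. f y + M * dist z y)" for z
  have low: "f a - M * dist z a \<le> f y + M * dist z y" if "y \<in> A" for y z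
  proof -
    have "M * dist a y \<le> M * (dist z a + dist z y)"
      using M dist_triangle3[of a y z] by (intro mult_left_mono) (auto simp: dist_commute)
    then show ?thesis using f[OF a that] by (simp add: algebra_simps)
  qed
  have bb: "bdd_below ((\<lambda>y. f y + M * dist z y) ` A)" for z
    using low by (intro bdd_belowI2[of _ "f a - M * dist z a"]) auto
  have step: "g x \<le> g y + M * dist x y" for x y
  proof -
    have "g x - M * dist x y \<le> g y"
      unfolding g_def
    proof (rule cINF_greatest[OF False])
      fix u assume u: "u \<in> A"
      have "(INF y\<in>A. f y + M * dist x y) \<le> f u + M * dist x u" by (rule cINF_lower[OF bb u])
      moreover have "M * dist x u \<le> M * (dist x y + dist y u)"
        using M by (intro mult_left_mono dist_triangle) auto
      ultimately show "(INF y\<in>A. f y + M * dist x y) - M * dist x y \<le> f u + M * dist y u"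
        by (simp add: algebra_simps)
    qed
    then show ?thesis by simp
  qed
  have "M-lipschitz_on UNIV g"
  proof (rule lipschitz_onI)
    show "dist (g x) (g y) \<le> M * dist x y" for x y
      using step[of x y] step[of y x] by (simp add: dist_real_def abs_le_iff dist_commute)
  qed (rule M)
  moreover have "g x = f x" if "x \<in> A" for x
  proof (rule antisym)
    show "g x \<le> f x" unfolding g_def using cINF_lower[OF bb that, of x] by simp
    show "f x \<le> g x" unfolding g_def
      using f[OF that] by (intro cINF_greatest[OF False]) (simp add: algebra_simps)
  qed
  ultimately show ?thesis using that by blast
qed

text \<open>In the weak sense v (y + w) - v y is the integral of H (y + s w) over s in [0, 1]. To
  see this, the increment is moved to the test function, the fundamental theorem of calculus is
  applied to \<phi> along the segment, and the integrations are exchanged; the weak identity is used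
  once for each s. Testing with bumps in both signs gives the pointwise bound.\<close>

lemma W1inf_difference_bound:
  fixes v :: "'a::euclidean_space \<Rightarrow> real"
  assumes U: "open U" "convex U"
    and vm: "v \<in> borel_measurable borel" and vb: "\<And>z. \<bar>v z\<bar> \<le> C" and C0: "C \<ge> 0"
    and Hm: "H \<in> borel_measurable borel" and Hb: "\<And>z. \<bar>H z\<bar> \<le> M"
    and weak: "\<And>\<phi>. \<phi> \<in> test_functions U \<Longrightarrow>
      (LINT z|lborel. v z * frechet_derivative \<phi> (at z) w) = - (LINT z|lborel. H z * \<phi> z)"
  shows "AE y in lborel. y \<in> U \<and> y + w \<in> U \<longrightarrow> \<bar>v (y + w) - v y\<bar> \<le> M"
proof -
  define W where "W = {y. y \<in> U \<and> y + w \<in> U}"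
  have Wo: "open W"
  proof -
    have "W = U \<inter> (\<lambda>y. y + w) -` U" by (auto simp: W_def)
    then show ?thesis using U(1) by (auto intro!: open_Int continuous_open_vimage continuous_intros)
  qed
  have est: "\<bar>LINT y|lborel. (v (y + w) - v y) * box_bump a b k y\<bar> \<le> M * (LINT y|lborel. box_bump a b k y)"
    and ints: "integrable lborel (\<lambda>y. (v (y + w) - v y) * box_bump a b k y)"
      "integrable lborel (box_bump a b k)"
    if ab: "cbox a b \<subseteq> W" for a b k
  proof -
    define \<phi> where "\<phi> = box_bump a b k"
    have \<phi>: "\<phi> \<in> test_functions W" unfolding \<phi>_def by (rule box_bump_test[OF ab])
    \<comment> \<open>The box of the bump lies in U together with its translate by w, and convexity
      of U adds all intermediate translates.\<close>
    have \<phi>s: "(\<lambda>y. \<phi> (y - s *\<^sub>R w)) \<in> test_functions U" if "s \<in> {0..1}" for s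
    proof -
      have "cbox (a + s *\<^sub>R w) (b + s *\<^sub>R w) \<subseteq> U"
      proof
        fix y assume "y \<in> cbox (a + s *\<^sub>R w) (b + s *\<^sub>R w)"
        then have "y - s *\<^sub>R w \<in> cbox a b" by (auto simp: mem_box algebra_simps)
        then have "y - s *\<^sub>R w \<in> U" "y - s *\<^sub>R w + w \<in> U" using ab by (auto simp: W_def)
        then have "(1 - s) *\<^sub>R (y - s *\<^sub>R w) + s *\<^sub>R (y - s *\<^sub>R w + w) \<in> U"
          using convexD[OF U(2), of "y - s *\<^sub>R w" "y - s *\<^sub>R w + w" "1 - s" s] that by auto
        then show "y \<in> U" by (simp add: algebra_simps)
      qed
      then show ?thesis unfolding \<phi>_def box_bump_translate by (rule box_bump_test)
    qed
    have pc: "continuous_on A \<phi>" for A by (rule test_function_continuous[OF \<phi>])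
    have dc: "continuous_on A (\<lambda>y. frechet_derivative \<phi> (at y) w)" for A
      by (rule test_function_deriv_continuous[OF \<phi>])
    have pm[measurable]: "\<phi> \<in> borel_measurable borel" and dm[measurable]: "(\<lambda>y. frechet_derivative \<phi> (at y) w) \<in> borel_measurable borel"
      using pc dc by (auto intro: borel_measurable_continuous_onI)
    note [measurable] = vm Hm
    have cs: "compact (supp \<phi>)" using \<phi> by (simp add: test_functions_def)
    have sz: "\<phi> z = 0" "frechet_derivative \<phi> (at z) w = 0" if "z \<notin> supp \<phi>" for z using test_function_outside[OF \<phi> that] by auto
    obtain K where K: "\<And>z h. \<bar>frechet_derivative \<phi> (at z) h\<bar> \<le> K * norm h" by (rule test_function_lipschitz[OF \<phi>]) blast
    have ip: "integrable lborel \<phi>" by (rule integrable_continuous_compact_support[OF pc cs sz(1)])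
    then show "integrable lborel (box_bump a b k)" by (simp add: \<phi>_def)
    have iv: "integrable lborel (\<lambda>y. u y * \<phi> y)" if "u \<in> borel_measurable borel" "\<And>y. \<bar>u y\<bar> \<le> D" for u D
      by (rule Bochner_Integration.integrable_bound[of _ "\<lambda>y. D * \<phi> y"])
        (use ip that in \<open>auto simp: abs_mult intro!: mult_mono order_trans[OF that(2) abs_ge_self]\<close>)
    have vwm[measurable]: "(\<lambda>y. v (y + w)) \<in> borel_measurable borel" by measurable
    have iv1: "integrable lborel (\<lambda>y. v (y + w) * \<phi> y)" "integrable lborel (\<lambda>y. v y * \<phi> y)"
      by (rule iv[of _ C]; use vb in auto)+
    then show "integrable lborel (\<lambda>y. (v (y + w) - v y) * box_bump a b k y)"
      by (simp add: \<phi>_def[symmetric] left_diff_distrib)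
    have dphi: "(\<integral>s. (frechet_derivative \<phi> (at (y - s *\<^sub>R w)) w) * indicator {0..1} s \<partial>lborel) = \<phi> y - \<phi> (y - w)" for y
    proof -
      have "(\<integral>s. (frechet_derivative \<phi> (at (y - s *\<^sub>R w)) w) * indicator {0..1} s \<partial>lborel) = - \<phi> (y - 1 *\<^sub>R w) - - \<phi> (y - 0 *\<^sub>R w)"
      proof (rule integral_FTC_Icc_real)
        fix s :: real
        have lin: "linear (frechet_derivative \<phi> (at (y - s *\<^sub>R w)))"
          using test_function_has_derivative[OF \<phi>] has_derivative_linear by blast
        have "((\<lambda>s. y - s *\<^sub>R w) has_derivative (\<lambda>t. - t *\<^sub>R w)) (at s)"
          by (auto intro!: derivative_eq_intros)
        from diff_chain_at[OF this test_function_has_derivative[OF \<phi>]]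
        have "((\<lambda>s. \<phi> (y - s *\<^sub>R w)) has_derivative (\<lambda>t. frechet_derivative \<phi> (at (y - s *\<^sub>R w)) (- t *\<^sub>R w))) (at s)"
          by (simp add: o_def)
        then have "((\<lambda>s. - \<phi> (y - s *\<^sub>R w)) has_derivative (\<lambda>t. - frechet_derivative \<phi> (at (y - s *\<^sub>R w)) (- t *\<^sub>R w))) (at s)"
          by (rule has_derivative_minus)
        then show "((\<lambda>s. - \<phi> (y - s *\<^sub>R w)) has_real_derivative frechet_derivative \<phi> (at (y - s *\<^sub>R w)) w) (at s)"
          by (simp add: has_field_derivative_def linear_scale[OF lin] linear_neg[OF lin] mult_commute_abs)
        show "isCont (\<lambda>s. frechet_derivative \<phi> (at (y - s *\<^sub>R w)) w) s"
          using continuous_on_compose2[OF dc[of UNIV], of UNIV "\<lambda>s. y - s *\<^sub>R w"]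
          by (auto intro!: continuous_intros simp: continuous_on_eq_continuous_at)
      qed simp
      then show ?thesis by simp
    qed
    define S where "S = {x + y | x y. x \<in> supp \<phi> \<and> y \<in> cball 0 (norm w)}"
    have cS: "compact S" unfolding S_def by (intro compact_sums cs compact_cball)
    have S1: "y \<in> S" if "y - s *\<^sub>R w \<in> supp \<phi>" "s \<in> {0..1}" for y s
    proof -
      have "norm (s *\<^sub>R w) \<le> norm w" using that(2) by (simp add: mult_left_le_one_le)
      then show ?thesis unfolding S_def using that(1)
        by (intro CollectI exI[of _ "y - s *\<^sub>R w"] exI[of _ "s *\<^sub>R w"]) auto
    qed
    let ?F = "\<lambda>y s. indicator {0..1} s * (v y * frechet_derivative \<phi> (at (y - s *\<^sub>R w)) w)"
    have Fm: "case_prod ?F \<in> borel_measurable (lborel \<Otimes>\<^sub>M lborel)"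
    proof -
      have [measurable]: "(\<lambda>p. frechet_derivative \<phi> (at (fst p - snd p *\<^sub>R w)) w) \<in> borel_measurable (borel \<Otimes>\<^sub>M borel)"
        by (rule measurable_compose[OF _ dm]) measurable
      show ?thesis unfolding case_prod_beta by measurable
    qed
    have Fi: "integrable (lborel \<Otimes>\<^sub>M lborel) (case_prod ?F)"
    proof (rule Bochner_Integration.integrable_bound[of _ "\<lambda>p. indicator (S \<times> {0..1}) p *\<^sub>R (C * (K * norm w))"])
      show "integrable (lborel \<Otimes>\<^sub>M lborel) (\<lambda>p. indicator (S \<times> {0..1::real}) p *\<^sub>R (C * (K * norm w)))"
        unfolding lborel_prod by (intro borel_integrable_compact compact_Times cS continuous_intros) auto
      show "AE p in lborel \<Otimes>\<^sub>M lborel. norm (case_prod ?F p) \<le> norm (indicator (S \<times> {0..1}) p *\<^sub>R (C * (K * norm w)))"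
      proof (rule AE_I2)
        fix p :: "'a \<times> real"
        obtain y s where p: "p = (y, s)" by fastforce
        have K0: "0 \<le> K * norm w" using K[of 0 w] abs_ge_zero order_trans by blast
        show "norm (case_prod ?F p) \<le> norm (indicator (S \<times> {0..1}) p *\<^sub>R (C * (K * norm w)))"
        proof (cases "y \<in> S \<and> s \<in> {0..1}")
          case True
          have "\<bar>v y\<bar> * \<bar>frechet_derivative \<phi> (at (y - s *\<^sub>R w)) w\<bar> \<le> C * (K * norm w)"
            by (intro mult_mono vb K C0 abs_ge_zero)
          then show ?thesis using C0 K0 True by (simp add: p abs_mult[of "v y"])
        next
          case False
          then have "?F y s = 0" using S1[of y s] sz(2)[of "y - s *\<^sub>R w"] by (auto simp: indicator_def)
          then show ?thesis by (simp only: p prod.case) simp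
        qed
      qed
    qed (rule Fm)
    have "(LINT y|lborel. (v (y + w) - v y) * \<phi> y) = (LINT y|lborel. v (y + w) * \<phi> y) - (LINT y|lborel. v y * \<phi> y)"
      using iv1 by (simp add: left_diff_distrib)
    also have "(LINT y|lborel. v (y + w) * \<phi> y) = (LINT y|lborel. v y * \<phi> (y - w))"
      using integral_lborel_translate[of "\<lambda>y. v y * \<phi> (y - w)" w] by simp
    also have "(LINT y|lborel. v y * \<phi> (y - w)) - (LINT y|lborel. v y * \<phi> y) = (LINT y|lborel. v y * \<phi> (y - w) - v y * \<phi> y)"
    proof (rule Bochner_Integration.integral_diff[symmetric])
      show "integrable lborel (\<lambda>y. v y * \<phi> (y - w))"
        using integrable_lborel_translate[OF iv1(1), of "-w"] by simp
    qed (rule iv1)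
    also have "\<dots> = - (LINT y|lborel. LINT s|lborel. ?F y s)"
    proof -
      have "v y * \<phi> (y - w) - v y * \<phi> y = - (LINT s|lborel. ?F y s)" for y
      proof -
        have "(LINT s|lborel. ?F y s) = (LINT s|lborel. v y * (frechet_derivative \<phi> (at (y - s *\<^sub>R w)) w * indicator {0..1} s))"
          by (intro Bochner_Integration.integral_cong) auto
        also have "\<dots> = v y * (\<phi> y - \<phi> (y - w))" by (simp only: integral_mult_right_zero dphi)
        finally show ?thesis by (simp add: algebra_simps)
      qed
      then show ?thesis by simp
    qed
    also have "(LINT y|lborel. LINT s|lborel. ?F y s) = (LINT s|lborel. LINT y|lborel. ?F y s)"
      by (rule lborel_pair.Fubini_integral[OF Fi, symmetric])
    also have "\<dots> = (LINT s|lborel. indicator {0..1} s * - (LINT y|lborel. H y * \<phi> (y - s *\<^sub>R w)))"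
    proof (rule Bochner_Integration.integral_cong[OF refl])
      fix s :: real
      show "(LINT y|lborel. ?F y s) = indicator {0..1} s * - (LINT y|lborel. H y * \<phi> (y - s *\<^sub>R w))"
      proof (cases "s \<in> {0..1}")
        case True
        have "frechet_derivative (\<lambda>y. \<phi> (y - s *\<^sub>R w)) (at y) = frechet_derivative \<phi> (at (y - s *\<^sub>R w))" for y
        proof -
          have "((\<lambda>y. y - s *\<^sub>R w) has_derivative (\<lambda>t. t)) (at y)"
            by (auto intro!: derivative_eq_intros)
          from diff_chain_at[OF this test_function_has_derivative[OF \<phi>]]
          show ?thesis by (intro frechet_derivative_at[symmetric]) (simp add: o_def)
        qed
        then show ?thesis using weak[OF \<phi>s[OF True]] True by simp
      qed simp
    qed
    also have "- (LINT s|lborel. indicator {0..1::real} s * - (LINT y|lborel. H y * \<phi> (y - s *\<^sub>R w)))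
      = (LINT s|lborel. indicator {0..1::real} s * (LINT y|lborel. H y * \<phi> (y - s *\<^sub>R w)))" by simp
    finally have J: "(LINT y|lborel. (v (y + w) - v y) * \<phi> y) = (LINT s|lborel. indicator {0..1::real} s * (LINT y|lborel. H y * \<phi> (y - s *\<^sub>R w)))" .
    have p0: "0 \<le> \<phi> y" for y by (simp add: \<phi>_def box_bump_bounds)
    have inner: "\<bar>LINT y|lborel. H y * \<phi> (y - s *\<^sub>R w)\<bar> \<le> M * (LINT y|lborel. \<phi> y)" for s
    proof -
      have ips: "integrable lborel (\<lambda>y. \<phi> (y - s *\<^sub>R w))"
        using integrable_lborel_translate[OF ip, of "- s *\<^sub>R w"] by simp
      have "norm (LINT y|lborel. H y * \<phi> (y - s *\<^sub>R w)) \<le> (LINT y|lborel. M * \<phi> (y - s *\<^sub>R w))"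
      proof (rule Bochner_Integration.integral_norm_bound_integral)
        have "integrable lborel (\<lambda>y. H (y + s *\<^sub>R w) * \<phi> y)" by (rule iv[of _ M]) (use Hb in auto)
        from integrable_lborel_translate[OF this, of "- s *\<^sub>R w"]
        show "integrable lborel (\<lambda>y. H y * \<phi> (y - s *\<^sub>R w))" by simp
      qed (use ips p0 Hb in \<open>auto simp: abs_mult intro!: mult_right_mono\<close>)
      also have "\<dots> = M * (LINT y|lborel. \<phi> y)"
        using integral_lborel_translate[OF pm, of "- s *\<^sub>R w"] by simp
      finally show ?thesis by simp
    qed
    let ?I = "M * (LINT y|lborel. \<phi> y)"
    have "norm (LINT s|lborel. indicator {0..1::real} s * (LINT y|lborel. H y * \<phi> (y - s *\<^sub>R w))) \<le> (LINT s|lborel. indicator {0..1::real} s *\<^sub>R ?I)"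
    \<comment> \<open>If the function of s is not integrable, its integral is 0 by convention and
      the nonnegative right-hand side bounds it.\<close>
    proof (cases "integrable lborel (\<lambda>s. indicator {0..1::real} s * (LINT y|lborel. H y * \<phi> (y - s *\<^sub>R w)))")
      case True
      moreover have "integrable lborel (\<lambda>s. indicator {0..1::real} s *\<^sub>R ?I)"
        by (intro borel_integrable_compact) auto
      ultimately show ?thesis
        by (rule Bochner_Integration.integral_norm_bound_integral)
          (use inner in \<open>auto simp: indicator_def\<close>)
    next
      case False
      then show ?thesis using inner[of 0] by (simp add: not_integrable_integral_eq)
    qed
    then show "\<bar>LINT y|lborel. (v (y + w) - v y) * box_bump a b k y\<bar> \<le> M * (LINT y|lborel. box_bump a b k y)"
      by (simp add: J[unfolded \<phi>_def] \<phi>_def)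
  qed
  have main: "AE y in lebesgue_on W. M - \<sigma> * (v (y + w) - v y) \<ge> 0" if \<sigma>: "\<sigma> = 1 \<or> \<sigma> = -1" for \<sigma> :: real
  proof (rule box_bump_nonneg_imp_AE_nonneg[OF Wo])
    let ?u = "\<lambda>y. M - \<sigma> * (v (y + w) - v y)"
    note [measurable] = vm
    have um: "?u \<in> borel_measurable borel" by measurable
    show "Linfty W ?u" unfolding Linfty_def
    proof (intro conjI exI AE_I2)
      show "?u \<in> borel_measurable (lebesgue_on W)"
        using um by (simp add: measurable_completion measurable_restrict_space1)
      show "norm (?u y) \<le> \<bar>M\<bar> + (C + C)" for y
        using \<sigma> vb[of y] vb[of "y + w"] by auto
    qed
    fix a b k assume ab: "cbox a b \<subseteq> W"
    have "(LINT y|lebesgue_on W. ?u y * box_bump a b k y) = (LINT y|lborel. ?u y * box_bump a b k y)"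
      by (rule integral_lebesgue_on_eq_lborel[OF Wo])
        (use um ab box_subset_cbox[of a b] in \<open>auto simp: measurable_completion measurable_restrict_space1 box_bump_eq_0_iff
          intro!: borel_measurable_continuous_onI smooth_algebra_continuous box_bump_smooth_algebra\<close>)
    also have "\<dots> = (LINT y|lborel. M * box_bump a b k y - \<sigma> * ((v (y + w) - v y) * box_bump a b k y))"
      by (simp add: algebra_simps)
    also have "\<dots> = M * (LINT y|lborel. box_bump a b k y) - \<sigma> * (LINT y|lborel. (v (y + w) - v y) * box_bump a b k y)"
      using ints[OF ab, of k] by simp
    also have "\<dots> \<ge> 0" using est[OF ab, of k] \<sigma> by auto
    finally show "(LINT y|lebesgue_on W. ?u y * box_bump a b k y) \<ge> 0" .
  qed
  have "AE y in lborel. y \<in> W \<longrightarrow> M - 1 * (v (y + w) - v y) \<ge> 0"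
    using main[of 1] unfolding AE_lebesgue_on_iff_lborel[OF Wo] by simp
  moreover have "AE y in lborel. y \<in> W \<longrightarrow> M - (-1) * (v (y + w) - v y) \<ge> 0"
    using main[of "-1"] unfolding AE_lebesgue_on_iff_lborel[OF Wo] by simp
  ultimately show ?thesis by eventually_elim (auto simp: W_def)
qed

text \<open>The exceptional set of y depends on w. By Fubini almost every y satisfies the bound for
  almost every w; these y form the set A. Two points of A are compared through a third one: for
  almost every small w both the step w from \<open>y1\<close> and the step
  \<open>y1 - y2 + w\<close> from \<open>y2\<close> are admissible and lead to the same point. The
  function is then extended from A.\<close>

lemma AE_diff_bound_imp_lipschitz:
  fixes v :: "'a::euclidean_space \<Rightarrow> real"
  assumes U: "open U" and vm: "v \<in> borel_measurable borel" and M0: "M \<ge> 0"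
    and diff: "\<And>w. AE y in lborel. y \<in> U \<and> y + w \<in> U \<longrightarrow> \<bar>v (y + w) - v y\<bar> \<le> M * norm w"
  obtains g where "M-lipschitz_on UNIV g" "AE y in lborel. y \<in> U \<longrightarrow> v y = g y"
proof -
  let ?P = "\<lambda>w y. y \<in> U \<and> y + w \<in> U \<longrightarrow> \<bar>v (y + w) - v y\<bar> \<le> M * norm w"
  have Pm: "{p \<in> space (lborel \<Otimes>\<^sub>M lborel). ?P (fst p) (snd p)} \<in> sets (lborel \<Otimes>\<^sub>M lborel)"
  proof -
    note [measurable] = vm borel_open[OF U]
    have [measurable]: "(\<lambda>p::'a \<times> 'a. snd p + fst p) \<in> lborel \<Otimes>\<^sub>M lborel \<rightarrow>\<^sub>M borel" by measurable
    show ?thesis by measurable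
  qed
  have "AE w in lborel. AE y in lborel. ?P w y" using diff by simp
  then have A: "AE y in lborel. AE w in lborel. ?P w y"
    using lborel_pair.AE_commute[OF Pm] by simp
  define A where "A = {y \<in> U. AE w in lborel. ?P w y}"
  have key: "v y1 - v y2 \<le> M * dist y1 y2" if y: "y1 \<in> A" "y2 \<in> A" for y1 y2
  proof (rule field_le_epsilon)
    fix e :: real assume "e > 0"
    define \<eta> where "\<eta> = e / (2 * (M + 1))"
    have \<eta>: "\<eta> > 0" "2 * (M * \<eta>) \<le> e" using \<open>e > 0\<close> M0 by (auto simp: \<eta>_def field_simps)
    obtain r where r: "r > 0" "ball y1 r \<subseteq> U" using U y(1) by (auto simp: A_def open_contains_ball)
    define \<delta> where "\<delta> = min r \<eta>"
    have \<delta>: "\<delta> > 0" using r \<eta> by (simp add: \<delta>_def)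
    have a1: "AE w in lborel. ?P w y1" and a2: "AE w in lborel. ?P w y2" using y by (auto simp: A_def)
    have "AE w in distr lborel borel ((+) (y1 - y2)). ?P w y2" unfolding lborel_distr_plus by (rule a2)
    then have a3: "AE w in lborel. ?P ((y1 - y2) + w) y2" by (rule AE_distrD[rotated]) measurable
    have "\<exists>w\<in>ball 0 \<delta>. ?P w y1 \<and> ?P ((y1 - y2) + w) y2"
    proof (rule ccontr)
      assume "\<not> ?thesis"
      then have no: "\<And>w. w \<in> ball 0 \<delta> \<Longrightarrow> \<not> (?P w y1 \<and> ?P ((y1 - y2) + w) y2)" by blast
      have "AE w in lborel. w \<notin> ball (0::'a) \<delta>" using a1 a3 by eventually_elim (use no in blast)
      then have "ball (0::'a) \<delta> \<in> null_sets lborel" by (subst AE_iff_null_sets) auto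
      then have "emeasure lborel (ball (0::'a) \<delta>) = 0" by auto
      then have "negligible (ball (0::'a) \<delta>)"
        by (simp add: negligible_iff_emeasure0)
      then show False using \<delta> open_not_negligible[of "ball (0::'a) \<delta>"] by simp
    qed
    then obtain w where w: "norm w < \<delta>" and P: "?P w y1" "?P ((y1 - y2) + w) y2"
      by (metis mem_ball_0)
    have "y1 + w \<in> ball y1 r" using w by (simp add: \<delta>_def dist_norm)
    then have U1: "y1 + w \<in> U" using r by blast
    have *: "y2 + ((y1 - y2) + w) = y1 + w" by simp
    have "\<bar>v (y1 + w) - v y1\<bar> \<le> M * norm w" using P(1) U1 y by (auto simp: A_def)
    moreover have "\<bar>v (y1 + w) - v y2\<bar> \<le> M * norm ((y1 - y2) + w)"
      using P(2) U1 y unfolding * by (auto simp: A_def)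
    moreover have "M * norm ((y1 - y2) + w) \<le> M * (dist y1 y2 + norm w)"
      using M0 norm_triangle_ineq[of "y1 - y2" w] by (intro mult_left_mono) (auto simp: dist_norm)
    moreover have "M * norm w \<le> M * \<eta>" using w M0 by (intro mult_left_mono) (auto simp: \<delta>_def)
    ultimately show "v y1 - v y2 \<le> M * dist y1 y2 + e" using \<eta>(2) by (simp add: algebra_simps)
  qed
  obtain g where g: "M-lipschitz_on UNIV g" "\<And>y. y \<in> A \<Longrightarrow> g y = v y"
    using lipschitz_extension_real[OF M0 key] by blast
  have "AE y in lborel. y \<in> U \<longrightarrow> v y = g y"
    using A
  proof eventually_elim
    case (elim y)
    show ?case
    proof
      assume "y \<in> U"
      then have "y \<in> A" using elim unfolding A_def by blast
      then show "v y = g y" by (simp add: g(2))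
    qed
  qed
  with g(1) show ?thesis using that by blast
qed

section \<open>Pointwise gradients as weak gradients\<close>

lemma integral_weak_gradient_lipschitz:
  fixes g :: "'a::euclidean_space \<Rightarrow> real"
  assumes g: "L-lipschitz_on UNIV g" and \<phi>: "\<phi> \<in> test_functions U" and e: "e \<in> Basis"
  shows "(LINT z|lborel. g z * frechet_derivative \<phi> (at z) e) = - (LINT z|lborel. (grad g z \<bullet> e) * \<phi> z)"
  using integral_dyadic_deriv_test_function(1)[OF g \<phi>, of e] by (simp add: grad_inner_Basis[OF e])

lemma test_function_deriv_measurable:
  "\<phi> \<in> test_functions U \<Longrightarrow> (\<lambda>z. frechet_derivative \<phi> (at z) e) \<in> borel_measurable borel"
  by (intro borel_measurable_continuous_onI test_function_deriv_continuous)

lemma test_function_measurable: "\<phi> \<in> test_functions U \<Longrightarrow> \<phi> \<in> borel_measurable borel"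
  by (intro borel_measurable_continuous_onI test_function_continuous)

lemma test_function_outside_domain:
  assumes "\<phi> \<in> test_functions U" "z \<notin> U"
  shows "\<phi> z = 0" "frechet_derivative \<phi> (at z) e = 0"
proof -
  have "z \<notin> supp \<phi>" using assms by (auto simp: test_functions_def)
  then show "\<phi> z = 0" "frechet_derivative \<phi> (at z) e = 0"
    using test_function_outside[OF assms(1)] by auto
qed

lemma Linfty_inner: "Linfty U G \<Longrightarrow> Linfty U (\<lambda>z. G z \<bullet> e)"
proof -
  assume G: "Linfty U G"
  then obtain C where "AE z in lebesgue_on U. norm (G z) \<le> C" by (auto simp: Linfty_def)
  then have "AE z in lebesgue_on U. norm (G z \<bullet> e) \<le> C * norm e"
  proof eventually_elim
    case (elim z)
    then show ?case using Cauchy_Schwarz_ineq2[of "G z" e] mult_right_mono[OF elim, of "norm e"] by simp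
  qed
  with G show ?thesis by (auto simp: Linfty_def)
qed

lemma Linfty_I:
  assumes "u \<in> borel_measurable borel" "\<And>z. norm (u z) \<le> C"
  shows "Linfty U u"
  using assms by (auto simp: Linfty_def measurable_completion measurable_restrict_space1)

lemma has_W1inf_gradient_lipschitz:
  fixes g :: "'a::euclidean_space \<Rightarrow> real"
  assumes U: "open U" and g: "L-lipschitz_on UNIV g" and C: "\<And>z. \<bar>g z\<bar> \<le> C"
  shows "has_W1inf_gradient U g (grad g)"
  unfolding has_W1inf_gradient_def
proof (intro conjI ballI)
  have gm: "g \<in> borel_measurable borel"
    by (rule borel_measurable_continuous_onI[OF lipschitz_on_continuous_on[OF g]])
  then show "Linfty U g" using C by (intro Linfty_I) auto
  have grm: "grad g \<in> borel_measurable borel" by (rule grad_measurable[OF g])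
  have "AE z in lebesgue_on U. norm (grad g z) \<le> L"
    unfolding AE_lebesgue_on_iff_lborel[OF U] using AE_grad_bound[OF g] by eventually_elim simp
  then show "Linfty U (grad g)" using grm
    by (auto simp: Linfty_def measurable_completion measurable_restrict_space1)
  fix \<phi> e assume \<phi>: "\<phi> \<in> test_functions U" and e: "e \<in> (Basis :: 'a set)"
  have "(LINT z|lebesgue_on U. g z * frechet_derivative \<phi> (at z) e) = (LINT z|lborel. g z * frechet_derivative \<phi> (at z) e)"
    using gm test_function_deriv_measurable[OF \<phi>] test_function_outside_domain[OF \<phi>]
    by (intro integral_lebesgue_on_eq_lborel[OF U]) (auto simp: measurable_completion measurable_restrict_space1)
  also have "\<dots> = - (LINT z|lborel. (grad g z \<bullet> e) * \<phi> z)"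
    by (rule integral_weak_gradient_lipschitz[OF g \<phi> e])
  also have "(LINT z|lborel. (grad g z \<bullet> e) * \<phi> z) = (LINT z|lebesgue_on U. (grad g z \<bullet> e) * \<phi> z)"
    using grm test_function_measurable[OF \<phi>] test_function_outside_domain[OF \<phi>]
    by (intro integral_lebesgue_on_eq_lborel[OF U, symmetric]) (auto simp: measurable_completion measurable_restrict_space1)
  finally show "(LINT z|lebesgue_on U. g z * frechet_derivative \<phi> (at z) e) = - (LINT z|lebesgue_on U. (grad g z \<bullet> e) * \<phi> z)" .
qed

text \<open>Convexity of U makes the constant global: the bound of the weak gradient controls
  differences across all of U. The given weak gradient and \<open>grad g\<close> satisfy the same
  weak identity, so the fundamental lemma identifies them; afterwards only \<open>grad\<close> has
  to be considered.\<close>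

theorem has_W1inf_gradient_imp_lipschitz:
  fixes f :: "'a::euclidean_space \<Rightarrow> real"
  assumes U: "open U" "convex U" and W: "has_W1inf_gradient U f G"
  obtains M C g where "M-lipschitz_on UNIV g" "\<And>z. \<bar>g z\<bar> \<le> C" "AE z in lebesgue_on U. f z = g z"
    "AE z in lebesgue_on U. G z = grad g z"
proof -
  have Lf: "Linfty U f" and LG: "Linfty U G"
    and weak0: "\<And>\<phi> e. \<phi> \<in> test_functions U \<Longrightarrow> e \<in> Basis \<Longrightarrow>
        (LINT z|lebesgue_on U. f z * frechet_derivative \<phi> (at z) e) = - (LINT z|lebesgue_on U. (G z \<bullet> e) * \<phi> z)"
    using W by (auto simp: has_W1inf_gradient_def)
  have fm: "f \<in> borel_measurable (lebesgue_on U)" using Lf by (simp add: Linfty_def)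
  obtain v C where v: "v \<in> borel_measurable borel" "\<And>z. \<bar>v z\<bar> \<le> C" "C \<ge> 0" "\<And>z. z \<notin> U \<Longrightarrow> v z = 0"
    "AE z in lebesgue_on U. f z = v z" by (rule Linfty_borel_representative[OF U(1) Lf]) blast
  have "\<exists>h D. h \<in> borel_measurable borel \<and> (\<forall>z. \<bar>h z\<bar> \<le> D) \<and> (AE z in lebesgue_on U. G z \<bullet> e = h z)" for e
    by (rule Linfty_borel_representative[OF U(1) Linfty_inner[OF LG, of e]]) blast
  then obtain h D where h: "\<And>e. h e \<in> borel_measurable borel" "\<And>e z. \<bar>h e z\<bar> \<le> D e"
    "\<And>e. AE z in lebesgue_on U. G z \<bullet> e = h e z" by metis
  note [measurable] = v(1) h(1)
  have weak1: "(LINT z|lborel. v z * frechet_derivative \<phi> (at z) e) = - (LINT z|lborel. h e z * \<phi> z)"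
    if \<phi>: "\<phi> \<in> test_functions U" and e: "e \<in> Basis" for \<phi> e
  proof -
    have "(LINT z|lborel. v z * frechet_derivative \<phi> (at z) e) = (LINT z|lebesgue_on U. f z * frechet_derivative \<phi> (at z) e)"
      by (rule integral_lebesgue_on_eq_lborel[OF U(1) v(5) fm v(1), symmetric])
        (use test_function_deriv_measurable[OF \<phi>] test_function_outside_domain[OF \<phi>] in auto)
    also have "\<dots> = - (LINT z|lebesgue_on U. (G z \<bullet> e) * \<phi> z)" by (rule weak0[OF \<phi> e])
    also have "(LINT z|lebesgue_on U. (G z \<bullet> e) * \<phi> z) = (LINT z|lborel. h e z * \<phi> z)"
      by (rule integral_lebesgue_on_eq_lborel[OF U(1) h(3) _ h(1)])
        (use Linfty_inner[OF LG] test_function_measurable[OF \<phi>] test_function_outside_domain[OF \<phi>] in \<open>auto simp: Linfty_def\<close>)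
    finally show ?thesis .
  qed
  \<comment> \<open>Each coordinate of w is at most its norm, so the sum of the bounds of the
    partial derivatives controls the derivative in every direction.\<close>
  define M where "M = (\<Sum>b\<in>Basis. D b)"
  have D0: "D b \<ge> 0" for b using h(2)[of b 0] by linarith
  have M0: "M \<ge> 0" unfolding M_def using D0 by (simp add: sum_nonneg)
  have diff: "AE y in lborel. y \<in> U \<and> y + w \<in> U \<longrightarrow> \<bar>v (y + w) - v y\<bar> \<le> M * norm w" for w
  proof (rule W1inf_difference_bound[OF U v(1) v(2) v(3), where H="\<lambda>z. \<Sum>b\<in>Basis. (w \<bullet> b) * h b z"])
    show "(\<lambda>z. \<Sum>b\<in>Basis. (w \<bullet> b) * h b z) \<in> borel_measurable borel" by measurable
    show "\<bar>\<Sum>b\<in>Basis. (w \<bullet> b) * h b z\<bar> \<le> M * norm w" for z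
    proof -
      have "\<bar>\<Sum>b\<in>Basis. (w \<bullet> b) * h b z\<bar> \<le> (\<Sum>b\<in>Basis. norm w * D b)"
        by (rule order_trans[OF sum_abs sum_mono]) (use h(2) in \<open>auto simp: abs_mult Basis_le_norm intro!: mult_mono\<close>)
      then show ?thesis by (simp add: M_def sum_distrib_left sum_distrib_right mult.commute)
    qed
    fix \<phi> assume \<phi>: "\<phi> \<in> test_functions U"
    have lin: "linear (frechet_derivative \<phi> (at z))" for z
      using test_function_has_derivative[OF \<phi>] has_derivative_linear by blast
    have expand: "frechet_derivative \<phi> (at z) w = (\<Sum>b\<in>Basis. (w \<bullet> b) * frechet_derivative \<phi> (at z) b)" for z
      by (subst euclidean_representation[symmetric, of w], subst linear_sum[OF lin]) (simp add: linear_scale[OF lin])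
    have cs: "compact (supp \<phi>)" using \<phi> by (simp add: test_functions_def)
    have bi: "integrable lborel (\<lambda>z. u z * p z)"
      if "u \<in> borel_measurable borel" "\<And>z. \<bar>u z\<bar> \<le> B" "continuous_on UNIV p" "\<And>z. z \<notin> supp \<phi> \<Longrightarrow> p z = 0" for u p and B :: real
    proof (rule Bochner_Integration.integrable_bound[of _ "\<lambda>z. B * \<bar>p z\<bar>"])
      show "integrable lborel (\<lambda>z. B * \<bar>p z\<bar>)"
        using integrable_continuous_compact_support[OF that(3) cs that(4)] by simp
      show "(\<lambda>z. u z * p z) \<in> borel_measurable lborel"
        using that(1) borel_measurable_continuous_onI[OF that(3)] by simp
    qed (use that(2) in \<open>auto simp: abs_mult intro!: mult_right_mono order_trans[OF that(2) abs_ge_self]\<close>)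
    have i1: "integrable lborel (\<lambda>z. v z * frechet_derivative \<phi> (at z) b)" for b
      by (rule bi[OF v(1,2) test_function_deriv_continuous[OF \<phi>]]) (rule test_function_outside(2)[OF \<phi>])
    have i2: "integrable lborel (\<lambda>z. h b z * \<phi> z)" for b
      by (rule bi[OF h(1,2) test_function_continuous[OF \<phi>]]) (rule test_function_outside(1)[OF \<phi>])
    have "(LINT z|lborel. v z * frechet_derivative \<phi> (at z) w)
      = (LINT z|lborel. (\<Sum>b\<in>Basis. (w \<bullet> b) * (v z * frechet_derivative \<phi> (at z) b)))"
      by (simp add: expand sum_distrib_left mult.left_commute)
    also have "\<dots> = (\<Sum>b\<in>Basis. (w \<bullet> b) * (LINT z|lborel. v z * frechet_derivative \<phi> (at z) b))"
      using i1 by (subst Bochner_Integration.integral_sum) auto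
    also have "\<dots> = - (\<Sum>b\<in>Basis. (w \<bullet> b) * (LINT z|lborel. h b z * \<phi> z))"
      by (simp add: weak1[OF \<phi>] sum_negf)
    also have "(\<Sum>b\<in>Basis. (w \<bullet> b) * (LINT z|lborel. h b z * \<phi> z)) = (LINT z|lborel. (\<Sum>b\<in>Basis. (w \<bullet> b) * (h b z * \<phi> z)))"
      using i2 by (subst Bochner_Integration.integral_sum) auto
    also have "\<dots> = (LINT z|lborel. (\<Sum>b\<in>Basis. (w \<bullet> b) * h b z) * \<phi> z)"
      by (simp add: sum_distrib_right mult.assoc)
    finally show "(LINT z|lborel. v z * frechet_derivative \<phi> (at z) w) = - (LINT z|lborel. (\<Sum>b\<in>Basis. (w \<bullet> b) * h b z) * \<phi> z)" .
  qed
  obtain g0 where g0: "M-lipschitz_on UNIV g0" "AE y in lborel. y \<in> U \<longrightarrow> v y = g0 y"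
    by (rule AE_diff_bound_imp_lipschitz[OF U(1) v(1) M0 diff])
  \<comment> \<open>The extension may be unbounded away from U. Cutting at the bound C of v keeps
    the Lipschitz constant and changes nothing where it agrees with v.\<close>
  define g where "g z = max (- C) (min C (g0 z))" for z
  have gl: "M-lipschitz_on UNIV g"
  proof (rule lipschitz_onI[OF _ M0])
    fix x y show "dist (g x) (g y) \<le> M * dist x y"
      using lipschitz_onD[OF g0(1), of x y] by (auto simp: g_def dist_real_def max_def min_def)
  qed
  have gb: "\<bar>g z\<bar> \<le> C" for z using v(3) by (auto simp: g_def)
  have gm: "g \<in> borel_measurable borel"
    by (rule borel_measurable_continuous_onI[OF lipschitz_on_continuous_on[OF gl]])
  have "AE z in lborel. z \<in> U \<longrightarrow> v z = g z"
    using g0(2)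
  proof eventually_elim
    case (elim z)
    then show ?case using v(2)[of z] by (auto simp: g_def)
  qed
  then have "AE z in lebesgue_on U. v z = g z" by (simp add: AE_lebesgue_on_iff_lborel[OF U(1)])
  with v(5) have fg: "AE z in lebesgue_on U. f z = g z" by eventually_elim simp
  have Lg: "Linfty U (grad g)" using has_W1inf_gradient_lipschitz[OF U(1) gl gb] by (simp add: has_W1inf_gradient_def)
  have "AE z in lebesgue_on U. G z \<bullet> e - grad g z \<bullet> e = 0" if e: "e \<in> Basis" for e
  proof (rule test_function_zero_imp_AE_zero[OF U(1)])
    show "Linfty U (\<lambda>z. G z \<bullet> e - grad g z \<bullet> e)"
      by (intro Linfty_diff Linfty_inner LG Lg)
    fix \<phi> assume \<phi>: "\<phi> \<in> test_functions U"
    have bi: "integrable (lebesgue_on U) (\<lambda>z. u z * \<phi> z)" if u: "Linfty U u" for u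
    proof -
      obtain B where B: "AE z in lebesgue_on U. norm (u z) \<le> B" using u by (auto simp: Linfty_def)
      have pi: "integrable lborel \<phi>"
        by (rule integrable_continuous_compact_support[OF test_function_continuous[OF \<phi>] _ test_function_outside(1)[OF \<phi>]])
          (use \<phi> in \<open>auto simp: test_functions_def\<close>)
      then have "integrable lebesgue \<phi>" by (simp add: integrable_completion)
      then have "integrable lebesgue (\<lambda>z. indicator U z *\<^sub>R \<phi> z)"
        using U(1) by (intro integrable_mult_indicator) (simp_all add: borel_open)
      then have "integrable (lebesgue_on U) \<phi>"
        using U(1) by (subst integrable_restrict_space) (simp_all add: borel_open)
      then have pU: "integrable (lebesgue_on U) (\<lambda>z. B * \<phi> z)" by (rule integrable_mult_right)
      show ?thesis
      proof (rule Bochner_Integration.integrable_bound[OF pU])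
        show "(\<lambda>z. u z * \<phi> z) \<in> borel_measurable (lebesgue_on U)"
          using u test_function_measurable[OF \<phi>]
          by (intro borel_measurable_times) (auto simp: Linfty_def measurable_completion measurable_restrict_space1)
        show "AE z in lebesgue_on U. norm (u z * \<phi> z) \<le> norm (B * \<phi> z)"
          using B by eventually_elim (auto simp: abs_mult intro!: mult_right_mono)
      qed
    qed
    have "(LINT z|lebesgue_on U. (G z \<bullet> e - grad g z \<bullet> e) * \<phi> z)
      = (LINT z|lebesgue_on U. (G z \<bullet> e) * \<phi> z) - (LINT z|lebesgue_on U. (grad g z \<bullet> e) * \<phi> z)"
      unfolding left_diff_distrib by (intro Bochner_Integration.integral_diff bi Linfty_inner LG Lg)
    also have "\<dots> = (LINT z|lebesgue_on U. g z * frechet_derivative \<phi> (at z) e) - (LINT z|lebesgue_on U. f z * frechet_derivative \<phi> (at z) e)"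
      using has_W1inf_gradient_lipschitz[OF U(1) gl gb] weak0[OF \<phi> e] \<phi> e
      by (simp add: has_W1inf_gradient_def)
    also have "(LINT z|lebesgue_on U. g z * frechet_derivative \<phi> (at z) e) = (LINT z|lebesgue_on U. f z * frechet_derivative \<phi> (at z) e)"
    proof (rule integral_cong_AE)
      show "AE z in lebesgue_on U. g z * frechet_derivative \<phi> (at z) e = f z * frechet_derivative \<phi> (at z) e"
        using fg by eventually_elim simp
    qed (use fm gm test_function_deriv_measurable[OF \<phi>] in \<open>auto intro!: borel_measurable_times simp: measurable_completion measurable_restrict_space1\<close>)
    finally show "(LINT z|lebesgue_on U. (G z \<bullet> e - grad g z \<bullet> e) * \<phi> z) = 0" by simp
  qed
  then have "AE z in lebesgue_on U. \<forall>e\<in>Basis. G z \<bullet> e - grad g z \<bullet> e = 0"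
    by (intro AE_finite_allI) auto
  then have "AE z in lebesgue_on U. G z = grad g z"
    by eventually_elim (auto intro: euclidean_eqI)
  with gl gb fg show ?thesis using that by blast
qed

section \<open>Fixed points, differential equations and Gronwall inequalities\<close>

lemma geometric_limit:
  fixes X :: "nat \<Rightarrow> 'b::banach"
  assumes step: "\<And>n. norm (X (Suc n) - X n) \<le> C * (1/2) ^ n"
  obtains l where "\<And>n. norm (X n - l) \<le> 2 * C * (1/2) ^ n" "X \<longlonglongrightarrow> l"
proof -
  have geo: "summable (\<lambda>n. C * (1/2::real) ^ n)" by (intro summable_mult summable_geometric) simp
  have sm: "summable (\<lambda>n. norm (X (Suc n) - X n))"
    by (rule summable_comparison_test'[OF geo]) (use step in auto)
  define l where "l = X 0 + (\<Sum>n. X (Suc n) - X n)"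
  have part: "(\<Sum>k<n. X (Suc k) - X k) = X n - X 0" for n by (rule sum_lessThan_telescope)
  have "(\<lambda>n. X n - X 0) \<longlonglongrightarrow> (\<Sum>n. X (Suc n) - X n)"
    using summable_LIMSEQ[OF summable_norm_cancel[OF sm]] by (simp add: part)
  from tendsto_add[OF tendsto_const[of "X 0"] this]
  have lim: "X \<longlonglongrightarrow> l" by (simp add: l_def)
  have tail: "norm (X (n + k) - X n) \<le> 2 * C * (1/2) ^ n * (1 - (1/2) ^ k)" for n k
  proof (induction k)
    case (Suc k)
    have "norm (X (n + Suc k) - X n) \<le> norm (X (Suc (n + k)) - X (n + k)) + norm (X (n + k) - X n)"
      by (metis add_Suc_right norm_triangle_ineq diff_add_cancel add_diff_eq)
    also have "\<dots> \<le> C * (1/2) ^ (n + k) + 2 * C * (1/2) ^ n * (1 - (1/2) ^ k)"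
      using step[of "n + k"] Suc by (intro add_mono) auto
    also have "\<dots> = 2 * C * (1/2) ^ n * (1 - (1/2) ^ Suc k)" by (simp add: power_add algebra_simps)
    finally show ?case .
  qed simp
  have C0: "C \<ge> 0" using step[of 0] by (simp add: order_trans[OF norm_ge_zero])
  have "norm (l - X n) \<le> 2 * C * (1/2) ^ n" for n
  proof (rule Lim_norm_ubound[OF _ _ always_eventually])
    show "(\<lambda>k. X (n + k) - X n) \<longlonglongrightarrow> l - X n"
      using LIMSEQ_ignore_initial_segment[OF lim, of n] by (intro tendsto_intros) (simp add: add.commute)
    show "\<forall>k. norm (X (n + k) - X n) \<le> 2 * C * (1/2) ^ n"
    proof
      fix k
      have "2 * C * (1/2) ^ n * (1 - (1/2) ^ k) \<le> 2 * C * (1/2) ^ n * 1"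
        using C0 by (intro mult_left_mono) auto
      then show "norm (X (n + k) - X n) \<le> 2 * C * (1/2) ^ n" using tail[of n k] by linarith
    qed
  qed simp
  then show ?thesis using that lim by (metis norm_minus_commute)
qed

text \<open>Banach's fixed point theorem for the distance "smallest K with
  \<open>norm (u i - v i) \<le> K * w i\<close> for all i". This distance may be infinite; only the
  first step from \<open>u0\<close> has to be finite. S has to be closed merely under limits with
  geometric rate, because the iteration produces no others.\<close>

lemma weighted_fixed_point:
  fixes S :: "('i \<Rightarrow> 'b::banach) set" and w :: "'i \<Rightarrow> real"
  assumes w: "\<And>i. w i \<ge> 0" and maps: "\<And>u. u \<in> S \<Longrightarrow> F u \<in> S"
    and contr: "\<And>u v K i. \<lbrakk>u \<in> S; v \<in> S; K \<ge> 0; \<And>i. norm (u i - v i) \<le> K * w i\<rbrakk> \<Longrightarrow> norm (F u i - F v i) \<le> K / 2 * w i"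
    and start: "u0 \<in> S" "K0 \<ge> 0" "\<And>i. norm (F u0 i - u0 i) \<le> K0 * w i"
    and closed: "\<And>X u K. \<lbrakk>\<And>n. X n \<in> S; \<And>n i. norm (X n i - u i) \<le> K * (1/2) ^ n * w i\<rbrakk> \<Longrightarrow> u \<in> S"
  obtains u where "u \<in> S" "F u = u"
proof -
  define X where "X n = (F ^^ n) u0" for n
  have XS: "X n \<in> S" for n by (induction n) (auto simp: X_def start maps)
  have XSuc: "X (Suc n) = F (X n)" for n by (simp add: X_def)
  have step: "norm (X (Suc n) i - X n i) \<le> K0 * (1/2) ^ n * w i" for n i
  proof (induction n arbitrary: i)
    case 0 then show ?case using start by (simp add: X_def)
  next
    case (Suc n)
    have "norm (F (X (Suc n)) i - F (X n) i) \<le> K0 * (1/2) ^ n / 2 * w i"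
      by (rule contr[OF XS XS _ Suc]) (use start(2) in simp)
    then show ?case by (simp add: XSuc[symmetric])
  qed
  have "\<exists>l. (\<forall>n. norm (X n i - l) \<le> 2 * (K0 * w i) * (1/2) ^ n) \<and> (\<lambda>n. X n i) \<longlonglongrightarrow> l" for i
  proof -
    have "norm (X (Suc n) i - X n i) \<le> K0 * w i * (1/2) ^ n" for n using step[of n i] by (simp add: mult_ac)
    from geometric_limit[of "\<lambda>n. X n i", OF this] show ?thesis by metis
  qed
  then obtain u where u: "\<And>n i. norm (X n i - u i) \<le> 2 * (K0 * w i) * (1/2) ^ n" "\<And>i. (\<lambda>n. X n i) \<longlonglongrightarrow> u i"
    by metis
  have u': "norm (X n i - u i) \<le> 2 * K0 * (1/2) ^ n * w i" for n i using u(1)[of n i] by (simp add: mult_ac)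
  have uS: "u \<in> S" by (rule closed[OF XS u'])
  have "F u i = u i" for i
  proof (rule LIMSEQ_unique[of "\<lambda>n. X (Suc n) i"])
    have "norm (X (Suc n) i - F u i) \<le> 2 * K0 * (1/2) ^ n / 2 * w i" for n
      unfolding XSuc by (rule contr[OF XS uS _ u']) (use start(2) in simp)
    then have b: "norm (X (Suc n) i - F u i) \<le> (K0 * w i) * (1/2) ^ n" for n by (simp add: mult_ac)
    have "(\<lambda>n. (K0 * w i) * (1/2) ^ n) \<longlonglongrightarrow> (K0 * w i) * 0"
      by (intro tendsto_intros LIMSEQ_realpow_zero) auto
    then show "(\<lambda>n. X (Suc n) i) \<longlonglongrightarrow> F u i"
      by (intro LIM_zero_cancel[OF Lim_null_comparison[OF always_eventually[OF allI[OF b]]]]) simp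
    show "(\<lambda>n. X (Suc n) i) \<longlonglongrightarrow> u i" using LIMSEQ_Suc[OF u(2)] .
  qed
  then show ?thesis using that uS by blast
qed

lemma continuous_on_geometric_limit:
  fixes u :: "'i::metric_space \<Rightarrow> 'b::banach"
  assumes "\<And>n. continuous_on S (X n)" "\<And>n i. i \<in> S \<Longrightarrow> norm (X n i - u i) \<le> C * (1/2) ^ n"
  shows "continuous_on S u"
proof (rule uniform_limit_theorem[where f=X and F=sequentially])
  have z: "(\<lambda>n. C * (1/2) ^ n) \<longlonglongrightarrow> 0"
    using tendsto_mult[OF tendsto_const[of C] LIMSEQ_realpow_zero[of "1/2"]] by simp
  show "uniform_limit S X u sequentially"
  proof (rule uniform_limitI)
    fix e :: real assume "e > 0"
    then have "\<forall>\<^sub>F n in sequentially. C * (1/2) ^ n < e" using z by (simp add: order_tendstoD)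
    then show "\<forall>\<^sub>F n in sequentially. \<forall>x\<in>S. dist (X n x) (u x) < e"
      by eventually_elim (auto simp: dist_norm intro: le_less_trans[OF assms(2)])
  qed
qed (use assms(1) in auto)

text \<open>Picard iteration in the weight exp (2 L s): the integral of L exp (2 L \<tau>) from 0 to
  s is below half of the weight, whatever the length of the interval, so the solution is global at
  once.\<close>

lemma forward_ode_exists:
  fixes c :: "real \<Rightarrow> 'a::euclidean_space \<Rightarrow> 'a"
  assumes cc: "continuous_on UNIV (\<lambda>p. c (fst p) (snd p))"
    and L: "L > 0" and lip: "\<And>s y y'. norm (c s y - c s y') \<le> L * norm (y - y')"
    and bd: "\<And>s y. norm (c s y) \<le> M"
  obtains \<eta> where "\<eta> 0 = z" "\<And>s. s \<ge> 0 \<Longrightarrow> (\<eta> has_vector_derivative c s (\<eta> s)) (at s within {0..})"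
proof -
  define S :: "(real \<Rightarrow> 'a) set" where "S = {u. continuous_on UNIV u}"
  \<comment> \<open>The maximum continues the iterates constantly to negative times, so that they
    are functions on the whole line.\<close>
  define F where "F u s = z + integral {0..max 0 s} (\<lambda>\<tau>. c \<tau> (u \<tau>))" for u s
  define w where "w s = exp (2 * L * max 0 s)" for s
  have M0: "M \<ge> 0" using bd[of 0 0] norm_ge_zero order_trans by blast
  have cu: "continuous_on A (\<lambda>\<tau>. c \<tau> (u \<tau>))" if "u \<in> S" for u A
  proof -
    have "continuous_on A u" using that by (auto simp: S_def elim: continuous_on_subset)
    then have "continuous_on A (\<lambda>\<tau>. (\<tau>, u \<tau>))" by (intro continuous_intros)
    from continuous_on_compose2[OF cc this] show ?thesis by simp
  qed
  have iu: "(\<lambda>\<tau>. c \<tau> (u \<tau>)) integrable_on {a..b}" if "u \<in> S" for u a b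
    by (rule integrable_continuous_real[OF cu[OF that]])
  have ivd: "((\<lambda>s. integral {0..s} (\<lambda>\<tau>. c \<tau> (u \<tau>))) has_vector_derivative c s (u s)) (at s within {0..})"
    if u: "u \<in> S" and s: "s \<ge> 0" for u s
  proof -
    have d: "((\<lambda>s. integral {0..s} (\<lambda>\<tau>. c \<tau> (u \<tau>))) has_vector_derivative c s (u s)) (at s within {0..s+1})"
      by (rule integral_has_vector_derivative[OF cu[OF u]]) (use s in auto)
    have "at s within {0..} = at s within {0..s+1}"
      by (rule at_within_nhd[of s "{..<s+1}"]) auto
    then show ?thesis using d by simp
  qed
  have FS: "F u \<in> S" if u: "u \<in> S" for u
  proof -
    have "continuous_on {0..} (\<lambda>s. integral {0..s} (\<lambda>\<tau>. c \<tau> (u \<tau>)))"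
      using ivd[OF u] by (auto simp: continuous_on_eq_continuous_within intro: has_vector_derivative_continuous)
    then have "continuous_on UNIV (\<lambda>s. integral {0..max 0 s} (\<lambda>\<tau>. c \<tau> (u \<tau>)))"
      by (rule continuous_on_compose2) (auto intro!: continuous_intros)
    then show ?thesis unfolding S_def F_def by (auto intro!: continuous_intros)
  qed
  obtain u where uS: "u \<in> S" and Fu: "F u = u"
  proof (rule weighted_fixed_point[of w S F "\<lambda>_. z" "M / (2 * L)"])
    show "w s \<ge> 0" for s by (simp add: w_def)
    show "F u \<in> S" if "u \<in> S" for u by (rule FS[OF that])
    show "(\<lambda>_. z) \<in> S" by (simp add: S_def)
    then have zS: "(\<lambda>_. z) \<in> S" .
    show "M / (2 * L) \<ge> 0" using M0 L by simp
    show "norm (F (\<lambda>_. z) s - z) \<le> M / (2 * L) * w s" for s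
    proof -
      have "norm (integral {0..max 0 s} (\<lambda>\<tau>. c \<tau> z)) \<le> M * (max 0 s - 0)"
        by (rule integral_bound) (use cu[OF zS] bd in auto)
      also have "\<dots> = M / (2 * L) * (2 * L * max 0 s)" using L by simp
      also have "\<dots> \<le> M / (2 * L) * w s"
        using M0 L exp_ge_add_one_self[of "2 * L * max 0 s"] unfolding w_def
        by (intro mult_left_mono divide_nonneg_nonneg) linarith+
      finally show ?thesis by (simp add: F_def)
    qed
    show "norm (F u s - F v s) \<le> K / 2 * w s"
      if uv: "u \<in> S" "v \<in> S" and K: "K \<ge> 0" and le: "\<And>s. norm (u s - v s) \<le> K * w s" for u v K s
    proof -
      define r where "r = max 0 s"
      have r: "r \<ge> 0" by (simp add: r_def)
      have I: "((\<lambda>\<tau>. L * K * exp (2 * L * \<tau>)) has_integral (K / 2 * exp (2 * L * r) - K / 2 * exp (2 * L * 0))) {0..r}"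
        using L by (intro fundamental_theorem_of_calculus[OF r])
          (auto intro!: derivative_eq_intros simp: has_real_derivative_iff_has_vector_derivative[symmetric])
      have "F u s - F v s = integral {0..r} (\<lambda>\<tau>. c \<tau> (u \<tau>) - c \<tau> (v \<tau>))"
        using iu uv by (simp add: F_def r_def Henstock_Kurzweil_Integration.integral_diff)
      also have "norm \<dots> \<le> integral {0..r} (\<lambda>\<tau>. L * K * exp (2 * L * \<tau>))"
      proof (rule integral_norm_bound_integral)
        show "(\<lambda>\<tau>. c \<tau> (u \<tau>) - c \<tau> (v \<tau>)) integrable_on {0..r}" using iu uv by (intro integrable_diff) auto
        show "(\<lambda>\<tau>. L * K * exp (2 * L * \<tau>)) integrable_on {0..r}" using I by blast
        fix \<tau> assume "\<tau> \<in> {0..r}"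
        then have "norm (u \<tau> - v \<tau>) \<le> K * exp (2 * L * \<tau>)" using le[of \<tau>] by (simp add: w_def)
        then have "L * norm (u \<tau> - v \<tau>) \<le> L * (K * exp (2 * L * \<tau>))" using L by (intro mult_left_mono) auto
        then show "norm (c \<tau> (u \<tau>) - c \<tau> (v \<tau>)) \<le> L * K * exp (2 * L * \<tau>)"
          using lip[of \<tau> "u \<tau>" "v \<tau>"] by (simp add: mult.assoc)
      qed
      also have "\<dots> = K / 2 * exp (2 * L * r) - K / 2" using integral_unique[OF I] by simp
      also have "\<dots> \<le> K / 2 * w s" using K by (simp add: w_def r_def)
      finally show ?thesis .
    qed
    show "u \<in> S" if X: "\<And>n. X n \<in> S" and le: "\<And>n s. norm (X n s - u s) \<le> K * (1/2) ^ n * w s" for X u K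
    proof -
      have "isCont u s" for s
      proof -
        have K0: "K \<ge> 0" using order_trans[OF norm_ge_zero le[of 0 0]] by (simp add: w_def)
        have "continuous_on (ball s 1) u"
        proof (rule continuous_on_geometric_limit[where X=X and C="K * w (s + 1)"])
          show "continuous_on (ball s 1) (X n)" for n using X by (auto simp: S_def intro: continuous_on_subset)
          fix n r assume "r \<in> ball s 1"
          then have "w r \<le> w (s + 1)" using L by (auto simp: w_def dist_real_def)
          then have "K * (1/2) ^ n * w r \<le> K * (1/2) ^ n * w (s + 1)" using K0 by (intro mult_left_mono) auto
          then show "norm (X n r - u r) \<le> K * w (s + 1) * (1/2) ^ n" using le[of n r] by (simp add: mult_ac)
        qed
        then show ?thesis by (simp add: continuous_on_eq_continuous_at)
      qed
      then show ?thesis by (simp add: S_def continuous_at_imp_continuous_on)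
    qed
  qed blast
  have ueq: "u s = z + integral {0..s} (\<lambda>\<tau>. c \<tau> (u \<tau>))" if "s \<ge> 0" for s
    using fun_cong[OF Fu, of s] that by (simp add: F_def max_def)
  show ?thesis
  proof (rule that[of u])
    show "u 0 = z" using ueq[of 0] by simp
    fix s :: real assume s: "s \<ge> 0"
    have "((\<lambda>s. z + integral {0..s} (\<lambda>\<tau>. c \<tau> (u \<tau>))) has_vector_derivative c s (u s)) (at s within {0..})"
      using has_vector_derivative_add[OF has_vector_derivative_const[of z] ivd[OF uS s]] by simp
    then show "(u has_vector_derivative c s (u s)) (at s within {0..})"
      by (rule has_vector_derivative_transform[rotated 2]) (use ueq s in auto)
  qed
qed

text \<open>Reversal of time. Characteristics are prescribed at their end point (t, z), because the
  value of the solution there is read off from the datum at time 0.\<close>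

lemma backward_ode_exists:
  fixes b :: "real \<Rightarrow> 'a::euclidean_space \<Rightarrow> 'a"
  assumes bc: "continuous_on UNIV (\<lambda>p. b (fst p) (snd p))"
    and L: "L > 0" and lip: "\<And>s y y'. norm (b s y - b s y') \<le> L * norm (y - y')"
    and bd: "\<And>s y. norm (b s y) \<le> M"
  shows "\<exists>\<gamma>. \<gamma> t = z \<and> (\<forall>s\<in>{0..t}. (\<gamma> has_vector_derivative b s (\<gamma> s)) (at s within {0..t}))"
proof -
  obtain \<eta> where \<eta>: "\<eta> 0 = z" "\<And>s. s \<ge> 0 \<Longrightarrow> (\<eta> has_vector_derivative - b (t - s) (\<eta> s)) (at s within {0..})"
  proof (rule forward_ode_exists[of "\<lambda>s y. - b (t - s) y" L M z])
    show "continuous_on UNIV (\<lambda>p. - b (t - fst p) (snd p))"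
    proof -
      have "continuous_on UNIV (\<lambda>p::real \<times> 'a. (t - fst p, snd p))" by (intro continuous_intros)
      from continuous_on_compose2[OF bc this] show ?thesis by (auto intro!: continuous_intros)
    qed
    show "norm (- b (t - s) y - - b (t - s) y') \<le> L * norm (y - y')" for s y y'
      using lip[of "t - s" y y'] by (metis minus_diff_minus norm_minus_cancel)
  qed (use L bd in auto)
  define \<gamma> where "\<gamma> s = \<eta> (t - s)" for s
  have "(\<gamma> has_vector_derivative b s (\<gamma> s)) (at s within {0..t})" if s: "s \<in> {0..t}" for s
  proof -
    have d: "(\<eta> has_vector_derivative - b (t - (t - s)) (\<eta> (t - s))) (at (t - s) within (\<lambda>s. t - s) ` {0..t})"
      by (rule has_vector_derivative_within_subset[OF \<eta>(2)]) (use s in auto)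
    have "((\<lambda>s. t - s) has_vector_derivative -1) (at s within {0..t})"
      by (auto intro!: derivative_eq_intros)
    from vector_diff_chain_within[OF this d]
    moreover have "\<gamma> = \<eta> \<circ> (\<lambda>s. t - s)" by (auto simp: \<gamma>_def)
    ultimately show ?thesis by simp
  qed
  then show ?thesis using \<eta>(1) by (intro exI[of _ \<gamma>]) (simp add: \<gamma>_def)
qed

section \<open>Gronwall inequalities backward in time\<close>

lemma norm_sq_has_derivative:
  fixes d :: "real \<Rightarrow> 'a::euclidean_space"
  assumes "(d has_vector_derivative d') (at s)"
  shows "((\<lambda>s. (norm (d s))\<^sup>2) has_real_derivative 2 * (d s \<bullet> d')) (at s)"
  unfolding power2_norm_eq_inner has_field_derivative_def
  using has_derivative_inner[OF assms[unfolded has_vector_derivative_def] assms[unfolded has_vector_derivative_def]]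
  by (rule has_derivative_eq_rhs) (auto simp: inner_commute)

lemma nondecreasing_interval:
  fixes q :: "real \<Rightarrow> real"
  assumes "0 \<le> t" "continuous_on {0..t} q"
    and "\<And>s. 0 < s \<Longrightarrow> s < t \<Longrightarrow> \<exists>q'. (q has_real_derivative q') (at s) \<and> q' \<ge> 0"
  shows "q 0 \<le> q t"
  using assms by (intro DERIV_nonneg_imp_increasing_open[of 0 t q]) auto

lemma deriv_within_imp_at:
  assumes "\<And>s. s \<in> {0..t} \<Longrightarrow> (d has_vector_derivative d' s) (at s within {0..t::real})" "0 < s" "s < t"
  shows "(d has_vector_derivative d' s) (at s)"
  using assms(1)[of s] assms(2,3) by (simp add: at_within_Icc_at)

lemma deriv_within_imp_continuous:
  assumes "\<And>s. s \<in> {0..t} \<Longrightarrow> (d has_vector_derivative d' s) (at s within {0..t::real})"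
  shows "continuous_on {0..t} d"
  unfolding continuous_on_eq_continuous_within
  using assms by (blast intro: has_vector_derivative_continuous)

text \<open>The product of the squared norm with exp (2 A) is nondecreasing. Squares are used
  because the norm is not differentiable where d vanishes.\<close>

lemma gronwall_backward:
  fixes d :: "real \<Rightarrow> 'a::euclidean_space"
  assumes t: "0 \<le> t" and d: "\<And>s. s \<in> {0..t} \<Longrightarrow> (d has_vector_derivative d' s) (at s within {0..t})"
    and le: "\<And>s. s \<in> {0..t} \<Longrightarrow> norm (d' s) \<le> a s * norm (d s)"
    and A: "\<And>s. (A has_real_derivative a s) (at s)"
  shows "norm (d 0) \<le> norm (d t) * exp (A t - A 0)"
proof -
  have cA: "continuous_on {0..t} A"
    using A by (intro continuous_at_imp_continuous_on ballI) (auto intro: DERIV_isCont)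
  have cd: "continuous_on {0..t} d" by (rule deriv_within_imp_continuous[OF d])
  let ?q = "\<lambda>s. (norm (d s))\<^sup>2 * exp (2 * A s)"
  have "?q 0 \<le> ?q t"
  proof (rule nondecreasing_interval[OF t])
    show "continuous_on {0..t} ?q" by (intro continuous_intros cA cd)
    fix s assume s: "0 < s" "s < t"
    have 1: "((\<lambda>s. (norm (d s))\<^sup>2) has_real_derivative 2 * (d s \<bullet> d' s)) (at s)"
      by (rule norm_sq_has_derivative[OF deriv_within_imp_at[OF d s]])
    have 2: "((\<lambda>s. exp (2 * A s)) has_real_derivative exp (2 * A s) * (2 * a s)) (at s)"
      using A by (auto intro!: derivative_eq_intros)
    have "\<bar>d s \<bullet> d' s\<bar> \<le> norm (d s) * norm (d' s)" by (rule Cauchy_Schwarz_ineq2)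
    also have "\<dots> \<le> norm (d s) * (a s * norm (d s))" using le[of s] s by (intro mult_left_mono) auto
    finally have "d s \<bullet> d' s + a s * (norm (d s))\<^sup>2 \<ge> 0" by (simp add: power2_eq_square mult_ac)
    then have "2 * exp (2 * A s) * (d s \<bullet> d' s + a s * (norm (d s))\<^sup>2) \<ge> 0" by (intro mult_nonneg_nonneg) auto
    moreover have "2 * exp (2 * A s) * (d s \<bullet> d' s + a s * (norm (d s))\<^sup>2) =
       2 * (d s \<bullet> d' s) * exp (2 * A s) + exp (2 * A s) * (2 * a s) * (norm (d s))\<^sup>2" by (simp add: algebra_simps)
    ultimately have "2 * (d s \<bullet> d' s) * exp (2 * A s) + exp (2 * A s) * (2 * a s) * (norm (d s))\<^sup>2 \<ge> 0" by simp
    then show "\<exists>q'. (?q has_real_derivative q') (at s) \<and> q' \<ge> 0"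
      using DERIV_mult[OF 1 2] by blast
  qed
  then have "(norm (d 0))\<^sup>2 \<le> (norm (d t))\<^sup>2 * (exp (2 * A t) / exp (2 * A 0))" by (simp add: field_simps)
  also have "\<dots> = (norm (d t) * exp (A t - A 0))\<^sup>2"
  proof -
    have "exp (2 * A t) / exp (2 * A 0) = (exp (A t - A 0))\<^sup>2"
      by (simp add: exp_diff[symmetric] exp_double[symmetric] algebra_simps)
    then show ?thesis by (simp add: power_mult_distrib)
  qed
  finally show ?thesis by (rule power2_le_imp_le) simp
qed

text \<open>The mixed term is split by 2 |d| e \<le> |d|^2 + e^2; this costs the 1 in the rate 2 L +
  1 and leaves the square of the source, whose integral carries the factor 1 / (2 lam). Its root in
  the conclusion is what makes the field map a contraction for large lam.\<close>

lemma gronwall_backward_source: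
  fixes d :: "real \<Rightarrow> 'a::euclidean_space"
  assumes t: "0 \<le> t" "t \<le> T" and d: "\<And>s. s \<in> {0..t} \<Longrightarrow> (d has_vector_derivative d' s) (at s within {0..t})"
    and le: "\<And>s. s \<in> {0..t} \<Longrightarrow> norm (d' s) \<le> L * norm (d s) + K * exp (lam * s)"
    and L: "L \<ge> 0" and K: "K \<ge> 0" and lam: "lam > 0" and d0: "d t = 0"
  shows "norm (d 0) \<le> sqrt (exp ((2 * L + 1) * T) / (2 * lam)) * (K * exp (lam * t))"
proof -
  define m where "m = 2 * L + 1"
  have m: "m > 0" using L by (simp add: m_def)
  have cd: "continuous_on {0..t} d" by (rule deriv_within_imp_continuous[OF d])
  let ?q = "\<lambda>s. (norm (d s))\<^sup>2 * exp (m * s) + exp (m * T) * K\<^sup>2 * (exp (2 * lam * s) / (2 * lam))"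
  have "?q 0 \<le> ?q t"
  proof (rule nondecreasing_interval[OF t(1)])
    show "continuous_on {0..t} ?q" using lam by (intro continuous_intros cd) auto
    fix s assume s: "0 < s" "s < t"
    have 1: "((\<lambda>s. (norm (d s))\<^sup>2) has_real_derivative 2 * (d s \<bullet> d' s)) (at s)"
      by (rule norm_sq_has_derivative[OF deriv_within_imp_at[OF d s]])
    have 2: "((\<lambda>s. exp (m * s)) has_real_derivative exp (m * s) * m) (at s)"
      by (auto intro!: derivative_eq_intros)
    have 3: "((\<lambda>s. exp (m * T) * K\<^sup>2 * (exp (2 * lam * s) / (2 * lam))) has_real_derivative exp (m * T) * K\<^sup>2 * exp (2 * lam * s)) (at s)"
      using lam by (auto intro!: derivative_eq_intros)
    define e where "e = K * exp (lam * s)"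
    have e2: "e\<^sup>2 = K\<^sup>2 * exp (2 * lam * s)" by (simp add: e_def power_mult_distrib exp_double[symmetric] mult.assoc)
    have "\<bar>d s \<bullet> d' s\<bar> \<le> norm (d s) * norm (d' s)" by (rule Cauchy_Schwarz_ineq2)
    also have "\<dots> \<le> norm (d s) * (L * norm (d s) + e)" using le[of s] s by (intro mult_left_mono) (auto simp: e_def)
    finally have cs: "- (d s \<bullet> d' s) \<le> L * (norm (d s))\<^sup>2 + norm (d s) * e" by (simp add: power2_eq_square algebra_simps)
    have "2 * (norm (d s) * e) \<le> (norm (d s))\<^sup>2 + e\<^sup>2" using sum_squares_bound[of "norm (d s)" e] by simp
    with cs have ge: "2 * (d s \<bullet> d' s) + m * (norm (d s))\<^sup>2 + e\<^sup>2 \<ge> 0" by (simp add: m_def algebra_simps)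
    have "exp (m * s) \<le> exp (m * T)" using s t m by simp
    then have "exp (m * s) * e\<^sup>2 \<le> exp (m * T) * e\<^sup>2" by (intro mult_right_mono) auto
    moreover have "exp (m * s) * (2 * (d s \<bullet> d' s) + m * (norm (d s))\<^sup>2 + e\<^sup>2) \<ge> 0" using ge by simp
    ultimately have "2 * (d s \<bullet> d' s) * exp (m * s) + exp (m * s) * m * (norm (d s))\<^sup>2 + exp (m * T) * e\<^sup>2 \<ge> 0"
      by (simp add: algebra_simps)
    then have "2 * (d s \<bullet> d' s) * exp (m * s) + exp (m * s) * m * (norm (d s))\<^sup>2 + exp (m * T) * K\<^sup>2 * exp (2 * lam * s) \<ge> 0"
      by (simp add: e2 mult.assoc)
    then show "\<exists>q'. (?q has_real_derivative q') (at s) \<and> q' \<ge> 0"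
      using DERIV_add[OF DERIV_mult[OF 1 2] 3] by blast
  qed
  then have "(norm (d 0))\<^sup>2 \<le> exp (m * T) * K\<^sup>2 * (exp (2 * lam * t) / (2 * lam)) - exp (m * T) * K\<^sup>2 * (1 / (2 * lam))"
    using d0 by simp
  also have "\<dots> \<le> exp (m * T) * K\<^sup>2 * (exp (2 * lam * t) / (2 * lam))" using lam by simp
  also have "\<dots> = (sqrt (exp (m * T) / (2 * lam)) * (K * exp (lam * t)))\<^sup>2"
    using lam by (simp add: power_mult_distrib exp_double[symmetric] mult.assoc)
  finally show ?thesis unfolding m_def by (rule power2_le_imp_le) (use K lam in simp)
qed

section \<open>Kernels of the electric field\<close>

lemma cball_borel[measurable]: "cball (x::'a::real_normed_vector) r \<in> sets borel"
  by (simp add: borel_closed)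

definition field :: "('x::euclidean_space \<Rightarrow> 'x) \<Rightarrow> ('x \<Rightarrow> real) \<Rightarrow> 'x \<Rightarrow> 'x" where
  "field K \<rho> x = (LINT z|lborel. \<rho> z *\<^sub>R K (x - z))"

text \<open>
  The last assumption is the log-Lipschitz estimate: the integral is split at distance \<open>2\<^sup>-\<^sup>N\<close>, each of
  the \<open>N\<close> dyadic shells outside contributes a multiple of the bound \<open>M\<close> of the density, and inside the
  Lipschitz constant \<open>\<Lambda>\<close> of the density is used.
\<close>

locale field_kernel =
  fixes K :: "'x::euclidean_space \<Rightarrow> 'x" and R CK :: real
  assumes K_measurable[measurable]: "K \<in> borel_measurable borel"
    and R_pos: "R > 0" and CK_nonneg: "CK \<ge> 0"
    and K_int1: "\<And>x. (\<integral>\<^sup>+y\<in>cball 0 R. norm (K (x - y)) \<partial>lborel) \<le> ennreal CK"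
    and K_int2: "\<And>y. (\<integral>\<^sup>+x\<in>cball 0 R. norm (K (x - y)) \<partial>lborel) \<le> ennreal CK"
    and K_lip: "\<And>\<rho> M \<Lambda> N x y. \<lbrakk>\<rho> \<in> borel_measurable borel; \<And>z. \<bar>\<rho> z\<bar> \<le> M; \<Lambda> \<ge> 0;
        \<And>a b. \<bar>\<rho> a - \<rho> b\<bar> \<le> \<Lambda> * norm (a - b); \<And>z. z \<notin> cball 0 R \<Longrightarrow> \<rho> z = 0\<rbrakk>
      \<Longrightarrow> norm (field K \<rho> x - field K \<rho> y) \<le> CK * ((1 + real N) * M + (1/2) ^ N * \<Lambda>) * norm (x - y)"
begin

lemma integrable_field:
  assumes \<rho>[measurable]: "\<rho> \<in> borel_measurable borel" and b: "\<And>z. \<bar>\<rho> z\<bar> \<le> M" and s: "\<And>z. z \<notin> cball 0 R \<Longrightarrow> \<rho> z = 0"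
  shows "integrable lborel (\<lambda>z. \<rho> z *\<^sub>R K (x - z))" "norm (field K \<rho> x) \<le> CK * M"
proof -
  have M0: "M \<ge> 0" using b[of 0] by linarith
  have "(\<integral>\<^sup>+z. norm (\<rho> z *\<^sub>R K (x - z)) \<partial>lborel) \<le> (\<integral>\<^sup>+z. ennreal M * (ennreal (norm (K (x - z))) * indicator (cball 0 R) z) \<partial>lborel)"
  proof (rule nn_integral_mono)
    fix z
    show "ennreal (norm (\<rho> z *\<^sub>R K (x - z))) \<le> ennreal M * (ennreal (norm (K (x - z))) * indicator (cball 0 R) z)"
    proof (cases "z \<in> cball 0 R")
      case True
      have "ennreal (norm (\<rho> z *\<^sub>R K (x - z))) \<le> ennreal (M * norm (K (x - z)))"
        using b[of z] by (intro ennreal_leI) (auto intro!: mult_right_mono)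
      then show ?thesis using True M0 by (simp add: ennreal_mult)
    next
      case False then show ?thesis using s[OF False] by simp
    qed
  qed
  also have "\<dots> = ennreal M * (\<integral>\<^sup>+z\<in>cball 0 R. norm (K (x - z)) \<partial>lborel)"
    by (rule nn_integral_cmult) measurable
  also have "\<dots> \<le> ennreal M * ennreal CK" by (intro mult_left_mono K_int1) simp
  also have "\<dots> = ennreal (CK * M)" using M0 CK_nonneg by (simp add: ennreal_mult mult.commute)
  finally have le: "(\<integral>\<^sup>+z. norm (\<rho> z *\<^sub>R K (x - z)) \<partial>lborel) \<le> ennreal (CK * M)" .
  show i: "integrable lborel (\<lambda>z. \<rho> z *\<^sub>R K (x - z))"
    by (rule integrableI_bounded) (use le in \<open>auto intro: le_less_trans\<close>)
  have "ennreal (norm (field K \<rho> x)) \<le> ennreal (CK * M)"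
    unfolding field_def using integral_norm_bound_ennreal[OF i] le by (rule order_trans)
  then show "norm (field K \<rho> x) \<le> CK * M" using M0 CK_nonneg by (simp add: ennreal_le_iff)
qed

lemma field_diff:
  assumes "\<rho> \<in> borel_measurable borel" "\<And>z. \<bar>\<rho> z\<bar> \<le> M" "\<And>z. z \<notin> cball 0 R \<Longrightarrow> \<rho> z = 0"
    and "\<rho>' \<in> borel_measurable borel" "\<And>z. \<bar>\<rho>' z\<bar> \<le> M'" "\<And>z. z \<notin> cball 0 R \<Longrightarrow> \<rho>' z = 0"
  shows "field K \<rho> x - field K \<rho>' x = field K (\<lambda>z. \<rho> z - \<rho>' z) x"
  unfolding field_def scaleR_diff_left
  by (rule Bochner_Integration.integral_diff[symmetric]; rule integrable_field; use assms in blast)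

end

section \<open>The kernel of the plane\<close>

lemma nn_integral_reflect:
  fixes f :: "'a::euclidean_space \<Rightarrow> ennreal"
  assumes "f \<in> borel_measurable borel"
  shows "(\<integral>\<^sup>+y. f y \<partial>lborel) = (\<integral>\<^sup>+z. f (x - z) \<partial>lborel)"
proof -
  have "(\<integral>\<^sup>+y. f y \<partial>lborel) = (\<integral>\<^sup>+y. f y \<partial>density (distr lborel borel (\<lambda>z. x + (-1) *\<^sub>R z)) (\<lambda>_. \<bar>-1::real\<bar> ^ DIM('a)))"
    by (subst lborel_affine[of "-1" x]) auto
  also have "\<dots> = (\<integral>\<^sup>+z. f (x - z) \<partial>lborel)"
    using assms by (subst nn_integral_density) (auto simp: nn_integral_distr)
  finally show ?thesis .
qed

lemma emeasure_cball_le_square: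
  assumes "DIM('a::euclidean_space) = 2" "r \<ge> 0"
  shows "emeasure lborel (cball (0::'a) r) \<le> ennreal (4 * r\<^sup>2)"
proof -
  have "cball (0::'a) r \<subseteq> cbox (- (r *\<^sub>R One)) (r *\<^sub>R One)"
  proof
    fix z :: 'a assume "z \<in> cball 0 r"
    then have "\<bar>z \<bullet> i\<bar> \<le> r" if "i \<in> Basis" for i using Basis_le_norm[OF that, of z] by simp
    then show "z \<in> cbox (- (r *\<^sub>R One)) (r *\<^sub>R One)" by (force simp: mem_box abs_le_iff)
  qed
  then have "emeasure lborel (cball (0::'a) r) \<le> emeasure lborel (cbox (- (r *\<^sub>R One)) (r *\<^sub>R One) :: 'a set)"
    by (intro emeasure_mono) auto
  also have "\<dots> = ennreal (\<Prod>b\<in>(Basis::'a set). 2 * r)"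
    using assms(2) by (subst emeasure_lborel_cbox) (auto simp: inner_diff_left inner_add_left algebra_simps intro!: arg_cong[where f=ennreal] prod.cong)
  also have "(\<Prod>b\<in>(Basis::'a set). 2 * r) = 4 * r\<^sup>2" using assms(1) by (simp add: power2_eq_square)
  finally show ?thesis .
qed

lemma ennreal_le_suminf: "s k \<le> (\<Sum>k. s k)" for s :: "nat \<Rightarrow> ennreal"
  using sum_le_suminf[of s "{k}"] by simp

text \<open>On the dyadic shell with outer radius r / 2^k the integrand is at most 2^(k+1) / r, and
  the disc has area at most 4 (r / 2^k)^2. The products form the geometric series 8 r / 2^k with sum
  16 r.\<close>

lemma nn_integral_inverse_norm:
  assumes D: "DIM('a::euclidean_space) = 2" and r: "r > 0"
  shows "(\<integral>\<^sup>+z\<in>cball (0::'a) r. ennreal (1 / norm z) \<partial>lborel) \<le> ennreal (16 * r)"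
proof -
  have "(\<integral>\<^sup>+z\<in>cball (0::'a) r. ennreal (1 / norm z) \<partial>lborel)
     \<le> (\<integral>\<^sup>+z. (\<Sum>k. ennreal (2 ^ Suc k / r) * indicator (cball (0::'a) (r / 2 ^ k)) z) \<partial>lborel)"
  proof (rule nn_integral_mono)
    fix z :: 'a
    let ?s = "\<lambda>k. ennreal (2 ^ Suc k / r) * indicator (cball (0::'a) (r / 2 ^ k)) z"
    show "ennreal (1 / norm z) * indicator (cball 0 r) z \<le> (\<Sum>k. ?s k)"
    proof (cases "z \<in> cball 0 r \<and> z \<noteq> 0")
      case True
      then have "0 < norm z / r" "norm z / r \<le> 1 / 2 ^ 0" using r by auto
      then obtain k where k: "norm z / r \<le> 1 / 2 ^ k" "1 / 2 ^ k < 2 * (norm z / r)"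
        using dyadic_scale[of "norm z / r" 0] by blast
      have z: "z \<in> cball 0 (r / 2 ^ k)" using k(1) r by (simp add: field_simps)
      have "1 / norm z \<le> 2 ^ Suc k / r" using k(2) r True by (simp add: field_simps)
      then have "ennreal (1 / norm z) * indicator (cball 0 r) z \<le> ?s k"
        using z True by (simp add: ennreal_leI)
      also have "\<dots> \<le> (\<Sum>k. ?s k)" by (rule ennreal_le_suminf)
      finally show ?thesis .
    qed auto
  qed
  also have "\<dots> = (\<Sum>k. ennreal (2 ^ Suc k / r) * emeasure lborel (cball (0::'a) (r / 2 ^ k)))"
    by (subst nn_integral_suminf) (auto simp: nn_integral_cmult_indicator)
  also have "\<dots> \<le> (\<Sum>k. ennreal (8 * r * (1/2) ^ k))"
  proof (rule suminf_le)
    fix k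
    have "ennreal (2 ^ Suc k / r) * emeasure lborel (cball (0::'a) (r / 2 ^ k)) \<le> ennreal (2 ^ Suc k / r) * ennreal (4 * (r / 2 ^ k)\<^sup>2)"
      by (intro mult_left_mono emeasure_cball_le_square D) (use r in auto)
    also have "\<dots> = ennreal (2 ^ Suc k / r * (4 * (r / 2 ^ k)\<^sup>2))" by (rule ennreal_mult[symmetric]) (use r in auto)
    also have "2 ^ Suc k / r * (4 * (r / 2 ^ k)\<^sup>2) = 8 * r * (1/2) ^ k"
      using r by (simp add: power2_eq_square field_simps)
    finally show "ennreal (2 ^ Suc k / r) * emeasure lborel (cball (0::'a) (r / 2 ^ k)) \<le> ennreal (8 * r * (1/2) ^ k)" .
  qed auto
  also have "\<dots> = ennreal (\<Sum>k. 8 * r * (1/2) ^ k)"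
    using r by (intro suminf_ennreal2 summable_mult summable_geometric) auto
  also have "(\<Sum>k. 8 * r * (1/2) ^ k) = 16 * r"
    by (subst suminf_mult) (auto simp: suminf_geometric)
  finally show ?thesis .
qed

definition plane_kernel :: "'a::euclidean_space \<Rightarrow> 'a" where
  "plane_kernel z = (1 / (2 * pi * (norm z)\<^sup>2)) *\<^sub>R z"

text \<open>Agrees with \<open>plane_kernel\<close> at distances of at least \<delta> and is linear
  below, so that for \<delta> > 0 the singularity is removed while the kernel stays
  continuous.\<close>

definition plane_kernel_cut :: "real \<Rightarrow> 'a::euclidean_space \<Rightarrow> 'a" where
  "plane_kernel_cut \<delta> z = (1 / (2 * pi * (max (norm z) \<delta>)\<^sup>2)) *\<^sub>R z"

lemma plane_kernel_measurable[measurable]: "plane_kernel \<in> borel_measurable borel"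
  and plane_kernel_cut_measurable[measurable]: "plane_kernel_cut \<delta> \<in> borel_measurable borel"
  unfolding plane_kernel_def plane_kernel_cut_def by measurable

lemma norm_plane_kernel: "norm (plane_kernel z) = (1 / (2 * pi)) * (1 / norm z)"
  by (cases "z = 0") (auto simp: plane_kernel_def power2_eq_square)

lemma inv_2pi: "0 < 1 / (2 * pi)" "3 * (1 / (2 * pi)) \<le> 1"
  using pi_gt3 by (auto simp: field_simps)

context
  fixes R :: real
  assumes R: "R > 0"
begin

text \<open>Independence of x comes from the split at distance R from the singularity: the near part
  is at most the integral of the inverse norm over a centered disc, 16 R, and far away the kernel is
  at most 1 / R on a disc of area at most 4 R^2.\<close>

lemma plane_kernel_integral:
  assumes D: "DIM('a::euclidean_space) = 2"
  shows "(\<integral>\<^sup>+y\<in>cball 0 R. norm (plane_kernel (x - y :: 'a)) \<partial>lborel) \<le> ennreal (20 * R)"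
proof -
  have "(\<integral>\<^sup>+y\<in>cball 0 R. norm (plane_kernel (x - y :: 'a)) \<partial>lborel)
     = (\<integral>\<^sup>+z. ennreal (norm (plane_kernel z)) * indicator (cball 0 R) (x - z) \<partial>lborel)"
    by (subst nn_integral_reflect[of _ x]) auto
  also have "\<dots> \<le> (\<integral>\<^sup>+z. ennreal (1 / norm z) * indicator (cball 0 R) z + ennreal (1 / R) * indicator (cball 0 R) (x - z) \<partial>lborel)"
  proof (rule nn_integral_mono)
    fix z :: 'a
    have le: "norm (plane_kernel z) \<le> 1 / norm z"
      unfolding norm_plane_kernel using inv_2pi by (intro mult_left_le_one_le) auto
    show "ennreal (norm (plane_kernel z)) * indicator (cball 0 R) (x - z)
        \<le> ennreal (1 / norm z) * indicator (cball 0 R) z + ennreal (1 / R) * indicator (cball 0 R) (x - z)"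
    proof (cases "norm z \<le> R")
      case True
      then show ?thesis using le by (auto simp: indicator_def ennreal_leI add_increasing2)
    next
      case False
      then have "1 / norm z \<le> 1 / R" using R by (intro divide_left_mono mult_pos_pos) auto
      then have "norm (plane_kernel z) \<le> 1 / R" using le by linarith
      then show ?thesis using False by (auto simp: indicator_def ennreal_leI)
    qed
  qed
  also have "\<dots> = (\<integral>\<^sup>+z\<in>cball (0::'a) R. ennreal (1 / norm z) \<partial>lborel) + (\<integral>\<^sup>+z. ennreal (1 / R) * indicator (cball 0 R) (x - z) \<partial>lborel)"
    by (rule nn_integral_add) measurable
  also have "(\<integral>\<^sup>+z. ennreal (1 / R) * indicator (cball 0 R) (x - z) \<partial>lborel) = ennreal (1 / R) * emeasure lborel (cball (0::'a) R)"
    by (subst nn_integral_reflect[of "\<lambda>z. ennreal (1 / R) * indicator (cball 0 R) z" x, symmetric]) (auto simp: nn_integral_cmult_indicator)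
  also have "\<dots> \<le> ennreal (1 / R) * ennreal (4 * R\<^sup>2)"
    by (intro mult_left_mono emeasure_cball_le_square D) (use R in auto)
  also have "ennreal (1 / R) * ennreal (4 * R\<^sup>2) = ennreal (4 * R)"
    using R by (simp add: ennreal_mult[symmetric] power2_eq_square)
  finally have "(\<integral>\<^sup>+y\<in>cball 0 R. norm (plane_kernel (x - y :: 'a)) \<partial>lborel) \<le> (\<integral>\<^sup>+z\<in>cball (0::'a) R. ennreal (1 / norm z) \<partial>lborel) + ennreal (4 * R)"
    by (simp add: add_left_mono)
  also have "\<dots> \<le> ennreal (16 * R) + ennreal (4 * R)"
    by (intro add_right_mono nn_integral_inverse_norm D R)
  also have "\<dots> = ennreal (20 * R)" using R by (simp flip: ennreal_plus)
  finally show ?thesis .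
qed

text \<open>A difference estimate for the inversion a / |a|^2, with the norms replaced by larger
  numbers A and B so that it covers the cut kernel. It rests on B^2 a - A^2 b = B^2 (a - b) + (B^2 -
  A^2) b; the 3 comes from 2 B + A \<le> 3 A.\<close>

lemma inversion_difference:
  fixes a b :: "'a::euclidean_space"
  assumes "norm a \<le> A" "norm b \<le> B" "\<bar>A - B\<bar> \<le> norm (a - b)" "B > 0" "B \<le> A"
  shows "norm ((1 / A\<^sup>2) *\<^sub>R a - (1 / B\<^sup>2) *\<^sub>R b) \<le> 3 * norm (a - b) / (A * B)"
proof -
  have A: "A > 0" using assms by linarith
  have "norm (B\<^sup>2 *\<^sub>R a - A\<^sup>2 *\<^sub>R b) = norm (B\<^sup>2 *\<^sub>R (a - b) + (B\<^sup>2 - A\<^sup>2) *\<^sub>R b)" by (simp add: algebra_simps)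
  also have "\<dots> \<le> B\<^sup>2 * norm (a - b) + \<bar>B\<^sup>2 - A\<^sup>2\<bar> * norm b"
    by (rule order_trans[OF norm_triangle_ineq]) simp
  also have "\<bar>B\<^sup>2 - A\<^sup>2\<bar> = \<bar>A - B\<bar> * (A + B)"
    using A assms by (simp add: power2_eq_square square_diff_square_factored abs_mult mult.commute)
  also have "\<bar>A - B\<bar> * (A + B) * norm b \<le> norm (a - b) * (A + B) * B"
    using assms A by (intro mult_mono) auto
  also have "B\<^sup>2 * norm (a - b) + norm (a - b) * (A + B) * B = norm (a - b) * (B * (2 * B + A))"
    by (simp add: power2_eq_square algebra_simps)
  also have "\<dots> \<le> norm (a - b) * (B * (3 * A))" using assms by (intro mult_left_mono) auto
  finally have le: "norm (B\<^sup>2 *\<^sub>R a - A\<^sup>2 *\<^sub>R b) \<le> 3 * norm (a - b) * (A * B)" by (simp add: mult_ac)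
  have "(1 / A\<^sup>2) *\<^sub>R a - (1 / B\<^sup>2) *\<^sub>R b = (1 / (A * B)\<^sup>2) *\<^sub>R (B\<^sup>2 *\<^sub>R a - A\<^sup>2 *\<^sub>R b)"
    using A assms by (simp add: scaleR_diff_right power_mult_distrib)
  then have "norm ((1 / A\<^sup>2) *\<^sub>R a - (1 / B\<^sup>2) *\<^sub>R b) = norm (B\<^sup>2 *\<^sub>R a - A\<^sup>2 *\<^sub>R b) / (A * B)\<^sup>2" by simp
  also have "\<dots> \<le> 3 * norm (a - b) * (A * B) / (A * B)\<^sup>2" by (intro divide_right_mono le) simp
  also have "\<dots> = 3 * norm (a - b) / (A * B)" using A assms by (simp add: power2_eq_square)
  finally show ?thesis .
qed

text \<open>The factor 3 is absorbed by 1 / (2 pi). The product 1 / (A B) is weakened to a sum of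
  squares in order to separate a from b: each term is then integrated on its own by
  \<open>nn_integral_cut_square\<close>.\<close>

lemma plane_kernel_cut_difference:
  fixes a b :: "'a::euclidean_space"
  assumes \<delta>: "\<delta> > 0"
  shows "norm (plane_kernel_cut \<delta> a - plane_kernel_cut \<delta> b) \<le> norm (a - b) * (1 / (max (norm a) \<delta>)\<^sup>2 + 1 / (max (norm b) \<delta>)\<^sup>2)"
proof -
  define A where "A = max (norm a) \<delta>"
  define B where "B = max (norm b) \<delta>"
  have AB: "A > 0" "B > 0" "norm a \<le> A" "norm b \<le> B" using \<delta> by (auto simp: A_def B_def)
  have d: "\<bar>A - B\<bar> \<le> norm (a - b)" using norm_triangle_ineq3[of a b] by (auto simp: A_def B_def max_def)
  have main: "norm ((1 / A\<^sup>2) *\<^sub>R a - (1 / B\<^sup>2) *\<^sub>R b) \<le> 3 * norm (a - b) / (A * B)"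
  proof (cases "B \<le> A")
    case True then show ?thesis using inversion_difference[of a A b B] AB d by simp
  next
    case False then show ?thesis using inversion_difference[of b B a A] AB d
      by (simp add: norm_minus_commute abs_minus_commute mult.commute)
  qed
  have "plane_kernel_cut \<delta> a - plane_kernel_cut \<delta> b = (1 / (2 * pi)) *\<^sub>R ((1 / A\<^sup>2) *\<^sub>R a - (1 / B\<^sup>2) *\<^sub>R b)"
    by (simp add: plane_kernel_cut_def A_def B_def scaleR_diff_right)
  then have "norm (plane_kernel_cut \<delta> a - plane_kernel_cut \<delta> b) = (1 / (2 * pi)) * norm ((1 / A\<^sup>2) *\<^sub>R a - (1 / B\<^sup>2) *\<^sub>R b)"
    using inv_2pi by simp
  also have "\<dots> \<le> (1 / (2 * pi)) * (3 * norm (a - b) / (A * B))" using inv_2pi by (intro mult_left_mono main) auto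
  also have "\<dots> = (3 * (1 / (2 * pi))) * (norm (a - b) / (A * B))" by simp
  also have "\<dots> \<le> 1 * (norm (a - b) / (A * B))" using inv_2pi AB by (intro mult_right_mono) auto
  also have "norm (a - b) / (A * B) = norm (a - b) * ((1 / A) * (1 / B))" by simp
  also have "(1 / A) * (1 / B) \<le> (1 / A)\<^sup>2 + (1 / B)\<^sup>2"
  proof -
    have "0 \<le> (1 / A) * (1 / B)" using AB by simp
    then show ?thesis using sum_squares_bound[of "1 / A" "1 / B"] by linarith
  qed
  finally show ?thesis by (simp add: A_def B_def power_one_over mult_left_mono)
qed

text \<open>The inverse square is scale invariant in the plane, so each of the N + 1 dyadic shells
  down to R / 2^N contributes the same amount 16, and the region beyond R adds 4. The linear growth
  in N is the logarithm of the log-Lipschitz estimate.\<close>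

lemma nn_integral_cut_square:
  assumes D: "DIM('a::euclidean_space) = 2"
  shows "(\<integral>\<^sup>+y\<in>cball 0 R. ennreal (1 / (max (norm (x - y :: 'a)) (R / 2 ^ N))\<^sup>2) \<partial>lborel) \<le> ennreal (20 * (1 + real N))"
proof -
  let ?\<delta> = "R / 2 ^ N"
  have "(\<integral>\<^sup>+y\<in>cball 0 R. ennreal (1 / (max (norm (x - y :: 'a)) ?\<delta>)\<^sup>2) \<partial>lborel)
     = (\<integral>\<^sup>+z. ennreal (1 / (max (norm z) ?\<delta>)\<^sup>2) * indicator (cball 0 R) (x - z) \<partial>lborel)"
    by (subst nn_integral_reflect[of _ x]) auto
  also have "\<dots> \<le> (\<integral>\<^sup>+z. (\<Sum>k\<le>N. ennreal (4 * 4 ^ k / R\<^sup>2) * indicator (cball (0::'a) (R / 2 ^ k)) z) + ennreal (1 / R\<^sup>2) * indicator (cball 0 R) (x - z) \<partial>lborel)"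
  proof (rule nn_integral_mono)
    fix z :: 'a
    let ?s = "\<lambda>k. ennreal (4 * 4 ^ k / R\<^sup>2) * indicator (cball (0::'a) (R / 2 ^ k)) z"
    have ik: "\<exists>k\<le>N. ennreal (1 / (max (norm z) ?\<delta>)\<^sup>2) \<le> ?s k" if zR: "norm z \<le> R"
    proof (cases "norm z \<le> ?\<delta>")
      case True
      then have "max (norm z) ?\<delta> = ?\<delta>" by simp
      moreover have "1 / ?\<delta>\<^sup>2 \<le> 4 * 4 ^ N / R\<^sup>2"
        using R by (simp add: power_divide power_mult[symmetric] mult.commute[of _ 2] power_mult divide_right_mono)
      ultimately show ?thesis using True by (intro exI[of _ N]) (simp add: ennreal_leI)
    next
      case False
      have "?\<delta> > 0" using R by simp
      then have z0: "norm z > 0" using False by linarith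
      then have "0 < norm z / R" "norm z / R \<le> 1 / 2 ^ 0" using R zR by auto
      then obtain k where k: "norm z / R \<le> 1 / 2 ^ k" "1 / 2 ^ k < 2 * (norm z / R)"
        using dyadic_scale[of "norm z / R" 0] by blast
      have "k \<le> N"
      proof (rule ccontr)
        assume "\<not> k \<le> N"
        then have "(1::real) / 2 ^ k \<le> 1 / 2 ^ N" by (simp add: frac_le)
        then have "norm z / R \<le> 1 / 2 ^ N" using k by linarith
        then show False using False R by (simp add: field_simps)
      qed
      moreover have "z \<in> cball 0 (R / 2 ^ k)" using k(1) R by (simp add: field_simps)
      moreover have "1 / (norm z)\<^sup>2 \<le> 4 * 4 ^ k / R\<^sup>2"
      proof -
        have "1 / norm z \<le> 2 * 2 ^ k / R" using k(2) R z0 by (simp add: field_simps)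
        then have "(1 / norm z)\<^sup>2 \<le> (2 * 2 ^ k / R)\<^sup>2" by (intro power_mono) auto
        then show ?thesis by (simp add: power_divide power_mult_distrib power_mult[symmetric] mult.commute[of _ 2] power_mult)
      qed
      ultimately show ?thesis using False by (intro exI[of _ k]) (simp add: ennreal_leI)
    qed
    show "ennreal (1 / (max (norm z) ?\<delta>)\<^sup>2) * indicator (cball 0 R) (x - z) \<le> (\<Sum>k\<le>N. ?s k) + ennreal (1 / R\<^sup>2) * indicator (cball 0 R) (x - z)"
    proof (cases "norm z \<le> R")
      case True
      then obtain k where k: "k \<le> N" "ennreal (1 / (max (norm z) ?\<delta>)\<^sup>2) \<le> ?s k" using ik by blast
      have "?s k \<le> (\<Sum>k\<le>N. ?s k)" using k(1) by (intro member_le_sum) auto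
      with k(2) have "ennreal (1 / (max (norm z) ?\<delta>)\<^sup>2) \<le> (\<Sum>k\<le>N. ?s k)" by (rule order_trans)
      then show ?thesis by (auto simp: indicator_def[of "cball 0 R" "x - z"] add_increasing2)
    next
      case False
      then have "max (norm z) ?\<delta> \<ge> R" by simp
      then have "1 / (max (norm z) ?\<delta>)\<^sup>2 \<le> 1 / R\<^sup>2" using R by (intro divide_left_mono power_mono) auto
      then show ?thesis by (auto simp: indicator_def[of "cball 0 R" "x - z"] ennreal_leI add_increasing)
    qed
  qed
  also have "\<dots> = (\<Sum>k\<le>N. ennreal (4 * 4 ^ k / R\<^sup>2) * emeasure lborel (cball (0::'a) (R / 2 ^ k))) + (\<integral>\<^sup>+z. ennreal (1 / R\<^sup>2) * indicator (cball 0 R) (x - z) \<partial>lborel)"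
  proof -
    have "(\<integral>\<^sup>+z. (\<Sum>k\<le>N. ennreal (4 * 4 ^ k / R\<^sup>2) * indicator (cball (0::'a) (R / 2 ^ k)) z) \<partial>lborel)
      = (\<Sum>k\<le>N. \<integral>\<^sup>+z. ennreal (4 * 4 ^ k / R\<^sup>2) * indicator (cball (0::'a) (R / 2 ^ k)) z \<partial>lborel)"
      by (rule nn_integral_sum) measurable
    also have "\<dots> = (\<Sum>k\<le>N. ennreal (4 * 4 ^ k / R\<^sup>2) * emeasure lborel (cball (0::'a) (R / 2 ^ k)))"
      by (intro sum.cong refl nn_integral_cmult_indicator) simp
    finally have sum: "(\<integral>\<^sup>+z. (\<Sum>k\<le>N. ennreal (4 * 4 ^ k / R\<^sup>2) * indicator (cball (0::'a) (R / 2 ^ k)) z) \<partial>lborel)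
      = (\<Sum>k\<le>N. ennreal (4 * 4 ^ k / R\<^sup>2) * emeasure lborel (cball (0::'a) (R / 2 ^ k)))" .
    show ?thesis unfolding sum[symmetric] by (rule nn_integral_add) measurable
  qed
  also have "(\<integral>\<^sup>+z. ennreal (1 / R\<^sup>2) * indicator (cball 0 R) (x - z) \<partial>lborel) = ennreal (1 / R\<^sup>2) * emeasure lborel (cball (0::'a) R)"
    by (subst nn_integral_reflect[of "\<lambda>z. ennreal (1 / R\<^sup>2) * indicator (cball 0 R) z" x, symmetric]) (auto simp: nn_integral_cmult_indicator)
  also have "(\<Sum>k\<le>N. ennreal (4 * 4 ^ k / R\<^sup>2) * emeasure lborel (cball (0::'a) (R / 2 ^ k))) + ennreal (1 / R\<^sup>2) * emeasure lborel (cball (0::'a) R)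
      \<le> (\<Sum>k\<le>N. ennreal (4 * 4 ^ k / R\<^sup>2) * ennreal (4 * (R / 2 ^ k)\<^sup>2)) + ennreal (1 / R\<^sup>2) * ennreal (4 * R\<^sup>2)"
    by (intro add_mono sum_mono mult_left_mono emeasure_cball_le_square D) (use R in auto)
  also have "\<dots> = (\<Sum>k\<le>N. ennreal 16) + ennreal 4"
  proof -
    have "4 * 4 ^ k / R\<^sup>2 * (4 * (R / 2 ^ k)\<^sup>2) = 16" for k :: nat
      using R by (simp add: power_divide power_mult[symmetric] mult.commute[of _ 2] power_mult)
    then show ?thesis using R by (simp add: ennreal_mult[symmetric])
  qed
  also have "\<dots> = ennreal (16 * (1 + real N) + 4)"
  proof -
    have "(\<Sum>k\<le>N. ennreal 16) = ennreal (\<Sum>k\<le>N. 16)" by (rule sum_ennreal) simp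
    then have "(\<Sum>k\<le>N. ennreal 16) + ennreal 4 = ennreal (\<Sum>k\<le>N. 16) + ennreal 4" by (simp only:)
    also have "\<dots> = ennreal ((\<Sum>k\<le>N. 16) + 4)" by (rule ennreal_plus[symmetric]) auto
    finally show ?thesis by (simp add: algebra_simps)
  qed
  also have "\<dots> \<le> ennreal (20 * (1 + real N))" by (intro ennreal_leI) simp
  finally show ?thesis .
qed

text \<open>Kernel and cut kernel differ only within distance \<delta>, and there the difference is
  no larger than the singular kernel.\<close>

lemma plane_kernel_cut_error_integral:
  assumes D: "DIM('a::euclidean_space) = 2" and \<delta>: "\<delta> > 0"
  shows "(\<integral>\<^sup>+z. norm (plane_kernel z - plane_kernel_cut \<delta> z :: 'a) \<partial>lborel) \<le> ennreal (16 * \<delta>)"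
proof -
  have "(\<integral>\<^sup>+z. norm (plane_kernel z - plane_kernel_cut \<delta> z :: 'a) \<partial>lborel) \<le> (\<integral>\<^sup>+z\<in>cball (0::'a) \<delta>. ennreal (1 / norm z) \<partial>lborel)"
  proof (rule nn_integral_mono)
    fix z :: 'a
    show "ennreal (norm (plane_kernel z - plane_kernel_cut \<delta> z)) \<le> ennreal (1 / norm z) * indicator (cball 0 \<delta>) z"
    proof (cases "norm z \<le> \<delta> \<and> z \<noteq> 0")
      case True
      have "norm (plane_kernel z - plane_kernel_cut \<delta> z) = \<bar>1 / (2 * pi * (norm z)\<^sup>2) - 1 / (2 * pi * \<delta>\<^sup>2)\<bar> * norm z"
        using True by (simp add: plane_kernel_def plane_kernel_cut_def max_def scaleR_diff_left[symmetric])
      also have "\<dots> \<le> 1 / (2 * pi * (norm z)\<^sup>2) * norm z"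
      proof (rule mult_right_mono)
        have "(norm z)\<^sup>2 \<le> \<delta>\<^sup>2" using True by (intro power_mono) auto
        then have "1 / (2 * pi * \<delta>\<^sup>2) \<le> 1 / (2 * pi * (norm z)\<^sup>2)" using True \<delta> by (intro divide_left_mono mult_left_mono) auto
        then show "\<bar>1 / (2 * pi * (norm z)\<^sup>2) - 1 / (2 * pi * \<delta>\<^sup>2)\<bar> \<le> 1 / (2 * pi * (norm z)\<^sup>2)" by simp
      qed simp
      also have "\<dots> = norm (plane_kernel z)" by (simp add: plane_kernel_def)
      also have "\<dots> \<le> 1 / norm z" unfolding norm_plane_kernel using inv_2pi by (intro mult_left_le_one_le) auto
      finally show ?thesis using True by (simp add: ennreal_leI)
    next
      case False
      then have "plane_kernel z - plane_kernel_cut \<delta> z = 0"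
        by (auto simp: plane_kernel_def plane_kernel_cut_def max_def)
      then show ?thesis by simp
    qed
  qed
  also have "\<dots> \<le> ennreal (16 * \<delta>)" by (rule nn_integral_inverse_norm[OF D \<delta>])
  finally show ?thesis .
qed

text \<open>The increment x - y falls on different factors. In the cut part it falls on the kernel,
  and the points x and y contribute 20 each to the constant 40. In the remainder it falls, after a
  reflection of the variable, on the density; this gives \<Lambda> times the mass 16 \<delta> of the
  error kernel with \<delta> = R / 2^N.\<close>

lemma plane_kernel_lipschitz:
  fixes \<rho> :: "'a::euclidean_space \<Rightarrow> real"
  assumes D: "DIM('a) = 2"
    and \<rho>[measurable]: "\<rho> \<in> borel_measurable borel" and b: "\<And>z. \<bar>\<rho> z\<bar> \<le> M" and \<Lambda>: "\<Lambda> \<ge> 0"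
    and lip: "\<And>a b. \<bar>\<rho> a - \<rho> b\<bar> \<le> \<Lambda> * norm (a - b)" and s: "\<And>z. z \<notin> cball 0 R \<Longrightarrow> \<rho> z = 0"
  shows "norm (field plane_kernel \<rho> x - field plane_kernel \<rho> y) \<le> max 40 (16 * R) * ((1 + real N) * M + (1/2) ^ N * \<Lambda>) * norm (x - y)"
proof -
  define \<delta> where "\<delta> = R / 2 ^ N"
  have \<delta>: "\<delta> > 0" using R by (simp add: \<delta>_def)
  have M0: "M \<ge> 0" using b[of 0] by linarith
  let ?k = "plane_kernel_cut \<delta> :: 'a \<Rightarrow> 'a"
  let ?e = "\<lambda>z::'a. plane_kernel z - ?k z"
  have e_fin: "(\<integral>\<^sup>+z. norm (?e z) \<partial>lborel) \<le> ennreal (16 * \<delta>)" by (rule plane_kernel_cut_error_integral[OF D \<delta>])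
  have ie: "integrable lborel (\<lambda>z. c z *\<^sub>R ?e z)" if "c \<in> borel_measurable borel" "\<And>z. \<bar>c z\<bar> \<le> B" for c B
  proof (rule Bochner_Integration.integrable_bound[of _ "\<lambda>z. B *\<^sub>R ?e z"])
    have "integrable lborel ?e" by (rule integrableI_bounded) (use e_fin in \<open>auto intro: le_less_trans\<close>)
    then show "integrable lborel (\<lambda>z. B *\<^sub>R ?e z)" by simp
    show "(\<lambda>z. c z *\<^sub>R ?e z) \<in> borel_measurable lborel" using that(1) by simp
    show "AE z in lborel. norm (c z *\<^sub>R ?e z) \<le> norm (B *\<^sub>R ?e z)"
      by (auto intro!: mult_right_mono order_trans[OF that(2) abs_ge_self])
  qed
  have ik: "integrable lborel (\<lambda>z. \<rho> z *\<^sub>R ?k (x - z))" for x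
  proof (rule integrableI_bounded_set[where A="cball 0 R" and B="M * (1 / (2 * pi * \<delta>))"])
    show "AE z in lborel. z \<in> cball 0 R \<longrightarrow> norm (\<rho> z *\<^sub>R ?k (x - z)) \<le> M * (1 / (2 * pi * \<delta>))"
    proof (intro AE_I2 impI)
      fix z
      define m where "m = max (norm (x - z)) \<delta>"
      have m: "m > 0" "norm (x - z) \<le> m" "\<delta> \<le> m" using \<delta> by (auto simp: m_def)
      have "norm (?k (x - z)) = 1 / (2 * pi * m\<^sup>2) * norm (x - z)" by (simp add: plane_kernel_cut_def m_def)
      also have "\<dots> \<le> 1 / (2 * pi * m\<^sup>2) * m" using m by (intro mult_left_mono) auto
      also have "\<dots> = 1 / (2 * pi * m)" using m by (simp add: power2_eq_square)
      also have "\<dots> \<le> 1 / (2 * pi * \<delta>)" using m \<delta> by (intro divide_left_mono) auto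
      finally show "norm (\<rho> z *\<^sub>R ?k (x - z)) \<le> M * (1 / (2 * pi * \<delta>))"
        using b[of z] M0 by (simp only: norm_scaleR real_norm_def) (intro mult_mono, auto)
    qed
  qed (use s emeasure_cball_le_square[OF D, of R] R in \<open>auto intro: le_less_trans\<close>)
  have \<rho>r: "(\<lambda>z. \<rho> (x - z)) \<in> borel_measurable borel" for x by measurable
  have refl: "(LINT z|lborel. \<rho> z *\<^sub>R ?e (x - z)) = (LINT z|lborel. \<rho> (x - z) *\<^sub>R ?e z)" 
     and irefl: "integrable lborel (\<lambda>z. \<rho> z *\<^sub>R ?e (x - z))" for x
  proof -
    have eq: "lborel = distr lborel borel (\<lambda>z. x - z :: 'a)"
      using lborel_affine[of "-1" x] by (simp add: density_1)
    have "(LINT z|lborel. \<rho> z *\<^sub>R ?e (x - z)) = (LINT z|distr lborel borel (\<lambda>z. x - z). \<rho> z *\<^sub>R ?e (x - z))"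
      using eq by simp
    also have "\<dots> = (LINT z|lborel. \<rho> (x - z) *\<^sub>R ?e z)" by (subst integral_distr) auto
    finally show "(LINT z|lborel. \<rho> z *\<^sub>R ?e (x - z)) = (LINT z|lborel. \<rho> (x - z) *\<^sub>R ?e z)" .
    have "integrable lborel (\<lambda>z. \<rho> (x - z) *\<^sub>R ?e z)" by (rule ie[OF \<rho>r b])
    then have "integrable (distr lborel borel (\<lambda>z. x - z)) (\<lambda>z. \<rho> z *\<^sub>R ?e (x - z))"
      by (subst integrable_distr_eq) auto
    then show "integrable lborel (\<lambda>z. \<rho> z *\<^sub>R ?e (x - z))" using eq by simp
  qed
  have split: "field plane_kernel \<rho> x = (LINT z|lborel. \<rho> z *\<^sub>R ?k (x - z)) + (LINT z|lborel. \<rho> (x - z) *\<^sub>R ?e z)" for x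
  proof -
    have "field plane_kernel \<rho> x = (LINT z|lborel. \<rho> z *\<^sub>R ?k (x - z) + \<rho> z *\<^sub>R ?e (x - z))"
      by (simp add: field_def scaleR_diff_right)
    then show ?thesis using ik[of x] irefl[of x] refl[of x] by simp
  qed
  have A: "norm ((LINT z|lborel. \<rho> (x - z) *\<^sub>R ?e z) - (LINT z|lborel. \<rho> (y - z) *\<^sub>R ?e z)) \<le> (\<Lambda> * norm (x - y)) * (16 * \<delta>)"
  proof -
    have i: "integrable lborel (\<lambda>z. \<rho> (x - z) *\<^sub>R ?e z - \<rho> (y - z) *\<^sub>R ?e z)"
      by (intro Bochner_Integration.integrable_diff ie[OF \<rho>r b])
    have "(LINT z|lborel. \<rho> (x - z) *\<^sub>R ?e z) - (LINT z|lborel. \<rho> (y - z) *\<^sub>R ?e z) = (LINT z|lborel. \<rho> (x - z) *\<^sub>R ?e z - \<rho> (y - z) *\<^sub>R ?e z)"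
      by (intro Bochner_Integration.integral_diff[symmetric] ie[OF \<rho>r b])
    then have "ennreal (norm ((LINT z|lborel. \<rho> (x - z) *\<^sub>R ?e z) - (LINT z|lborel. \<rho> (y - z) *\<^sub>R ?e z)))
       \<le> (\<integral>\<^sup>+z. norm (\<rho> (x - z) *\<^sub>R ?e z - \<rho> (y - z) *\<^sub>R ?e z) \<partial>lborel)"
      using integral_norm_bound_ennreal[OF i] by simp
    also have "\<dots> \<le> (\<integral>\<^sup>+z. ennreal (\<Lambda> * norm (x - y)) * ennreal (norm (?e z)) \<partial>lborel)"
    proof (rule nn_integral_mono)
      fix z
      have "norm (\<rho> (x - z) *\<^sub>R ?e z - \<rho> (y - z) *\<^sub>R ?e z) = \<bar>\<rho> (x - z) - \<rho> (y - z)\<bar> * norm (?e z)"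
        by (simp add: scaleR_diff_left[symmetric])
      also have "\<dots> \<le> (\<Lambda> * norm (x - y)) * norm (?e z)" using lip[of "x - z" "y - z"] by (intro mult_right_mono) auto
      finally show "ennreal (norm (\<rho> (x - z) *\<^sub>R ?e z - \<rho> (y - z) *\<^sub>R ?e z)) \<le> ennreal (\<Lambda> * norm (x - y)) * ennreal (norm (?e z))"
        using \<Lambda> by (simp add: ennreal_mult[symmetric] ennreal_leI)
    qed
    also have "\<dots> = ennreal (\<Lambda> * norm (x - y)) * (\<integral>\<^sup>+z. norm (?e z) \<partial>lborel)" by (rule nn_integral_cmult) measurable
    also have "\<dots> \<le> ennreal (\<Lambda> * norm (x - y)) * ennreal (16 * \<delta>)" by (intro mult_left_mono e_fin) simp
    also have "\<dots> = ennreal ((\<Lambda> * norm (x - y)) * (16 * \<delta>))" using \<Lambda> \<delta> by (simp add: ennreal_mult)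
    finally show ?thesis using \<Lambda> \<delta> by (simp add: ennreal_le_iff)
  qed
  have B: "norm ((LINT z|lborel. \<rho> z *\<^sub>R ?k (x - z)) - (LINT z|lborel. \<rho> z *\<^sub>R ?k (y - z))) \<le> (M * norm (x - y)) * (40 * (1 + real N))"
  proof -
    let ?w = "\<lambda>x z. 1 / (max (norm (x - z :: 'a)) \<delta>)\<^sup>2"
    have "ennreal (norm ((LINT z|lborel. \<rho> z *\<^sub>R ?k (x - z)) - (LINT z|lborel. \<rho> z *\<^sub>R ?k (y - z))))
      \<le> (\<integral>\<^sup>+z. norm (\<rho> z *\<^sub>R ?k (x - z) - \<rho> z *\<^sub>R ?k (y - z)) \<partial>lborel)"
      using integral_norm_bound_ennreal[OF Bochner_Integration.integrable_diff[OF ik[of x] ik[of y]]]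
      by (simp only: Bochner_Integration.integral_diff[OF ik[of x] ik[of y]])
    also have "\<dots> \<le> (\<integral>\<^sup>+z. ennreal (M * norm (x - y)) * (ennreal (?w x z) * indicator (cball 0 R) z + ennreal (?w y z) * indicator (cball 0 R) z) \<partial>lborel)"
    proof (rule nn_integral_mono)
      fix z
      show "ennreal (norm (\<rho> z *\<^sub>R ?k (x - z) - \<rho> z *\<^sub>R ?k (y - z))) \<le> ennreal (M * norm (x - y)) * (ennreal (?w x z) * indicator (cball 0 R) z + ennreal (?w y z) * indicator (cball 0 R) z)"
      proof (cases "z \<in> cball 0 R")
        case True
        have "norm (\<rho> z *\<^sub>R ?k (x - z) - \<rho> z *\<^sub>R ?k (y - z)) = \<bar>\<rho> z\<bar> * norm (?k (x - z) - ?k (y - z))"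
          by (simp add: scaleR_diff_right[symmetric])
        also have "\<dots> \<le> M * (norm ((x - z) - (y - z)) * (?w x z + ?w y z))"
          using plane_kernel_cut_difference[OF \<delta>, of "x - z" "y - z"] b M0 by (intro mult_mono) auto
        finally have "norm (\<rho> z *\<^sub>R ?k (x - z) - \<rho> z *\<^sub>R ?k (y - z)) \<le> M * norm (x - y) * (?w x z + ?w y z)" by simp
        then have "ennreal (norm (\<rho> z *\<^sub>R ?k (x - z) - \<rho> z *\<^sub>R ?k (y - z))) \<le> ennreal (M * norm (x - y)) * ennreal (?w x z + ?w y z)"
          using M0 by (simp add: ennreal_mult[symmetric] ennreal_leI del: ennreal_plus)
        also have "ennreal (?w x z + ?w y z) = ennreal (?w x z) + ennreal (?w y z)" by (rule ennreal_plus) auto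
        finally show ?thesis using True by simp
      qed (simp add: s)
    qed
    also have "\<dots> = ennreal (M * norm (x - y)) * ((\<integral>\<^sup>+z\<in>cball 0 R. ennreal (?w x z) \<partial>lborel) + (\<integral>\<^sup>+z\<in>cball 0 R. ennreal (?w y z) \<partial>lborel))"
    proof -
      have "(\<integral>\<^sup>+z. ennreal (?w x z) * indicator (cball 0 R) z + ennreal (?w y z) * indicator (cball 0 R) z \<partial>lborel)
        = (\<integral>\<^sup>+z\<in>cball 0 R. ennreal (?w x z) \<partial>lborel) + (\<integral>\<^sup>+z\<in>cball 0 R. ennreal (?w y z) \<partial>lborel)"
        by (rule nn_integral_add) measurable
      from this[symmetric] show ?thesis by (simp only:) (rule nn_integral_cmult, measurable)
    qed
    also have "\<dots> \<le> ennreal (M * norm (x - y)) * (ennreal (20 * (1 + real N)) + ennreal (20 * (1 + real N)))"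
      unfolding \<delta>_def by (intro mult_left_mono add_mono nn_integral_cut_square D) simp
    also have "\<dots> = ennreal ((M * norm (x - y)) * (40 * (1 + real N)))"
      using M0 by (simp add: ennreal_mult[symmetric] ennreal_plus[symmetric] del: ennreal_plus)
    finally show ?thesis using M0 by (simp add: ennreal_le_iff)
  qed
  have "field plane_kernel \<rho> x - field plane_kernel \<rho> y =
      ((LINT z|lborel. \<rho> z *\<^sub>R ?k (x - z)) - (LINT z|lborel. \<rho> z *\<^sub>R ?k (y - z)))
      + ((LINT z|lborel. \<rho> (x - z) *\<^sub>R ?e z) - (LINT z|lborel. \<rho> (y - z) *\<^sub>R ?e z))"
    by (simp only: split algebra_simps)
  then have "norm (field plane_kernel \<rho> x - field plane_kernel \<rho> y) \<le> (M * norm (x - y)) * (40 * (1 + real N)) + (\<Lambda> * norm (x - y)) * (16 * \<delta>)"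
    by (simp only:) (rule order_trans[OF norm_triangle_ineq add_mono[OF B A]])
  also have "\<dots> = (40 * ((1 + real N) * M) + 16 * R * ((1/2) ^ N * \<Lambda>)) * norm (x - y)"
    by (simp add: \<delta>_def algebra_simps power_one_over)
  also have "\<dots> \<le> (max 40 (16 * R) * ((1 + real N) * M) + max 40 (16 * R) * ((1/2) ^ N * \<Lambda>)) * norm (x - y)"
    using M0 \<Lambda> by (intro mult_right_mono add_mono) auto
  finally show ?thesis by (simp add: distrib_left)
qed

lemma field_kernel_plane:
  assumes D: "DIM('a::euclidean_space) = 2"
  shows "field_kernel (plane_kernel :: 'a \<Rightarrow> 'a) R (max 40 (20 * R))"
proof
  have le: "ennreal (20 * R) \<le> ennreal (max 40 (20 * R))" by (intro ennreal_leI) simp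
  show "(\<integral>\<^sup>+y\<in>cball 0 R. norm (plane_kernel (x - y :: 'a)) \<partial>lborel) \<le> ennreal (max 40 (20 * R))" for x
    by (rule order_trans[OF plane_kernel_integral[OF D] le])
  show "(\<integral>\<^sup>+x\<in>cball 0 R. norm (plane_kernel (x - y :: 'a)) \<partial>lborel) \<le> ennreal (max 40 (20 * R))" for y
    using order_trans[OF plane_kernel_integral[OF D, of y] le] by (simp add: norm_plane_kernel norm_minus_commute)
  fix \<rho> :: "'a \<Rightarrow> real" and M \<Lambda> :: real and N :: nat and x y :: 'a
  assume a: "\<rho> \<in> borel_measurable borel" "\<And>z. \<bar>\<rho> z\<bar> \<le> M" "\<Lambda> \<ge> 0"
        "\<And>a b. \<bar>\<rho> a - \<rho> b\<bar> \<le> \<Lambda> * norm (a - b)" "\<And>z. z \<notin> cball 0 R \<Longrightarrow> \<rho> z = 0"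
  have M0: "M \<ge> 0" using a(2)[of 0] by linarith
  show "norm (field plane_kernel \<rho> x - field plane_kernel \<rho> y) \<le> max 40 (20 * R) * ((1 + real N) * M + (1/2) ^ N * \<Lambda>) * norm (x - y)"
  proof (rule order_trans[OF plane_kernel_lipschitz[OF D a, where N=N]])
    show "max 40 (16 * R) * ((1 + real N) * M + (1/2) ^ N * \<Lambda>) * norm (x - y) \<le> max 40 (20 * R) * ((1 + real N) * M + (1/2) ^ N * \<Lambda>) * norm (x - y)"
      using R M0 a(3) by (intro mult_right_mono) auto
  qed
qed (use R in auto)

end

section \<open>The kernel of the line\<close>

definition line_kernel :: "real ^ 'n \<Rightarrow> real ^ 'n" where
  "line_kernel z = (\<chi> i. if 0 \<le> z $ i then 1 else 0)"

text \<open>The kernel is Heaviside's function in the only coordinate, so the field is a primitive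
  of the density and M is a Lipschitz constant. In the constant, the volume of the ball serves the
  two integral bounds, and the 1 lifts M to the required bound for every N.\<close>

lemma field_kernel_line:
  assumes card1: "CARD('n::finite) = 1" and R: "R > 0"
  shows "field_kernel (line_kernel :: real ^ 'n \<Rightarrow> real ^ 'n) R (1 + measure lborel (cball (0 :: real ^ 'n) R))"
proof
  obtain i0 :: 'n where i0: "UNIV = {i0}" using card1 by (auto simp: card_1_singleton_iff)
  let ?C = "1 + measure lborel (cball (0 :: real ^ 'n) R)"
  have all: "(\<forall>i. P i) \<longleftrightarrow> P i0" for P :: "'n \<Rightarrow> bool" using i0 by (metis UNIV_I singletonD)
  have nrm: "norm (v :: real ^ 'n) = \<bar>v $ i0\<bar>" for v
    by (simp add: norm_vec_def L2_set_def i0)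
  have le1: "norm (line_kernel z :: real ^ 'n) \<le> 1" for z by (simp add: nrm line_kernel_def)
  show meas: "(line_kernel :: real ^ 'n \<Rightarrow> real ^ 'n) \<in> borel_measurable borel"
  proof -
    have [measurable]: "(\<lambda>z :: real ^ 'n. z $ i0) \<in> borel_measurable borel"
      by (intro borel_measurable_continuous_onI continuous_intros)
    have "i = i0" for i :: 'n using i0 by blast
    define c :: "real ^ 'n" where "c = (\<chi> i. 1)"
    have "(line_kernel :: real ^ 'n \<Rightarrow> real ^ 'n) = (\<lambda>z. if 0 \<le> z $ i0 then c else 0)"
      using \<open>\<And>i. i = i0\<close> by (intro ext) (simp add: line_kernel_def vec_eq_iff c_def, metis)
    moreover have "(\<lambda>z :: real ^ 'n. if 0 \<le> z $ i0 then c else 0) \<in> borel_measurable borel" by measurable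
    ultimately show ?thesis by simp
  qed
  have fin: "emeasure lborel (cball (0 :: real ^ 'n) R) \<le> ennreal ?C"
  proof -
    have "emeasure lborel (cball (0 :: real ^ 'n) R) = ennreal (measure lborel (cball (0 :: real ^ 'n) R))"
      using emeasure_bounded_finite[OF bounded_cball, of "0 :: real ^ 'n" R] by (intro emeasure_eq_ennreal_measure) auto
    then show ?thesis by (simp add: ennreal_leI)
  qed
  have I: "(\<integral>\<^sup>+y\<in>cball 0 R. norm (line_kernel (g y) :: real ^ 'n) \<partial>lborel) \<le> ennreal ?C" for g :: "real ^ 'n \<Rightarrow> real ^ 'n"
  proof -
    have "(\<integral>\<^sup>+y\<in>cball 0 R. norm (line_kernel (g y) :: real ^ 'n) \<partial>lborel) \<le> (\<integral>\<^sup>+y\<in>cball (0 :: real ^ 'n) R. 1 \<partial>lborel)"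
      by (rule nn_integral_mono) (auto simp: indicator_def le1)
    also have "\<dots> \<le> ennreal ?C" using fin by simp
    finally show ?thesis .
  qed
  show "(\<integral>\<^sup>+y\<in>cball 0 R. norm (line_kernel (x - y) :: real ^ 'n) \<partial>lborel) \<le> ennreal ?C" for x by (rule I)
  show "(\<integral>\<^sup>+x\<in>cball 0 R. norm (line_kernel (x - y) :: real ^ 'n) \<partial>lborel) \<le> ennreal ?C" for y by (rule I)
  fix \<rho> :: "real ^ 'n \<Rightarrow> real" and M \<Lambda> :: real and N :: nat and x y :: "real ^ 'n"
  assume \<rho>[measurable]: "\<rho> \<in> borel_measurable borel" and b: "\<And>z. \<bar>\<rho> z\<bar> \<le> M" and \<Lambda>: "\<Lambda> \<ge> 0"
    and "\<And>a b. \<bar>\<rho> a - \<rho> b\<bar> \<le> \<Lambda> * norm (a - b)" and s: "\<And>z. z \<notin> cball 0 R \<Longrightarrow> \<rho> z = 0"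
  note [measurable] = meas
  have M0: "M \<ge> 0" using b[of 0] by linarith
  have int: "integrable lborel (\<lambda>z. \<rho> z *\<^sub>R line_kernel (x - z))" for x
  proof (rule integrableI_bounded_set[where A="cball 0 R" and B=M])
    show "AE z in lborel. z \<in> cball 0 R \<longrightarrow> norm (\<rho> z *\<^sub>R line_kernel (x - z)) \<le> M"
    proof (intro AE_I2 impI)
      fix z show "norm (\<rho> z *\<^sub>R line_kernel (x - z)) \<le> M"
        using mult_mono[OF b[of z] le1[of "x - z"]] M0 by simp
    qed
  qed (use s fin in \<open>auto intro: le_less_trans\<close>)
  have half: "norm (field line_kernel \<rho> x - field line_kernel \<rho> y) \<le> M * norm (x - y)" if xy: "x $ i0 \<le> y $ i0" for x y :: "real ^ 'n"
  proof -
    have "ennreal (norm (field line_kernel \<rho> x - field line_kernel \<rho> y)) \<le> (\<integral>\<^sup>+z. norm (\<rho> z *\<^sub>R line_kernel (x - z) - \<rho> z *\<^sub>R line_kernel (y - z)) \<partial>lborel)"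
      using integral_norm_bound_ennreal[OF Bochner_Integration.integrable_diff[OF int[of x] int[of y]]]
      by (simp only: field_def Bochner_Integration.integral_diff[OF int[of x] int[of y]])
    also have "\<dots> \<le> (\<integral>\<^sup>+z. ennreal M * indicator (cbox x y) z \<partial>lborel)"
    proof (rule nn_integral_mono)
      fix z
      have "norm (\<rho> z *\<^sub>R line_kernel (x - z) - \<rho> z *\<^sub>R line_kernel (y - z)) = \<bar>\<rho> z\<bar> * norm (line_kernel (x - z) - line_kernel (y - z))"
        by (simp add: scaleR_diff_right[symmetric])
      also have "\<dots> \<le> M * indicator (cbox x y) z"
        using b[of z] M0 xy by (auto simp: nrm line_kernel_def indicator_def mem_box_cart all)
      finally show "ennreal (norm (\<rho> z *\<^sub>R line_kernel (x - z) - \<rho> z *\<^sub>R line_kernel (y - z))) \<le> ennreal M * indicator (cbox x y) z"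
        by (auto simp: indicator_def ennreal_leI split: if_splits)
    qed
    also have "\<dots> = ennreal M * emeasure lborel (cbox x y)" by (simp add: nn_integral_cmult_indicator)
    also have "emeasure lborel (cbox x y) = ennreal (norm (x - y))"
    proof -
      have "x \<in> cbox x y" using xy by (simp add: mem_box_cart all)
      then have "cbox x y \<noteq> {}" by blast
      then have "measure lborel (cbox x y) = y $ i0 - x $ i0" by (simp add: content_cbox_cart i0)
      then show ?thesis using xy emeasure_eq_ennreal_measure[of lborel "cbox x y"] emeasure_bounded_finite[OF bounded_cbox, of x y]
        by (simp add: nrm)
    qed
    finally have "ennreal (norm (field line_kernel \<rho> x - field line_kernel \<rho> y)) \<le> ennreal (M * norm (x - y))"
      using M0 by (simp add: ennreal_mult)
    then show ?thesis using M0 by (simp add: ennreal_le_iff)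
  qed
  have "norm (field line_kernel \<rho> x - field line_kernel \<rho> y) \<le> M * norm (x - y)"
    using half[of x y] half[of y x] by (cases "x $ i0 \<le> y $ i0") (auto simp: norm_minus_commute)
  also have "\<dots> \<le> ?C * ((1 + real N) * M + (1/2) ^ N * \<Lambda>) * norm (x - y)"
  proof (rule mult_right_mono)
    have "M \<le> (1 + real N) * M" using M0 by (simp add: algebra_simps)
    then have "M \<le> (1 + real N) * M + (1/2) ^ N * \<Lambda>" using \<Lambda> by (simp add: add_increasing2)
    moreover have "0 \<le> (1 + real N) * M + (1/2) ^ N * \<Lambda>" using M0 \<Lambda> by simp
    ultimately show "M \<le> ?C * ((1 + real N) * M + (1/2) ^ N * \<Lambda>)"
      using mult_right_mono[of 1 ?C "(1 + real N) * M + (1/2) ^ N * \<Lambda>"] by simp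
  qed simp
  finally show "norm (field line_kernel \<rho> x - field line_kernel \<rho> y) \<le> ?C * ((1 + real N) * M + (1/2) ^ N * \<Lambda>) * norm (x - y)" .
qed (use R in auto)

section \<open>Existence for a Lipschitz magnetic field\<close>

definition dens :: "('x \<times> 'v::euclidean_space \<Rightarrow> real) \<Rightarrow> 'x::euclidean_space \<Rightarrow> real" where
  "dens g x = (LINT v|lborel. g (x, v))"

lemma curve_speed_bound:
  fixes \<gamma> :: "real \<Rightarrow> 'a::euclidean_space"
  assumes d: "\<And>\<sigma>. \<sigma> \<in> {0..t} \<Longrightarrow> (\<gamma> has_vector_derivative \<gamma>' \<sigma>) (at \<sigma> within {0..t})"
    and M: "\<And>\<sigma>. norm (\<gamma>' \<sigma>) \<le> M" and st: "0 \<le> \<sigma>" "\<sigma> \<le> \<tau>" "\<tau> \<le> t"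
  shows "norm (\<gamma> \<tau> - \<gamma> \<sigma>) \<le> M * (\<tau> - \<sigma>)"
proof -
  have "norm (\<gamma> \<tau> - \<gamma> \<sigma>) \<le> M * norm (\<tau> - \<sigma>)"
  proof (rule differentiable_bound[of "{0..t}" \<gamma> "\<lambda>\<sigma> h. h *\<^sub>R \<gamma>' \<sigma>"])
    fix \<sigma> assume "\<sigma> \<in> {0..t}"
    from d[OF this] show "(\<gamma> has_derivative (\<lambda>h. h *\<^sub>R \<gamma>' \<sigma>)) (at \<sigma> within {0..t})"
      by (simp add: has_vector_derivative_def)
    show "onorm (\<lambda>h. h *\<^sub>R \<gamma>' \<sigma>) \<le> M"
    proof (rule onorm_le)
      fix h :: real
      show "norm (h *\<^sub>R \<gamma>' \<sigma>) \<le> M * norm h"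
        using mult_left_mono[OF M[of \<sigma>], of "\<bar>h\<bar>"] by (simp add: mult.commute)
    qed
  qed (use st in auto)
  then show ?thesis using st by simp
qed

text \<open>
  \<open>J\<close> and \<open>I\<close> are the paddings by zeros of velocities and fields, and \<open>W\<close> is the product \<open>\<otimes>\<close>.
\<close>

locale vlasov = field_kernel K Rx CK
  for K :: "'x::euclidean_space \<Rightarrow> 'x" and Rx CK +
  fixes J :: "'v::euclidean_space \<Rightarrow> 'x" and I :: "'x \<Rightarrow> 'v" and W :: "'v \<Rightarrow> 'b::euclidean_space \<Rightarrow> 'v"
    and Rv :: real and mux muv :: "species \<Rightarrow> real"
  assumes J: "linear J" "\<And>v. norm (J v) \<le> norm v"
    and I: "linear I" "\<And>x. norm (I x) \<le> norm x"
    and W: "bounded_bilinear W" "\<And>v b. v \<bullet> W v b = 0"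
    and Rv: "Rv > 0"
begin

section \<open>Densities of functions supported in the closed domain\<close>

definition vol :: real where "vol = measure lborel (cball (0::'v) Rv)"

lemma vol_nonneg: "vol \<ge> 0" by (simp add: vol_def)

definition phase_supported :: "('x \<times> 'v \<Rightarrow> real) \<Rightarrow> bool" where
  "phase_supported g \<longleftrightarrow> (\<forall>x v. g (x, v) \<noteq> 0 \<longrightarrow> norm x \<le> Rx \<and> norm v \<le> Rv)"

lemma phase_supported_diff: "phase_supported g \<Longrightarrow> phase_supported h \<Longrightarrow> phase_supported (\<lambda>z. g z - h z)"
  unfolding phase_supported_def by (metis diff_zero)

lemma
  assumes gc: "continuous_on UNIV g" and gs: "phase_supported g"
  shows dens_measurable: "dens g \<in> borel_measurable borel"
    and dens_outside: "\<And>x. x \<notin> cball 0 Rx \<Longrightarrow> dens g x = 0"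
    and integrable_dens: "\<And>x. integrable lborel (\<lambda>v. g (x, v))"
proof -
  have "g \<in> borel_measurable borel" by (rule borel_measurable_continuous_onI[OF gc])
  moreover have "sets (borel \<Otimes>\<^sub>M lborel) = sets (borel :: ('x \<times> 'v) measure)"
    by (metis borel_prod sets_lborel sets_pair_measure_cong)
  ultimately have "(\<lambda>(x, v). g (x, v)) \<in> borel_measurable (borel \<Otimes>\<^sub>M lborel)"
    by (simp cong: measurable_cong_sets)
  from lborel.borel_measurable_lebesgue_integral[OF this]
  show "dens g \<in> borel_measurable borel" by (simp add: dens_def[abs_def])
  show "dens g x = 0" if "x \<notin> cball 0 Rx" for x
  proof -
    have "g (x, v) = 0" for v using gs that by (auto simp: phase_supported_def)
    then show ?thesis by (simp add: dens_def)
  qed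
  show "integrable lborel (\<lambda>v. g (x, v))" for x
  proof (rule integrable_continuous_compact_support[where S="cball 0 Rv"])
    show "continuous_on UNIV (\<lambda>v. g (x, v))"
      by (rule continuous_on_compose2[OF gc]) (auto intro!: continuous_intros)
  qed (use gs in \<open>auto simp: phase_supported_def\<close>)
qed

lemma dens_bound:
  assumes gc: "continuous_on UNIV g" and gs: "phase_supported g" and b: "\<And>v. \<bar>g (x, v)\<bar> \<le> M"
  shows "\<bar>dens g x\<bar> \<le> M * vol"
proof -
  have "norm (LINT v|lborel. g (x, v)) \<le> (LINT v|lborel. indicator (cball (0::'v) Rv) v *\<^sub>R M)"
  proof (rule Bochner_Integration.integral_norm_bound_integral[OF integrable_dens[OF gc gs]])
    show "integrable lborel (\<lambda>v. indicator (cball (0::'v) Rv) v *\<^sub>R M)"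
      by (intro borel_integrable_compact) auto
    show "norm (g (x, v)) \<le> indicator (cball 0 Rv) v *\<^sub>R M" for v
      using b[of v] gs by (auto simp: phase_supported_def indicator_def)
  qed
  then show ?thesis by (simp add: dens_def vol_def mult.commute)
qed

lemma dens_diff:
  assumes "continuous_on UNIV g" "phase_supported g" "continuous_on UNIV h" "phase_supported h"
  shows "dens g x - dens h x = dens (\<lambda>z. g z - h z) x"
  unfolding dens_def using integrable_dens[OF assms(1,2), of x] integrable_dens[OF assms(3,4), of x] by simp

lemma dens_lipschitz:
  assumes gc: "continuous_on UNIV g" and gs: "phase_supported g"
    and lip: "\<And>z z'. \<bar>g z - g z'\<bar> \<le> \<Lambda> * norm (z - z')"
  shows "\<bar>dens g x - dens g y\<bar> \<le> (\<Lambda> * vol) * norm (x - y)"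
proof -
  have "norm (LINT v|lborel. g (x, v) - g (y, v)) \<le> (LINT v|lborel. indicator (cball (0::'v) Rv) v *\<^sub>R (\<Lambda> * norm (x - y)))"
  proof (rule Bochner_Integration.integral_norm_bound_integral)
    show "integrable lborel (\<lambda>v. g (x, v) - g (y, v))"
      using integrable_dens[OF gc gs] by simp
    show "integrable lborel (\<lambda>v. indicator (cball (0::'v) Rv) v *\<^sub>R (\<Lambda> * norm (x - y)))"
      by (intro borel_integrable_compact) auto
    show "norm (g (x, v) - g (y, v)) \<le> indicator (cball 0 Rv) v *\<^sub>R (\<Lambda> * norm (x - y))" for v
    proof (cases "v \<in> cball 0 Rv")
      case True
      then show ?thesis using lip[of "(x, v)" "(y, v)"] by (simp add: norm_Pair)
    next
      case False
      then have "g (x, v) = 0" "g (y, v) = 0" using gs by (auto simp: phase_supported_def)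
      then show ?thesis using False by simp
    qed
  qed
  then show ?thesis
    using integrable_dens[OF gc gs] by (simp add: dens_def vol_def mult_ac)
qed

text \<open>
  Velocities are truncated outside the domain, which makes \<open>v \<otimes> B\<close> globally Lipschitz.
\<close>

definition tr :: "'v \<Rightarrow> 'v" where "tr v = (Rv / max Rv (norm v)) *\<^sub>R v"

lemma norm_tr: "norm (tr v) \<le> Rv"
proof -
  have "norm v \<le> max Rv (norm v)" "max Rv (norm v) > 0" using Rv by auto
  then show ?thesis using Rv by (simp add: tr_def field_simps)
qed

lemma tr_id: "norm v \<le> Rv \<Longrightarrow> tr v = v" using Rv by (simp add: tr_def max_def)

lemma W_tr: "v \<bullet> W (tr v) b = 0"
  using W(2)[of v b] by (simp add: tr_def bounded_bilinear.scaleR_left[OF W(1)])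

lemma tr_lipschitz: "norm (tr v - tr w) \<le> 2 * norm (v - w)"
proof -
  define a where "a = max Rv (norm v)"
  define b where "b = max Rv (norm w)"
  have ab: "a > 0" "b > 0" "Rv \<le> a" "norm w \<le> b" "\<bar>b - a\<bar> \<le> norm (v - w)"
    using Rv norm_triangle_ineq3[of v w] by (auto simp: a_def b_def max_def)
  have "tr v - tr w = (Rv / a) *\<^sub>R (v - w) + (Rv / a - Rv / b) *\<^sub>R w"
    by (simp add: tr_def a_def b_def algebra_simps)
  also have "norm \<dots> \<le> (Rv / a) * norm (v - w) + \<bar>Rv / a - Rv / b\<bar> * norm w"
    using ab Rv by (intro order_trans[OF norm_triangle_ineq]) simp
  also have "(Rv / a) * norm (v - w) \<le> 1 * norm (v - w)" using ab by (intro mult_right_mono) auto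
  also have "\<bar>Rv / a - Rv / b\<bar> * norm w = (Rv / a) * (norm w / b) * \<bar>b - a\<bar>"
  proof -
    have "Rv / a - Rv / b = (Rv / (a * b)) * (b - a)" using ab by (simp add: field_simps)
    then have "\<bar>Rv / a - Rv / b\<bar> = (Rv / (a * b)) * \<bar>b - a\<bar>" using ab Rv by (simp add: abs_mult)
    then show ?thesis by simp
  qed
  also have "\<dots> \<le> 1 * 1 * norm (v - w)" using ab Rv by (intro mult_mono) auto
  finally show ?thesis by simp
qed

definition CW :: real where "CW = (SOME C. \<forall>v b. norm (W v b) \<le> norm v * norm b * C \<and> C \<ge> 0)"

lemma CW: "norm (W v b) \<le> norm v * norm b * CW" "CW \<ge> 0"
proof -
  have "\<exists>C. \<forall>v b. norm (W v b) \<le> norm v * norm b * C \<and> C \<ge> 0"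
    using bounded_bilinear.nonneg_bounded[OF W(1)] by blast
  from someI_ex[OF this] show "norm (W v b) \<le> norm v * norm b * CW" "CW \<ge> 0" by (auto simp: CW_def)
qed

definition \<mu> :: real where "\<mu> = \<bar>mux Plus\<bar> + \<bar>mux Minus\<bar>"
definition \<nu> :: real where "\<nu> = \<bar>muv Plus\<bar> + \<bar>muv Minus\<bar>"

lemma mu_le: "\<bar>mux s\<bar> \<le> \<mu>" "\<bar>muv s\<bar> \<le> \<nu>" "\<mu> \<ge> 0" "\<nu> \<ge> 0"
  by (cases s; auto simp: \<mu>_def \<nu>_def)+

end

text \<open>\<open>r0\<close> and \<open>s0\<close> bound the support of the datum,
  \<open>r1\<close> and \<open>s1\<close> that of the solution up to time \<open>T\<close>. The
  first condition on \<open>T\<close> limits the path of a particle with speed at most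
  \<open>\<mu> * Rv\<close>. The second limits the growth of sqrt (1 + |v|^2), whose rate is
  \<open>\<nu>\<close> times the bound of the electric field. Neither condition contains
  \<open>LB\<close>, \<open>CB\<close> or \<open>L0\<close>, which is why \<open>T\<close> can be
  fixed before the magnetic field.\<close>

locale vlasov_existence = vlasov K Rx CK J I W Rv mux muv
  for K :: "'x::euclidean_space \<Rightarrow> 'x" and Rx CK and J :: "'v::euclidean_space \<Rightarrow> 'x" and I and W :: "'v \<Rightarrow> 'b::euclidean_space \<Rightarrow> 'v"
    and Rv mux muv +
  fixes f0 :: "species \<Rightarrow> 'x \<times> 'v \<Rightarrow> real" and L0 F0 r0 s0 r1 s1 T :: real and B :: "real \<times> 'x \<Rightarrow> 'b" and LB CB :: real
  assumes f0_lip: "\<And>s. L0-lipschitz_on UNIV (f0 s)" and f0_bd: "\<And>s z. \<bar>f0 s z\<bar> \<le> F0"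
    and f0_supp: "\<And>s x v. f0 s (x, v) \<noteq> 0 \<Longrightarrow> norm x \<le> r0 \<and> norm v \<le> s0"
    and r1: "r1 < Rx" and s1: "0 \<le> s1" "s1 < Rv" and s0: "0 \<le> s0"
    and T: "T > 0" "r0 + T * \<mu> * Rv \<le> r1" "sqrt (1 + s0\<^sup>2) + T * (\<nu> * (CK * (2 * F0 * vol))) \<le> sqrt (1 + s1\<^sup>2)"
    and B_lip: "LB-lipschitz_on UNIV B" and B_bd: "\<And>p. norm (B p) \<le> CB"
begin

text \<open>Fields and solutions are made total in time by freezing them outside [0, T]. Freezing
  does not increase Lipschitz constants in time.\<close>

definition ct :: "real \<Rightarrow> real" where "ct t = max 0 (min T t)"

lemma ct: "ct t \<in> {0..T}" "t \<in> {0..T} \<Longrightarrow> ct t = t" "\<bar>ct t - ct t'\<bar> \<le> \<bar>t - t'\<bar>" "continuous_on A ct"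
  using T(1) unfolding ct_def by (auto intro!: continuous_intros)

definition ME :: real where "ME = CK * (2 * F0 * vol)"

lemma consts_nonneg: "L0 \<ge> 0" "F0 \<ge> 0" "LB \<ge> 0" "CB \<ge> 0" "ME \<ge> 0"
proof -
  show "L0 \<ge> 0" "LB \<ge> 0" using f0_lip B_lip lipschitz_on_nonneg by blast+
  show "F0 \<ge> 0" using f0_bd[of Plus undefined] by linarith
  then show "ME \<ge> 0" using CK_nonneg vol_nonneg by (simp add: ME_def)
  show "CB \<ge> 0" using B_bd[of undefined] norm_ge_zero order_trans by blast
qed

text \<open>
  Along an admissible field the solution has Lipschitz constant \<open>L0 exp (AA t - AA 0)\<close> at time \<open>t\<close>,
  where \<open>AA\<close> is the integral of the Lipschitz constant \<open>c0 + \<nu> ell t\<close> of the characteristic field.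
  The new electric field then has a Lipschitz constant of the order of \<open>CE (1 + AA t - AA 0)\<close>, and \<open>H\<close> is chosen such that
  this is at most \<open>ell t = H exp (H t)\<close>.
\<close>

definition c0 :: real where "c0 = 1 + 2 * \<mu> + \<nu> * \<mu> * (2 * CW * CB + CW * Rv * LB)"

definition CE :: real where "CE = CK * (4 * F0 * vol + 2 * L0 * vol)"

text \<open>The factor 1 + \<open>c0\<close> + \<open>\<nu>\<close> comes from 1 + AA t - AA 0 \<le>
  (1 + c0 + \<nu>) exp (H t) for t \<ge> 0. The last summand gives H \<ge> 1, hence t \<le> exp (H
  t), which this inequality uses.\<close>

definition H :: real where "H = CE * (1 + c0 + \<nu>) + 1"

lemma c0_pos: "c0 \<ge> 1" "CE \<ge> 0" "H \<ge> 1"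
proof -
  show c0: "c0 \<ge> 1" using mu_le CW(2) consts_nonneg Rv by (simp add: c0_def add_nonneg_nonneg)
  show CE: "CE \<ge> 0" using CK_nonneg consts_nonneg vol_nonneg by (simp add: CE_def)
  have "1 + c0 + \<nu> \<ge> 0" using c0 mu_le by linarith
  then show "H \<ge> 1" using CE by (simp add: H_def)
qed

definition ell :: "real \<Rightarrow> real" where "ell t = H * exp (H * ct t)"

definition AA :: "real \<Rightarrow> real" where "AA t = c0 * t + \<nu> * exp (H * t)"

definition LL :: real where "LL = c0 + \<nu> * (H * exp (H * T))"

definition Mb :: real where "Mb = \<mu> * Rv + \<nu> * (ME + \<mu> * (Rv * CB * CW))"

definition fields :: "(real \<times> 'x \<Rightarrow> 'x) set" where
  "fields = {E. continuous_on UNIV E \<and> (\<forall>p. norm (E p) \<le> ME) \<and> (\<forall>t x y. norm (E (t, x) - E (t, y)) \<le> ell t * norm (x - y))}"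

definition vf :: "(real \<times> 'x \<Rightarrow> 'x) \<Rightarrow> species \<Rightarrow> real \<Rightarrow> 'x \<times> 'v \<Rightarrow> 'x \<times> 'v" where
  "vf E s t z = (mux s *\<^sub>R J (tr (snd z)),
     muv s *\<^sub>R (I (E (t, fst z)) + mux s *\<^sub>R W (tr (snd z)) (B (ct t, fst z))))"

lemma fields_bd: "E \<in> fields \<Longrightarrow> norm (E p) \<le> ME"
  unfolding fields_def by blast

lemma ell_le: "ell t \<le> H * exp (H * T)" "ell t \<ge> 0"
  using ct(1)[of t] c0_pos by (auto simp: ell_def)

section \<open>Bounds for the characteristic field\<close>

lemma vf_lip_E:
  assumes E: "\<And>p. norm (E p - E' p) \<le> e" 
  shows "norm (vf E s t z - vf E' s t z) \<le> \<nu> * norm (E (t, fst z) - E' (t, fst z))"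
proof -
  have "vf E s t z - vf E' s t z = (0, muv s *\<^sub>R (I (E (t, fst z) - E' (t, fst z))))"
    by (simp add: vf_def linear_diff[OF I(1)] scaleR_diff_right[symmetric])
  then have "norm (vf E s t z - vf E' s t z) = \<bar>muv s\<bar> * norm (I (E (t, fst z) - E' (t, fst z)))" by (simp add: norm_Pair)
  also have "\<dots> \<le> \<nu> * norm (E (t, fst z) - E' (t, fst z))" using mu_le I by (intro mult_mono) auto
  finally show ?thesis .
qed

text \<open>The share of the electric field is kept apart as a function of time. Replacing it here
  by its maximum would give characteristics estimates too coarse to reproduce \<open>ell\<close>
  under the field map.\<close>

lemma vf_lip:
  assumes E: "E \<in> fields"
  shows "norm (vf E s t z - vf E s t z') \<le> (c0 + \<nu> * ell t) * norm (z - z')"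
proof -
  obtain x v where z: "z = (x, v)" by fastforce
  obtain x' v' where z': "z' = (x', v')" by fastforce
  define n where "n = norm (z - z')"
  have nx: "norm (x - x') \<le> n" and nv: "norm (v - v') \<le> n" and n0: "n \<ge> 0"
    using norm_fst_le[of "x - x'" "v - v'"] norm_snd_le[of "v - v'" "x - x'"] by (auto simp: z z' n_def)
  have trn: "norm (tr v - tr v') \<le> 2 * n" using tr_lipschitz[of v v'] nv by linarith
  have a1: "norm (mux s *\<^sub>R J (tr v) - mux s *\<^sub>R J (tr v')) \<le> \<mu> * (2 * n)"
  proof -
    have "norm (mux s *\<^sub>R J (tr v) - mux s *\<^sub>R J (tr v')) = \<bar>mux s\<bar> * norm (J (tr v - tr v'))"
      by (simp add: linear_diff[OF J(1)] scaleR_diff_right[symmetric])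
    also have "\<dots> \<le> \<mu> * (2 * n)" using mu_le order_trans[OF J(2) trn] by (intro mult_mono) auto
    finally show ?thesis .
  qed
  have a2: "norm (I (E (t, x)) - I (E (t, x'))) \<le> ell t * n"
  proof -
    have "norm (I (E (t, x)) - I (E (t, x'))) \<le> norm (E (t, x) - E (t, x'))"
      using I(2)[of "E (t, x) - E (t, x')"] by (simp add: linear_diff[OF I(1)])
    also have "\<dots> \<le> ell t * norm (x - x')" using E by (auto simp: fields_def)
    also have "\<dots> \<le> ell t * n" using ell_le nx by (intro mult_left_mono) auto
    finally show ?thesis .
  qed
  have a3: "norm (W (tr v) (B (ct t, x)) - W (tr v') (B (ct t, x'))) \<le> (2 * CW * CB + CW * Rv * LB) * n"
  proof -
    have "W (tr v) (B (ct t, x)) - W (tr v') (B (ct t, x')) = W (tr v - tr v') (B (ct t, x)) + W (tr v') (B (ct t, x) - B (ct t, x'))"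
      by (simp add: bounded_bilinear.diff_left[OF W(1)] bounded_bilinear.diff_right[OF W(1)])
    also have "norm \<dots> \<le> norm (tr v - tr v') * norm (B (ct t, x)) * CW + norm (tr v') * norm (B (ct t, x) - B (ct t, x')) * CW"
      by (rule order_trans[OF norm_triangle_ineq add_mono[OF CW(1) CW(1)]])
    also have "\<dots> \<le> (2 * n) * CB * CW + Rv * (LB * n) * CW"
    proof (intro add_mono mult_right_mono[OF _ CW(2)] mult_mono)
      have "norm (B (ct t, x) - B (ct t, x')) \<le> LB * norm (x - x')"
        using lipschitz_onD[OF B_lip, of "(ct t, x)" "(ct t, x')"] by (simp add: dist_norm norm_Pair)
      also have "\<dots> \<le> LB * n" using nx consts_nonneg by (intro mult_left_mono)
      finally show "norm (B (ct t, x) - B (ct t, x')) \<le> LB * n" .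
    qed (use trn B_bd norm_tr n0 Rv in auto)
    finally show ?thesis by (simp add: algebra_simps)
  qed
  have a4: "norm (muv s *\<^sub>R (I (E (t, x)) + mux s *\<^sub>R W (tr v) (B (ct t, x))) - muv s *\<^sub>R (I (E (t, x')) + mux s *\<^sub>R W (tr v') (B (ct t, x'))))
     \<le> \<nu> * (ell t * n + \<mu> * ((2 * CW * CB + CW * Rv * LB) * n))"
  proof -
    have "muv s *\<^sub>R (I (E (t, x)) + mux s *\<^sub>R W (tr v) (B (ct t, x))) - muv s *\<^sub>R (I (E (t, x')) + mux s *\<^sub>R W (tr v') (B (ct t, x')))
      = muv s *\<^sub>R ((I (E (t, x)) - I (E (t, x'))) + mux s *\<^sub>R (W (tr v) (B (ct t, x)) - W (tr v') (B (ct t, x'))))"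
      by (simp add: algebra_simps)
    also have "norm \<dots> = \<bar>muv s\<bar> * norm ((I (E (t, x)) - I (E (t, x'))) + mux s *\<^sub>R (W (tr v) (B (ct t, x)) - W (tr v') (B (ct t, x'))))"
      by simp
    also have "\<dots> \<le> \<nu> * (ell t * n + \<mu> * ((2 * CW * CB + CW * Rv * LB) * n))"
    proof (intro mult_mono mu_le order_trans[OF norm_triangle_ineq] add_mono a2)
      show "norm (mux s *\<^sub>R (W (tr v) (B (ct t, x)) - W (tr v') (B (ct t, x')))) \<le> \<mu> * ((2 * CW * CB + CW * Rv * LB) * n)"
        using a3 mu_le unfolding norm_scaleR by (intro mult_mono) auto
    qed auto
    finally show ?thesis .
  qed
  have "norm (vf E s t z - vf E s t z') \<le> norm (mux s *\<^sub>R J (tr v) - mux s *\<^sub>R J (tr v'))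
     + norm (muv s *\<^sub>R (I (E (t, x)) + mux s *\<^sub>R W (tr v) (B (ct t, x))) - muv s *\<^sub>R (I (E (t, x')) + mux s *\<^sub>R W (tr v') (B (ct t, x'))))"
    unfolding z z' vf_def by (simp add: norm_Pair_le)
  also have "\<dots> \<le> \<mu> * (2 * n) + \<nu> * (ell t * n + \<mu> * ((2 * CW * CB + CW * Rv * LB) * n))"
    by (rule add_mono[OF a1 a4])
  also have "\<dots> = (c0 - 1 + \<nu> * ell t) * n" by (simp add: c0_def algebra_simps)
  also have "\<dots> \<le> (c0 + \<nu> * ell t) * n" using n0 by (intro mult_right_mono) auto
  finally show ?thesis by (simp add: n_def)
qed

lemma LL: "LL > 0" "c0 + \<nu> * ell t \<le> LL"
proof -
  show "LL > 0" using c0_pos mu_le by (simp add: LL_def add_pos_nonneg)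
  show "c0 + \<nu> * ell t \<le> LL" using ell_le mu_le by (simp add: LL_def mult_left_mono)
qed

lemma vf_LL: "E \<in> fields \<Longrightarrow> norm (vf E s t z - vf E s t z') \<le> LL * norm (z - z')"
  using order_trans[OF vf_lip mult_right_mono[OF LL(2)]] by auto

lemma vf_fst_bd: "norm (fst (vf E s t z)) \<le> \<mu> * Rv"
  using mult_mono[OF mu_le(1)[of s] order_trans[OF J(2) norm_tr[of "snd z"]]] mu_le by (simp add: vf_def)

lemma vf_bd:
  assumes E: "E \<in> fields" shows "norm (vf E s t z) \<le> Mb"
proof -
  have "norm (snd (vf E s t z)) \<le> \<nu> * (ME + \<mu> * (Rv * CB * CW))"
  proof -
    have "norm (W (tr (snd z)) (B (ct t, fst z))) \<le> Rv * CB * CW"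
      by (rule order_trans[OF CW(1)]) (use norm_tr B_bd Rv CW consts_nonneg in \<open>auto intro!: mult_mono\<close>)
    then have "norm (mux s *\<^sub>R W (tr (snd z)) (B (ct t, fst z))) \<le> \<mu> * (Rv * CB * CW)"
      using mu_le unfolding norm_scaleR by (intro mult_mono) auto
    moreover have "norm (I (E (t, fst z))) \<le> ME" using I(2) E order_trans by (fastforce simp: fields_def)
    ultimately have "norm (I (E (t, fst z)) + mux s *\<^sub>R W (tr (snd z)) (B (ct t, fst z))) \<le> ME + \<mu> * (Rv * CB * CW)"
      by (intro order_trans[OF norm_triangle_ineq] add_mono)
    then show ?thesis using mu_le unfolding vf_def by (simp, intro mult_mono) auto
  qed
  then have "norm (fst (vf E s t z)) + norm (snd (vf E s t z)) \<le> Mb" unfolding Mb_def using vf_fst_bd by (intro add_mono)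
  moreover have "norm (vf E s t z) \<le> norm (fst (vf E s t z)) + norm (snd (vf E s t z))"
    by (metis norm_Pair_le prod.collapse)
  ultimately show ?thesis by linarith
qed

lemma vf_continuous:
  assumes E: "E \<in> fields" shows "continuous_on UNIV (\<lambda>p. vf E s (fst p) (snd p))"
proof -
  have trc: "continuous_on UNIV tr"
    by (rule lipschitz_on_continuous_on[where L=2]) (auto intro!: lipschitz_onI simp: dist_norm tr_lipschitz)
  have Jc: "continuous_on UNIV J" and Ic: "continuous_on UNIV I"
    using J(1) I(1) linear_continuous_on linear_conv_bounded_linear by auto
  have Ec: "continuous_on UNIV E" using E by (simp add: fields_def)
  have Bc: "continuous_on UNIV B" by (rule lipschitz_on_continuous_on[OF B_lip])
  show ?thesis unfolding vf_def
    by (intro continuous_intros bounded_bilinear.continuous_on[OF W(1)]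
        continuous_on_compose2[OF Jc] continuous_on_compose2[OF Ic] continuous_on_compose2[OF trc]
        continuous_on_compose2[OF Ec] continuous_on_compose2[OF Bc] continuous_on_compose2[OF ct(4)[of UNIV]]) auto
qed

section \<open>Characteristics and their initial points\<close>

definition ichar :: "(real \<times> 'x \<Rightarrow> 'x) \<Rightarrow> species \<Rightarrow> real \<Rightarrow> 'x \<times> 'v \<Rightarrow> (real \<Rightarrow> 'x \<times> 'v) \<Rightarrow> bool" where
  "ichar E s t z \<gamma> \<longleftrightarrow> \<gamma> t = z \<and> (\<forall>\<sigma>\<in>{0..t}. (\<gamma> has_vector_derivative vf E s \<sigma> (\<gamma> \<sigma>)) (at \<sigma> within {0..t}))"

lemma ichar_exists: "E \<in> fields \<Longrightarrow> \<exists>\<gamma>. ichar E s t z \<gamma>"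
  unfolding ichar_def by (rule backward_ode_exists[OF vf_continuous LL(1) vf_LL vf_bd])

lemma ichar_derivative: "ichar E s t z \<gamma> \<Longrightarrow> \<sigma> \<in> {0..t} \<Longrightarrow> (\<gamma> has_vector_derivative vf E s \<sigma> (\<gamma> \<sigma>)) (at \<sigma> within {0..t})"
  by (simp add: ichar_def)

lemma ichar_restrict:
  assumes "ichar E s t z \<gamma>" "0 \<le> \<sigma>" "\<sigma> \<le> t" shows "ichar E s \<sigma> (\<gamma> \<sigma>) \<gamma>"
  using assms unfolding ichar_def
  by (auto intro: has_vector_derivative_within_subset[of _ _ _ "{0..t}"])

text \<open>The exponent is the exact integral of the Lipschitz constant and not
  \<open>LL * t\<close>: the field map turns this exponent, up to constants, into the new Lipschitz
  constant, and the bound reproduces itself only in this form.\<close>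

lemma ichar_diff:
  assumes E: "E \<in> fields" and t: "t \<in> {0..T}" and g: "ichar E s t z \<gamma>" and g': "ichar E s t z' \<gamma>'"
  shows "norm (\<gamma> 0 - \<gamma>' 0) \<le> norm (z - z') * exp (AA t - AA 0)"
proof -
  have "norm (\<gamma> 0 - \<gamma>' 0) \<le> norm (\<gamma> t - \<gamma>' t) * exp (AA t - AA 0)"
  proof (rule gronwall_backward[where d="\<lambda>\<sigma>. \<gamma> \<sigma> - \<gamma>' \<sigma>" and d'="\<lambda>\<sigma>. vf E s \<sigma> (\<gamma> \<sigma>) - vf E s \<sigma> (\<gamma>' \<sigma>)" and a="\<lambda>\<sigma>. c0 + \<nu> * (H * exp (H * \<sigma>))"])
    show "0 \<le> t" using t by simp
    show "((\<lambda>\<sigma>. \<gamma> \<sigma> - \<gamma>' \<sigma>) has_vector_derivative vf E s \<sigma> (\<gamma> \<sigma>) - vf E s \<sigma> (\<gamma>' \<sigma>)) (at \<sigma> within {0..t})" if "\<sigma> \<in> {0..t}" for \<sigma>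
      by (intro has_vector_derivative_diff ichar_derivative[OF g that] ichar_derivative[OF g' that])
    show "norm (vf E s \<sigma> (\<gamma> \<sigma>) - vf E s \<sigma> (\<gamma>' \<sigma>)) \<le> (c0 + \<nu> * (H * exp (H * \<sigma>))) * norm (\<gamma> \<sigma> - \<gamma>' \<sigma>)" if "\<sigma> \<in> {0..t}" for \<sigma>
    proof -
      have "ct \<sigma> = \<sigma>" using ct(2)[of \<sigma>] that t by auto
      then show ?thesis using vf_lip[OF E, of s \<sigma>] by (simp add: ell_def)
    qed
    show "(AA has_real_derivative c0 + \<nu> * (H * exp (H * \<sigma>))) (at \<sigma>)" for \<sigma>
      unfolding AA_def by (auto intro!: derivative_eq_intros)
  qed
  then show ?thesis using g g' by (simp add: ichar_def)
qed

lemma ichar_unique_foot: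
  assumes "E \<in> fields" "t \<in> {0..T}" "ichar E s t z \<gamma>" "ichar E s t z \<gamma>'"
  shows "\<gamma> 0 = \<gamma>' 0"
  using ichar_diff[OF assms] by simp

definition foot :: "(real \<times> 'x \<Rightarrow> 'x) \<Rightarrow> species \<Rightarrow> real \<Rightarrow> 'x \<times> 'v \<Rightarrow> 'x \<times> 'v" where
  "foot E s t z = (SOME \<gamma>. ichar E s t z \<gamma>) 0"

lemma foot_eq:
  assumes "E \<in> fields" "t \<in> {0..T}" "ichar E s t z \<gamma>" shows "foot E s t z = \<gamma> 0"
  unfolding foot_def
  by (rule ichar_unique_foot[OF assms(1,2) someI[of "ichar E s t z", OF assms(3)] assms(3)])

lemma AA_mono: "t \<in> {0..T} \<Longrightarrow> AA 0 \<le> AA t \<and> AA t \<le> AA T"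
proof -
  assume t: "t \<in> {0..T}"
  have H0: "H > 0" using c0_pos by linarith
  have "exp (H * 0) \<le> exp (H * t)" "exp (H * t) \<le> exp (H * T)" using t H0 by auto
  moreover have "c0 * 0 \<le> c0 * t" "c0 * t \<le> c0 * T" using t c0_pos by (auto intro!: mult_left_mono)
  ultimately show ?thesis unfolding AA_def
    by (intro conjI add_mono mult_left_mono[OF _ mu_le(4)])
qed

lemma foot_lipschitz_space:
  assumes E: "E \<in> fields" and t: "t \<in> {0..T}"
  shows "norm (foot E s t z - foot E s t z') \<le> exp (AA t - AA 0) * norm (z - z')"
proof -
  obtain \<gamma> \<gamma>' where g: "ichar E s t z \<gamma>" "ichar E s t z' \<gamma>'" using ichar_exists[OF E] by metis
  then show ?thesis using ichar_diff[OF E t g] foot_eq[OF E t] by (simp add: mult.commute)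
qed

lemma ichar_speed:
  assumes E: "E \<in> fields" and g: "ichar E s t z \<gamma>" and st: "0 \<le> \<sigma>" "\<sigma> \<le> \<tau>" "\<tau> \<le> t"
  shows "norm (\<gamma> \<tau> - \<gamma> \<sigma>) \<le> Mb * (\<tau> - \<sigma>)"
  by (rule curve_speed_bound[OF ichar_derivative[OF g] vf_bd[OF E] st])

lemma Mb_nonneg: "Mb \<ge> 0"
  using mu_le consts_nonneg CW Rv by (simp add: Mb_def)

text \<open>The characteristic through (t, z) is restarted at time t'. Its foot is then compared at
  equal times with that of (t', z), and the two starting points differ by the path travelled between
  t' and t.\<close>

lemma foot_lipschitz_time:
  assumes E: "E \<in> fields" and t: "t \<in> {0..T}" "t' \<in> {0..T}" "t' \<le> t"
  shows "norm (foot E s t z - foot E s t' z) \<le> exp (AA T - AA 0) * Mb * (t - t')"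
proof -
  obtain \<gamma> where g: "ichar E s t z \<gamma>" using ichar_exists[OF E] by metis
  have g': "ichar E s t' (\<gamma> t') \<gamma>" by (rule ichar_restrict[OF g]) (use t in auto)
  have "norm (foot E s t z - foot E s t' z) = norm (foot E s t' (\<gamma> t') - foot E s t' z)"
    using foot_eq[OF E t(1) g] foot_eq[OF E t(2) g'] by simp
  also have "\<dots> \<le> exp (AA t' - AA 0) * norm (\<gamma> t' - z)" by (rule foot_lipschitz_space[OF E t(2)])
  also have "\<dots> \<le> exp (AA T - AA 0) * (Mb * (t - t'))"
  proof (rule mult_mono)
    show "norm (\<gamma> t' - z) \<le> Mb * (t - t')"
      using ichar_speed[OF E g, of t' t] t g by (simp add: ichar_def norm_minus_commute)
  qed (use AA_mono[OF t(2)] in auto)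
  finally show ?thesis by (simp add: mult.assoc)
qed

section \<open>The transported datum\<close>

definition sol :: "(real \<times> 'x \<Rightarrow> 'x) \<Rightarrow> species \<Rightarrow> real \<times> 'x \<times> 'v \<Rightarrow> real" where
  "sol E s p = f0 s (foot E s (ct (fst p)) (snd p))"

lemma f0_lipD: "\<bar>f0 s z - f0 s z'\<bar> \<le> L0 * norm (z - z')"
  using lipschitz_onD[OF f0_lip, of z z' s] by (simp add: dist_real_def dist_norm)

lemma sol_lip_space:
  assumes E: "E \<in> fields"
  shows "\<bar>sol E s (t, z) - sol E s (t, z')\<bar> \<le> L0 * exp (AA (ct t) - AA 0) * norm (z - z')"
proof -
  have "\<bar>sol E s (t, z) - sol E s (t, z')\<bar> \<le> L0 * norm (foot E s (ct t) z - foot E s (ct t) z')"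
    unfolding sol_def using f0_lipD by simp
  also have "\<dots> \<le> L0 * (exp (AA (ct t) - AA 0) * norm (z - z'))"
    by (intro mult_left_mono foot_lipschitz_space[OF E ct(1)] consts_nonneg)
  finally show ?thesis by (simp add: mult.assoc)
qed

lemma sol_lip_time:
  assumes E: "E \<in> fields"
  shows "\<bar>sol E s (t, z) - sol E s (t', z)\<bar> \<le> L0 * exp (AA T - AA 0) * Mb * \<bar>t - t'\<bar>"
proof -
  have ft: "norm (foot E s (ct t) z - foot E s (ct t') z) \<le> exp (AA T - AA 0) * Mb * \<bar>ct t - ct t'\<bar>"
  proof (cases "ct t' \<le> ct t")
    case True
    then show ?thesis using foot_lipschitz_time[OF E ct(1) ct(1) True] by simp
  next
    case False
    then have "ct t \<le> ct t'" by simp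
    from foot_lipschitz_time[OF E ct(1) ct(1) this] show ?thesis using False by (simp add: norm_minus_commute)
  qed
  have "\<bar>sol E s (t, z) - sol E s (t', z)\<bar> \<le> L0 * norm (foot E s (ct t) z - foot E s (ct t') z)"
    unfolding sol_def using f0_lipD by simp
  also have "\<dots> \<le> L0 * (exp (AA T - AA 0) * Mb * \<bar>t - t'\<bar>)"
    using Mb_nonneg ct(3)[of t t'] consts_nonneg
    by (intro mult_left_mono order_trans[OF ft]) (auto intro!: mult_left_mono)
  finally show ?thesis by (simp add: mult.assoc)
qed

lemma sol_bd: "\<bar>sol E s p\<bar> \<le> F0" by (simp add: sol_def f0_bd)

text \<open>
  The function \<open>sqrt (1 + |v|\<^sup>2)\<close> changes along characteristics at most at the rate \<open>\<nu> ME\<close>,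
  because \<open>v \<bullet> W v b = 0\<close>.
\<close>

lemma sol_support:
  assumes E: "E \<in> fields" and nz: "sol E s (t, x, v) \<noteq> 0"
  shows "norm x \<le> r1 \<and> norm v \<le> s1"
proof -
  define \<tau> where "\<tau> = ct t"
  have \<tau>: "\<tau> \<in> {0..T}" using ct(1) by (simp add: \<tau>_def)
  obtain \<gamma> where g: "ichar E s \<tau> (x, v) \<gamma>" using ichar_exists[OF E] by metis
  have "f0 s (\<gamma> 0) \<noteq> 0" using nz foot_eq[OF E \<tau> g] by (simp add: sol_def \<tau>_def)
  then have init: "norm (fst (\<gamma> 0)) \<le> r0" "norm (snd (\<gamma> 0)) \<le> s0" using f0_supp[of s "fst (\<gamma> 0)" "snd (\<gamma> 0)"] by auto
  have fin: "\<gamma> \<tau> = (x, v)" using g by (simp add: ichar_def)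
  have dfst: "((\<lambda>\<sigma>. fst (\<gamma> \<sigma>)) has_vector_derivative fst (vf E s \<sigma> (\<gamma> \<sigma>))) (at \<sigma> within {0..\<tau>})"
    and dsnd: "((\<lambda>\<sigma>. snd (\<gamma> \<sigma>)) has_vector_derivative snd (vf E s \<sigma> (\<gamma> \<sigma>))) (at \<sigma> within {0..\<tau>})"
    if "\<sigma> \<in> {0..\<tau>}" for \<sigma>
    using bounded_linear.has_vector_derivative[OF bounded_linear_fst ichar_derivative[OF g that]]
      bounded_linear.has_vector_derivative[OF bounded_linear_snd ichar_derivative[OF g that]] by auto
  have "norm (fst (\<gamma> \<tau>) - fst (\<gamma> 0)) \<le> \<mu> * Rv * (\<tau> - 0)"
    by (rule curve_speed_bound[OF dfst vf_fst_bd]) (use \<tau> in auto)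
  also have "\<dots> \<le> \<mu> * Rv * T" using \<tau> mu_le Rv by (intro mult_left_mono) auto
  finally have "norm x \<le> r0 + T * \<mu> * Rv"
    using init(1) norm_triangle_sub[of x "fst (\<gamma> 0)"] by (simp add: fin mult_ac)
  then have X: "norm x \<le> r1" using T(2) by linarith
  \<comment> \<open>The root of 1 + |v|^2 replaces |v| because it is differentiable at v = 0 as
    well; the quotient |v| / sqrt (1 + |v|^2) in its derivative is at most 1.\<close>
  let ?q = "\<lambda>\<sigma>. \<nu> * ME * \<sigma> - sqrt (1 + (norm (snd (\<gamma> \<sigma>)))\<^sup>2)"
  have "?q 0 \<le> ?q \<tau>"
  proof (rule nondecreasing_interval)
    show "0 \<le> \<tau>" using \<tau> by simp
    have "continuous_on {0..\<tau>} (\<lambda>\<sigma>. snd (\<gamma> \<sigma>))" by (rule deriv_within_imp_continuous[OF dsnd])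
    then have "continuous_on {0..\<tau>} (\<lambda>\<sigma>. (norm (snd (\<gamma> \<sigma>)))\<^sup>2)"
      by (intro continuous_on_power continuous_on_norm)
    then show "continuous_on {0..\<tau>} ?q"
      by (intro continuous_on_diff continuous_on_real_sqrt continuous_on_add continuous_on_mult continuous_on_const continuous_on_id)
    fix \<sigma> assume \<sigma>: "0 < \<sigma>" "\<sigma> < \<tau>"
    let ?V = "snd (\<gamma> \<sigma>)" let ?V' = "snd (vf E s \<sigma> (\<gamma> \<sigma>))"
    define n where "n = 1 + (norm ?V)\<^sup>2"
    have n: "n > 0" "norm ?V \<le> sqrt n" by (auto simp: n_def add_pos_nonneg real_le_rsqrt)
    have "((\<lambda>\<sigma>. (norm (snd (\<gamma> \<sigma>)))\<^sup>2) has_real_derivative 2 * (?V \<bullet> ?V')) (at \<sigma>)"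
      by (rule norm_sq_has_derivative[OF deriv_within_imp_at[OF dsnd \<sigma>]])
    then have dn: "((\<lambda>\<sigma>. 1 + (norm (snd (\<gamma> \<sigma>)))\<^sup>2) has_real_derivative 2 * (?V \<bullet> ?V')) (at \<sigma>)"
      using DERIV_add[OF DERIV_const[of 1]] by fastforce
    have "((\<lambda>\<sigma>. sqrt (1 + (norm (snd (\<gamma> \<sigma>)))\<^sup>2)) has_real_derivative inverse (sqrt n) / 2 * (2 * (?V \<bullet> ?V'))) (at \<sigma>)"
      using DERIV_chain2[OF DERIV_real_sqrt dn] n(1) unfolding n_def by simp
    moreover have "((\<lambda>\<sigma>. \<nu> * ME * \<sigma>) has_real_derivative \<nu> * ME) (at \<sigma>)"
      by (auto intro!: derivative_eq_intros)
    ultimately have d: "(?q has_real_derivative \<nu> * ME - inverse (sqrt n) / 2 * (2 * (?V \<bullet> ?V'))) (at \<sigma>)"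
      by (rule DERIV_diff[rotated])
    have "?V \<bullet> ?V' = muv s * (?V \<bullet> I (E (\<sigma>, fst (\<gamma> \<sigma>))))"
      using W_tr[of ?V] by (simp add: vf_def inner_add_right)
    also have "\<dots> \<le> \<bar>muv s\<bar> * \<bar>?V \<bullet> I (E (\<sigma>, fst (\<gamma> \<sigma>)))\<bar>" by (metis abs_ge_self abs_mult)
    also have "\<dots> \<le> \<nu> * (norm ?V * ME)"
    proof (intro mult_mono mu_le)
      have "norm (I (E (\<sigma>, fst (\<gamma> \<sigma>)))) \<le> ME" using I(2) E order_trans by (fastforce simp: fields_def)
      then show "\<bar>?V \<bullet> I (E (\<sigma>, fst (\<gamma> \<sigma>)))\<bar> \<le> norm ?V * ME"
        by (intro order_trans[OF Cauchy_Schwarz_ineq2] mult_left_mono) auto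
    qed auto
    also have "\<dots> \<le> \<nu> * (sqrt n * ME)" using n mu_le consts_nonneg by (intro mult_left_mono mult_right_mono) auto
    finally have "inverse (sqrt n) / 2 * (2 * (?V \<bullet> ?V')) \<le> inverse (sqrt n) * (\<nu> * (sqrt n * ME))"
      using n by simp
    also have "\<dots> = \<nu> * ME" using n by simp
    finally show "\<exists>q'. (?q has_real_derivative q') (at \<sigma>) \<and> q' \<ge> 0" using d by (intro exI conjI) auto
  qed
  then have "sqrt (1 + (norm v)\<^sup>2) \<le> sqrt (1 + (norm (snd (\<gamma> 0)))\<^sup>2) + \<nu> * ME * \<tau>" by (simp add: fin)
  also have "\<dots> \<le> sqrt (1 + s0\<^sup>2) + \<nu> * ME * T"
    using init(2) \<tau> mu_le consts_nonneg by (intro add_mono mult_left_mono real_sqrt_le_mono power_mono) auto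
  also have "\<dots> \<le> sqrt (1 + s1\<^sup>2)" using T(3) by (simp add: ME_def mult_ac)
  finally have "(norm v)\<^sup>2 \<le> s1\<^sup>2" by simp
  then show ?thesis using X s1(1) by (simp add: power2_le_iff_abs_le)
qed

section \<open>The field map and its fixed point\<close>

definition gd :: "(real \<times> 'x \<Rightarrow> 'x) \<Rightarrow> real \<Rightarrow> 'x \<times> 'v \<Rightarrow> real" where
  "gd E t z = sol E Plus (t, z) - sol E Minus (t, z)"

lemma gd_lip:
  assumes "E \<in> fields"
  shows "\<bar>gd E t z - gd E t z'\<bar> \<le> 2 * L0 * exp (AA (ct t) - AA 0) * norm (z - z')"
  using sol_lip_space[OF assms, of Plus t z z'] sol_lip_space[OF assms, of Minus t z z'] unfolding gd_def by linarith

lemma gd_continuous: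
  assumes "E \<in> fields" shows "continuous_on UNIV (gd E t)"
proof (rule lipschitz_on_continuous_on[where L="2 * L0 * exp (AA (ct t) - AA 0)"], rule lipschitz_onI)
  show "dist (gd E t z) (gd E t z') \<le> 2 * L0 * exp (AA (ct t) - AA 0) * dist z z'" for z z'
    using gd_lip[OF assms] by (simp add: dist_norm)
qed (use consts_nonneg in simp)

lemma gd_supported: "E \<in> fields \<Longrightarrow> phase_supported (gd E t)"
proof -
  assume E: "E \<in> fields"
  have "norm x \<le> Rx \<and> norm v \<le> Rv" if "gd E t (x, v) \<noteq> 0" for x v
  proof -
    have "sol E Plus (t, x, v) \<noteq> 0 \<or> sol E Minus (t, x, v) \<noteq> 0" using that by (auto simp: gd_def)
    then show ?thesis using sol_support[OF E] r1 s1 by force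
  qed
  then show ?thesis by (simp add: phase_supported_def)
qed

lemma gd_bd: "\<bar>gd E t z\<bar> \<le> 2 * F0"
  using sol_bd[of E Plus "(t, z)"] sol_bd[of E Minus "(t, z)"] unfolding gd_def by linarith

definition Fmap :: "(real \<times> 'x \<Rightarrow> 'x) \<Rightarrow> real \<times> 'x \<Rightarrow> 'x" where
  "Fmap E p = field K (dens (gd E (fst p))) (snd p)"

lemma dens_gd:
  assumes "E \<in> fields"
  shows "dens (gd E t) \<in> borel_measurable borel" "\<bar>dens (gd E t) x\<bar> \<le> 2 * F0 * vol" "x \<notin> cball 0 Rx \<Longrightarrow> dens (gd E t) x = 0"
  using dens_measurable[OF gd_continuous gd_supported] dens_bound[OF gd_continuous gd_supported gd_bd]
    dens_outside[OF gd_continuous gd_supported] assms by auto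

lemma Fmap_bd: "E \<in> fields \<Longrightarrow> norm (Fmap E p) \<le> ME"
  unfolding Fmap_def ME_def by (rule integrable_field(2)) (use dens_gd in auto)

lemma Fmap_difference:
  assumes E: "E \<in> fields" "E' \<in> fields" and e: "\<And>z. \<bar>gd E t z - gd E' t' z\<bar> \<le> e"
  shows "norm (Fmap E (t, x) - Fmap E' (t', x)) \<le> CK * (e * vol)"
proof -
  let ?h = "\<lambda>z. gd E t z - gd E' t' z"
  have hc: "continuous_on UNIV ?h" by (intro continuous_on_diff gd_continuous E)
  have hs: "phase_supported ?h" by (intro phase_supported_diff gd_supported E)
  have "Fmap E (t, x) - Fmap E' (t', x) = field K (\<lambda>z. dens (gd E t) z - dens (gd E' t') z) x"
    unfolding Fmap_def fst_conv snd_conv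
    by (rule field_diff[where M="2 * F0 * vol" and M'="2 * F0 * vol"]) (use dens_gd E in auto)
  also have "(\<lambda>z. dens (gd E t) z - dens (gd E' t') z) = dens ?h"
    by (intro ext dens_diff gd_continuous gd_supported E)
  also have "norm (field K (dens ?h) x) \<le> CK * (e * vol)"
    by (rule integrable_field(2)[OF dens_measurable[OF hc hs] dens_bound[OF hc hs e] dens_outside[OF hc hs]])
  finally show ?thesis .
qed

text \<open>N is A / ln 2 rounded up, and 1 / ln 2 \<le> 2. In the kernel estimate this trades the
  factor exp A, by which the Lipschitz constant of the density grows, for a term linear in
  A.\<close>

lemma log_choice:
  assumes "A \<ge> 0" obtains N :: nat where "(1/2) ^ N * exp A \<le> 1" "real N \<le> 2 * A + 1"
proof -
  define N where "N = nat \<lceil>A / ln 2\<rceil>"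
  have l2: "ln (2::real) > 0" "1/2 \<le> ln (2::real)" using ln_ge_iff[of 2 "1/2"] exp_half_le2 by auto
  have N: "A / ln 2 \<le> real N" "real N \<le> A / ln 2 + 1" using assms l2 by (auto simp: N_def)
  have "A \<le> real N * ln 2" using N(1) l2 by (simp add: field_simps)
  then have "exp A \<le> exp (real N * ln 2)" by simp
  also have "\<dots> = 2 ^ N" by (simp add: exp_of_nat_mult)
  finally have "(1/2) ^ N * exp A \<le> 1" by (simp add: power_one_over field_simps)
  moreover have "A / ln 2 \<le> 2 * A"
  proof -
    have "A * (1/2) \<le> A * ln 2" using l2 assms by (intro mult_left_mono)
    then show ?thesis using l2 by (simp add: field_simps)
  qed
  ultimately show ?thesis using that N(2) by fastforce
qed

text \<open>With N from \<open>log_choice\<close> the contribution of the inner region is at most a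
  multiple of \<open>L0\<close>, and the shells contribute 1 + N \<le> 2 + 2 A. So the result is
  linear in the exponent A of the characteristics, and the constant H was chosen to dominate
  it.\<close>

lemma Fmap_lip:
  assumes E: "E \<in> fields"
  shows "norm (Fmap E (t, x) - Fmap E (t, y)) \<le> ell t * norm (x - y)"
proof -
  define \<tau> where "\<tau> = ct t"
  have \<tau>: "\<tau> \<ge> 0" "\<tau> \<in> {0..T}" using ct(1)[of t] by (auto simp: \<tau>_def)
  define A where "A = AA \<tau> - AA 0"
  have A0: "A \<ge> 0" using AA_mono[OF \<tau>(2)] by (simp add: A_def)
  obtain N where N: "(1/2) ^ N * exp A \<le> 1" "real N \<le> 2 * A + 1" by (rule log_choice[OF A0])
  let ?M = "2 * F0 * vol" let ?\<Lambda> = "2 * L0 * exp A * vol"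
  have M0: "?M \<ge> 0" using consts_nonneg vol_nonneg by simp
  have "norm (Fmap E (t, x) - Fmap E (t, y)) \<le> CK * ((1 + real N) * ?M + (1/2) ^ N * ?\<Lambda>) * norm (x - y)"
    unfolding Fmap_def fst_conv snd_conv
  proof (rule K_lip)
    show "\<bar>dens (gd E t) a - dens (gd E t) b\<bar> \<le> ?\<Lambda> * norm (a - b)" for a b
      using dens_lipschitz[OF gd_continuous[OF E] gd_supported[OF E] gd_lip[OF E]] by (simp add: A_def \<tau>_def)
  qed (use dens_gd[OF E] consts_nonneg vol_nonneg in auto)
  also have "CK * ((1 + real N) * ?M + (1/2) ^ N * ?\<Lambda>) \<le> CK * ((2 + 2 * A) * ?M + 2 * L0 * vol)"
  proof (rule mult_left_mono[OF add_mono CK_nonneg])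
    show "(1 + real N) * ?M \<le> (2 + 2 * A) * ?M" using N M0 by (intro mult_right_mono) auto
    have "(1/2) ^ N * ?\<Lambda> = ((1/2) ^ N * exp A) * (2 * L0 * vol)" by simp
    also have "\<dots> \<le> 1 * (2 * L0 * vol)" using N(1) consts_nonneg vol_nonneg by (intro mult_right_mono) auto
    finally show "(1/2) ^ N * ?\<Lambda> \<le> 2 * L0 * vol" by simp
  qed
  also have "\<dots> \<le> CE * (1 + A)"
  proof -
    have "CK * ((2 + 2 * A) * ?M + 2 * L0 * vol) = CK * (4 * F0 * vol) * (1 + A) + CK * (2 * L0 * vol) * 1" by (simp add: algebra_simps)
    also have "\<dots> \<le> CK * (4 * F0 * vol) * (1 + A) + CK * (2 * L0 * vol) * (1 + A)"
      using A0 CK_nonneg consts_nonneg vol_nonneg by (intro add_left_mono mult_left_mono) auto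
    also have "\<dots> = CE * (1 + A)" by (simp add: CE_def algebra_simps)
    finally show ?thesis .
  qed
  also have "\<dots> \<le> CE * ((1 + c0 + \<nu>) * exp (H * \<tau>))"
  proof (rule mult_left_mono[OF _ c0_pos(2)])
    have "\<tau> \<le> H * \<tau>" using mult_right_mono[OF c0_pos(3) \<tau>(1)] by simp
    then have e: "\<tau> \<le> exp (H * \<tau>)" "1 \<le> exp (H * \<tau>)" using exp_ge_add_one_self[of "H * \<tau>"] \<tau>(1) by linarith+
    have "1 + A = 1 + c0 * \<tau> + \<nu> * (exp (H * \<tau>) - 1)" by (simp add: A_def AA_def algebra_simps)
    also have "\<dots> \<le> exp (H * \<tau>) + c0 * exp (H * \<tau>) + \<nu> * exp (H * \<tau>)"
      using e c0_pos mu_le by (intro add_mono mult_left_mono) auto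
    also have "\<dots> = (1 + c0 + \<nu>) * exp (H * \<tau>)" by (simp add: algebra_simps)
    finally show "1 + A \<le> (1 + c0 + \<nu>) * exp (H * \<tau>)" .
  qed
  also have "\<dots> \<le> ell t"
    by (simp add: ell_def H_def \<tau>_def[symmetric] algebra_simps)
  finally show ?thesis by (simp add: mult_right_mono)
qed

lemma Fmap_fields:
  assumes E: "E \<in> fields" shows "Fmap E \<in> fields"
proof -
  define D where "D = CK * (2 * (L0 * exp (AA T - AA 0) * Mb) * vol)"
  have D0: "D \<ge> 0" using CK_nonneg consts_nonneg Mb_nonneg vol_nonneg by (simp add: D_def)
  have time: "norm (Fmap E (t, x) - Fmap E (t', x)) \<le> D * \<bar>t - t'\<bar>" for t t' x
  proof -
    have "norm (Fmap E (t, x) - Fmap E (t', x)) \<le> CK * (2 * (L0 * exp (AA T - AA 0) * Mb * \<bar>t - t'\<bar>) * vol)"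
    proof (rule Fmap_difference[OF E E])
      show "\<bar>gd E t z - gd E t' z\<bar> \<le> 2 * (L0 * exp (AA T - AA 0) * Mb * \<bar>t - t'\<bar>)" for z
        using sol_lip_time[OF E, of Plus t z t'] sol_lip_time[OF E, of Minus t z t'] unfolding gd_def by linarith
    qed
    then show ?thesis by (simp add: D_def mult_ac)
  qed
  have "(D + H * exp (H * T))-lipschitz_on UNIV (Fmap E)"
  proof (rule lipschitz_onI)
    fix p q :: "real \<times> 'x"
    obtain t x where p: "p = (t, x)" by fastforce
    obtain t' y where q: "q = (t', y)" by fastforce
    have np: "\<bar>t - t'\<bar> \<le> norm (p - q)" "norm (x - y) \<le> norm (p - q)"
      using norm_fst_le[of "t - t'" "x - y"] norm_snd_le[of "x - y" "t - t'"] by (auto simp: p q)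
    have "norm (Fmap E p - Fmap E q) \<le> norm (Fmap E (t, x) - Fmap E (t', x)) + norm (Fmap E (t', x) - Fmap E (t', y))"
      unfolding p q by (rule norm_diff_triangle_le) auto
    also have "\<dots> \<le> D * \<bar>t - t'\<bar> + (H * exp (H * T)) * norm (x - y)"
      by (rule add_mono[OF time order_trans[OF Fmap_lip[OF E] mult_right_mono[OF ell_le(1)]]]) simp
    also have "\<dots> \<le> D * norm (p - q) + (H * exp (H * T)) * norm (p - q)"
      using np D0 c0_pos by (intro add_mono mult_left_mono) auto
    finally show "dist (Fmap E p) (Fmap E q) \<le> (D + H * exp (H * T)) * dist p q" by (simp add: dist_norm algebra_simps)
  qed (use D0 c0_pos in auto)
  then have "continuous_on UNIV (Fmap E)" by (rule lipschitz_on_continuous_on)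
  then show ?thesis using Fmap_bd[OF E] Fmap_lip[OF E] by (simp add: fields_def)
qed

text \<open>Here the crude constant \<open>LL\<close> is good enough: the factor exp ((2 LL + 1) T)
  may be huge, since 1 / (2 lam) compensates it once lam is chosen.\<close>

lemma foot_field_difference:
  assumes E: "E \<in> fields" "E' \<in> fields" and t: "t \<in> {0..T}" and K: "K' \<ge> 0" and lam: "lam > 0"
    and le: "\<And>\<tau> x. norm (E (\<tau>, x) - E' (\<tau>, x)) \<le> K' * exp (lam * ct \<tau>)"
  shows "norm (foot E s t z - foot E' s t z) \<le> sqrt (exp ((2 * LL + 1) * T) / (2 * lam)) * (\<nu> * K' * exp (lam * t))"
proof -
  obtain \<gamma> where g: "ichar E s t z \<gamma>" using ichar_exists[OF E(1)] by metis
  obtain \<gamma>' where g': "ichar E' s t z \<gamma>'" using ichar_exists[OF E(2)] by metis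
  have "norm (\<gamma> 0 - \<gamma>' 0) \<le> sqrt (exp ((2 * LL + 1) * T) / (2 * lam)) * (\<nu> * K' * exp (lam * t))"
  proof (rule gronwall_backward_source[where d="\<lambda>\<sigma>. \<gamma> \<sigma> - \<gamma>' \<sigma>" and d'="\<lambda>\<sigma>. vf E s \<sigma> (\<gamma> \<sigma>) - vf E' s \<sigma> (\<gamma>' \<sigma>)"])
    show "0 \<le> t" "t \<le> T" using t by auto
    show "((\<lambda>\<sigma>. \<gamma> \<sigma> - \<gamma>' \<sigma>) has_vector_derivative vf E s \<sigma> (\<gamma> \<sigma>) - vf E' s \<sigma> (\<gamma>' \<sigma>)) (at \<sigma> within {0..t})" if "\<sigma> \<in> {0..t}" for \<sigma>
      by (intro has_vector_derivative_diff ichar_derivative[OF g that] ichar_derivative[OF g' that])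
    show "norm (vf E s \<sigma> (\<gamma> \<sigma>) - vf E' s \<sigma> (\<gamma>' \<sigma>)) \<le> LL * norm (\<gamma> \<sigma> - \<gamma>' \<sigma>) + \<nu> * K' * exp (lam * \<sigma>)" if "\<sigma> \<in> {0..t}" for \<sigma>
    proof -
      have ct: "ct \<sigma> = \<sigma>" using ct(2)[of \<sigma>] that t by auto
      have bd: "norm (E p - E' p) \<le> ME + ME" for p
        using E by (intro order_trans[OF norm_triangle_ineq4] add_mono fields_bd)
      have "norm (vf E s \<sigma> (\<gamma>' \<sigma>) - vf E' s \<sigma> (\<gamma>' \<sigma>)) \<le> \<nu> * norm (E (\<sigma>, fst (\<gamma>' \<sigma>)) - E' (\<sigma>, fst (\<gamma>' \<sigma>)))"
        by (rule vf_lip_E[OF bd])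
      also have "\<dots> \<le> \<nu> * (K' * exp (lam * \<sigma>))" using le[of \<sigma>] mu_le unfolding ct by (intro mult_left_mono) auto
      finally have "norm (vf E s \<sigma> (\<gamma>' \<sigma>) - vf E' s \<sigma> (\<gamma>' \<sigma>)) \<le> \<nu> * K' * exp (lam * \<sigma>)" by simp
      then show ?thesis using vf_LL[OF E(1), of s \<sigma> "\<gamma> \<sigma>" "\<gamma>' \<sigma>"]
          norm_triangle_ineq[of "vf E s \<sigma> (\<gamma> \<sigma>) - vf E s \<sigma> (\<gamma>' \<sigma>)" "vf E s \<sigma> (\<gamma>' \<sigma>) - vf E' s \<sigma> (\<gamma>' \<sigma>)"] by simp
    qed
  qed (use LL mu_le K lam g g' in \<open>auto simp: ichar_def\<close>)
  then show ?thesis using foot_eq[OF E(1) t g] foot_eq[OF E(2) t g'] by simp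
qed

lemma field_fixed_point:
  obtains E where "E \<in> fields" "Fmap E = E"
proof -
  define Dc where "Dc = CK * (2 * L0 * \<nu> * vol)"
  have Dc0: "Dc \<ge> 0" using CK_nonneg consts_nonneg mu_le vol_nonneg by (simp add: Dc_def)
  define ee where "ee = exp ((2 * LL + 1) * T)"
  have ee: "ee > 0" by (simp add: ee_def)
  \<comment> \<open>The square of the contraction factor is
    \<open>ee * Dc\<^sup>2 / (2 * lam)\<close>, which is at most 1/4 for this rate. The field
    \<open>B\<close> enters through \<open>ee\<close>, that is, it changes only the weight.\<close>
  define lam where "lam = 2 * Dc\<^sup>2 * ee + 1"
  have lam: "lam > 0" using ee by (simp add: lam_def add_nonneg_pos)
  have half: "sqrt (ee / (2 * lam)) * Dc \<le> 1 / 2"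
  proof -
    have "(sqrt (ee / (2 * lam)) * Dc)\<^sup>2 = ee * Dc\<^sup>2 / (2 * lam)"
      using ee lam by (simp add: power_mult_distrib)
    also have "\<dots> \<le> (1/2)\<^sup>2" using lam ee by (simp add: lam_def field_simps power2_eq_square)
    finally show ?thesis by (rule power2_le_imp_le) simp
  qed
  define w where "w p = exp (lam * ct (fst p))" for p :: "real \<times> 'x"
  have w1: "w p \<ge> 1" for p using lam ct(1)[of "fst p"] by (simp add: w_def)
  have wT: "w p \<le> exp (lam * T)" for p using lam ct(1)[of "fst p"] by (simp add: w_def)
  show ?thesis
  proof (rule weighted_fixed_point[of w fields Fmap "\<lambda>_. 0" ME])
    show "w p \<ge> 0" for p using w1[of p] by linarith
    show "Fmap E \<in> fields" if "E \<in> fields" for E by (rule Fmap_fields[OF that])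
    show z: "(\<lambda>_. 0) \<in> fields" using consts_nonneg ell_le by (simp add: fields_def)
    show "ME \<ge> 0" by (rule consts_nonneg)
    show "norm (Fmap (\<lambda>_. 0) p - 0) \<le> ME * w p" for p
      using Fmap_bd[OF z, of p] mult_left_mono[OF w1[of p] consts_nonneg(5)] by simp
    show "norm (Fmap E p - Fmap E' p) \<le> K' / 2 * w p"
      if E: "E \<in> fields" "E' \<in> fields" and K': "K' \<ge> 0" and le: "\<And>q. norm (E q - E' q) \<le> K' * w q" for E E' K' p
    proof -
      obtain t x where p: "p = (t, x)" by fastforce
      let ?e = "L0 * (sqrt (ee / (2 * lam)) * (\<nu> * K' * w p))"
      have sd: "\<bar>sol E s (t, z) - sol E' s (t, z)\<bar> \<le> ?e" for s z
      proof -
        have "\<bar>sol E s (t, z) - sol E' s (t, z)\<bar> \<le> L0 * norm (foot E s (ct t) z - foot E' s (ct t) z)"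
          using f0_lipD by (simp add: sol_def)
        also have "\<dots> \<le> ?e"
          using foot_field_difference[OF E ct(1)[of t] K' lam, of s z] le consts_nonneg
          by (intro mult_left_mono) (auto simp: w_def p ee_def)
        finally show ?thesis .
      qed
      have "norm (Fmap E p - Fmap E' p) \<le> CK * ((2 * ?e) * vol)"
        unfolding p
      proof (rule Fmap_difference[OF E])
        show "\<bar>gd E t z - gd E' t z\<bar> \<le> 2 * (L0 * (sqrt (ee / (2 * lam)) * (\<nu> * K' * w (t, x))))" for z
          using sd[of Plus z] sd[of Minus z] unfolding gd_def p by linarith
      qed
      also have "\<dots> = (sqrt (ee / (2 * lam)) * Dc) * (K' * w p)" by (simp add: Dc_def)
      also have "\<dots> \<le> (1/2) * (K' * w p)" using half K' w1[of p] by (intro mult_right_mono) auto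
      finally show ?thesis by simp
    qed
    show "E \<in> fields" if X: "\<And>n. X n \<in> fields" and le: "\<And>n p. norm (X n p - E p) \<le> K' * (1/2) ^ n * w p" for X E K'
    proof -
      have K0: "K' \<ge> 0"
      proof -
        have "0 \<le> K' * w undefined" using order_trans[OF norm_ge_zero le[of 0 undefined]] by simp
        then show ?thesis using w1[of undefined] by (simp add: zero_le_mult_iff)
      qed
      have le': "norm (X n p - E p) \<le> (K' * exp (lam * T)) * (1/2) ^ n" for n p
      proof -
        have "K' * (1/2) ^ n * w p \<le> K' * (1/2) ^ n * exp (lam * T)" using K0 by (intro mult_left_mono wT) auto
        then show ?thesis using le[of n p] by (simp add: mult_ac)
      qed
      have "(\<lambda>n. (K' * exp (lam * T)) * (1/2) ^ n) \<longlonglongrightarrow> (K' * exp (lam * T)) * 0"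
        by (intro tendsto_intros LIMSEQ_realpow_zero) auto
      then have lim: "(\<lambda>n. X n p) \<longlonglongrightarrow> E p" for p
        by (intro LIM_zero_cancel[OF Lim_null_comparison[OF always_eventually[OF allI[OF le']]]]) simp
      have "continuous_on UNIV E"
        by (rule continuous_on_geometric_limit[of UNIV X E "K' * exp (lam * T)"]) (use X le' in \<open>auto simp: fields_def\<close>)
      moreover have "norm (E p) \<le> ME" for p
        by (rule Lim_bounded[OF tendsto_norm[OF lim]]) (use X fields_bd in blast)
      moreover have "norm (E (t, x) - E (t, y)) \<le> ell t * norm (x - y)" for t x y
        by (rule Lim_bounded[OF tendsto_norm[OF tendsto_diff[OF lim lim]]]) (use X in \<open>auto simp: fields_def\<close>)
      ultimately show ?thesis by (simp add: fields_def)
    qed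
  qed (rule that)
qed

section \<open>Regularity of the transported datum and the transport equation\<close>

lemma sol_lipschitz:
  assumes E: "E \<in> fields"
  shows "(L0 * exp (AA T - AA 0) * (1 + Mb))-lipschitz_on UNIV (sol E s)"
proof (rule lipschitz_onI)
  fix p q :: "real \<times> 'x \<times> 'v"
  obtain t z where p: "p = (t, z)" by (cases p)
  obtain t' z' where q: "q = (t', z')" by (cases q)
  let ?c = "L0 * exp (AA T - AA 0)"
  have c0: "?c \<ge> 0" using consts_nonneg by simp
  have np: "\<bar>t - t'\<bar> \<le> norm (p - q)" "norm (z - z') \<le> norm (p - q)"
    using norm_fst_le[of "t - t'" "z - z'"] norm_snd_le[of "z - z'" "t - t'"] by (auto simp: p q)
  have "\<bar>sol E s (t, z) - sol E s (t', z)\<bar> \<le> ?c * Mb * norm (p - q)"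
    using sol_lip_time[OF E, of s t z t'] mult_left_mono[OF np(1), of "?c * Mb"] c0 Mb_nonneg by simp
  moreover have "\<bar>sol E s (t', z) - sol E s (t', z')\<bar> \<le> ?c * norm (p - q)"
  proof -
    have "L0 * exp (AA (ct t') - AA 0) * norm (z - z') \<le> ?c * norm (p - q)"
      using AA_mono[OF ct(1)[of t']] np(2) consts_nonneg by (intro mult_mono mult_left_mono) auto
    then show ?thesis using sol_lip_space[OF E, of s t' z z'] by linarith
  qed
  ultimately have "\<bar>sol E s p - sol E s q\<bar> \<le> ?c * Mb * norm (p - q) + ?c * norm (p - q)" unfolding p q by linarith
  also have "\<dots> = ?c * (1 + Mb) * norm (p - q)" by (simp add: algebra_simps)
  finally show "dist (sol E s p) (sol E s q) \<le> ?c * (1 + Mb) * dist p q" by (simp add: dist_norm)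
qed (use consts_nonneg Mb_nonneg in simp)

lemma sol_initial: "E \<in> fields \<Longrightarrow> sol E s (0, z) = f0 s z"
proof -
  assume E: "E \<in> fields"
  have t0: "0 \<in> {0..T}" using T by simp
  obtain \<gamma> where g: "ichar E s 0 z \<gamma>" using ichar_exists[OF E] by metis
  then have "foot E s 0 z = z" using foot_eq[OF E t0 g] by (simp add: ichar_def)
  then show ?thesis using ct(2)[OF t0] by (simp add: sol_def)
qed

text \<open>The characteristic through (t, z) is followed only up to time t, so the chain rule gives
  a derivative from the left. One-sided derivatives are unique as well, and along the curve the
  solution is constant.\<close>

lemma sol_transport:
  assumes E: "E \<in> fields" and t: "0 < t" "t \<le> T" and D: "(sol E s has_derivative D) (at (t, z))"
  shows "D (1, vf E s t z) = 0"
proof -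
  have tT: "t \<in> {0..T}" using t by simp
  obtain \<gamma> where g: "ichar E s t z \<gamma>" using ichar_exists[OF E] by metis
  have const: "sol E s (\<sigma>, \<gamma> \<sigma>) = f0 s (\<gamma> 0)" if "\<sigma> \<in> {0..t}" for \<sigma>
  proof -
    have \<sigma>: "\<sigma> \<in> {0..T}" using that t by auto
    have "ichar E s \<sigma> (\<gamma> \<sigma>) \<gamma>" by (rule ichar_restrict[OF g]) (use that in auto)
    then show ?thesis using foot_eq[OF E \<sigma>] ct(2)[OF \<sigma>] by (simp add: sol_def)
  qed
  have gz: "\<gamma> t = z" using g by (simp add: ichar_def)
  have "((\<lambda>\<sigma>. (\<sigma>, \<gamma> \<sigma>)) has_vector_derivative (1, vf E s t z)) (at t within {0..t})"
    using has_vector_derivative_Pair[OF has_vector_derivative_id ichar_derivative[OF g, of t]] t gz by simp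
  moreover have "(sol E s has_derivative D) (at (t, \<gamma> t) within (\<lambda>\<sigma>. (\<sigma>, \<gamma> \<sigma>)) ` {0..t})"
    using D unfolding gz by (rule has_derivative_at_withinI)
  ultimately have d: "((sol E s \<circ> (\<lambda>\<sigma>. (\<sigma>, \<gamma> \<sigma>))) has_vector_derivative D (1, vf E s t z)) (at t within {0..t})"
    using vector_derivative_diff_chain_within by blast
  have "((\<lambda>\<sigma>. f0 s (\<gamma> 0)) has_vector_derivative D (1, vf E s t z)) (at t within {0..t})"
    by (rule has_vector_derivative_transform[OF _ _ d]) (use t const in auto)
  moreover have "((\<lambda>\<sigma>. f0 s (\<gamma> 0)) has_vector_derivative 0) (at t within {0..t})" by simp
  ultimately show ?thesis
    using vector_derivative_unique_within[of t "{0..t}"] t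
    by (metis at_within_Icc_at_left trivial_limit_at_left_real)
qed

end

section \<open>Uniqueness of Lipschitz solutions\<close>

text \<open>The coefficient c need not be differentiable: it suffices that u times its quotients in
  the direction -w converges boundedly. If c is constant in the direction w the limit is 0, however
  irregular c is in the other directions.\<close>

lemma integral_by_parts_translation:
  fixes u c d :: "'a::euclidean_space \<Rightarrow> real"
  assumes u: "L-lipschitz_on UNIV u" and c[measurable]: "c \<in> borel_measurable borel" and S: "compact S"
    and out: "\<And>z n. z \<notin> S \<Longrightarrow> c z * dyadic_quot u w n z = 0" "\<And>z. z \<notin> S \<Longrightarrow> c z * u z = 0"
      "\<And>z n. z \<notin> S \<Longrightarrow> u z * dyadic_quot c (-w) n z = 0"
    and bd: "\<And>z. z \<in> S \<Longrightarrow> \<bar>c z\<bar> \<le> C" "\<And>z n. z \<in> S \<Longrightarrow> \<bar>u z * dyadic_quot c (-w) n z\<bar> \<le> C'"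
    and lim: "AE z in lborel. (\<lambda>n. u z * dyadic_quot c (-w) n z) \<longlonglongrightarrow> d z" and d[measurable]: "d \<in> borel_measurable borel"
  shows "integrable lborel (\<lambda>z. c z * dyadic_deriv u w z)" "integrable lborel d"
    "(LINT z|lborel. c z * dyadic_deriv u w z) = (LINT z|lborel. d z)"
proof -
  have uc: "continuous_on A u" for A using lipschitz_on_continuous_on[OF u] continuous_on_subset by blast
  have um[measurable]: "u \<in> borel_measurable borel" using uc by (auto intro: borel_measurable_continuous_onI)
  have qm[measurable]: "dyadic_quot u v n \<in> borel_measurable borel" "dyadic_quot c v n \<in> borel_measurable borel" for v n
    by (auto intro: dyadic_quot_measurable)
  have dm[measurable]: "dyadic_deriv u w \<in> borel_measurable borel" by (rule dyadic_deriv_measurable[OF u])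
  have indS: "integrable lborel (\<lambda>z. indicator S z *\<^sub>R D)" for D :: real
    by (intro borel_integrable_compact S continuous_intros)
  have ae1: "AE z in lborel. (\<lambda>n. c z * dyadic_quot u w n z) \<longlonglongrightarrow> c z * dyadic_deriv u w z"
    using AE_dyadic_deriv[OF u, of w] by eventually_elim (auto intro: tendsto_intros)
  have bd1: "AE z in lborel. norm (c z * dyadic_quot u w n z) \<le> indicator S z *\<^sub>R (C * (L * norm w))" for n
  proof (rule AE_I2)
    fix z show "norm (c z * dyadic_quot u w n z) \<le> indicator S z *\<^sub>R (C * (L * norm w))"
    proof (cases "z \<in> S")
      case True
      then show ?thesis using mult_mono[OF bd(1)[OF True] dyadic_quot_bound[OF u, of w n z]] bd(1)[OF True]
        by (simp add: abs_mult)
    next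
      case False
      then show ?thesis using out(1)[OF False] by simp
    qed
  qed
  have L1: "(\<lambda>n. LINT z|lborel. c z * dyadic_quot u w n z) \<longlonglongrightarrow> (LINT z|lborel. c z * dyadic_deriv u w z)"
    by (rule integral_dominated_convergence[OF _ _ indS ae1 bd1]) auto
  show "integrable lborel (\<lambda>z. c z * dyadic_deriv u w z)"
    by (rule integrable_dominated_convergence[OF _ _ indS ae1 bd1]) auto
  have bd2: "AE z in lborel. norm (u z * dyadic_quot c (-w) n z) \<le> indicator S z *\<^sub>R C'" for n
  proof (rule AE_I2)
    fix z show "norm (u z * dyadic_quot c (-w) n z) \<le> indicator S z *\<^sub>R C'"
      using bd(2)[of z n] out(3)[of z n] by (cases "z \<in> S") auto
  qed
  have L2: "(\<lambda>n. LINT z|lborel. u z * dyadic_quot c (-w) n z) \<longlonglongrightarrow> (LINT z|lborel. d z)"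
    by (rule integral_dominated_convergence[OF _ _ indS lim bd2]) auto
  show "integrable lborel d"
    by (rule integrable_dominated_convergence[OF _ _ indS lim bd2]) auto
  have cu: "integrable lborel (\<lambda>z. c z * u z)"
  proof -
    obtain D where D: "\<And>z. z \<in> S \<Longrightarrow> \<bar>u z\<bar> \<le> D"
      using compact_imp_bounded[OF compact_continuous_image[OF uc S]] by (auto simp: bounded_iff)
    show ?thesis
    proof (rule Bochner_Integration.integrable_bound[OF indS[of "C * D"]])
      show "AE z in lborel. norm (c z * u z) \<le> norm (indicator S z *\<^sub>R (C * D))"
      proof (rule AE_I2)
        fix z show "norm (c z * u z) \<le> norm (indicator S z *\<^sub>R (C * D))"
        proof (cases "z \<in> S")
          case True
          have "\<bar>c z\<bar> * \<bar>u z\<bar> \<le> C * D" using bd(1)[OF True] D[OF True] by (intro mult_mono) auto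
          from order_trans[OF this abs_ge_self] show ?thesis using True by (simp add: abs_mult)
        qed (use out(2) in simp)
      qed
    qed measurable
  qed
  have shift: "(LINT z|lborel. c z * dyadic_quot u w n z) = (LINT z|lborel. u z * dyadic_quot c (-w) n z)" for n
  proof -
    define k where "k = w /\<^sub>R 2 ^ n"
    have i1: "integrable lborel (\<lambda>z. c z * dyadic_quot u w n z)"
    proof (rule Bochner_Integration.integrable_bound[OF indS[of "C * (L * norm w)"]])
      show "AE z in lborel. norm (c z * dyadic_quot u w n z) \<le> norm (indicator S z *\<^sub>R (C * (L * norm w)))"
        using bd1[of n]
      proof eventually_elim
        case (elim z)
        from order_trans[OF elim abs_ge_self] show ?case by (simp only: real_norm_def)
      qed
    qed measurable
    have e1: "c z * u (z + k) = c z * u z + (1 / 2 ^ n) * (c z * dyadic_quot u w n z)" for z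
      by (simp add: dyadic_quot_def k_def algebra_simps)
    have i2: "integrable lborel (\<lambda>z. c z * u (z + k))" unfolding e1 using i1 cu by simp
    have i3: "integrable lborel (\<lambda>z. c (z - k) * u z)"
      using integrable_lborel_translate[OF i2, of "-k"] by simp
    have "(LINT z|lborel. c z * dyadic_quot u w n z) = (LINT z|lborel. 2 ^ n * (c z * u (z + k) - c z * u z))"
      by (simp add: dyadic_quot_def k_def algebra_simps)
    also have "\<dots> = 2 ^ n * ((LINT z|lborel. c z * u (z + k)) - (LINT z|lborel. c z * u z))"
      using i2 cu by simp
    also have "(LINT z|lborel. c z * u (z + k)) = (LINT z|lborel. c (z - k) * u z)"
      using integral_lborel_translate[of "\<lambda>z. c (z - k) * u z" k] by simp
    also have "2 ^ n * ((LINT z|lborel. c (z - k) * u z) - (LINT z|lborel. c z * u z))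
      = (LINT z|lborel. 2 ^ n * (c (z - k) * u z - c z * u z))" using i3 cu by simp
    also have "\<dots> = (LINT z|lborel. u z * dyadic_quot c (-w) n z)" by (simp add: dyadic_quot_def k_def algebra_simps)
    finally show ?thesis .
  qed
  show "(LINT z|lborel. c z * dyadic_deriv u w z) = (LINT z|lborel. d z)"
    using LIMSEQ_unique[OF L1] L2 by (simp add: shift)
qed

text \<open>The product q z q y is at most half the sum of the squares; in each of the two terms the
  free variable is integrated against the kernel only.\<close>

lemma schur_test:
  fixes k :: "'a::euclidean_space \<Rightarrow> 'a \<Rightarrow> ennreal" and q :: "'a \<Rightarrow> real"
  assumes km: "case_prod k \<in> borel_measurable (lborel \<Otimes>\<^sub>M lborel)" and qm[measurable]: "q \<in> borel_measurable borel"
    and q0: "\<And>z. q z \<ge> 0"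
    and k1: "\<And>z. (\<integral>\<^sup>+y. k z y \<partial>lborel) \<le> C" and k2: "\<And>y. (\<integral>\<^sup>+z. k z y \<partial>lborel) \<le> C"
  shows "(\<integral>\<^sup>+z. \<integral>\<^sup>+y. k z y * ennreal (q z) * ennreal (q y) \<partial>lborel \<partial>lborel) \<le> C * (\<integral>\<^sup>+z. ennreal ((q z)\<^sup>2) \<partial>lborel)"
proof -
  let ?Q = "\<lambda>z. ennreal ((q z)\<^sup>2 / 2)"
  have km1[measurable]: "k z \<in> borel_measurable borel" for z using measurable_compose[OF measurable_Pair1' km] by simp
  have km2[measurable]: "(\<lambda>z. k z y) \<in> borel_measurable borel" for y using measurable_compose[OF measurable_Pair2' km] by simp
  have kq: "case_prod (\<lambda>z y. k z y * ?Q y) \<in> borel_measurable (lborel \<Otimes>\<^sub>M lborel)"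
    using km unfolding case_prod_beta by measurable
  have am: "k z y * ennreal (q z) * ennreal (q y) \<le> k z y * ?Q z + k z y * ?Q y" for z y
  proof -
    have "q z * q y \<le> (q z)\<^sup>2 / 2 + (q y)\<^sup>2 / 2" using sum_squares_bound[of "q z" "q y"] by simp
    then have "ennreal (q z) * ennreal (q y) \<le> ?Q z + ?Q y"
      using q0 by (simp add: ennreal_mult[symmetric] ennreal_plus[symmetric] ennreal_leI del: ennreal_plus)
    then show ?thesis unfolding distrib_left[symmetric] mult.assoc by (rule mult_left_mono) simp
  qed
  have "(\<integral>\<^sup>+z. \<integral>\<^sup>+y. k z y * ennreal (q z) * ennreal (q y) \<partial>lborel \<partial>lborel)
      \<le> (\<integral>\<^sup>+z. (\<integral>\<^sup>+y. k z y * ?Q z \<partial>lborel) + (\<integral>\<^sup>+y. k z y * ?Q y \<partial>lborel) \<partial>lborel)"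
  proof (rule nn_integral_mono)
    fix z
    have "(\<integral>\<^sup>+y. k z y * ennreal (q z) * ennreal (q y) \<partial>lborel) \<le> (\<integral>\<^sup>+y. k z y * ?Q z + k z y * ?Q y \<partial>lborel)"
      by (rule nn_integral_mono[OF am])
    also have "\<dots> = (\<integral>\<^sup>+y. k z y * ?Q z \<partial>lborel) + (\<integral>\<^sup>+y. k z y * ?Q y \<partial>lborel)"
      by (rule nn_integral_add) measurable
    finally show "(\<integral>\<^sup>+y. k z y * ennreal (q z) * ennreal (q y) \<partial>lborel) \<le> (\<integral>\<^sup>+y. k z y * ?Q z \<partial>lborel) + (\<integral>\<^sup>+y. k z y * ?Q y \<partial>lborel)" .
  qed
  also have "\<dots> \<le> (\<integral>\<^sup>+z. C * ?Q z + (\<integral>\<^sup>+y. k z y * ?Q y \<partial>lborel) \<partial>lborel)"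
  proof (intro nn_integral_mono add_right_mono)
    fix z
    have "(\<integral>\<^sup>+y. k z y * ?Q z \<partial>lborel) = (\<integral>\<^sup>+y. k z y \<partial>lborel) * ?Q z" by (intro nn_integral_multc) measurable
    also have "\<dots> \<le> C * ?Q z" by (intro mult_right_mono k1) simp
    finally show "(\<integral>\<^sup>+y. k z y * ?Q z \<partial>lborel) \<le> C * ?Q z" .
  qed
  also have "\<dots> = (\<integral>\<^sup>+z. C * ?Q z \<partial>lborel) + (\<integral>\<^sup>+z. \<integral>\<^sup>+y. k z y * ?Q y \<partial>lborel \<partial>lborel)"
  proof (rule nn_integral_add)
    show "(\<lambda>z. \<integral>\<^sup>+y. k z y * ?Q y \<partial>lborel) \<in> borel_measurable lborel"
      using lborel.borel_measurable_nn_integral[OF kq] by simp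
  qed measurable
  also have "(\<integral>\<^sup>+z. \<integral>\<^sup>+y. k z y * ?Q y \<partial>lborel \<partial>lborel) = (\<integral>\<^sup>+y. \<integral>\<^sup>+z. k z y * ?Q y \<partial>lborel \<partial>lborel)"
    by (rule lborel_pair.Fubini'[OF kq, symmetric])
  also have "\<dots> \<le> (\<integral>\<^sup>+y. C * ?Q y \<partial>lborel)"
  proof (rule nn_integral_mono)
    fix y
    have "(\<integral>\<^sup>+z. k z y * ?Q y \<partial>lborel) = (\<integral>\<^sup>+z. k z y \<partial>lborel) * ?Q y" by (intro nn_integral_multc) measurable
    also have "\<dots> \<le> C * ?Q y" by (intro mult_right_mono k2) simp
    finally show "(\<integral>\<^sup>+z. k z y * ?Q y \<partial>lborel) \<le> C * ?Q y" .
  qed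
  also have "(\<integral>\<^sup>+z. C * ?Q z \<partial>lborel) + (\<integral>\<^sup>+z. C * ?Q z \<partial>lborel) = C * ((\<integral>\<^sup>+z. ?Q z \<partial>lborel) + (\<integral>\<^sup>+z. ?Q z \<partial>lborel))"
    by (simp add: nn_integral_cmult distrib_left)
  also have "(\<integral>\<^sup>+z. ?Q z \<partial>lborel) + (\<integral>\<^sup>+z. ?Q z \<partial>lborel) = (\<integral>\<^sup>+z. ?Q z + ?Q z \<partial>lborel)"
    by (rule nn_integral_add[symmetric]) measurable
  also have "(\<lambda>z. ?Q z + ?Q z) = (\<lambda>z. ennreal ((q z)\<^sup>2))"
    by (auto simp: ennreal_plus[symmetric] simp del: ennreal_plus)
  finally show ?thesis by (simp add: add_left_mono)
qed

text \<open>The nonnegative integral sees only the positive part of A, and the real integral of A is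
  at most that of its positive part.\<close>

lemma integral_le_nn_bound:
  fixes A :: "'a \<Rightarrow> real"
  assumes i: "integrable M A" and c: "c \<ge> 0" and le: "(\<integral>\<^sup>+z. ennreal (A z) \<partial>M) \<le> ennreal c"
  shows "(LINT z|M. A z) \<le> c"
proof -
  have im: "integrable M (\<lambda>z. max 0 (A z))" using i by auto
  have le1: "(LINT z|M. A z) \<le> (LINT z|M. max 0 (A z))" by (rule integral_mono[OF i im]) auto
  have "ennreal (LINT z|M. max 0 (A z)) = (\<integral>\<^sup>+z. ennreal (max 0 (A z)) \<partial>M)"
    by (rule nn_integral_eq_integral[OF im, symmetric]) auto
  also have "\<dots> = (\<integral>\<^sup>+z. ennreal (A z) \<partial>M)" by (intro nn_integral_cong) (auto simp: max_def ennreal_neg)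
  also have "\<dots> \<le> ennreal c" by (rule le)
  finally have "(LINT z|M. max 0 (A z)) \<le> c" using c by (simp add: ennreal_le_iff)
  with le1 show ?thesis by linarith
qed

lemma AE_fst_neq: "AE p in lborel. fst (p :: real \<times> 'b::euclidean_space) \<noteq> c"
proof -
  have "emeasure (lborel \<Otimes>\<^sub>M lborel) ({c} \<times> (UNIV :: 'b set)) = 0"
    by (subst lborel.emeasure_pair_measure_Times) auto
  then have "{c} \<times> (UNIV :: 'b set) \<in> null_sets lborel"
    unfolding lborel_prod by (intro null_setsI) (auto intro!: borel_closed closed_Times)
  from AE_not_in[OF this] show ?thesis by eventually_elim auto
qed

lemma measurable_pair_continuous:
  fixes g :: "'a::euclidean_space \<times> 'b::euclidean_space \<Rightarrow> 'c::topological_space"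
  assumes "continuous_on UNIV g" shows "g \<in> borel_measurable (borel \<Otimes>\<^sub>M lborel)"
proof -
  have "sets (borel \<Otimes>\<^sub>M lborel) = sets (borel :: ('a \<times> 'b) measure)"
    by (metis borel_prod sets_lborel sets_pair_measure_cong)
  then show ?thesis using borel_measurable_continuous_onI[OF assms] by (simp cong: measurable_cong_sets)
qed

lemma grad_unique:
  assumes "(f has_derivative (\<lambda>h. grad f z \<bullet> h)) (at z)" "(f has_derivative D) (at z)"
  shows "grad f z \<bullet> h = D h"
  using has_derivative_unique[OF assms] by metis

context vlasov
begin

section \<open>Drift, field difference and interaction energy\<close>

definition EF :: "(species \<Rightarrow> real \<times> 'x \<times> 'v \<Rightarrow> real) \<Rightarrow> real \<times> 'x \<Rightarrow> 'x" where
  "EF f p = field K (dens (\<lambda>z. f Plus (fst p, z) - f Minus (fst p, z))) (snd p)"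

text \<open>The velocity of characteristics in space-time, so that the Vlasov equation reads
  \<open>grad (f s) p \<bullet> drift f B s p = 0\<close>. Velocities are not truncated here: each
  component has to be independent of its own coordinate, a property of \<open>W v b\<close> that the
  factor in \<open>tr\<close> would in general destroy.\<close>

definition drift :: "(species \<Rightarrow> real \<times> 'x \<times> 'v \<Rightarrow> real) \<Rightarrow> (real \<times> 'x \<Rightarrow> 'b) \<Rightarrow> species \<Rightarrow> real \<times> 'x \<times> 'v \<Rightarrow> real \<times> 'x \<times> 'v" where
  "drift f B s p = (1, mux s *\<^sub>R J (snd (snd p)),
     muv s *\<^sub>R (I (EF f (fst p, fst (snd p))) + mux s *\<^sub>R W (snd (snd p)) (B (fst p, fst (snd p)))))"

lemma EF_measurable:
  assumes f: "\<And>s. L-lipschitz_on UNIV (f s)"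
  shows "EF f \<in> borel_measurable borel"
proof -
  have fm[measurable]: "f s \<in> borel_measurable borel" for s
    by (rule borel_measurable_continuous_onI[OF lipschitz_on_continuous_on[OF f]])
  have 1: "(\<lambda>(p :: real \<times> 'x, v :: 'v). f Plus (fst p, snd p, v) - f Minus (fst p, snd p, v)) \<in> borel_measurable (borel \<Otimes>\<^sub>M lborel)"
    unfolding case_prod_beta
    by (intro borel_measurable_diff measurable_compose[OF measurable_pair_continuous fm] continuous_intros)
  have \<rho>m[measurable]: "(\<lambda>p. dens (\<lambda>z. f Plus (fst p, z) - f Minus (fst p, z)) (snd p)) \<in> borel_measurable borel"
    using lborel.borel_measurable_lebesgue_integral[OF 1] by (simp add: dens_def)
  have 2: "(\<lambda>(p :: real \<times> 'x, y). dens (\<lambda>z. f Plus (fst p, z) - f Minus (fst p, z)) y *\<^sub>R K (snd p - y)) \<in> borel_measurable (borel \<Otimes>\<^sub>M lborel)"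
  proof -
    have "(\<lambda>q :: (real \<times> 'x) \<times> 'x. (fst (fst q), snd q)) \<in> borel \<Otimes>\<^sub>M lborel \<rightarrow>\<^sub>M borel"
      by (intro measurable_pair_continuous continuous_intros)
    from measurable_compose[OF this \<rho>m]
    have "(\<lambda>q :: (real \<times> 'x) \<times> 'x. dens (\<lambda>z. f Plus (fst (fst q), z) - f Minus (fst (fst q), z)) (snd q)) \<in> borel_measurable (borel \<Otimes>\<^sub>M lborel)"
      by simp
    moreover have "(\<lambda>q :: (real \<times> 'x) \<times> 'x. K (snd (fst q) - snd q)) \<in> borel_measurable (borel \<Otimes>\<^sub>M lborel)"
      by (intro measurable_compose[OF measurable_pair_continuous K_measurable] continuous_intros)
    ultimately show ?thesis unfolding case_prod_beta by (rule borel_measurable_scaleR)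
  qed
  show ?thesis
    using lborel.borel_measurable_lebesgue_integral[OF 2] unfolding EF_def[abs_def] field_def by simp
qed

text \<open>Writes the nonlocal interaction as an integral operator on phase space acting on the sum
  of the two differences, the form to which \<open>schur_test\<close> applies.\<close>

lemma EF_difference_le:
  fixes f g :: "species \<Rightarrow> real \<times> 'x \<times> 'v \<Rightarrow> real"
  assumes f: "\<And>s. continuous_on UNIV (f s)" and g: "\<And>s. continuous_on UNIV (g s)"
    and fs: "\<And>s t. phase_supported (\<lambda>z. f s (t, z))" and gs: "\<And>s t. phase_supported (\<lambda>z. g s (t, z))"
    and fb: "\<And>s p. \<bar>f s p\<bar> \<le> M" and gb: "\<And>s p. \<bar>g s p\<bar> \<le> M"
  shows "ennreal (norm (EF f (t, x) - EF g (t, x)))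
    \<le> (\<integral>\<^sup>+\<zeta>. (ennreal (norm (K (x - fst \<zeta>))) * indicator (cball 0 Rx \<times> cball 0 Rv) \<zeta>)
        * ennreal (\<bar>f Plus (t, \<zeta>) - g Plus (t, \<zeta>)\<bar> + \<bar>f Minus (t, \<zeta>) - g Minus (t, \<zeta>)\<bar>) \<partial>lborel)"
proof -
  let ?F = "\<lambda>z. f Plus (t, z) - f Minus (t, z)" let ?G = "\<lambda>z. g Plus (t, z) - g Minus (t, z)"
  let ?h = "\<lambda>z. ?F z - ?G z"
  let ?q = "\<lambda>z. \<bar>f Plus (t, z) - g Plus (t, z)\<bar> + \<bar>f Minus (t, z) - g Minus (t, z)\<bar>"
  have fc: "continuous_on UNIV (\<lambda>z. f s (t, z))" and gc: "continuous_on UNIV (\<lambda>z. g s (t, z))" for s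
    by (intro continuous_on_compose2[OF f] continuous_on_compose2[OF g] continuous_intros; simp)+
  have Fc: "continuous_on UNIV ?F" and Gc: "continuous_on UNIV ?G" and hc: "continuous_on UNIV ?h" and qc: "continuous_on UNIV ?q"
    by (intro continuous_intros fc gc)+
  have Fs: "phase_supported ?F" and Gs: "phase_supported ?G" and hs: "phase_supported ?h"
    by (intro phase_supported_diff fs gs)+
  have Fb: "\<bar>?F z\<bar> \<le> 2 * M" and Gb: "\<bar>?G z\<bar> \<le> 2 * M" for z
    using fb[of Plus "(t, z)"] fb[of Minus "(t, z)"] gb[of Plus "(t, z)"] gb[of Minus "(t, z)"] by linarith+
  have hb: "\<bar>?h z\<bar> \<le> 4 * M" for z using Fb[of z] Gb[of z] by linarith
  note F = dens_measurable[OF Fc Fs] dens_bound[OF Fc Fs Fb] dens_outside[OF Fc Fs]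
  note G = dens_measurable[OF Gc Gs] dens_bound[OF Gc Gs Gb] dens_outside[OF Gc Gs]
  note Hh = dens_measurable[OF hc hs] dens_bound[OF hc hs hb] dens_outside[OF hc hs]
  have qs: "?q z = 0" if "z \<notin> cball 0 Rx \<times> cball 0 Rv" for z
  proof -
    have "f s (t, z) = 0" "g s (t, z) = 0" for s
      using that fs[of s t] gs[of s t] by (cases z; auto simp: phase_supported_def)+
    then show ?thesis by simp
  qed
  have "EF f (t, x) - EF g (t, x) = field K (\<lambda>y. dens ?F y - dens ?G y) x"
    unfolding EF_def fst_conv snd_conv by (rule field_diff[OF F G])
  also have "(\<lambda>y. dens ?F y - dens ?G y) = dens ?h" by (intro ext dens_diff Fc Fs Gc Gs)
  finally have "ennreal (norm (EF f (t, x) - EF g (t, x))) \<le> (\<integral>\<^sup>+y. ennreal (norm (dens ?h y *\<^sub>R K (x - y))) \<partial>lborel)"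
    unfolding field_def using integral_norm_bound_ennreal[OF integrable_field(1)[OF Hh]] by simp
  also have "\<dots> \<le> (\<integral>\<^sup>+y. \<integral>\<^sup>+w. (ennreal (norm (K (x - y))) * indicator (cball 0 Rx \<times> cball 0 Rv) (y, w)) * ennreal (?q (y, w)) \<partial>lborel \<partial>lborel)"
  proof (rule nn_integral_mono)
    fix y
    have qm: "(\<lambda>w. ennreal (?q (y, w))) \<in> borel_measurable borel"
      by (intro measurable_compose[OF borel_measurable_continuous_onI measurable_ennreal] continuous_on_compose2[OF qc] continuous_intros) auto
    have "ennreal \<bar>dens ?h y\<bar> \<le> (\<integral>\<^sup>+w. ennreal (norm (?h (y, w))) \<partial>lborel)"
      unfolding dens_def using integral_norm_bound_ennreal[OF integrable_dens[OF hc hs, of y]] by simp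
    also have "\<dots> \<le> (\<integral>\<^sup>+w. ennreal (?q (y, w)) \<partial>lborel)"
      by (intro nn_integral_mono ennreal_leI) auto
    finally have le: "ennreal \<bar>dens ?h y\<bar> \<le> (\<integral>\<^sup>+w. ennreal (?q (y, w)) \<partial>lborel)" .
    have "ennreal (norm (dens ?h y *\<^sub>R K (x - y))) = ennreal (norm (K (x - y))) * ennreal \<bar>dens ?h y\<bar>"
      by (simp add: ennreal_mult[symmetric] mult.commute)
    also have "\<dots> \<le> ennreal (norm (K (x - y))) * (\<integral>\<^sup>+w. ennreal (?q (y, w)) \<partial>lborel)" by (intro mult_left_mono le) simp
    also have "\<dots> = (\<integral>\<^sup>+w. ennreal (norm (K (x - y))) * ennreal (?q (y, w)) \<partial>lborel)"
      using qm by (intro nn_integral_cmult[symmetric]) simp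
    also have "\<dots> = (\<integral>\<^sup>+w. (ennreal (norm (K (x - y))) * indicator (cball 0 Rx \<times> cball 0 Rv) (y, w)) * ennreal (?q (y, w)) \<partial>lborel)"
    proof (rule nn_integral_cong)
      fix w show "ennreal (norm (K (x - y))) * ennreal (?q (y, w)) = (ennreal (norm (K (x - y))) * indicator (cball 0 Rx \<times> cball 0 Rv) (y, w)) * ennreal (?q (y, w))"
      proof (cases "(y, w) \<in> cball 0 Rx \<times> cball 0 Rv")
        case True then show ?thesis by (simp only: indicator_simps mult_1_right)
      next
        case False then show ?thesis by (simp only: qs[OF False] ennreal_0 mult_zero_right)
      qed
    qed
    finally show "ennreal (norm (dens ?h y *\<^sub>R K (x - y))) \<le> \<dots>" .
  qed
  also have "\<dots> = (\<integral>\<^sup>+\<zeta>. (ennreal (norm (K (x - fst \<zeta>))) * indicator (cball 0 Rx \<times> cball 0 Rv) \<zeta>) * ennreal (?q \<zeta>) \<partial>(lborel \<Otimes>\<^sub>M lborel))"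
  proof -
    have qm[measurable]: "(\<lambda>\<zeta>. ennreal (?q \<zeta>)) \<in> borel_measurable (lborel \<Otimes>\<^sub>M lborel)"
      unfolding lborel_prod
      by (intro measurable_compose[OF borel_measurable_continuous_onI[OF qc, folded measurable_lborel2] measurable_ennreal])
    have [measurable]: "cball 0 Rx \<times> cball (0::'v) Rv \<in> sets (lborel \<Otimes>\<^sub>M lborel)" by measurable
    have "(\<lambda>\<zeta>. (ennreal (norm (K (x - fst \<zeta>))) * indicator (cball 0 Rx \<times> cball 0 Rv) \<zeta>) * ennreal (?q \<zeta>)) \<in> borel_measurable (lborel \<Otimes>\<^sub>M lborel)"
      by measurable
    from lborel.nn_integral_fst[OF this] show ?thesis by simp
  qed
  finally show ?thesis unfolding lborel_prod .
qed

lemma kernel_mass: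
  "(\<integral>\<^sup>+\<zeta>. ennreal (norm (K (x - fst \<zeta>))) * indicator (cball 0 Rx \<times> cball (0::'v) Rv) \<zeta> \<partial>lborel) \<le> ennreal (CK * vol)"
  "(\<integral>\<^sup>+\<zeta>. ennreal (norm (K (fst \<zeta> - y))) * indicator (cball 0 Rx \<times> cball (0::'v) Rv) \<zeta> \<partial>lborel) \<le> ennreal (CK * vol)"
proof -
  have gen: "(\<integral>\<^sup>+\<zeta>. ennreal (norm (K (\<phi> (fst \<zeta>)))) * indicator (cball 0 Rx \<times> cball (0::'v) Rv) \<zeta> \<partial>lborel) \<le> ennreal (CK * vol)"
    if \<phi>[measurable]: "\<phi> \<in> borel_measurable borel" and le: "(\<integral>\<^sup>+y\<in>cball 0 Rx. norm (K (\<phi> y)) \<partial>lborel) \<le> ennreal CK" for \<phi> :: "'x \<Rightarrow> 'x"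
  proof -
    have [measurable]: "cball 0 Rx \<times> cball (0::'v) Rv \<in> sets (lborel \<Otimes>\<^sub>M lborel)" by measurable
    have m: "(\<lambda>\<zeta>. ennreal (norm (K (\<phi> (fst \<zeta>)))) * indicator (cball 0 Rx \<times> cball (0::'v) Rv) \<zeta>) \<in> borel_measurable (lborel \<Otimes>\<^sub>M lborel)"
      by measurable
    have "(\<integral>\<^sup>+\<zeta>. ennreal (norm (K (\<phi> (fst \<zeta>)))) * indicator (cball 0 Rx \<times> cball (0::'v) Rv) \<zeta> \<partial>lborel)
      = (\<integral>\<^sup>+y. \<integral>\<^sup>+w. (ennreal (norm (K (\<phi> y))) * indicator (cball 0 Rx) y) * indicator (cball (0::'v) Rv) w \<partial>lborel \<partial>lborel)"
      using lborel.nn_integral_fst[OF m] by (simp add: lborel_prod[symmetric] indicator_times mult.assoc)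
    also have "\<dots> = (\<integral>\<^sup>+y. (ennreal (norm (K (\<phi> y))) * indicator (cball 0 Rx) y) * ennreal vol \<partial>lborel)"
    proof (rule nn_integral_cong)
      fix y
      have "emeasure lborel (cball (0::'v) Rv) = ennreal vol"
        unfolding vol_def using emeasure_bounded_finite[OF bounded_cball, of "0::'v" Rv] by (intro emeasure_eq_ennreal_measure) auto
      then show "(\<integral>\<^sup>+w. (ennreal (norm (K (\<phi> y))) * indicator (cball 0 Rx) y) * indicator (cball (0::'v) Rv) w \<partial>lborel)
          = (ennreal (norm (K (\<phi> y))) * indicator (cball 0 Rx) y) * ennreal vol"
        by (subst nn_integral_cmult_indicator) auto
    qed
    also have "\<dots> = (\<integral>\<^sup>+y\<in>cball 0 Rx. norm (K (\<phi> y)) \<partial>lborel) * ennreal vol" by (rule nn_integral_multc) measurable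
    also have "\<dots> \<le> ennreal CK * ennreal vol" by (intro mult_right_mono le) simp
    finally show ?thesis using CK_nonneg vol_nonneg by (simp add: ennreal_mult)
  qed
  show "(\<integral>\<^sup>+\<zeta>. ennreal (norm (K (x - fst \<zeta>))) * indicator (cball 0 Rx \<times> cball (0::'v) Rv) \<zeta> \<partial>lborel) \<le> ennreal (CK * vol)"
    by (rule gen[of "\<lambda>y. x - y"]) (measurable, rule K_int1)
  show "(\<integral>\<^sup>+\<zeta>. ennreal (norm (K (fst \<zeta> - y))) * indicator (cball 0 Rx \<times> cball (0::'v) Rv) \<zeta> \<partial>lborel) \<le> ennreal (CK * vol)"
    by (rule gen[of "\<lambda>z. z - y"]) (measurable, rule K_int2)
qed

text \<open>Schur's test needs bounded marginals in both variables, hence a kernel cut off in both.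
  The second cut-off may be inserted because q vanishes outside the domain.\<close>

lemma interaction_bound:
  fixes q :: "'x \<times> 'v \<Rightarrow> real"
  assumes qm: "q \<in> borel_measurable borel" and q0: "\<And>z. q z \<ge> 0" and qs: "\<And>z. z \<notin> cball 0 Rx \<times> cball 0 Rv \<Longrightarrow> q z = 0"
  shows "(\<integral>\<^sup>+z. ennreal (q z) * (\<integral>\<^sup>+\<zeta>. (ennreal (norm (K (fst z - fst \<zeta>))) * indicator (cball 0 Rx \<times> cball 0 Rv) \<zeta>) * ennreal (q \<zeta>) \<partial>lborel) \<partial>lborel)
    \<le> ennreal (CK * vol) * (\<integral>\<^sup>+z. ennreal ((q z)\<^sup>2) \<partial>lborel)"
proof -
  note [measurable] = qm
  let ?\<Omega> = "cball 0 Rx \<times> cball (0::'v) Rv"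
  define k where "k z \<zeta> = ennreal (norm (K (fst z - fst \<zeta>))) * indicator ?\<Omega> z * indicator ?\<Omega> \<zeta>" for z \<zeta> :: "'x \<times> 'v"
  have Om[measurable]: "?\<Omega> \<in> sets borel" by (intro borel_closed closed_Times) auto
  have fm: "(fst :: 'x \<times> 'v \<Rightarrow> 'x) \<in> borel_measurable borel"
    by (intro borel_measurable_continuous_onI continuous_intros)
  have km: "case_prod k \<in> borel_measurable (lborel \<Otimes>\<^sub>M lborel)"
  proof -
    have "(\<lambda>p :: ('x \<times> 'v) \<times> ('x \<times> 'v). fst (fst p) - fst (snd p)) \<in> borel_measurable (borel \<Otimes>\<^sub>M lborel)"
      by (intro measurable_pair_continuous continuous_intros)
    then have [measurable]: "(\<lambda>p :: ('x \<times> 'v) \<times> ('x \<times> 'v). fst (fst p) - fst (snd p)) \<in> borel_measurable (lborel \<Otimes>\<^sub>M lborel)"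
      by (simp cong: measurable_cong_sets sets_pair_measure_cong)
    show ?thesis unfolding k_def case_prod_beta by measurable
  qed
  have kz: "(\<lambda>\<zeta>. ennreal (norm (K (fst z - fst \<zeta>))) * indicator ?\<Omega> \<zeta> * ennreal (q \<zeta>)) \<in> borel_measurable lborel" for z :: "'x \<times> 'v"
  proof -
    have [measurable]: "(\<lambda>\<zeta> :: 'x \<times> 'v. fst z - fst \<zeta>) \<in> borel_measurable lborel" using fm by simp
    show ?thesis by measurable
  qed
  have "(\<integral>\<^sup>+z. ennreal (q z) * (\<integral>\<^sup>+\<zeta>. (ennreal (norm (K (fst z - fst \<zeta>))) * indicator ?\<Omega> \<zeta>) * ennreal (q \<zeta>) \<partial>lborel) \<partial>lborel)
    = (\<integral>\<^sup>+z. \<integral>\<^sup>+\<zeta>. k z \<zeta> * ennreal (q z) * ennreal (q \<zeta>) \<partial>lborel \<partial>lborel)"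
  proof (rule nn_integral_cong)
    fix z :: "'x \<times> 'v"
    show "ennreal (q z) * (\<integral>\<^sup>+\<zeta>. (ennreal (norm (K (fst z - fst \<zeta>))) * indicator ?\<Omega> \<zeta>) * ennreal (q \<zeta>) \<partial>lborel) = (\<integral>\<^sup>+\<zeta>. k z \<zeta> * ennreal (q z) * ennreal (q \<zeta>) \<partial>lborel)"
    proof (subst nn_integral_cmult[symmetric, OF kz], rule nn_integral_cong)
      fix \<zeta> :: "'x \<times> 'v"
      show "ennreal (q z) * (ennreal (norm (K (fst z - fst \<zeta>))) * indicator ?\<Omega> \<zeta> * ennreal (q \<zeta>)) = k z \<zeta> * ennreal (q z) * ennreal (q \<zeta>)"
      proof (cases "z \<in> ?\<Omega>")
        case True then show ?thesis by (simp only: k_def indicator_simps mult_1_right) (simp only: mult_ac)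
      next
        case False then show ?thesis using qs[OF False] by simp
      qed
    qed
  qed
  also have "\<dots> \<le> ennreal (CK * vol) * (\<integral>\<^sup>+z. ennreal ((q z)\<^sup>2) \<partial>lborel)"
  proof (rule schur_test[OF km qm q0])
    show "(\<integral>\<^sup>+\<zeta>. k z \<zeta> \<partial>lborel) \<le> ennreal (CK * vol)" for z
      by (rule order_trans[OF nn_integral_mono kernel_mass(1)[of "fst z"]]) (auto simp: k_def indicator_def)
    show "(\<integral>\<^sup>+z. k z \<zeta> \<partial>lborel) \<le> ennreal (CK * vol)" for \<zeta>
      by (rule order_trans[OF nn_integral_mono kernel_mass(2)[of "fst \<zeta>"]]) (auto simp: k_def indicator_def)
  qed
  finally show ?thesis .
qed

text \<open>The weight vanishes from T on, so no boundary term arises there, and before T its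
  negative derivative exceeds \<kappa> times the weight by exp (- \<kappa> t). To the left of 0 the
  exponential grows; the bounds start at -1, which leaves room for the steps of the difference
  quotients.\<close>

lemma energy_weight:
  fixes \<kappa> T :: real
  assumes \<kappa>: "\<kappa> \<ge> 0" and T: "T > 0"
  defines "chi \<equiv> \<lambda>t. exp (- (\<kappa> * t)) * max 0 (T - t)"
  shows "\<exists>D C. (\<forall>a b. a \<ge> -1 \<longrightarrow> b \<ge> -1 \<longrightarrow> \<bar>chi a - chi b\<bar> \<le> D * \<bar>a - b\<bar>) \<and> (\<forall>a. a \<ge> -1 \<longrightarrow> \<bar>chi a\<bar> \<le> C)"
    "t \<noteq> T \<Longrightarrow> (chi has_real_derivative (if t < T then - (exp (- (\<kappa> * t)) * (\<kappa> * (T - t) + 1)) else 0)) (at t)"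
proof -
  have e: "exp (- (\<kappa> * a)) \<le> exp \<kappa>" if "a \<ge> -1" for a
    using mult_left_mono[OF that \<kappa>] by simp
  have m: "max 0 (T - a) \<le> T + 1" if "a \<ge> -1" for a using that T by simp
  have el: "\<bar>exp (- (\<kappa> * a)) - exp (- (\<kappa> * b))\<bar> \<le> \<kappa> * exp \<kappa> * \<bar>a - b\<bar>" if ab: "a \<ge> -1" "b \<ge> -1" for a b
  proof -
    have "norm (exp (- (\<kappa> * a)) - exp (- (\<kappa> * b))) \<le> \<kappa> * exp \<kappa> * norm (a - b)"
    proof (rule field_differentiable_bound[of "{-1..}" _ "\<lambda>t. - \<kappa> * exp (- (\<kappa> * t))"])
      show "((\<lambda>t. exp (- (\<kappa> * t))) has_field_derivative - \<kappa> * exp (- (\<kappa> * z))) (at z within {-1..})" for z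
        by (auto intro!: derivative_eq_intros)
      show "norm (- \<kappa> * exp (- (\<kappa> * z))) \<le> \<kappa> * exp \<kappa>" if "z \<in> {-1..}" for z
        using e[of z] that \<kappa> by (simp add: abs_mult mult_left_mono)
    qed (use ab in auto)
    then show ?thesis by simp
  qed
  have A: "\<bar>chi a - chi b\<bar> \<le> (\<kappa> * exp \<kappa> * (T + 1) + exp \<kappa>) * \<bar>a - b\<bar>" if ab: "a \<ge> -1" "b \<ge> -1" for a b
  proof -
    have "chi a - chi b = (exp (- (\<kappa> * a)) - exp (- (\<kappa> * b))) * max 0 (T - a) + exp (- (\<kappa> * b)) * (max 0 (T - a) - max 0 (T - b))"
      by (simp add: chi_def algebra_simps)
    also have "\<bar>\<dots>\<bar> \<le> \<bar>exp (- (\<kappa> * a)) - exp (- (\<kappa> * b))\<bar> * max 0 (T - a) + exp (- (\<kappa> * b)) * \<bar>max 0 (T - a) - max 0 (T - b)\<bar>"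
      by (rule order_trans[OF abs_triangle_ineq]) (simp add: abs_mult)
    also have "\<dots> \<le> (\<kappa> * exp \<kappa> * \<bar>a - b\<bar>) * (T + 1) + exp \<kappa> * \<bar>a - b\<bar>"
      using el[OF ab] m[OF ab(1)] e[OF ab(2)] \<kappa> by (intro add_mono mult_mono) (auto simp: max_def)
    finally show ?thesis by (simp add: algebra_simps)
  qed
  have B: "\<bar>chi a\<bar> \<le> exp \<kappa> * (T + 1)" if "a \<ge> -1" for a
    using mult_mono[OF e[OF that] m[OF that]] by (simp add: chi_def abs_mult)
  have C: "(chi has_real_derivative (if t < T then - (exp (- (\<kappa> * t)) * (\<kappa> * (T - t) + 1)) else 0)) (at t)" if "t \<noteq> T" for t
  proof (cases "t < T")
    case True
    have "((\<lambda>t. exp (- (\<kappa> * t)) * (T - t)) has_real_derivative - (exp (- (\<kappa> * t)) * (\<kappa> * (T - t) + 1))) (at t)"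
      by (auto intro!: derivative_eq_intros simp: algebra_simps)
    then have "(chi has_real_derivative - (exp (- (\<kappa> * t)) * (\<kappa> * (T - t) + 1))) (at t)"
      by (rule has_field_derivative_transform_within_open[of _ _ _ "{..<T}"]) (use True in \<open>auto simp: chi_def\<close>)
    then show ?thesis using True by simp
  next
    case False
    have "(chi has_real_derivative 0) (at t)"
      by (rule has_field_derivative_transform_within_open[of "\<lambda>_. 0" _ _ "{T<..}"]) (use False that in \<open>auto simp: chi_def\<close>)
    then show ?thesis using False by simp
  qed
  show "\<exists>D C. (\<forall>a b. a \<ge> -1 \<longrightarrow> b \<ge> -1 \<longrightarrow> \<bar>chi a - chi b\<bar> \<le> D * \<bar>a - b\<bar>) \<and> (\<forall>a. a \<ge> -1 \<longrightarrow> \<bar>chi a\<bar> \<le> C)"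
    using A B by blast
  show "t \<noteq> T \<Longrightarrow> (chi has_real_derivative (if t < T then - (exp (- (\<kappa> * t)) * (\<kappa> * (T - t) + 1)) else 0)) (at t)"
    by (rule C)
qed

text \<open>
  Energy estimate for \<open>u = (f - g)\<^sup>2\<close>: each component of the drift is constant along its own
  coordinate direction, so the drift may be moved through the integral without differentiating it.
\<close>

lemma energy_identity:
  fixes u :: "real \<times> 'x \<times> 'v \<Rightarrow> real"
  assumes u: "L-lipschitz_on UNIV u" and us: "\<And>t x v. u (t, x, v) \<noteq> 0 \<Longrightarrow> 0 \<le> t \<and> norm x \<le> Rx \<and> norm v \<le> Rv"
    and ub: "\<And>p. \<bar>u p\<bar> \<le> Cu"
    and Em: "EF f \<in> borel_measurable borel" and Eb: "\<And>p. norm (EF f p) \<le> ME"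
    and Bm: "B \<in> borel_measurable borel" and Bb: "\<And>p. norm (B p) \<le> CB"
    and \<kappa>: "\<kappa> \<ge> 0" and T: "T > 0"
  defines "chi \<equiv> \<lambda>t. exp (- (\<kappa> * t)) * max 0 (T - t)"
    and "w \<equiv> \<lambda>p. (if fst p < T then exp (- (\<kappa> * fst p)) * (\<kappa> * (T - fst p) + 1) else 0)"
  shows "integrable lborel (\<lambda>p. chi (fst p) * (grad u p \<bullet> drift f B s p))" "integrable lborel (\<lambda>p. w p * u p)"
    "(LINT p|lborel. chi (fst p) * (grad u p \<bullet> drift f B s p)) = (LINT p|lborel. w p * u p)"
proof -
  obtain D C where chi: "\<And>a b. a \<ge> -1 \<Longrightarrow> b \<ge> -1 \<Longrightarrow> \<bar>chi a - chi b\<bar> \<le> D * \<bar>a - b\<bar>" "\<And>a. a \<ge> -1 \<Longrightarrow> \<bar>chi a\<bar> \<le> C"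
    "\<And>t. t \<noteq> T \<Longrightarrow> (chi has_real_derivative (if t < T then - (exp (- (\<kappa> * t)) * (\<kappa> * (T - t) + 1)) else 0)) (at t)"
  proof -
    obtain D C where "\<And>a b. a \<ge> -1 \<Longrightarrow> b \<ge> -1 \<Longrightarrow> \<bar>chi a - chi b\<bar> \<le> D * \<bar>a - b\<bar>" "\<And>a. a \<ge> -1 \<Longrightarrow> \<bar>chi a\<bar> \<le> C"
      using energy_weight(1)[OF \<kappa> T] unfolding chi_def by blast
    then show ?thesis using that energy_weight(2)[OF \<kappa> T] unfolding chi_def by blast
  qed
  have chiT: "chi t = 0" if "t \<ge> T" for t using that by (simp add: chi_def)
  have chic: "continuous_on UNIV chi" unfolding chi_def by (intro continuous_intros)
  have C0: "C \<ge> 0" using chi(2)[of 0] by linarith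
  \<comment> \<open>One unit of room on every side, because the quotients take steps of norm at most
    1. Beyond T + 1 both the weight and its backward quotients vanish.\<close>
  define S where "S = {-1..T+1} \<times> cball (0::'x) (Rx + 1) \<times> cball (0::'v) (Rv + 1)"
  have S: "compact S" unfolding S_def by (intro compact_Times) auto
  define c where "c b p = chi (fst p) * (drift f B s p \<bullet> b)" for b p
  have uc: "continuous_on UNIV u" by (rule lipschitz_on_continuous_on[OF u])
  have um[measurable]: "u \<in> borel_measurable borel" by (rule borel_measurable_continuous_onI[OF uc])
  have dm: "drift f B s \<in> borel_measurable borel"
  proof -
    have Jc: "continuous_on UNIV J" and Ic: "continuous_on UNIV I"
      using J(1) I(1) linear_continuous_on linear_conv_bounded_linear by auto
    have pm: "(\<lambda>p :: real \<times> 'x \<times> 'v. (fst p, fst (snd p))) \<in> borel_measurable borel"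
      by (intro borel_measurable_continuous_onI continuous_intros)
    have vm: "(\<lambda>p :: real \<times> 'x \<times> 'v. snd (snd p)) \<in> borel_measurable borel"
      by (intro borel_measurable_continuous_onI continuous_intros)
    have 1: "(\<lambda>p :: real \<times> 'x \<times> 'v. I (EF f (fst p, fst (snd p)))) \<in> borel_measurable borel"
      by (rule measurable_compose[OF measurable_compose[OF pm Em] borel_measurable_continuous_onI[OF Ic]])
    have 2: "(\<lambda>p :: real \<times> 'x \<times> 'v. W (snd (snd p)) (B (fst p, fst (snd p)))) \<in> borel_measurable borel"
    proof -
      have "continuous_on UNIV (\<lambda>q. W (fst q) (snd q))" by (intro bounded_bilinear.continuous_on[OF W(1)] continuous_intros)
      then have "(\<lambda>q. W (fst q) (snd q)) \<in> borel_measurable (borel \<Otimes>\<^sub>M borel)" unfolding borel_prod by (rule borel_measurable_continuous_onI)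
      from measurable_compose[OF measurable_Pair[OF vm measurable_compose[OF pm Bm]] this] show ?thesis by simp
    qed
    have 3: "(\<lambda>p :: real \<times> 'x \<times> 'v. J (snd (snd p))) \<in> borel_measurable borel"
      by (rule measurable_compose[OF vm borel_measurable_continuous_onI[OF Jc]])
    show ?thesis unfolding drift_def
      unfolding borel_prod[symmetric]
      by (intro measurable_Pair borel_measurable_scaleR borel_measurable_add measurable_const) 
        (use 1 2 3 in \<open>auto simp: borel_prod\<close>)
  qed
  have chim[measurable]: "chi \<in> borel_measurable borel" by (rule borel_measurable_continuous_onI[OF chic])
  have fstm[measurable]: "(fst :: real \<times> 'x \<times> 'v \<Rightarrow> real) \<in> borel_measurable borel"
    by (intro borel_measurable_continuous_onI continuous_intros)
  have cm: "c b \<in> borel_measurable borel" for b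
    unfolding c_def using dm by (intro borel_measurable_times borel_measurable_inner measurable_compose[OF fstm chim]) auto
  define Cd where "Cd = 1 + (\<mu> * (Rv + 1) + \<nu> * (ME + \<mu> * ((Rv + 1) * CB * CW)))"
  have ME0: "ME \<ge> 0" and CB0: "CB \<ge> 0" using order_trans[OF norm_ge_zero Eb] order_trans[OF norm_ge_zero Bb] by auto
  have drift_bd: "norm (drift f B s p) \<le> Cd" if p: "p \<in> S" for p
  proof -
    obtain t x v where pe: "p = (t, x, v)" by (cases p)
    have v: "norm v \<le> Rv + 1" using p by (simp add: pe S_def)
    have 1: "norm (mux s *\<^sub>R J v) \<le> \<mu> * (Rv + 1)" unfolding norm_scaleR
      using mu_le order_trans[OF J(2) v] by (intro mult_mono) auto
    have "norm (W v (B (t, x))) \<le> (Rv + 1) * CB * CW"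
      by (rule order_trans[OF CW(1)]) (use v Bb CB0 CW Rv in \<open>auto intro!: mult_mono\<close>)
    then have "norm (mux s *\<^sub>R W v (B (t, x))) \<le> \<mu> * ((Rv + 1) * CB * CW)" unfolding norm_scaleR
      using mu_le by (intro mult_mono) auto
    then have "norm (I (EF f (t, x)) + mux s *\<^sub>R W v (B (t, x))) \<le> ME + \<mu> * ((Rv + 1) * CB * CW)"
      using order_trans[OF I(2) Eb[of "(t, x)"]] by (intro order_trans[OF norm_triangle_ineq] add_mono)
    then have 2: "norm (muv s *\<^sub>R (I (EF f (t, x)) + mux s *\<^sub>R W v (B (t, x)))) \<le> \<nu> * (ME + \<mu> * ((Rv + 1) * CB * CW))"
      unfolding norm_scaleR using mu_le by (intro mult_mono) auto
    have "norm (drift f B s p) \<le> norm (1::real) + (norm (mux s *\<^sub>R J v) + norm (muv s *\<^sub>R (I (EF f (t, x)) + mux s *\<^sub>R W v (B (t, x)))))"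
      unfolding drift_def pe fst_conv snd_conv by (intro order_trans[OF norm_Pair_le] add_left_mono norm_Pair_le)
    then show ?thesis using 1 2 unfolding Cd_def by simp
  qed
  have near: "p \<in> {-1..} \<times> cball 0 (Rx + 1) \<times> cball 0 (Rv + 1)" if "u (p + r *\<^sub>R b) \<noteq> 0" "norm b \<le> 1" "0 \<le> r" "r \<le> 1" for p b r
  proof -
    obtain t x v where pe: "p = (t, x, v)" by (cases p)
    obtain b1 b2 b3 where be: "b = (b1, b2, b3)" by (cases b)
    have "norm (r *\<^sub>R b) \<le> 1" using that by (simp add: mult_le_one)
    then have "\<bar>r * b1\<bar> \<le> 1" "norm (r *\<^sub>R b2) \<le> 1" "norm (r *\<^sub>R b3) \<le> 1"
      using norm_fst_le[of "r * b1" "(r *\<^sub>R b2, r *\<^sub>R b3)"] norm_snd_le[of "(r *\<^sub>R b2, r *\<^sub>R b3)" "r * b1"]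
        norm_fst_le[of "r *\<^sub>R b2" "r *\<^sub>R b3"] norm_snd_le[of "r *\<^sub>R b3" "r *\<^sub>R b2"]
      unfolding be scaleR_Pair real_norm_def real_scaleR_def by linarith+
    moreover have "0 \<le> t + r * b1" "norm (x + r *\<^sub>R b2) \<le> Rx" "norm (v + r *\<^sub>R b3) \<le> Rv"
      using us[of "t + r * b1" "x + r *\<^sub>R b2" "v + r *\<^sub>R b3"] that(1) by (auto simp: pe be)
    ultimately show ?thesis
      using norm_triangle_ineq4[of "x + r *\<^sub>R b2" "r *\<^sub>R b2"] norm_triangle_ineq4[of "v + r *\<^sub>R b3" "r *\<^sub>R b3"] by (auto simp: pe)
  qed
  have inv2: "(0::real) \<le> 1 / 2 ^ n" "1 / 2 ^ n \<le> (1::real)" for n by auto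
  have nearS: "u p = 0 \<and> dyadic_quot u b n p = 0" if b: "norm b \<le> 1" and p: "p \<notin> {-1..} \<times> cball 0 (Rx + 1) \<times> cball 0 (Rv + 1)" for b n p
  proof -
    have 1: "u p = 0" using near[of p 0 b] p b by auto
    have "u (p + (1 / 2 ^ n) *\<^sub>R b) = 0" using near[of p "1 / 2 ^ n" b] p b inv2 by blast
    then show ?thesis using 1 by (simp add: dyadic_quot_def divide_inverse)
  qed
  have out12: "c b p * dyadic_quot u b n p = 0 \<and> c b p * u p = 0" if b: "norm b \<le> 1" and p: "p \<notin> S" for b n p
  proof (cases "p \<in> {-1..} \<times> cball 0 (Rx + 1) \<times> cball 0 (Rv + 1)")
    case True
    then have "fst p \<ge> T" using p by (auto simp: S_def)
    then show ?thesis by (simp add: c_def chiT)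
  qed (use nearS[OF b] in simp)
  have cbd: "\<bar>c b p\<bar> \<le> C * Cd" if b: "norm b \<le> 1" and p: "p \<in> S" for b p
  proof -
    have "\<bar>drift f B s p \<bullet> b\<bar> \<le> norm (drift f B s p) * norm b" by (rule Cauchy_Schwarz_ineq2)
    also have "\<dots> \<le> Cd * 1" using drift_bd[OF p] b by (intro mult_mono) (auto intro: order_trans[OF norm_ge_zero])
    finally show ?thesis unfolding c_def abs_mult
      using chi(2)[of "fst p"] p C0 by (intro mult_mono) (auto simp: S_def)
  qed
  \<comment> \<open>A coefficient that is constant in the direction b has vanishing quotients in
    this direction, so integration by parts leaves nothing.\<close>
  have space: "integrable lborel (\<lambda>p. c b p * dyadic_deriv u b p)" "(LINT p|lborel. c b p * dyadic_deriv u b p) = 0"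
    if b: "norm b \<le> 1" and inv: "\<And>p r. c b (p + r *\<^sub>R b) = c b p" for b
  proof -
    have dq0: "dyadic_quot (c b) (-b) n p = 0" for n p
      using inv[of p "- (1 / 2 ^ n)"] by (simp add: dyadic_quot_def divide_inverse)
    have h: "c b p * dyadic_quot u b n p = 0" "c b p * u p = 0" "u p * dyadic_quot (c b) (-b) n p = 0" if "p \<notin> S" for p n
      using out12[OF b that] dq0 by auto
    have l: "AE p in lborel. (\<lambda>n. u p * dyadic_quot (c b) (-b) n p) \<longlonglongrightarrow> 0" by (simp add: dq0)
    have bb: "\<bar>u p * dyadic_quot (c b) (- b) n p\<bar> \<le> 0" for p n by (simp add: dq0)
    note R = integral_by_parts_translation[OF u cm[of b] S h cbd[OF b] bb l borel_measurable_const]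
    show "integrable lborel (\<lambda>p. c b p * dyadic_deriv u b p)" by (rule R(1))
    show "(LINT p|lborel. c b p * dyadic_deriv u b p) = 0" using R(3) by simp
  qed
  define e1 where "e1 = (1::real, 0::'x \<times> 'v)"
  have ne1: "norm e1 \<le> 1" by (simp add: e1_def norm_Pair)
  have ce1: "c e1 p = chi (fst p)" for p by (simp add: c_def e1_def drift_def)
  have time: "integrable lborel (\<lambda>p. c e1 p * dyadic_deriv u e1 p)" "integrable lborel (\<lambda>p. w p * u p)"
    "(LINT p|lborel. c e1 p * dyadic_deriv u e1 p) = (LINT p|lborel. w p * u p)"
  proof -
    have dqc: "dyadic_quot (c e1) (- e1) n p = dyadic_quot chi (-1) n (fst p)" for n p
      by (simp only: dyadic_quot_def ce1) (simp add: e1_def)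
    have bdchi: "\<bar>dyadic_quot chi (-1) n t\<bar> \<le> D" if "t \<ge> 0" for n t
    proof -
      have "\<bar>chi (t - 1 / 2 ^ n) - chi t\<bar> \<le> D * \<bar>1 / 2 ^ n\<bar>"
        using chi(1)[of "t - 1 / 2 ^ n" t] that inv2[of n] by auto
      then have "2 ^ n * \<bar>chi (t - 1 / 2 ^ n) - chi t\<bar> \<le> 2 ^ n * (D * \<bar>1 / 2 ^ n\<bar>)" by (intro mult_left_mono) auto
      also have "\<dots> = D" by simp
      finally show ?thesis by (simp add: dyadic_quot_def divide_inverse abs_mult)
    qed
    have D0: "D \<ge> 0" using bdchi[of 0 0] by linarith
    have h3: "u p * dyadic_quot (c e1) (- e1) n p = 0" if p: "p \<notin> S" for p n
    proof (cases "p \<in> {-1..} \<times> cball 0 (Rx + 1) \<times> cball 0 (Rv + 1)")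
      case True
      then have "fst p > T + 1" using p by (auto simp: S_def)
      then have "T \<le> fst p" "T \<le> fst p - 1 / 2 ^ n" using inv2[of n] by linarith+
      then have "chi (fst p) = 0" "chi (fst p - 1 / 2 ^ n) = 0" by (simp_all add: chiT)
      then show ?thesis unfolding dqc by (simp add: dyadic_quot_def divide_inverse)
    qed (use nearS[OF ne1] in simp)
    have bb: "\<bar>u p * dyadic_quot (c e1) (- e1) n p\<bar> \<le> Cu * D" for p n
    proof (cases "u p = 0")
      case True
      then show ?thesis using D0 order_trans[OF abs_ge_zero ub] by simp
    next
      case False
      then have "fst p \<ge> 0" using us[of "fst p" "fst (snd p)" "snd (snd p)"] by simp
      then show ?thesis unfolding dqc abs_mult
        using ub bdchi D0 order_trans[OF abs_ge_zero ub] by (intro mult_mono) auto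
    qed
    have l: "AE p in lborel. (\<lambda>n. u p * dyadic_quot (c e1) (- e1) n p) \<longlonglongrightarrow> w p * u p"
      using AE_fst_neq[of T]
    proof eventually_elim
      case (elim p)
      define d where "d = (if fst p < T then - (exp (- (\<kappa> * fst p)) * (\<kappa> * (T - fst p) + 1)) else 0)"
      have "(chi has_derivative (\<lambda>h. d * h)) (at (fst p))"
        using chi(3)[OF elim] by (simp add: has_field_derivative_def d_def)
      from dyadic_quot_tendsto[OF this, of "-1"] have "(\<lambda>n. u p * dyadic_quot (c e1) (- e1) n p) \<longlonglongrightarrow> u p * (d * -1)"
        unfolding dqc by (intro tendsto_intros)
      moreover have "u p * (d * -1) = w p * u p" by (simp add: w_def d_def)
      ultimately show ?case by simp
    qed
    have wm: "(\<lambda>p. w p * u p) \<in> borel_measurable borel" unfolding w_def by measurable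
    have h12: "c e1 p * dyadic_quot u e1 n p = 0" "c e1 p * u p = 0" if "p \<notin> S" for p n using out12[OF ne1 that] by auto
    note R = integral_by_parts_translation[OF u cm[of e1] S h12 h3 cbd[OF ne1] bb l wm]
    show "integrable lborel (\<lambda>p. c e1 p * dyadic_deriv u e1 p)" by (rule R(1))
    show "integrable lborel (\<lambda>p. w p * u p)" by (rule R(2))
    show "(LINT p|lborel. c e1 p * dyadic_deriv u e1 p) = (LINT p|lborel. w p * u p)" by (rule R(3))
  qed
  have e1B: "e1 \<in> Basis" by (simp add: e1_def Basis_prod_def)
  have inv: "c b (p + r *\<^sub>R b) = c b p" if b: "b \<in> Basis - {e1}" for b p r
  proof -
    obtain t x v where pe: "p = (t, x, v)" by (cases p)
    consider e where "b = (0, e, 0)" | e where "b = (0, 0, e)" 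
      using b by (auto simp: Basis_prod_def e1_def)
    then show ?thesis
    proof cases
      case (1 e)
      then show ?thesis by (simp add: c_def drift_def pe)
    next
      case (2 e)
      \<comment> \<open>Linearity in the first argument and \<open>e \<bullet> W e z = 0\<close>: no
        component of the magnetic force depends on its own velocity coordinate.\<close>
      have "W (v + r *\<^sub>R e) z \<bullet> e = W v z \<bullet> e" for z
        using W(2)[of e z] by (simp add: bounded_bilinear.add_left[OF W(1)] bounded_bilinear.scaleR_left[OF W(1)] inner_add_left inner_add_right inner_commute)
      then show ?thesis using 2 by (simp add: c_def drift_def pe inner_add_left)
    qed
  qed
  have nb: "norm b \<le> 1" if "b \<in> Basis" for b :: "real \<times> 'x \<times> 'v" using that by simp
  have int_all: "integrable lborel (\<lambda>p. c b p * dyadic_deriv u b p)" if b: "b \<in> Basis" for b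
    using time(1) space(1)[OF nb[OF b] inv] b by (cases "b = e1") auto
  have expand: "chi (fst p) * (grad u p \<bullet> drift f B s p) = (\<Sum>b\<in>Basis. c b p * dyadic_deriv u b p)" for p
    by (simp add: grad_inner c_def sum_distrib_left mult.assoc)
  show "integrable lborel (\<lambda>p. chi (fst p) * (grad u p \<bullet> drift f B s p))"
    unfolding expand using int_all by (intro Bochner_Integration.integrable_sum)
  show "integrable lborel (\<lambda>p. w p * u p)" by (rule time(2))
  have "(LINT p|lborel. chi (fst p) * (grad u p \<bullet> drift f B s p)) = (\<Sum>b\<in>Basis. LINT p|lborel. c b p * dyadic_deriv u b p)"
    unfolding expand by (rule Bochner_Integration.integral_sum[OF int_all])
  also have "\<dots> = (LINT p|lborel. c e1 p * dyadic_deriv u e1 p) + (\<Sum>b\<in>Basis - {e1}. LINT p|lborel. c b p * dyadic_deriv u b p)"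
    by (rule sum.remove[OF finite_Basis e1B])
  also have "(\<Sum>b\<in>Basis - {e1}. LINT p|lborel. c b p * dyadic_deriv u b p) = 0"
    by (rule sum.neutral) (use space(2)[OF nb inv] in auto)
  finally show "(LINT p|lborel. chi (fst p) * (grad u p \<bullet> drift f B s p)) = (LINT p|lborel. w p * u p)"
    using time(3) by simp
qed

text \<open>Applied to f - g, the drift of f leaves only the difference of the electric forces times
  the velocity gradient of g, which is at most L. After multiplication with 2 (f - g) and the
  weight, the interaction term is at most \<kappa> times the weighted square by Schur's test. The
  energy identity produces strictly more than this unless the difference vanishes before T; time T
  follows by continuity.\<close>

theorem lipschitz_solutions_unique:
  fixes f g :: "species \<Rightarrow> real \<times> 'x \<times> 'v \<Rightarrow> real"
  assumes f: "\<And>s. L-lipschitz_on UNIV (f s)" and g: "\<And>s. L-lipschitz_on UNIV (g s)"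
    and fs: "\<And>s t. phase_supported (\<lambda>z. f s (t, z))" and gs: "\<And>s t. phase_supported (\<lambda>z. g s (t, z))"
    and fb: "\<And>s p. \<bar>f s p\<bar> \<le> M" and gb: "\<And>s p. \<bar>g s p\<bar> \<le> M"
    and init: "\<And>s t z. t \<le> 0 \<Longrightarrow> f s (t, z) = g s (t, z)"
    and Bm: "B \<in> borel_measurable borel" and Bb: "\<And>p. norm (B p) \<le> CB" and T: "T > 0"
    and eqf: "AE p in lborel. 0 < fst p \<and> fst p < T \<longrightarrow> (\<forall>s. grad (f s) p \<bullet> drift f B s p = 0)"
    and eqg: "AE p in lborel. 0 < fst p \<and> fst p < T \<longrightarrow> (\<forall>s. grad (g s) p \<bullet> drift g B s p = 0)"
  shows "0 \<le> t \<Longrightarrow> t \<le> T \<Longrightarrow> f s (t, z) = g s (t, z)"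
proof -
  have L0: "L \<ge> 0" using lipschitz_on_nonneg[OF f] .
  have M0: "M \<ge> 0" using order_trans[OF abs_ge_zero fb] .
  have fc: "continuous_on UNIV (f s)" and gc: "continuous_on UNIV (g s)" for s
    using lipschitz_on_continuous_on[OF f] lipschitz_on_continuous_on[OF g] by auto
  define h where "h s p = f s p - g s p" for s p
  define u where "u s p = (h s p)\<^sup>2" for s p
  have hb: "\<bar>h s p\<bar> \<le> 2 * M" for s p using fb[of s p] gb[of s p] unfolding h_def by linarith
  have ulip: "(2 * L * (4 * M))-lipschitz_on UNIV (u s)" for s
  proof (rule lipschitz_onI)
    fix p q
    have "\<bar>f s p - f s q\<bar> \<le> L * dist p q" "\<bar>g s p - g s q\<bar> \<le> L * dist p q"
      using lipschitz_onD[OF f, of p q s] lipschitz_onD[OF g, of p q s] by (auto simp: dist_real_def)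
    then have "\<bar>h s p - h s q\<bar> \<le> 2 * L * dist p q" unfolding h_def by linarith
    moreover have "\<bar>h s p + h s q\<bar> \<le> 4 * M" using hb[of s p] hb[of s q] by linarith
    ultimately have "\<bar>h s p - h s q\<bar> * \<bar>h s p + h s q\<bar> \<le> (2 * L * dist p q) * (4 * M)" using L0 by (intro mult_mono) auto
    moreover have "u s p - u s q = (h s p - h s q) * (h s p + h s q)" by (simp add: u_def power2_eq_square algebra_simps)
    ultimately show "dist (u s p) (u s q) \<le> 2 * L * (4 * M) * dist p q" by (simp add: dist_real_def abs_mult mult_ac)
  qed (use L0 M0 in simp)
  have uc: "continuous_on UNIV (u s)" for s by (rule lipschitz_on_continuous_on[OF ulip])
  have hc: "continuous_on UNIV (h s)" for s unfolding h_def by (intro continuous_intros fc gc)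
  have u0: "u s p \<ge> 0" for s p by (simp add: u_def)
  have ub: "\<bar>u s p\<bar> \<le> (2 * M)\<^sup>2" for s p
    using power_mono[OF hb, of s p 2] by (simp add: u_def)
  have hs: "norm x \<le> Rx \<and> norm v \<le> Rv" if "h s (t, x, v) \<noteq> 0" for s t x v
  proof -
    have "f s (t, x, v) \<noteq> 0 \<or> g s (t, x, v) \<noteq> 0" using that by (auto simp: h_def)
    then show ?thesis using fs[of s t] gs[of s t] unfolding phase_supported_def by blast
  qed
  have us: "0 \<le> t \<and> norm x \<le> Rx \<and> norm v \<le> Rv" if "u s (t, x, v) \<noteq> 0" for s t x v
  proof -
    have "h s (t, x, v) \<noteq> 0" using that by (auto simp: u_def)
    moreover have "t > 0" using init[of t s] \<open>h s (t, x, v) \<noteq> 0\<close> by (force simp: h_def)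
    ultimately show ?thesis using hs[of s t x v] by simp
  qed
  \<comment> \<open>One factor 2 is from the derivative of the square, the other from (a + b)^2
    \<le> 2 (a^2 + b^2) for the two species; L bounds the gradient of g, \<nu> the force
    coefficients, and \<open>CK * vol\<close> is the constant of Schur's test.\<close>
  define \<kappa> where "\<kappa> = 4 * L * \<nu> * CK * vol"
  have \<kappa>: "\<kappa> \<ge> 0" using L0 mu_le CK_nonneg vol_nonneg by (simp add: \<kappa>_def)
  define chi where "chi t = exp (- (\<kappa> * t)) * max 0 (T - t)" for t
  define w where "w p = (if fst p < T then exp (- (\<kappa> * fst p)) * (\<kappa> * (T - fst p) + 1) else 0)" for p :: "real \<times> 'x \<times> 'v"
  have chi0: "chi t \<ge> 0" for t by (simp add: chi_def)
  have chic: "continuous_on UNIV chi" unfolding chi_def by (intro continuous_intros)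
  have chim[measurable]: "chi \<in> borel_measurable borel" by (rule borel_measurable_continuous_onI[OF chic])
  have EFb: "norm (EF f p) \<le> CK * (2 * M * vol)" for p
  proof -
    let ?F = "\<lambda>z. f Plus (fst p, z) - f Minus (fst p, z)"
    have Fc: "continuous_on UNIV ?F" by (intro continuous_intros continuous_on_compose2[OF fc]) auto
    have Fs: "phase_supported ?F" by (intro phase_supported_diff fs)
    have Fb: "\<bar>?F z\<bar> \<le> 2 * M" for z using fb[of Plus "(fst p, z)"] fb[of Minus "(fst p, z)"] by linarith
    show ?thesis unfolding EF_def
      by (rule integrable_field(2)[OF dens_measurable[OF Fc Fs] dens_bound[OF Fc Fs Fb] dens_outside[OF Fc Fs]])
  qed
  define A where "A s p = chi (fst p) * (grad (u s) p \<bullet> drift f B s p)" for s p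
  have Ai: "integrable lborel (A s)" and wi: "integrable lborel (\<lambda>p. w p * u s p)"
    and Aw: "(LINT p|lborel. A s p) = (LINT p|lborel. w p * u s p)" for s
  proof -
    note EI = energy_identity[OF ulip[of s] us[of s] ub[of s] EF_measurable[OF f] EFb Bm Bb \<kappa> T, folded chi_def w_def]
    show "integrable lborel (A s)" unfolding A_def[abs_def] by (rule EI(1))
    show "integrable lborel (\<lambda>p. w p * u s p)" by (rule EI(2))
    show "(LINT p|lborel. A s p) = (LINT p|lborel. w p * u s p)" unfolding A_def by (rule EI(3))
  qed
  define Q where "Q p = \<bar>h Plus p\<bar> + \<bar>h Minus p\<bar>" for p
  have Qc: "continuous_on UNIV Q" unfolding Q_def by (intro continuous_intros hc)
  have Qm[measurable]: "Q \<in> borel_measurable borel" by (rule borel_measurable_continuous_onI[OF Qc])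
  have Q0: "Q p \<ge> 0" for p by (simp add: Q_def)
  have Qu: "(Q p)\<^sup>2 \<le> 2 * (u Plus p + u Minus p)" for p
    using sum_squares_bound[of "\<bar>h Plus p\<bar>" "\<bar>h Minus p\<bar>"] by (simp add: Q_def u_def power2_sum)
  have Qs: "Q (t, z) = 0" if "z \<notin> cball 0 Rx \<times> cball 0 Rv" for t z
  proof -
    obtain x v where z: "z = (x, v)" by (cases z)
    have "h s (t, x, v) = 0" for s using that hs[of s t x v] by (auto simp: z)
    then show ?thesis by (simp add: Q_def z)
  qed
  define NN where "NN p = (\<integral>\<^sup>+\<zeta>. (ennreal (norm (K (fst (snd p) - fst \<zeta>))) * indicator (cball 0 Rx \<times> cball 0 Rv) \<zeta>) * ennreal (Q (fst p, \<zeta>)) \<partial>lborel)" for p :: "real \<times> 'x \<times> 'v"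
  have Ebound: "ennreal (norm (EF f (fst p, fst (snd p)) - EF g (fst p, fst (snd p)))) \<le> NN p" for p
    using EF_difference_le[OF fc gc fs gs fb gb, where t="fst p" and x="fst (snd p)"] by (simp add: NN_def Q_def h_def)
  have pointwise: "AE p in lborel. A Plus p + A Minus p \<le> (2 * L * \<nu> * chi (fst p)) * (Q p * norm (EF f (fst p, fst (snd p)) - EF g (fst p, fst (snd p))))"
  proof -
    have all_s: "(AE p in lborel. P Plus p) \<Longrightarrow> (AE p in lborel. P Minus p) \<Longrightarrow> (AE p in lborel. \<forall>s. P s p)" for P :: "species \<Rightarrow> real \<times> 'x \<times> 'v \<Rightarrow> bool"
    proof -
      assume "AE p in lborel. P Plus p" "AE p in lborel. P Minus p"
      then show "AE p in lborel. \<forall>s. P s p" by eventually_elim (metis species.exhaust)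
    qed
    have d: "AE p in lborel. \<forall>s. (f s has_derivative (\<lambda>k. grad (f s) p \<bullet> k)) (at p) \<and> (g s has_derivative (\<lambda>k. grad (g s) p \<bullet> k)) (at p)
        \<and> (u s has_derivative (\<lambda>k. grad (u s) p \<bullet> k)) (at p) \<and> norm (grad (g s) p) \<le> L"
      by (rule all_s; use rademacher[OF f] rademacher[OF g] rademacher[OF ulip] AE_grad_bound[OF g] in \<open>intro AE_conjI; blast\<close>)
    from d eqf eqg AE_fst_neq[of 0] show ?thesis
    proof eventually_elim
      case (elim p)
      let ?E = "EF f (fst p, fst (snd p)) - EF g (fst p, fst (snd p))"
      consider "fst p < 0" | "0 < fst p" "fst p < T" | "fst p \<ge> T" using elim(4) by linarith
      then show ?case
      proof cases
        case 1
        \<comment> \<open>For negative times f and g coincide on an open set.\<close>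
        have "A s p = 0" for s
        proof -
          have "(u s has_derivative (\<lambda>_. 0)) (at p)"
          proof (rule has_derivative_transform_within_open[OF has_derivative_const[of 0]])
            show "open ({..<0::real} \<times> (UNIV :: ('x \<times> 'v) set))" by (intro open_Times) auto
            show "p \<in> {..<0::real} \<times> (UNIV :: ('x \<times> 'v) set)" using 1 by (cases p) auto
            show "0 = u s q" if "q \<in> {..<0::real} \<times> (UNIV :: ('x \<times> 'v) set)" for q
              using that init[of "fst q" s "snd q"] by (auto simp: u_def h_def)
          qed
          then have "grad (u s) p \<bullet> drift f B s p = 0" using grad_unique elim(1) by blast
          then show ?thesis by (simp add: A_def)
        qed
        then show ?thesis using L0 mu_le chi0 Q0 by simp
      next
        case 2
        have one: "A s p \<le> 2 * L * \<nu> * chi (fst p) * (\<bar>h s p\<bar> * norm ?E)" for s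
        proof -
          have df: "(f s has_derivative (\<lambda>k. grad (f s) p \<bullet> k)) (at p)" and dg: "(g s has_derivative (\<lambda>k. grad (g s) p \<bullet> k)) (at p)"
            and du: "(u s has_derivative (\<lambda>k. grad (u s) p \<bullet> k)) (at p)" and bg: "norm (grad (g s) p) \<le> L"
            using elim(1) by auto
          have "((\<lambda>q. (f s q - g s q) * (f s q - g s q)) has_derivative
              (\<lambda>k. (f s p - g s p) * (grad (f s) p \<bullet> k - grad (g s) p \<bullet> k) + (grad (f s) p \<bullet> k - grad (g s) p \<bullet> k) * (f s p - g s p))) (at p)"
            by (intro has_derivative_mult has_derivative_diff df dg)
          then have "(u s has_derivative (\<lambda>k. 2 * h s p * (grad (f s) p \<bullet> k - grad (g s) p \<bullet> k))) (at p)"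
            by (simp add: u_def[abs_def] h_def power2_eq_square algebra_simps)
          then have "grad (u s) p \<bullet> drift f B s p = 2 * h s p * (grad (f s) p \<bullet> drift f B s p - grad (g s) p \<bullet> drift f B s p)"
            by (rule grad_unique[OF du])
          also have "grad (f s) p \<bullet> drift f B s p = 0" using elim(2) 2 by blast
          also have "grad (g s) p \<bullet> drift f B s p = grad (g s) p \<bullet> (0, 0, muv s *\<^sub>R I ?E)"
          proof -
            \<comment> \<open>The magnetic parts cancel, and the drifts differ by the electric force
              alone.\<close>
            have "drift f B s p = drift g B s p + (0, 0, muv s *\<^sub>R I ?E)"
              by (simp add: drift_def linear_diff[OF I(1)] algebra_simps)
            then show ?thesis using elim(3) 2 by (simp add: inner_add_right)
          qed
          finally have eq: "grad (u s) p \<bullet> drift f B s p = - (2 * h s p * (grad (g s) p \<bullet> (0, 0, muv s *\<^sub>R I ?E)))" by simp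
          have "\<bar>grad (g s) p \<bullet> (0, 0, muv s *\<^sub>R I ?E)\<bar> \<le> norm (grad (g s) p) * norm (0::real, 0::'x, muv s *\<^sub>R I ?E)"
            by (rule Cauchy_Schwarz_ineq2)
          also have "\<dots> \<le> L * (\<nu> * norm ?E)"
          proof (rule mult_mono[OF bg])
            have "norm (0::real, 0::'x, muv s *\<^sub>R I ?E) = \<bar>muv s\<bar> * norm (I ?E)" by (simp add: norm_Pair)
            also have "\<dots> \<le> \<nu> * norm ?E" using mu_le I by (intro mult_mono) auto
            finally show "norm (0::real, 0::'x, muv s *\<^sub>R I ?E) \<le> \<nu> * norm ?E" .
          qed (use L0 in auto)
          finally have b1: "\<bar>grad (g s) p \<bullet> (0, 0, muv s *\<^sub>R I ?E)\<bar> \<le> L * (\<nu> * norm ?E)" .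
          have "grad (u s) p \<bullet> drift f B s p \<le> \<bar>2 * h s p * (grad (g s) p \<bullet> (0, 0, muv s *\<^sub>R I ?E))\<bar>" unfolding eq by linarith
          also have "\<dots> = 2 * \<bar>h s p\<bar> * \<bar>grad (g s) p \<bullet> (0, 0, muv s *\<^sub>R I ?E)\<bar>" by (simp add: abs_mult)
          also have "\<dots> \<le> 2 * \<bar>h s p\<bar> * (L * (\<nu> * norm ?E))" by (intro mult_left_mono b1) auto
          finally have "chi (fst p) * (grad (u s) p \<bullet> drift f B s p) \<le> chi (fst p) * (2 * \<bar>h s p\<bar> * (L * (\<nu> * norm ?E)))"
            by (intro mult_left_mono chi0)
          then show ?thesis by (simp add: A_def mult_ac)
        qed
        show ?thesis using one[of Plus] one[of Minus] by (simp add: Q_def algebra_simps)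
      next
        case 3
        then have "chi (fst p) = 0" by (simp add: chi_def)
        then show ?thesis by (simp add: A_def)
      qed
    qed
  qed
  define U where "U p = u Plus p + u Minus p" for p
  have Uc: "continuous_on UNIV U" unfolding U_def by (intro continuous_intros uc)
  have U0: "U p \<ge> 0" for p using u0 by (simp add: U_def)
  have chiU: "integrable lborel (\<lambda>p. chi (fst p) * U p)"
  proof (rule integrable_continuous_compact_support[where S="{0..T} \<times> cball (0::'x) Rx \<times> cball (0::'v) Rv"])
    show "continuous_on UNIV (\<lambda>p. chi (fst p) * U p)" by (intro continuous_intros Uc continuous_on_compose2[OF chic]) auto
    show "compact ({0..T} \<times> cball (0::'x) Rx \<times> cball (0::'v) Rv)" by (intro compact_Times) auto
    fix p assume p: "p \<notin> {0..T} \<times> cball (0::'x) Rx \<times> cball (0::'v) Rv"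
    obtain t x v where pe: "p = (t, x, v)" by (cases p)
    show "chi (fst p) * U p = 0"
    proof (cases "t > T")
      case True then show ?thesis by (simp add: pe chi_def)
    next
      case False
      then have "u s p = 0" for s using us[of s t x v] p by (auto simp: pe)
      then show ?thesis by (simp add: U_def)
    qed
  qed
  have nn: "(\<integral>\<^sup>+p. ennreal (A Plus p + A Minus p) \<partial>lborel) \<le> ennreal (\<kappa> * (LINT p|lborel. chi (fst p) * U p))"
  proof -
    let ?c = "\<lambda>t. ennreal (2 * L * \<nu> * chi t)"
    have Qm2: "(\<lambda>q :: (real \<times> 'x \<times> 'v) \<times> 'x \<times> 'v. ennreal (Q (fst (fst q), snd q))) \<in> borel_measurable (borel \<Otimes>\<^sub>M lborel)"
      by (intro measurable_compose[OF measurable_pair_continuous measurable_ennreal] continuous_on_compose2[OF Qc] continuous_intros) auto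
    have NNm: "NN \<in> borel_measurable borel"
    proof -
      have Om: "cball 0 Rx \<times> cball (0::'v) Rv \<in> sets borel" by (intro borel_closed closed_Times) auto
      have [measurable]: "(\<lambda>q :: (real \<times> 'x \<times> 'v) \<times> 'x \<times> 'v. K (fst (snd (fst q)) - fst (snd q))) \<in> borel_measurable (borel \<Otimes>\<^sub>M lborel)"
        by (intro measurable_compose[OF measurable_pair_continuous K_measurable] continuous_intros)
      have 1: "(\<lambda>q :: (real \<times> 'x \<times> 'v) \<times> 'x \<times> 'v. ennreal (norm (K (fst (snd (fst q)) - fst (snd q))))) \<in> borel_measurable (borel \<Otimes>\<^sub>M lborel)"
        by measurable
      have 2: "(\<lambda>q :: (real \<times> 'x \<times> 'v) \<times> 'x \<times> 'v. indicator (cball 0 Rx \<times> cball (0::'v) Rv) (snd q) :: ennreal) \<in> borel_measurable (borel \<Otimes>\<^sub>M lborel)"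
        using Om by (intro measurable_compose[OF measurable_snd] borel_measurable_indicator) simp
      have "(\<lambda>(p :: real \<times> 'x \<times> 'v, \<zeta>). ennreal (norm (K (fst (snd p) - fst \<zeta>))) * indicator (cball 0 Rx \<times> cball 0 Rv) \<zeta> * ennreal (Q (fst p, \<zeta>))) \<in> borel_measurable (borel \<Otimes>\<^sub>M lborel)"
        unfolding case_prod_beta by (intro borel_measurable_times_ennreal 1 2 Qm2)
      from lborel.borel_measurable_nn_integral[OF this] show ?thesis by (simp add: NN_def[abs_def])
    qed
    have cm: "(\<lambda>p :: real \<times> 'x \<times> 'v. ?c (fst p)) \<in> borel_measurable borel"
      by (intro measurable_compose[OF borel_measurable_continuous_onI measurable_ennreal] continuous_intros continuous_on_compose2[OF chic]) auto
    have "(\<integral>\<^sup>+p. ennreal (A Plus p + A Minus p) \<partial>lborel) \<le> (\<integral>\<^sup>+p. ?c (fst p) * (ennreal (Q p) * NN p) \<partial>lborel)"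
    proof (rule nn_integral_mono_AE)
      show "AE p in lborel. ennreal (A Plus p + A Minus p) \<le> ?c (fst p) * (ennreal (Q p) * NN p)"
        using pointwise
      proof eventually_elim
        case (elim p)
        let ?E = "norm (EF f (fst p, fst (snd p)) - EF g (fst p, fst (snd p)))"
        have "ennreal (A Plus p + A Minus p) \<le> ennreal ((2 * L * \<nu> * chi (fst p)) * (Q p * ?E))" by (rule ennreal_leI[OF elim])
        also have "\<dots> = ?c (fst p) * (ennreal (Q p) * ennreal ?E)"
          using L0 mu_le chi0 Q0 by (simp add: ennreal_mult)
        also have "\<dots> \<le> ?c (fst p) * (ennreal (Q p) * NN p)" by (intro mult_left_mono Ebound) auto
        finally show ?case .
      qed
    qed
    also have "\<dots> = (\<integral>\<^sup>+t. \<integral>\<^sup>+z. ?c t * (ennreal (Q (t, z)) * NN (t, z)) \<partial>lborel \<partial>lborel)"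
    proof -
      have "(\<lambda>p. ?c (fst p) * (ennreal (Q p) * NN p)) \<in> borel_measurable (lborel \<Otimes>\<^sub>M lborel)"
        unfolding lborel_prod using cm NNm by simp
      from lborel.nn_integral_fst[OF this] show ?thesis unfolding lborel_prod by simp
    qed
    also have "\<dots> \<le> (\<integral>\<^sup>+t. \<integral>\<^sup>+z. ?c t * (ennreal (CK * vol) * ennreal ((Q (t, z))\<^sup>2)) \<partial>lborel \<partial>lborel)"
    proof (rule nn_integral_mono)
      fix t
      have Qtm[measurable]: "(\<lambda>z. Q (t, z)) \<in> borel_measurable borel"
        by (intro borel_measurable_continuous_onI continuous_on_compose2[OF Qc] continuous_intros) auto
      have "(\<lambda>z. (t, z)) \<in> (borel :: ('x \<times> 'v) measure) \<rightarrow>\<^sub>M borel" by (intro borel_measurable_continuous_onI continuous_intros)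
      from measurable_compose[OF this NNm] have [measurable]: "(\<lambda>z. NN (t, z)) \<in> borel_measurable borel" .
      have "(\<integral>\<^sup>+z. ?c t * (ennreal (Q (t, z)) * NN (t, z)) \<partial>lborel) = ?c t * (\<integral>\<^sup>+z. ennreal (Q (t, z)) * NN (t, z) \<partial>lborel)"
        by (rule nn_integral_cmult) measurable
      also have "(\<integral>\<^sup>+z. ennreal (Q (t, z)) * NN (t, z) \<partial>lborel) \<le> ennreal (CK * vol) * (\<integral>\<^sup>+z. ennreal ((Q (t, z))\<^sup>2) \<partial>lborel)"
        using interaction_bound[of "\<lambda>z. Q (t, z)"] Qtm Q0 Qs by (simp add: NN_def)
      also have "ennreal (CK * vol) * (\<integral>\<^sup>+z. ennreal ((Q (t, z))\<^sup>2) \<partial>lborel) = (\<integral>\<^sup>+z. ennreal (CK * vol) * ennreal ((Q (t, z))\<^sup>2) \<partial>lborel)"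
        by (rule nn_integral_cmult[symmetric]) measurable
      also have "?c t * \<dots> = (\<integral>\<^sup>+z. ?c t * (ennreal (CK * vol) * ennreal ((Q (t, z))\<^sup>2)) \<partial>lborel)"
        by (rule nn_integral_cmult[symmetric]) measurable
      finally show "(\<integral>\<^sup>+z. ?c t * (ennreal (Q (t, z)) * NN (t, z)) \<partial>lborel) \<le> (\<integral>\<^sup>+z. ?c t * (ennreal (CK * vol) * ennreal ((Q (t, z))\<^sup>2)) \<partial>lborel)"
        by (simp add: mult_left_mono)
    qed
    also have "\<dots> = (\<integral>\<^sup>+p. ?c (fst p) * (ennreal (CK * vol) * ennreal ((Q p)\<^sup>2)) \<partial>lborel)"
    proof -
      have "(\<lambda>p. ?c (fst p) * (ennreal (CK * vol) * ennreal ((Q p)\<^sup>2))) \<in> borel_measurable (lborel \<Otimes>\<^sub>M lborel)"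
        unfolding lborel_prod using cm by simp
      from lborel.nn_integral_fst[OF this] show ?thesis unfolding lborel_prod by simp
    qed
    also have "\<dots> \<le> (\<integral>\<^sup>+p. ennreal (\<kappa> * (chi (fst p) * U p)) \<partial>lborel)"
    proof (rule nn_integral_mono)
      fix p :: "real \<times> 'x \<times> 'v"
      have nn: "0 \<le> 2 * L * \<nu> * chi (fst p)" "0 \<le> CK * vol" using L0 mu_le chi0 CK_nonneg vol_nonneg by auto
      have "?c (fst p) * (ennreal (CK * vol) * ennreal ((Q p)\<^sup>2)) = ennreal ((2 * L * \<nu> * chi (fst p)) * ((CK * vol) * (Q p)\<^sup>2))"
        using nn by (simp add: ennreal_mult)
      also have "\<dots> \<le> ennreal ((2 * L * \<nu> * chi (fst p)) * ((CK * vol) * (2 * U p)))"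
        using nn Qu[of p] by (intro ennreal_leI mult_left_mono) (auto simp: U_def)
      also have "(2 * L * \<nu> * chi (fst p)) * ((CK * vol) * (2 * U p)) = \<kappa> * (chi (fst p) * U p)" by (simp add: \<kappa>_def)
      finally show "?c (fst p) * (ennreal (CK * vol) * ennreal ((Q p)\<^sup>2)) \<le> ennreal (\<kappa> * (chi (fst p) * U p))" .
    qed
    also have "\<dots> = ennreal (LINT p|lborel. \<kappa> * (chi (fst p) * U p))"
      using chiU \<kappa> chi0 U0 by (intro nn_integral_eq_integral) auto
    finally show ?thesis by simp
  qed
  have le: "(LINT p|lborel. A Plus p + A Minus p) \<le> \<kappa> * (LINT p|lborel. chi (fst p) * U p)"
    by (rule integral_le_nn_bound[OF _ _ nn]) (use Ai \<kappa> chi0 U0 in \<open>auto intro!: integral_nonneg_AE\<close>)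
  \<comment> \<open>By the choice of the weight, w - \<kappa> chi equals exp (- \<kappa> t) before T
    and 0 afterwards. So R is nonnegative, and its integral is at most 0.\<close>
  define R where "R p = w p * U p - \<kappa> * (chi (fst p) * U p)" for p
  have wU: "integrable lborel (\<lambda>p. w p * U p)"
    using Bochner_Integration.integrable_add[OF wi[of Plus] wi[of Minus]] by (simp add: U_def distrib_left)
  have Ri: "integrable lborel R" unfolding R_def[abs_def]
    by (intro Bochner_Integration.integrable_diff wU integrable_mult_right chiU)
  have Rint: "(LINT p|lborel. R p) \<le> 0"
  proof -
    have "(LINT p|lborel. R p) = (LINT p|lborel. w p * U p) - \<kappa> * (LINT p|lborel. chi (fst p) * U p)"
      unfolding R_def using wU chiU by simp
    also have "(LINT p|lborel. w p * U p) = (LINT p|lborel. A Plus p + A Minus p)"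
      using wi[of Plus] wi[of Minus] Ai Aw by (simp add: U_def distrib_left)
    finally show ?thesis using le by simp
  qed
  have Req: "R p = (if fst p < T then exp (- (\<kappa> * fst p)) * U p else 0)" for p
    by (simp add: R_def w_def chi_def algebra_simps)
  have R0: "R p \<ge> 0" for p using U0 by (simp add: Req)
  have "AE p in lborel. R p = 0"
  proof -
    have "(LINT p|lborel. R p) \<ge> 0" by (rule integral_nonneg_AE) (use R0 in auto)
    then have "(LINT p|lborel. R p) = 0" using Rint by linarith
    then show ?thesis using integral_nonneg_eq_0_iff_AE[OF Ri] R0 by simp
  qed
  then have U_AE: "AE p in lborel. fst p < T \<longrightarrow> U p = 0" by eventually_elim (simp add: Req split: if_splits)
  have U_open: "U p = 0" if p: "fst p < T" for p
  proof (rule ccontr)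
    assume "U p \<noteq> 0"
    define V where "V = {q. fst q < T} \<inter> {q. U q \<noteq> 0}"
    have "open V" unfolding V_def using Uc by (intro open_Int open_Collect_less open_Collect_neq continuous_intros) auto
    moreover have "p \<in> V" using p \<open>U p \<noteq> 0\<close> by (simp add: V_def)
    ultimately have "\<not> negligible V" using open_not_negligible by blast
    moreover have "AE q in lborel. q \<notin> V" using U_AE by eventually_elim (auto simp: V_def)
    then have "V \<in> null_sets lborel" using \<open>open V\<close> by (subst AE_iff_null_sets) (auto intro: borel_open)
    then have "negligible V" by (simp add: negligible_iff_emeasure0 null_sets_def)
    ultimately show False by blast
  qed
  have closed: "U p = 0" if p: "fst p \<le> T" for p
  proof (rule continuous_constant_on_closure[of "{q. fst q < T}" U 0])
    show "continuous_on (closure {q. fst q < T}) U" using Uc continuous_on_subset by blast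
    show "U q = 0" if "q \<in> {q. fst q < T}" for q using U_open that by simp
    have "closure ({..<T} \<times> (UNIV :: ('x \<times> 'v) set)) = {..T} \<times> UNIV" by (simp add: closure_Times)
    moreover have "{..<T} \<times> (UNIV :: ('x \<times> 'v) set) = {q. fst q < T}" by auto
    ultimately show "p \<in> closure {q. fst q < T}" using p by (cases p) auto
  qed
  assume "0 \<le> t" "t \<le> T"
  then have "U (t, z) = 0" using closed by simp
  then have "u s (t, z) = 0" using u0 by (cases s) (auto simp: U_def add_nonneg_eq_0_iff)
  then show ?thesis by (simp add: u_def h_def)
qed

end

section \<open>Coordinates and the electric field\<close>

lemma rank_inj: "card {..i} = card {..j} \<longleftrightarrow> i = (j :: 'n::{finite,linorder})"
proof
  assume eq: "card {..i} = card {..j}"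
  show "i = j"
  proof (rule ccontr)
    assume "i \<noteq> j"
    then have "{..i} \<subset> {..j} \<or> {..j} \<subset> {..i}" by (cases "i < j") (auto simp: not_less)
    then have "card {..i} < card {..j} \<or> card {..j} < card {..i}" by (auto intro: psubset_card_mono)
    then show False using eq by simp
  qed
qed simp

lemma coord_rank: "coord (card {..i}) x = x $ i"
proof -
  have "{j. card {..j} = card {..i}} = {i}" by (auto simp: rank_inj)
  then show ?thesis by (simp add: coord_def)
qed

lemma rank_bij: "bij_betw (\<lambda>i :: 'n::{finite,linorder}. card {..i}) UNIV {1..CARD('n::{finite,linorder})}"
proof -
  have inj: "inj (\<lambda>i :: 'n. card {..i})" by (rule injI) (simp add: rank_inj)
  have "range (\<lambda>i :: 'n. card {..i}) \<subseteq> {1..CARD('n::{finite,linorder})}"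
    by (auto simp: Suc_le_eq card_gt_0_iff intro: card_mono[OF finite_class.finite_UNIV subset_UNIV])
  moreover have "card (range (\<lambda>i :: 'n. card {..i})) = card {1..CARD('n::{finite,linorder})}" by (simp add: card_image[OF inj])
  ultimately have "range (\<lambda>i :: 'n. card {..i}) = {1..CARD('n::{finite,linorder})}" by (intro card_subset_eq) auto
  then show ?thesis using inj by (simp add: bij_betw_def)
qed

lemma sum_rank: "(\<Sum>i\<in>UNIV. g (card {..i :: 'n::{finite,linorder}})) = (\<Sum>k\<in>{1..CARD('n::{finite,linorder})}. g k)"
  by (rule sum.reindex_bij_betw[OF rank_bij])

lemma coord_eq_0:
  fixes x :: "real ^ 'n::{finite,linorder}"
  assumes "k \<notin> {1..CARD('n::{finite,linorder})}" shows "coord k x = 0"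
proof -
  have "{i :: 'n. card {..i} = k} = {}" using rank_bij[where 'n='n] assms by (auto simp: bij_betw_def)
  then show ?thesis by (simp add: coord_def)
qed

lemma inner_coord:
  fixes x y :: "real ^ 'n::{finite,linorder}"
  shows "x \<bullet> y = (\<Sum>k\<in>{1..CARD('n::{finite,linorder})}. coord k x * coord k y)"
  using sum_rank[where 'n='n, of "\<lambda>k. coord k x * coord k y"] by (simp add: inner_vec_def coord_rank)

lemma coord_vec_of:
  "k \<in> {1..CARD('n::{finite,linorder})} \<Longrightarrow> coord k (vec_of a :: real ^ 'n::{finite,linorder}) = a k"
proof -
  assume "k \<in> {1..CARD('n::{finite,linorder})}"
  then have "k \<in> range (\<lambda>i :: 'n. card {..i})" using bij_betw_imp_surj_on[OF rank_bij[where 'n='n]] by simp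
  then obtain i :: 'n where "k = card {..i}" by blast
  then show ?thesis by (simp add: coord_rank vec_of_def)
qed

lemma inner_vec_of:
  fixes x :: "real ^ 'n::{finite,linorder}"
  shows "x \<bullet> vec_of a = (\<Sum>k\<in>{1..CARD('n::{finite,linorder})}. coord k x * a k)"
  unfolding inner_coord by (intro sum.cong refl) (simp add: coord_vec_of)

lemma coord_linear: "coord k (x + y) = coord k x + coord k y" "coord k (c *\<^sub>R x) = c * coord k x"
  by (simp_all add: coord_def sum.distrib sum_distrib_left)

text \<open>Both sides are the sum over the indices that the two vectors have in common: the
  paddings in the two directions are adjoint. This moves the padding of the gradient in the equation
  to the velocity in the drift.\<close>

lemma inner_zpad:
  fixes v :: "real ^ 'n::{finite,linorder}" and p :: "real ^ 'm::{finite,linorder}"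
  shows "v \<bullet> zpad p = zpad v \<bullet> p"
proof -
  let ?g = "\<lambda>k. coord k v * coord k p"
  have "v \<bullet> zpad p = (\<Sum>k\<in>{1..CARD('n::{finite,linorder})}. ?g k)" by (simp add: zpad_def inner_vec_of)
  also have "\<dots> = (\<Sum>k\<in>{1..CARD('n::{finite,linorder})} \<inter> {1..CARD('m::{finite,linorder})}. ?g k)"
    by (rule sum.mono_neutral_right) (auto simp: coord_eq_0)
  also have "\<dots> = (\<Sum>k\<in>{1..CARD('m::{finite,linorder})}. ?g k)"
    by (rule sum.mono_neutral_left) (auto simp: coord_eq_0)
  also have "\<dots> = zpad v \<bullet> p"
    by (subst inner_commute) (simp add: zpad_def inner_vec_of mult.commute)
  finally show ?thesis .
qed

lemma linear_zpad: "linear zpad"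
  by (rule linearI) (simp_all add: zpad_def vec_of_def vec_eq_iff coord_linear)

lemma norm_zpad:
  fixes x :: "real ^ 'n::{finite,linorder}"
  shows "norm (zpad x :: real ^ 'm::{finite,linorder}) \<le> norm x"
proof (rule power2_le_imp_le)
  have "(norm (zpad x :: real ^ 'm::{finite,linorder}))\<^sup>2 = (\<Sum>k\<in>{1..CARD('m::{finite,linorder})}. coord k x * coord k x)"
    unfolding power2_norm_eq_inner inner_coord by (intro sum.cong refl) (simp add: zpad_def coord_vec_of)
  also have "\<dots> = (\<Sum>k\<in>{1..CARD('m::{finite,linorder})} \<inter> {1..CARD('n::{finite,linorder})}. coord k x * coord k x)"
    by (rule sum.mono_neutral_right) (auto simp: coord_eq_0)
  also have "\<dots> \<le> (\<Sum>k\<in>{1..CARD('n::{finite,linorder})}. coord k x * coord k x)" by (rule sum_mono2) auto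
  also have "\<dots> = (norm x)\<^sup>2" by (simp add: power2_norm_eq_inner inner_coord)
  finally show "(norm (zpad x :: real ^ 'm::{finite,linorder}))\<^sup>2 \<le> (norm x)\<^sup>2" .
qed simp

lemma bounded_bilinear_otimes: "bounded_bilinear ((\<otimes>) :: real ^ 'v::{finite,linorder} \<Rightarrow> real ^ 'b::{finite,linorder} \<Rightarrow> real ^ 'v::{finite,linorder})"
  unfolding bilinear_conv_bounded_bilinear[symmetric] bilinear_def
  by (intro conjI allI linearI)
    (auto simp: otimes_def vec_of_def vec_eq_iff coord_linear algebra_simps)

lemma inner_otimes_self:
  fixes v :: "real ^ 'v::{finite,linorder}"
  assumes "CARD('v::{finite,linorder}) = 2 \<or> CARD('v::{finite,linorder}) = 3" shows "v \<bullet> (v \<otimes> b) = 0"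
proof -
  have s2: "(\<Sum>k\<in>{Suc 0..2}. h k) = h 1 + h 2" "(\<Sum>k\<in>{Suc 0..3}. h k) = h 1 + h 2 + h 3" for h :: "nat \<Rightarrow> real"
    by (simp_all add: numeral_2_eq_2 numeral_3_eq_3)
  show ?thesis
  proof (cases "CARD('v::{finite,linorder}) = 2")
    case True
    then show ?thesis by (simp add: otimes_def inner_vec_of s2)
  next
    case False
    then have "CARD('v::{finite,linorder}) = 3" using assms by simp
    then show ?thesis by (simp add: otimes_def inner_vec_of s2) (simp add: algebra_simps)
  qed
qed

section \<open>One kernel for both dimensions\<close>

definition field_of :: "real ^ 'x::{finite,linorder} \<Rightarrow> real ^ 'x::{finite,linorder}" where
  "field_of = (if CARD('x::{finite,linorder}) = 1 then line_kernel else plane_kernel)"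

lemma field_kernel_field_of:
  assumes "CARD('x::{finite,linorder}) = 1 \<or> CARD('x::{finite,linorder}) = 2" "R > 0"
  obtains C where "field_kernel (field_of :: real ^ 'x::{finite,linorder} \<Rightarrow> real ^ 'x::{finite,linorder}) R C"
proof (cases "CARD('x::{finite,linorder}) = 1")
  case True
  then show ?thesis using field_kernel_line[OF True assms(2)] that by (simp add: field_of_def)
next
  case False
  then have "DIM(real ^ 'x::{finite,linorder}) = 2" using assms by simp
  from field_kernel_plane[OF assms(2) this] show ?thesis using that False by (simp add: field_of_def)
qed

lemma integral_lebesgue_on_eq_indicator:
  fixes \<rho> :: "'a::euclidean_space \<Rightarrow> real"
  assumes "A \<in> sets borel" "\<rho> \<in> borel_measurable borel"
  shows "(LINT y|lebesgue_on A. \<rho> y) = (LINT y|lborel. indicator A y * \<rho> y)"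
proof -
  have "A \<in> sets lebesgue" using assms(1) by simp
  then have "(LINT y|lebesgue_on A. \<rho> y) = (LINT y|lebesgue. indicator A y *\<^sub>R \<rho> y)" by (simp add: integral_restrict_space)
  also have "\<dots> = (LINT y|lborel. indicator A y *\<^sub>R \<rho> y)" using assms by (intro integral_completion) simp
  finally show ?thesis by simp
qed

lemma charge_density_eq_dens: "charge_density f t = dens (\<lambda>z. f Plus (t, z) - f Minus (t, z))"
  by (auto simp: charge_density_def dens_def)

lemma efield_eq_field:
  fixes f :: "species \<Rightarrow> real \<times> (real ^ 'x::{finite,linorder}) \<times> (real ^ 'v::{finite,linorder}) \<Rightarrow> real"
  assumes k: "field_kernel (field_of :: real ^ 'x::{finite,linorder} \<Rightarrow> real ^ 'x::{finite,linorder}) R C" and d: "CARD('x::{finite,linorder}) = 1 \<or> CARD('x::{finite,linorder}) = 2"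
    and \<rho>: "charge_density f t \<in> borel_measurable borel" "\<And>y. \<bar>charge_density f t y\<bar> \<le> M"
      "\<And>y. y \<notin> cball 0 R \<Longrightarrow> charge_density f t y = 0"
  shows "efield f t x = field field_of (charge_density f t) x"
proof (cases "CARD('x::{finite,linorder}) = 1")
  case True
  show ?thesis unfolding vec_eq_iff
  proof
    fix i
    have "{y :: real ^ 'x::{finite,linorder}. y $ i \<le> x $ i} \<in> sets borel"
      by (intro borel_closed closed_Collect_le continuous_intros)
    then have "efield f t x $ i = (LINT y|lborel. indicator {y. y $ i \<le> x $ i} y * charge_density f t y)"
      using True \<rho>(1) by (simp add: efield_def integral_lebesgue_on_eq_indicator)
    also have "\<dots> = (LINT y|lborel. (charge_density f t y *\<^sub>R field_of (x - y)) $ i)"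
      using True by (intro Bochner_Integration.integral_cong) (auto simp: field_of_def line_kernel_def indicator_def)
    also have "\<dots> = field field_of (charge_density f t) x $ i"
      unfolding field_def
      by (rule integral_bounded_linear[OF bounded_linear_vec_nth field_kernel.integrable_field(1)[OF k \<rho>]])
    finally show "efield f t x $ i = field field_of (charge_density f t) x $ i" .
  qed
next
  case False
  have "(LINT y|lborel. (charge_density f t y / (norm (x - y))\<^sup>2) *\<^sub>R (x - y))
    = (LINT y|lborel. (2 * pi) *\<^sub>R (charge_density f t y *\<^sub>R field_of (x - y)))"
  proof (rule Bochner_Integration.integral_cong[OF refl])
    fix y
    have "field_of (x - y) = (1 / (2 * pi * (norm (x - y))\<^sup>2)) *\<^sub>R (x - y)"
      using False by (simp add: field_of_def plane_kernel_def)
    then show "(charge_density f t y / (norm (x - y))\<^sup>2) *\<^sub>R (x - y) = (2 * pi) *\<^sub>R (charge_density f t y *\<^sub>R field_of (x - y))"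
      by simp
  qed
  also have "\<dots> = (2 * pi) *\<^sub>R field field_of (charge_density f t) x"
    unfolding field_def
    by (rule Bochner_Integration.integral_scaleR_right)
  finally show ?thesis using False by (simp add: efield_def)
qed

section \<open>Null sets of products and properties of the datum\<close>

lemma AE_lborel_pairI:
  fixes Q :: "'d::euclidean_space \<times> 'e::euclidean_space \<Rightarrow> bool"
  assumes Q: "{p. Q p} \<in> sets borel" "AE x in lborel. AE y in lborel. Q (x, y)"
  shows "AE p in lborel. Q p"
proof -
  have "{p. Q p} \<in> sets (lborel \<Otimes>\<^sub>M lborel)" using Q(1) unfolding lborel_prod by simp
  then have "AE p in lborel \<Otimes>\<^sub>M lborel. Q p"
    by (intro lborel_pair.AE_pair_measure[OF _ Q(2)]) (simp add: space_pair_measure)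
  then show ?thesis unfolding lborel_prod .
qed

text \<open>The magnetic field agrees with its representative up to a null set of (t, x), while the
  equation is required almost everywhere in (t, x, v). The cylinder over a null set is again a null
  set.\<close>

lemma AE_lborel_Pair_fst_snd:
  assumes "AE q in lborel. P (q :: 'a::euclidean_space \<times> 'b::euclidean_space)"
  shows "AE p in lborel. P (fst p, fst (snd (p :: 'a \<times> 'b \<times> 'c::euclidean_space)))"
proof -
  obtain N where N: "{q. \<not> P q} \<subseteq> N" "N \<in> null_sets lborel"
    using assms unfolding eventually_ae_filter by auto
  have Nm: "N \<in> sets borel" using N(2) by auto
  have "AE q in lborel \<Otimes>\<^sub>M lborel. q \<notin> N" unfolding lborel_prod by (rule AE_not_in[OF N(2)])
  from lborel_pair.AE_pair[OF this] have 1: "AE t in lborel. AE x in lborel. (t, x) \<notin> N" by simp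
  have "AE p in lborel. (fst p, fst (snd (p :: 'a \<times> 'b \<times> 'c))) \<notin> N"
  proof (rule AE_lborel_pairI)
    have "(\<lambda>p :: 'a \<times> 'b \<times> 'c. (fst p, fst (snd p))) \<in> borel_measurable borel"
      by (intro borel_measurable_continuous_onI continuous_intros)
    from measurable_sets[OF this, of "- N"] Nm show "{p :: 'a \<times> 'b \<times> 'c. (fst p, fst (snd p)) \<notin> N} \<in> sets borel"
      by (simp add: vimage_def)
    show "AE t in lborel. AE z in lborel. (fst (t, z), fst (snd (t, z :: 'b \<times> 'c))) \<notin> N"
      using 1
    proof eventually_elim
      case (elim t)
      show ?case
      proof (rule AE_lborel_pairI)
        have "(\<lambda>z :: 'b \<times> 'c. (t, fst z)) \<in> borel_measurable borel"
          by (intro borel_measurable_continuous_onI continuous_intros)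
        from measurable_sets[OF this, of "- N"] Nm show "{z :: 'b \<times> 'c. (fst (t, z), fst (snd (t, z))) \<notin> N} \<in> sets borel"
          by (simp add: vimage_def)
        show "AE x in lborel. AE v in lborel. (fst (t, x, v :: 'c), fst (snd (t, x, v))) \<notin> N"
          using elim by eventually_elim simp
      qed
    qed
  qed
  then show ?thesis by eventually_elim (use N(1) in blast)
qed

lemma zero_outside_supp:
  assumes "z \<notin> supp f" shows "f z = 0"
proof (rule ccontr)
  assume "f z \<noteq> 0"
  then have "z \<in> {z. f z \<noteq> 0}" by simp
  then have "z \<in> closure {z. f z \<noteq> 0}" by (rule subsetD[OF closure_subset])
  with assms show False unfolding supp_def by contradiction
qed

lemma C1_compact_lipschitz:
  fixes f :: "'a::euclidean_space \<Rightarrow> real"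
  assumes C1: "C1 f" and cs: "compact (supp f)"
  obtains L F where "L-lipschitz_on UNIV f" "\<And>z. \<bar>f z\<bar> \<le> F"
proof -
  obtain G where Gc: "continuous_on UNIV G" and G: "\<And>z. (f has_derivative (\<lambda>h. G z \<bullet> h)) (at z)"
    using C1 by (auto simp: C1_def)
  have out: "f z = 0" if z: "z \<notin> supp f" for z
    by (rule zero_outside_supp[OF z])
  have Gout: "G z = 0" if z: "z \<notin> supp f" for z
  proof -
    have op: "open (- supp f)" by (simp add: supp_def open_Compl)
    have "(f has_derivative (\<lambda>h. 0)) (at z)"
      by (rule has_derivative_transform_within_open[OF has_derivative_const[of 0] op])
         (use z out in auto)
    from fun_cong[OF has_derivative_unique[OF G this], of "G z"] have "G z \<bullet> G z = 0" .
    then show ?thesis by simp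
  qed
  have fc: "continuous_on UNIV f" by (intro continuous_at_imp_continuous_on ballI has_derivative_continuous[OF G])
  obtain L where L: "\<And>z. z \<in> supp f \<Longrightarrow> norm (G z) \<le> L"
    using compact_imp_bounded[OF compact_continuous_image[OF continuous_on_subset[OF Gc subset_UNIV] cs]] by (auto simp: bounded_iff)
  obtain F where F: "\<And>z. z \<in> supp f \<Longrightarrow> norm (f z) \<le> F"
    using compact_imp_bounded[OF compact_continuous_image[OF continuous_on_subset[OF fc subset_UNIV] cs]] by (auto simp: bounded_iff)
  have "\<bar>L\<bar>-lipschitz_on UNIV f"
  proof (rule bounded_derivative_imp_lipschitz[OF _ convex_UNIV])
    show "(f has_derivative (\<lambda>h. G z \<bullet> h)) (at z within UNIV)" for z using G by simp
    show "onorm (\<lambda>h. G z \<bullet> h) \<le> \<bar>L\<bar>" for z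
    proof (rule onorm_bound)
      fix h :: 'a
      have "norm (G z) \<le> \<bar>L\<bar>" using L[of z] Gout[of z] by (cases "z \<in> supp f") auto
      then have "norm (G z) * norm h \<le> \<bar>L\<bar> * norm h" by (intro mult_right_mono) auto
      then show "norm (G z \<bullet> h) \<le> \<bar>L\<bar> * norm h" using Cauchy_Schwarz_ineq2[of "G z" h] by simp
    qed simp
  qed simp
  moreover have "\<bar>f z\<bar> \<le> \<bar>F\<bar>" for z using F[of z] out[of z] by (cases "z \<in> supp f") auto
  ultimately show ?thesis using that by blast
qed

text \<open>A compact subset of the open domain keeps a positive distance from its boundary. This
  gap is the source of a positive time of existence.\<close>

lemma supp_strictly_inside:
  fixes f :: "'x::euclidean_space \<times> 'v::euclidean_space \<Rightarrow> real"
  assumes cs: "compact (supp f)" and sub: "supp f \<subseteq> ball 0 Rx \<times> ball 0 Rv" and R: "Rx > 0" "Rv > 0"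
  obtains r s where "0 \<le> r" "r < Rx" "0 \<le> s" "s < Rv" "\<And>x v. f (x, v) \<noteq> 0 \<Longrightarrow> norm x \<le> r \<and> norm v \<le> s"
proof (cases "supp f = {}")
  case True
  then have "f z = 0" for z by (intro zero_outside_supp) simp
  then show ?thesis using that[of 0 0] R by simp
next
  case False
  have c: "continuous_on (supp f) (\<lambda>z. norm (fst z))" "continuous_on (supp f) (\<lambda>z. norm (snd z))" by (intro continuous_intros)+
  obtain a where a: "a \<in> supp f" "\<And>z. z \<in> supp f \<Longrightarrow> norm (fst z) \<le> norm (fst a)"
    using continuous_attains_sup[OF cs False c(1)] by blast
  obtain b where b: "b \<in> supp f" "\<And>z. z \<in> supp f \<Longrightarrow> norm (snd z) \<le> norm (snd b)"
    using continuous_attains_sup[OF cs False c(2)] by blast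
  have sup: "z \<in> supp f" if z: "f z \<noteq> 0" for z
    using z zero_outside_supp by metis
  show ?thesis
  proof (rule that[of "norm (fst a)" "norm (snd b)"])
    show "norm (fst a) < Rx" "norm (snd b) < Rv" using sub a(1) b(1) by (auto simp: mem_Times_iff)
    show "norm x \<le> norm (fst a) \<and> norm v \<le> norm (snd b)" if z: "f (x, v) \<noteq> 0" for x v
      using a(2)[OF sup[OF z]] b(2)[OF sup[OF z]] by simp
  qed auto
qed

section \<open>Strong solutions\<close>

lemma grad_eqI:
  assumes "(f has_derivative (\<lambda>h. grad f z \<bullet> h)) (at z)" "(f has_derivative (\<lambda>h. w \<bullet> h)) (at z)"
  shows "grad f z = w"
  using grad_unique[OF assms] vector_eq_rdot by blast

lemma grad_eq_0_if_locally_zero: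
  assumes d: "(f has_derivative (\<lambda>h. grad f z \<bullet> h)) (at z)" and V: "open V" "z \<in> V" "\<And>y. y \<in> V \<Longrightarrow> f y = 0"
  shows "grad f z = 0"
proof (rule grad_eqI[OF d])
  have "(f has_derivative (\<lambda>h. 0)) (at z)"
    by (rule has_derivative_transform_within_open[OF has_derivative_const[of 0] V(1,2)]) (simp add: V(3))
  then show "(f has_derivative (\<lambda>h. 0 \<bullet> h)) (at z)" by simp
qed

lemma continuous_AE_eq_imp_eq:
  fixes f g :: "'a::euclidean_space \<Rightarrow> real"
  assumes U: "open U" and f: "continuous_on U f" and g: "continuous_on U g"
    and ae: "AE z in lebesgue_on U. f z = g z" and z: "z \<in> U"
  shows "f z = g z"
proof (rule ccontr)
  assume ne: "f z \<noteq> g z"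
  define V where "V = U \<inter> (\<lambda>z. f z - g z) -` (- {0})"
  have Vo: "open V" unfolding V_def by (intro continuous_open_preimage U continuous_on_diff f g) auto
  have "z \<in> V" using z ne by (simp add: V_def)
  then have "\<not> negligible V" using open_not_negligible[OF Vo] by blast
  moreover have "AE q in lborel. q \<notin> V" using ae unfolding AE_lebesgue_on_iff_lborel[OF U]
    by eventually_elim (auto simp: V_def)
  then have "V \<in> null_sets lborel" using Vo by (subst AE_iff_null_sets) (auto intro: borel_open)
  then have "negligible V" by (simp add: negligible_iff_emeasure0 null_sets_def)
  ultimately show False by blast
qed

lemma lipschitz_vector:
  fixes b :: "'n::finite \<Rightarrow> 'a::metric_space \<Rightarrow> real"
  assumes "\<And>i. (L i)-lipschitz_on UNIV (b i)"
  shows "(\<Sum>i\<in>UNIV. L i)-lipschitz_on UNIV (\<lambda>p. \<chi> i. b i p)"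
proof (rule lipschitz_onI)
  fix p q
  have "dist (\<chi> i. b i p) (\<chi> i. b i q) \<le> (\<Sum>i\<in>UNIV. \<bar>b i p - b i q\<bar>)"
    unfolding dist_norm by (rule order_trans[OF norm_le_l1_cart]) simp
  also have "\<dots> \<le> (\<Sum>i\<in>UNIV. L i * dist p q)"
    using lipschitz_onD[OF assms] by (intro sum_mono) (simp add: dist_real_def)
  finally show "dist (\<chi> i. b i p) (\<chi> i. b i q) \<le> (\<Sum>i\<in>UNIV. L i) * dist p q" by (simp add: sum_distrib_right)
qed (use lipschitz_on_nonneg[OF assms] in \<open>simp add: sum_nonneg\<close>)

lemma W1inf_vector_lipschitz:
  fixes B :: "'a::euclidean_space \<Rightarrow> real ^ 'n::finite"
  assumes U: "open U" "convex U" and W: "\<And>i. W1inf U (\<lambda>z. B z $ i)"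
  obtains L C Bt where "L-lipschitz_on UNIV Bt" "\<And>p. norm (Bt p) \<le> C" "AE p in lborel. p \<in> U \<longrightarrow> B p = Bt p"
proof -
  have "\<exists>L C b. L-lipschitz_on UNIV b \<and> (\<forall>z. \<bar>b z\<bar> \<le> C) \<and> (AE z in lebesgue_on U. B z $ i = b z)" for i
  proof -
    obtain G where "has_W1inf_gradient U (\<lambda>z. B z $ i) G" using W[of i] by (auto simp: W1inf_def)
    from has_W1inf_gradient_imp_lipschitz[OF U this] show ?thesis by metis
  qed
  then obtain L C b where b: "\<And>i. (L i)-lipschitz_on UNIV (b i)" "\<And>i z. \<bar>b i z\<bar> \<le> C i"
    "\<And>i. AE z in lebesgue_on U. B z $ i = b i z" by metis
  have "AE z in lborel. \<forall>i. z \<in> U \<longrightarrow> B z $ i = b i z"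
    using AE_finite_allI[of UNIV "\<lambda>i z. z \<in> U \<longrightarrow> B z $ i = b i z" lborel] b(3)
    by (simp add: AE_lebesgue_on_iff_lborel[OF U(1)])
  then have "AE z in lborel. z \<in> U \<longrightarrow> B z = (\<chi> i. b i z)" by eventually_elim (simp add: vec_eq_iff)
  moreover have "norm (\<chi> i. b i p) \<le> (\<Sum>i\<in>UNIV. C i)" for p
    by (rule order_trans[OF norm_le_l1_cart]) (simp add: sum_mono b(2))
  ultimately show ?thesis using that[OF lipschitz_vector[of L b, OF b(1)]] by blast
qed

lemma AE_lebesgue_on_strip:
  assumes "AE p in lborel. 0 < fst p \<and> fst p < T \<longrightarrow> P (p :: real \<times> 'a::euclidean_space)"
  shows "AE p in lebesgue_on ({0..T} \<times> UNIV). P p"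
proof -
  have m: "{0..T} \<times> (UNIV :: 'a set) \<in> sets lebesgue" by (simp add: borel_closed closed_Times)
  have "AE p in lborel. p \<in> {0..T} \<times> UNIV \<longrightarrow> P p"
    using assms AE_fst_neq[of 0] AE_fst_neq[of T] by eventually_elim (auto simp: less_le)
  then have "AE p in lebesgue. p \<in> {0..T} \<times> UNIV \<longrightarrow> P p" by (rule AE_completion)
  then show ?thesis using m by (simp add: AE_restrict_space_iff)
qed

lemma AE_lborel_strip:
  assumes "AE p in lebesgue_on ({0..T} \<times> UNIV). P (p :: real \<times> 'a::euclidean_space)"
  shows "AE p in lborel. 0 < fst p \<and> fst p < T \<longrightarrow> P p"
proof -
  have m: "{0..T} \<times> (UNIV :: 'a set) \<in> sets lebesgue" by (simp add: borel_closed closed_Times)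
  have "AE p in lborel. p \<in> {0..T} \<times> UNIV \<longrightarrow> P p"
    using assms m by (simp add: AE_restrict_space_iff AE_completion_iff)
  then show ?thesis by eventually_elim (auto simp: mem_Times_iff)
qed

lemma choice3: "\<forall>s. \<exists>a b c. P s a b c \<Longrightarrow> \<exists>A B C. \<forall>s. P s (A s) (B s) (C s)"
  by metis

lemma species_AE:
  assumes "\<And>s. AE p in M. P s p" shows "AE p in M. \<forall>s :: species. P s p"
  using assms[of Plus] assms[of Minus] by eventually_elim (metis species.exhaust)

section \<open>Strong solutions and Lipschitz solutions in kernel form\<close>

locale vlasov_poisson = vlasov "field_of :: real ^ 'dx::{finite,linorder} \<Rightarrow> real ^ 'dx::{finite,linorder}" Rx CK
    "zpad :: real ^ 'dv::{finite,linorder} \<Rightarrow> real ^ 'dx::{finite,linorder}" "zpad"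
    "(\<otimes>) :: real ^ 'dv::{finite,linorder} \<Rightarrow> real ^ 'db::{finite,linorder} \<Rightarrow> real ^ 'dv::{finite,linorder}" Rv mux muv
  for Rx CK Rv mux muv +
  fixes f0 :: "species \<Rightarrow> (real ^ 'dx::{finite,linorder}) \<times> (real ^ 'dv::{finite,linorder}) \<Rightarrow> real"
    and Bt :: "real \<times> (real ^ 'dx::{finite,linorder}) \<Rightarrow> (real ^ 'db::{finite,linorder})"
  assumes card_dx: "CARD('dx::{finite,linorder}) = 1 \<or> CARD('dx::{finite,linorder}) = 2"
begin

lemma pde_inner:
  fixes a :: real and b :: "real ^ 'dx::{finite,linorder}" and c v :: "real ^ 'dv::{finite,linorder}"
  shows "a + mux s * (v \<bullet> zpad b) + muv s * ((zpad E + mux s *\<^sub>R (v \<otimes> Bv)) \<bullet> c)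
    = (a, b, c) \<bullet> (1, mux s *\<^sub>R zpad v, muv s *\<^sub>R (zpad E + mux s *\<^sub>R (v \<otimes> Bv)))"
proof -
  have "v \<bullet> zpad b = b \<bullet> zpad v" by (metis inner_zpad inner_commute)
  then show ?thesis by (simp add: inner_commute[of c])
qed

lemma efield_eq_EF:
  assumes "\<And>s. continuous_on UNIV (\<lambda>z. f s (t, z))" "\<And>s. phase_supported (\<lambda>z. f s (t, z))" "\<And>s p. \<bar>f s p\<bar> \<le> M"
  shows "efield f t x = EF f (t, x)"
proof -
  let ?F = "\<lambda>z. f Plus (t, z) - f Minus (t, z)"
  have Fc: "continuous_on UNIV ?F" by (intro continuous_on_diff assms)
  have Fs: "phase_supported ?F" by (intro phase_supported_diff assms)
  have Fb: "\<bar>?F z\<bar> \<le> 2 * M" for z using assms(3)[of Plus "(t, z)"] assms(3)[of Minus "(t, z)"] by linarith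
  have "efield f t x = field field_of (charge_density f t) x"
    by (rule efield_eq_field[OF field_kernel_axioms card_dx]; unfold charge_density_eq_dens)
      (use dens_measurable[OF Fc Fs] dens_bound[OF Fc Fs Fb] dens_outside[OF Fc Fs] in auto)
  then show ?thesis by (simp add: EF_def charge_density_eq_dens)
qed

lemma supp_closure_phase_supported:
  assumes "supp h \<subseteq> closure (phase_domain Rx Rv)" shows "phase_supported h"
  unfolding phase_supported_def
proof (intro allI impI)
  fix x v assume "h (x, v) \<noteq> 0"
  then have "(x, v) \<in> supp h" using zero_outside_supp[of "(x, v)" h] by blast
  then have "(x, v) \<in> closure (ball 0 Rx \<times> ball 0 Rv)" using assms by (auto simp: phase_domain_def)
  moreover have "closure (ball 0 Rx \<times> ball 0 Rv) \<subseteq> cball 0 Rx \<times> cball (0 :: real ^ 'dv::{finite,linorder}) Rv"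
    by (intro closure_minimal closed_Times) auto
  ultimately show "norm x \<le> Rx \<and> norm v \<le> Rv" by auto
qed

text \<open>
  Where \<open>B\<close> and its Lipschitz representative may differ, the solution vanishes for all velocities,
  and so does its velocity gradient.
\<close>

lemma strong_solution_lipschitz:
  assumes T: "T > 0" and sol: "strong_solution mux muv f0 T B g"
    and supp: "\<And>s t. t \<in> {0..T} \<Longrightarrow> supp (\<lambda>z. g s (t, z)) \<subseteq> closure (phase_domain Rx Rv)"
    and BB: "AE q in lborel. q \<in> {0<..<T} \<times> ball 0 Rx \<longrightarrow> B q = Bt q"
  obtains M C gt where "\<And>s. M-lipschitz_on UNIV (gt s)" "\<And>s p. \<bar>gt s p\<bar> \<le> C" "\<And>s t. phase_supported (\<lambda>z. gt s (t, z))"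
    "\<And>s t z. t \<in> {0..T} \<Longrightarrow> gt s (t, z) = g s (t, z)" "\<And>s t z. t \<le> 0 \<Longrightarrow> gt s (t, z) = f0 s z"
    "AE p in lborel. 0 < fst p \<and> fst p < T \<longrightarrow> (\<forall>s. grad (gt s) p \<bullet> drift gt Bt s p = 0)"
proof -
  let ?U = "{0<..<T} \<times> (UNIV :: ((real ^ 'dx::{finite,linorder}) \<times> (real ^ 'dv::{finite,linorder})) set)"
  have U: "open ?U" "convex ?U" by (intro open_Times convex_Times; simp)+
  have clU: "closure ?U = {0..T} \<times> UNIV" using T by (simp add: closure_Times)
  have gc: "continuous_on ({0..T} \<times> UNIV) (g s)" for s
    using sol by (simp add: strong_solution_def)
  have g0: "g s (0, z) = f0 s z" for s z
    using sol by (cases z) (simp add: strong_solution_def)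
  let ?P = "\<lambda>s z Gz. case (z, Gz) of ((t, x, v), (dt_f, dx_f, dv_f)) \<Rightarrow>
      dt_f + mux s * (v \<bullet> zpad dx_f) + muv s * ((zpad (efield g t x) + mux s *\<^sub>R (v \<otimes> B (t, x))) \<bullet> dv_f) = 0"
  have "\<forall>s. \<exists>G. has_W1inf_gradient ?U (g s) G \<and> (AE z in lebesgue_on ({0..T} \<times> UNIV). ?P s z (G z))"
    using sol unfolding strong_solution_def by blast
  from choice[OF this] obtain G where G: "\<And>s. has_W1inf_gradient ?U (g s) (G s)"
    and pde: "\<And>s. AE z in lebesgue_on ({0..T} \<times> UNIV). ?P s z (G s z)" by blast
  have "\<forall>s. \<exists>M C gl. M-lipschitz_on UNIV gl \<and> (\<forall>z. \<bar>gl z\<bar> \<le> C) \<and> (AE z in lebesgue_on ?U. g s z = gl z) \<and> (AE z in lebesgue_on ?U. G s z = grad gl z)"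
  proof
    show "\<exists>M C gl. M-lipschitz_on UNIV gl \<and> (\<forall>z. \<bar>gl z\<bar> \<le> C) \<and> (AE z in lebesgue_on ?U. g s z = gl z) \<and> (AE z in lebesgue_on ?U. G s z = grad gl z)" for s
      by (rule has_W1inf_gradient_imp_lipschitz[OF U G[of s]]) blast
  qed
  from choice3[OF this] obtain M0 C0 gl where gl0: "\<And>s. (M0 s)-lipschitz_on UNIV (gl s)" "\<And>s z. \<bar>gl s z\<bar> \<le> C0 s"
    "\<And>s. AE z in lebesgue_on ?U. g s z = gl s z" "\<And>s. AE z in lebesgue_on ?U. G s z = grad (gl s) z" by blast
  define M where "M = max (M0 Plus) (M0 Minus)"
  define C where "C = max (C0 Plus) (C0 Minus)"
  have le: "M0 s \<le> M" "C0 s \<le> C" for s by (cases s; simp add: M_def C_def)+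
  have gl: "M-lipschitz_on UNIV (gl s)" "\<bar>gl s z\<bar> \<le> C" for s z
    using lipschitz_on_le[OF gl0(1) le(1)] order_trans[OF gl0(2) le(2)] by auto
  have glc: "continuous_on A (gl s)" for s A using lipschitz_on_continuous_on[OF gl(1)] continuous_on_subset by blast
  have M0: "M \<ge> 0" using lipschitz_on_nonneg[OF gl(1)] .
  have eqU: "g s z - gl s z = 0" if "z \<in> ?U" for s z
  proof -
    have "continuous_on ?U (g s)" by (rule continuous_on_subset[OF gc]) auto
    from continuous_AE_eq_imp_eq[OF U(1) this glc gl0(3) that] show ?thesis by simp
  qed
  have eq: "g s z = gl s z" if z: "z \<in> {0..T} \<times> UNIV" for s z
  proof -
    have "g s z - gl s z = 0"
      by (rule continuous_constant_on_closure[of ?U "\<lambda>z. g s z - gl s z" 0 z])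
        (use z eqU in \<open>auto simp: clU intro!: continuous_on_diff gc glc\<close>)
    then show ?thesis by simp
  qed
  \<comment> \<open>Freezing the time outside [0, T] gives functions on the whole space that equal
    the datum for all t \<le> 0, as \<open>lipschitz_solutions_unique\<close> expects, and it does
    not increase the Lipschitz constant.\<close>
  define ct where "ct t = max 0 (min T t)" for t
  have ct: "ct t \<in> {0..T}" "t \<in> {0..T} \<Longrightarrow> ct t = t" "\<bar>ct t - ct t'\<bar> \<le> \<bar>t - t'\<bar>" "t \<le> 0 \<Longrightarrow> ct t = 0" for t t'
    using T by (auto simp: ct_def)
  define gt where "gt s p = gl s (ct (fst p), snd p)" for s p
  have gtl: "M-lipschitz_on UNIV (gt s)" for s
  proof (rule lipschitz_onI[OF _ M0])
    fix p q :: "real \<times> (real ^ 'dx::{finite,linorder}) \<times> (real ^ 'dv::{finite,linorder})"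
    have "dist (gt s p) (gt s q) \<le> M * dist (ct (fst p), snd p) (ct (fst q), snd q)"
      unfolding gt_def by (rule lipschitz_onD[OF gl(1)]) auto
    also have "\<dots> \<le> M * dist p q"
    proof (rule mult_left_mono[OF _ M0])
      have "(dist (ct (fst p)) (ct (fst q)))\<^sup>2 \<le> (dist (fst p) (fst q))\<^sup>2"
        using ct(3) by (intro power_mono) (auto simp: dist_real_def)
      then show "dist (ct (fst p), snd p) (ct (fst q), snd q) \<le> dist p q"
        by (simp add: dist_prod_def)
    qed
    finally show "dist (gt s p) (gt s q) \<le> M * dist p q" .
  qed
  have gtb: "\<bar>gt s p\<bar> \<le> C" for s p by (simp add: gt_def gl(2))
  have gtg: "gt s (t, z) = g s (ct t, z)" for s t z using eq[of "(ct t, z)"] ct(1)[of t] by (simp add: gt_def)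
  have gts: "phase_supported (\<lambda>z. gt s (t, z))" for s t
    unfolding gtg by (rule supp_closure_phase_supported[OF supp[OF ct(1)]])
  have gtc: "continuous_on A (gt s)" for s A using lipschitz_on_continuous_on[OF gtl] continuous_on_subset by blast
  have gt_in: "gt s (t, z) = g s (t, z)" if "t \<in> {0..T}" for s t z using gtg ct(2)[OF that] by simp
  have gt_init: "gt s (t, z) = f0 s z" if "t \<le> 0" for s t z using gtg ct(4)[OF that] g0 by simp
  \<comment> \<open>The support condition gives zeros only for norm x > Rx. The points of the sphere
    are reached as limits of dilated points, by continuity.\<close>
  have outer: "gt s (t, x, v) = 0" if x: "norm x \<ge> Rx" for s t x v
  proof -
    have "(\<lambda>n. gt s (t, (1 + 1 / real (Suc n)) *\<^sub>R x, v)) \<longlonglongrightarrow> gt s (t, (1 + 0) *\<^sub>R x, v)"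
    proof (rule continuous_on_tendsto_compose[OF gtc[of UNIV]])
      have "(\<lambda>n. 1 / real (Suc n)) \<longlonglongrightarrow> 0" using LIMSEQ_inverse_real_of_nat by (simp add: inverse_eq_divide)
      then show "(\<lambda>n. (t, (1 + 1 / real (Suc n)) *\<^sub>R x, v)) \<longlonglongrightarrow> (t, (1 + 0) *\<^sub>R x, v)"
        by (intro tendsto_intros)
    qed auto
    moreover have "gt s (t, (1 + 1 / real (Suc n)) *\<^sub>R x, v) = 0" for n
    proof -
      have "Rx < norm ((1 + 1 / real (Suc n)) *\<^sub>R x)"
      proof -
        have "1 * Rx < (1 + 1 / real (Suc n)) * Rx" using R_pos by (intro mult_strict_right_mono) auto
        also have "\<dots> \<le> (1 + 1 / real (Suc n)) * norm x" using x by (intro mult_left_mono) auto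
        finally show ?thesis by simp
      qed
      then show ?thesis using gts[of s t] unfolding phase_supported_def by (meson not_less)
    qed
    ultimately show ?thesis by (simp add: LIMSEQ_const_iff)
  qed
  have "AE p in lborel. 0 < fst p \<and> fst p < T \<longrightarrow> grad (gt s) p \<bullet> drift gt Bt s p = 0" for s
  proof -
    have Gae: "AE p in lborel. p \<in> ?U \<longrightarrow> G s p = grad (gl s) p"
      using gl0(4)[of s] by (simp add: AE_lebesgue_on_iff_lborel[OF U(1)])
    have Bae: "AE p in lborel. (fst p, fst (snd (p :: real \<times> (real ^ 'dx::{finite,linorder}) \<times> (real ^ 'dv::{finite,linorder})))) \<in> {0<..<T} \<times> ball 0 Rx
        \<longrightarrow> B (fst p, fst (snd p)) = Bt (fst p, fst (snd p))"
      by (rule AE_lborel_Pair_fst_snd[OF BB])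
    show ?thesis
      using AE_lborel_strip[OF pde[of s]] Gae Bae rademacher[OF gtl[of s]] rademacher[OF gl(1)[of s]]
    proof eventually_elim
      case (elim p)
      show ?case
      proof
        assume t: "0 < fst p \<and> fst p < T"
        obtain t x v where p: "p = (t, x, v)" by (cases p)
        have pU: "p \<in> ?U" using t by (simp add: p)
        have t': "t \<in> {0..T}" using t by (simp add: p)
        have "(gl s has_derivative (\<lambda>h. grad (gt s) p \<bullet> h)) (at p)"
        proof (rule has_derivative_transform_within_open[OF elim(4) U(1) pU])
          show "gt s q = gl s q" if "q \<in> ?U" for q
            using that ct(2)[of "fst q"] by (auto simp: gt_def)
        qed
        then have Gp: "G s p = grad (gt s) p" using grad_eqI[OF elim(5)] elim(2) pU by simp
        obtain a b c where abc: "grad (gt s) p = (a, b, c)" by (cases "grad (gt s) p")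
        have ef: "efield g t x = EF gt (t, x)"
        proof -
          have "charge_density g t = charge_density gt t" using gt_in[OF t'] by (simp add: charge_density_def fun_eq_iff)
          then have "efield g t x = efield gt t x" by (simp add: efield_def)
          also have "\<dots> = EF gt (t, x)"
            by (rule efield_eq_EF[OF _ gts gtb]) (intro continuous_on_compose2[OF gtc[of UNIV]] continuous_intros, auto)
          finally show ?thesis .
        qed
        have "?P s p (G s p)" by (rule mp[OF elim(1) t])
        then have eqB: "(a, b, c) \<bullet> (1, mux s *\<^sub>R zpad v, muv s *\<^sub>R (zpad (EF gt (t, x)) + mux s *\<^sub>R (v \<otimes> B (t, x)))) = 0"
          by (simp only: Gp[unfolded p] abc[unfolded p] p prod.case pde_inner ef)
        have "(a, b, c) \<bullet> (1, mux s *\<^sub>R zpad v, muv s *\<^sub>R (zpad (EF gt (t, x)) + mux s *\<^sub>R (v \<otimes> Bt (t, x)))) = 0"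
        proof (cases "norm x < Rx")
          case True
          then have "B (t, x) = Bt (t, x)" using elim(3) t by (simp add: p)
          then show ?thesis using eqB by simp
        next
          case False
          have "c \<bullet> e = 0" for e
          proof -
            have "dyadic_quot (gt s) (0, 0, e) n p = 0" for n using outer[of x s t] False by (simp add: dyadic_quot_def p)
            then have "(\<lambda>n. dyadic_quot (gt s) (0, 0, e) n p) \<longlonglongrightarrow> 0" by simp
            from LIMSEQ_unique[OF dyadic_quot_tendsto[OF elim(4), of "(0, 0, e)"] this] show ?thesis by (simp add: abc)
          qed
          then show ?thesis using eqB by simp
        qed
        then show "grad (gt s) p \<bullet> drift gt Bt s p = 0" by (simp add: abc[unfolded p] drift_def p)
      qed
    qed
  qed
  then have "AE p in lborel. \<forall>s. 0 < fst p \<and> fst p < T \<longrightarrow> grad (gt s) p \<bullet> drift gt Bt s p = 0" by (rule species_AE)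
  then have fin: "AE p in lborel. 0 < fst p \<and> fst p < T \<longrightarrow> (\<forall>s. grad (gt s) p \<bullet> drift gt Bt s p = 0)"
    by eventually_elim blast
  show ?thesis by (rule that[OF gtl gtb gts gt_in gt_init fin])
qed

lemma strong_solution_unique:
  assumes T: "T > 0" and f: "strong_solution mux muv f0 T B f" and g: "strong_solution mux muv f0 T B g"
    and fs: "\<And>s t. t \<in> {0..T} \<Longrightarrow> supp (\<lambda>z. f s (t, z)) \<subseteq> closure (phase_domain Rx Rv)"
    and gs: "\<And>s t. t \<in> {0..T} \<Longrightarrow> supp (\<lambda>z. g s (t, z)) \<subseteq> closure (phase_domain Rx Rv)"
    and BB: "AE q in lborel. q \<in> {0<..<T} \<times> ball 0 Rx \<longrightarrow> B q = Bt q"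
    and Bt: "LB-lipschitz_on UNIV Bt" "\<And>p. norm (Bt p) \<le> CB" and t: "t \<in> {0..T}"
  shows "g s (t, z) = f s (t, z)"
proof -
  obtain M1 C1 ft where ft: "\<And>s. M1-lipschitz_on UNIV (ft s)" "\<And>s p. \<bar>ft s p\<bar> \<le> C1" "\<And>s t. phase_supported (\<lambda>z. ft s (t, z))"
    "\<And>s t z. t \<in> {0..T} \<Longrightarrow> ft s (t, z) = f s (t, z)" "\<And>s t z. t \<le> 0 \<Longrightarrow> ft s (t, z) = f0 s z"
    "AE p in lborel. 0 < fst p \<and> fst p < T \<longrightarrow> (\<forall>s. grad (ft s) p \<bullet> drift ft Bt s p = 0)"
    by (rule strong_solution_lipschitz[OF T f fs BB]) blast+
  obtain M2 C2 gt where gt: "\<And>s. M2-lipschitz_on UNIV (gt s)" "\<And>s p. \<bar>gt s p\<bar> \<le> C2" "\<And>s t. phase_supported (\<lambda>z. gt s (t, z))"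
    "\<And>s t z. t \<in> {0..T} \<Longrightarrow> gt s (t, z) = g s (t, z)" "\<And>s t z. t \<le> 0 \<Longrightarrow> gt s (t, z) = f0 s z"
    "AE p in lborel. 0 < fst p \<and> fst p < T \<longrightarrow> (\<forall>s. grad (gt s) p \<bullet> drift gt Bt s p = 0)"
    by (rule strong_solution_lipschitz[OF T g gs BB]) blast+
  have "gt s (t, z) = ft s (t, z)"
  proof (rule lipschitz_solutions_unique[where L="max M2 M1" and M="max C2 C1" and B=Bt])
    show "(max M2 M1)-lipschitz_on UNIV (gt s)" "(max M2 M1)-lipschitz_on UNIV (ft s)" for s
      using lipschitz_on_le[OF gt(1)] lipschitz_on_le[OF ft(1)] by auto
    show "\<bar>gt s p\<bar> \<le> max C2 C1" "\<bar>ft s p\<bar> \<le> max C2 C1" for s p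
      using order_trans[OF gt(2)] order_trans[OF ft(2)] by auto
    show "Bt \<in> borel_measurable borel" by (rule borel_measurable_continuous_onI[OF lipschitz_on_continuous_on[OF Bt(1)]])
    show "gt s (t, z) = ft s (t, z)" if "t \<le> 0" for s t z using ft(5)[OF that] gt(5)[OF that] by simp
  qed (use ft gt Bt t T in auto)
  then show ?thesis using ft(4)[OF t] gt(4)[OF t] by simp
qed

lemma strong_solution_exists:
  assumes ex: "vlasov_existence field_of Rx CK zpad zpad (\<otimes>) Rv mux muv f0 L0 F0 r0 s0 r1 s1 T Bt LB CB"
    and BB: "AE q in lborel. q \<in> {0<..<T} \<times> ball 0 Rx \<longrightarrow> B q = Bt q"
  shows "\<exists>f. strong_solution mux muv f0 T B f \<and> (\<forall>s. \<forall>t\<in>{0..T}. supp (\<lambda>z. f s (t, z)) \<subseteq> closure (phase_domain Rx Rv))"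
proof -
  interpret X: vlasov_existence field_of Rx CK zpad zpad "(\<otimes>)" Rv mux muv f0 L0 F0 r0 s0 r1 s1 T Bt LB CB by (rule ex)
  obtain E where E: "E \<in> X.fields" "X.Fmap E = E" by (rule X.field_fixed_point)
  define f where "f = X.sol E"
  let ?U = "{0<..<T} \<times> (UNIV :: ((real ^ 'dx::{finite,linorder}) \<times> (real ^ 'dv::{finite,linorder})) set)"
  have fl: "(L0 * exp (X.AA T - X.AA 0) * (1 + X.Mb))-lipschitz_on UNIV (f s)" for s unfolding f_def by (rule X.sol_lipschitz[OF E(1)])
  have fc: "continuous_on A (f s)" for s A using lipschitz_on_continuous_on[OF fl] continuous_on_subset by blast
  have fb: "\<bar>f s p\<bar> \<le> F0" for s p unfolding f_def by (rule X.sol_bd)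
  have fsup: "norm x \<le> r1 \<and> norm v \<le> s1" if "f s (t, x, v) \<noteq> 0" for s t x v using X.sol_support[OF E(1)] that unfolding f_def by blast
  have fs: "phase_supported (\<lambda>z. f s (t, z))" for s t
    unfolding phase_supported_def using fsup X.r1 X.s1 by fastforce
  have ef: "efield f t x = E (t, x)" for t x
  proof -
    have "efield f t x = EF f (t, x)"
      by (rule efield_eq_EF[OF _ fs fb]) (intro continuous_on_compose2[OF fc[of UNIV]] continuous_intros, auto)
    also have "\<dots> = X.Fmap E (t, x)" by (simp add: EF_def X.Fmap_def X.gd_def[abs_def] f_def)
    finally show ?thesis by (simp add: E(2))
  qed
  have "strong_solution mux muv f0 T B f"
    unfolding strong_solution_def
  proof (intro allI conjI exI)
    fix s
    show "continuous_on ({0..T} \<times> UNIV) (f s)" by (rule fc)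
    show "f s (0, x, v) = f0 s (x, v)" for x v unfolding f_def by (rule X.sol_initial[OF E(1)])
    show "has_W1inf_gradient ?U (f s) (grad (f s))"
      by (rule has_W1inf_gradient_lipschitz[OF _ fl fb]) (intro open_Times; simp)
    have Bae: "AE p in lborel. (fst p, fst (snd (p :: real \<times> (real ^ 'dx::{finite,linorder}) \<times> (real ^ 'dv::{finite,linorder})))) \<in> {0<..<T} \<times> ball 0 Rx
        \<longrightarrow> B (fst p, fst (snd p)) = Bt (fst p, fst (snd p))"
      by (rule AE_lborel_Pair_fst_snd[OF BB])
    show "AE z in lebesgue_on ({0..T} \<times> UNIV). case (z, grad (f s) z) of ((t, x, v), (dt_f, dx_f, dv_f)) \<Rightarrow>
        dt_f + mux s * (v \<bullet> zpad dx_f) + muv s * ((zpad (efield f t x) + mux s *\<^sub>R (v \<otimes> B (t, x))) \<bullet> dv_f) = 0"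
    proof (rule AE_lebesgue_on_strip)
      show "AE z in lborel. 0 < fst z \<and> fst z < T \<longrightarrow> (case (z, grad (f s) z) of ((t, x, v), (dt_f, dx_f, dv_f)) \<Rightarrow>
        dt_f + mux s * (v \<bullet> zpad dx_f) + muv s * ((zpad (efield f t x) + mux s *\<^sub>R (v \<otimes> B (t, x))) \<bullet> dv_f) = 0)"
        using Bae rademacher[OF fl[of s]]
      proof eventually_elim
        case (elim p)
        show ?case
        proof
          assume t: "0 < fst p \<and> fst p < T"
          obtain t x v where p: "p = (t, x, v)" by (cases p)
          obtain a b c where abc: "grad (f s) p = (a, b, c)" by (cases "grad (f s) p")
          have "grad (f s) p \<bullet> (1, mux s *\<^sub>R zpad v, muv s *\<^sub>R (zpad (efield f t x) + mux s *\<^sub>R (v \<otimes> B (t, x)))) = 0"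
          \<comment> \<open>Where the solution may be nonzero, the truncation is inactive and B
            equals its representative. Everywhere else the solution vanishes in a neighbourhood, and
            so does its gradient.\<close>
          proof (cases "norm x \<le> r1 \<and> norm v \<le> s1")
            case True
            have B: "B (t, x) = Bt (t, x)" using elim(1) t True X.r1 by (simp add: p)
            have tr: "tr v = v" using True X.s1 by (intro tr_id) simp
            have "X.ct t = t" using t by (intro X.ct(2)) (simp add: p)
            then have vf: "X.vf E s t (x, v) = (mux s *\<^sub>R zpad v, muv s *\<^sub>R (zpad (efield f t x) + mux s *\<^sub>R (v \<otimes> B (t, x))))"
              by (simp add: X.vf_def tr ef B)
            have "grad (f s) p \<bullet> (1, X.vf E s t (x, v)) = 0"
              by (rule X.sol_transport[OF E(1), of t s "\<lambda>h. grad (f s) p \<bullet> h" "(x, v)"])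
                (use t elim(2) in \<open>auto simp: p f_def\<close>)
            then show ?thesis by (simp only: vf)
          next
            case False
            have "grad (f s) p = 0"
            proof (rule grad_eq_0_if_locally_zero[OF elim(2)])
              let ?V = "{q :: real \<times> (real ^ 'dx::{finite,linorder}) \<times> (real ^ 'dv::{finite,linorder}). r1 < norm (fst (snd q))} \<union> {q. s1 < norm (snd (snd q))}"
              show "open ?V" by (intro open_Un open_Collect_less continuous_intros)
              show "p \<in> ?V" using False by (auto simp: p)
              show "f s q = 0" if q: "q \<in> ?V" for q
              proof (cases q)
                case (fields a b c)
                then show ?thesis using q fsup[of s a b c] by (auto simp: not_le[symmetric])
              qed
            qed
            then show ?thesis by simp
          qed
          then show "case (p, grad (f s) p) of ((t, x, v), (dt_f, dx_f, dv_f)) \<Rightarrow>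
            dt_f + mux s * (v \<bullet> zpad dx_f) + muv s * ((zpad (efield f t x) + mux s *\<^sub>R (v \<otimes> B (t, x))) \<bullet> dv_f) = 0"
            by (simp only: abc[unfolded p] p prod.case pde_inner)
        qed
      qed
    qed
  qed
  moreover have "supp (\<lambda>z. f s (t, z)) \<subseteq> closure (phase_domain Rx Rv)" for s t
    unfolding supp_def
  proof (rule closure_mono, rule subsetI)
    fix z :: "(real ^ 'dx::{finite,linorder}) \<times> (real ^ 'dv::{finite,linorder})" assume "z \<in> {z. f s (t, z) \<noteq> 0}"
    then show "z \<in> phase_domain Rx Rv" using fsup[of s t "fst z" "snd z"] X.r1 X.s1
      by (cases z) (auto simp: phase_domain_def)
  qed
  ultimately show ?thesis by blast
qed

end

theorem theorem3p5:
  fixes Rx Rv :: real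
    and mu_x mu_v :: "species \<Rightarrow> real"
    and f0 :: "species \<Rightarrow> (real ^ 'dx::{finite,linorder}) \<times> (real ^ 'dv::{finite,linorder}) \<Rightarrow> real"
  assumes dims: "(CARD('dx::{finite,linorder}), CARD('dv::{finite,linorder})) \<in> {(1, 2), (2, 2), (2, 3)}"
    and dim_B: "CARD('db::{finite,linorder}) = (if CARD('dv::{finite,linorder}) = 2 then 1 else 3)"
    and radii: "Rx > 0" "Rv > 0"
    and scaling_minus: "mu_x Minus = 1" "mu_v Minus = -1"
    and scaling_plus: "mu_x Plus > 0" "mu_v Plus > 0"
    and f0_C1: "\<And>s. C1 (f0 s)"
    and f0_nonneg: "\<And>s z. f0 s z \<ge> 0"
    and f0_compact: "\<And>s. compact (supp (f0 s))"
    and f0_supp: "\<And>s. supp (f0 s) \<subseteq> phase_domain Rx Rv"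
    and f0_neutral: "(LINT z|lborel. f0 Plus z - f0 Minus z) = 0"
  shows "\<exists>T>0. \<forall>B :: real \<times> (real ^ 'dx::{finite,linorder}) \<Rightarrow> (real ^ 'db::{finite,linorder}).
    (\<forall>i. W1inf ({0<..<T} \<times> ball 0 Rx) (\<lambda>z. B z $ i)) \<longrightarrow>
    (\<exists>f. (strong_solution mu_x mu_v f0 T B f \<and>
          (\<forall>s. \<forall>t\<in>{0..T}. supp (\<lambda>z. f s (t, z)) \<subseteq> closure (phase_domain Rx Rv))) \<and>
         (\<forall>g. strong_solution mu_x mu_v f0 T B g \<and>
              (\<forall>s. \<forall>t\<in>{0..T}. supp (\<lambda>z. g s (t, z)) \<subseteq> closure (phase_domain Rx Rv)) \<longrightarrow>
              (\<forall>s. \<forall>z\<in>{0..T} \<times> UNIV. g s z = f s z)))"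
proof -
  have dx: "CARD('dx::{finite,linorder}) = 1 \<or> CARD('dx::{finite,linorder}) = 2"
    and dv: "CARD('dv::{finite,linorder}) = 2 \<or> CARD('dv::{finite,linorder}) = 3" using dims by auto
  obtain CK where k: "field_kernel (field_of :: real ^ 'dx::{finite,linorder} \<Rightarrow> real ^ 'dx::{finite,linorder}) Rx CK"
    using field_kernel_field_of[OF dx radii(1)] by blast
  have "vlasov (field_of :: real ^ 'dx::{finite,linorder} \<Rightarrow> real ^ 'dx::{finite,linorder}) Rx CK
    (zpad :: real ^ 'dv::{finite,linorder} \<Rightarrow> real ^ 'dx::{finite,linorder}) zpad
    ((\<otimes>) :: real ^ 'dv::{finite,linorder} \<Rightarrow> real ^ 'db::{finite,linorder} \<Rightarrow> real ^ 'dv::{finite,linorder}) Rv"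
    unfolding vlasov_def vlasov_axioms_def
    by (intro conjI allI k linear_zpad norm_zpad bounded_bilinear_otimes inner_otimes_self[OF dv] radii)
  then interpret V: vlasov "field_of :: real ^ 'dx::{finite,linorder} \<Rightarrow> real ^ 'dx::{finite,linorder}" Rx CK
    "zpad :: real ^ 'dv::{finite,linorder} \<Rightarrow> real ^ 'dx::{finite,linorder}" zpad
    "(\<otimes>) :: real ^ 'dv::{finite,linorder} \<Rightarrow> real ^ 'db::{finite,linorder} \<Rightarrow> real ^ 'dv::{finite,linorder}" Rv mu_x mu_v .
  have "\<exists>L F r q. L-lipschitz_on UNIV (f0 s) \<and> (\<forall>z. \<bar>f0 s z\<bar> \<le> F) \<and> 0 \<le> r \<and> r < Rx \<and> 0 \<le> q \<and> q < Rv
      \<and> (\<forall>x v. f0 s (x, v) \<noteq> 0 \<longrightarrow> norm x \<le> r \<and> norm v \<le> q)" for s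
  proof -
    obtain L F where "L-lipschitz_on UNIV (f0 s)" "\<And>z. \<bar>f0 s z\<bar> \<le> F"
      using C1_compact_lipschitz[OF f0_C1 f0_compact] by blast
    moreover obtain r q where "0 \<le> r" "r < Rx" "0 \<le> q" "q < Rv" "\<And>x v. f0 s (x, v) \<noteq> 0 \<Longrightarrow> norm x \<le> r \<and> norm v \<le> q"
      using supp_strictly_inside[OF f0_compact f0_supp[unfolded phase_domain_def] radii] by metis
    ultimately show ?thesis by blast
  qed
  then obtain L F r q where data: "\<And>s. (L s)-lipschitz_on UNIV (f0 s)" "\<And>s z. \<bar>f0 s z\<bar> \<le> F s" "\<And>s. 0 \<le> r s" "\<And>s. r s < Rx"
      "\<And>s. 0 \<le> q s" "\<And>s. q s < Rv" "\<And>s x v. f0 s (x, v) \<noteq> 0 \<Longrightarrow> norm x \<le> r s \<and> norm v \<le> q s" by metis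
  define mx where "mx h = max (h Plus) (h Minus)" for h :: "species \<Rightarrow> real"
  have mx: "h s \<le> mx h" for h s by (cases s) (auto simp: mx_def)
  have r0: "0 \<le> mx r" "mx r < Rx" and q0: "0 \<le> mx q" "mx q < Rv" using data(3-6) by (auto simp: mx_def max_def)
  \<comment> \<open>Midpoints between the support of the datum and the boundary: one half of the gap
    is left for the motion up to time T, the other keeps the support strictly inside the
    domain.\<close>
  define r1 where "r1 = (mx r + Rx) / 2"
  define s1 where "s1 = (mx q + Rv) / 2"
  have r1: "mx r < r1" "r1 < Rx" and s1: "mx q < s1" "s1 < Rv" "0 \<le> s1" using r0 q0 by (auto simp: r1_def s1_def)
  \<comment> \<open>The largest possible rate of growth of sqrt (1 + |v|^2) along a
    characteristic.\<close>
  define E0 where "E0 = V.\<nu> * (CK * (2 * mx F * V.vol))"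
  have F0: "0 \<le> mx F" using data(2)[of Plus undefined] mx[of F Plus] by linarith
  have CK0: "CK \<ge> 0" using k by (simp add: field_kernel_def)
  have E0: "E0 \<ge> 0" using V.mu_le V.vol_nonneg F0 CK0 by (simp add: E0_def)
  define gap where "gap = sqrt (1 + s1\<^sup>2) - sqrt (1 + (mx q)\<^sup>2)"
  have "(mx q)\<^sup>2 < s1\<^sup>2" using s1 q0 by (intro power_strict_mono) auto
  then have gap: "gap > 0" by (simp add: gap_def)
  \<comment> \<open>Each quotient is an admissible change divided by a bound of its rate; the 1 in
    the denominators excludes division by 0. All quantities are fixed before \<open>B\<close> is
    introduced.\<close>
  define T where "T = min ((r1 - mx r) / (V.\<mu> * Rv + 1)) (gap / (E0 + 1))"
  have den: "V.\<mu> * Rv + 1 > 0" "E0 + 1 > 0" using V.mu_le radii E0 by (auto intro: add_nonneg_pos)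
  have T: "T > 0" using den gap r1 by (simp add: T_def)
  have T1: "mx r + T * V.\<mu> * Rv \<le> r1"
  proof -
    have "T * (V.\<mu> * Rv) \<le> T * (V.\<mu> * Rv + 1)" using T by (intro mult_left_mono) auto
    also have "\<dots> \<le> (r1 - mx r) / (V.\<mu> * Rv + 1) * (V.\<mu> * Rv + 1)" using den by (intro mult_right_mono) (auto simp: T_def)
    also have "\<dots> = r1 - mx r" using den by simp
    finally show ?thesis by (simp add: mult.assoc)
  qed
  have T2: "sqrt (1 + (mx q)\<^sup>2) + T * E0 \<le> sqrt (1 + s1\<^sup>2)"
  proof -
    have "T * E0 \<le> T * (E0 + 1)" using T by (intro mult_left_mono) auto
    also have "\<dots> \<le> gap / (E0 + 1) * (E0 + 1)" using den by (intro mult_right_mono) (auto simp: T_def)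
    also have "\<dots> = gap" using den by simp
    finally show ?thesis by (simp add: gap_def)
  qed
  show ?thesis
  proof (intro exI[of _ T] conjI allI impI T)
    fix B :: "real \<times> (real ^ 'dx::{finite,linorder}) \<Rightarrow> (real ^ 'db::{finite,linorder})"
    assume W: "\<forall>i. W1inf ({0<..<T} \<times> ball 0 Rx) (\<lambda>z. B z $ i)"
    have "open ({0<..<T} \<times> ball (0 :: real ^ 'dx::{finite,linorder}) Rx)" "convex ({0<..<T} \<times> ball (0 :: real ^ 'dx::{finite,linorder}) Rx)"
      by (intro open_Times convex_Times; simp)+
    then obtain LB CB Bt where Bt: "LB-lipschitz_on UNIV Bt" "\<And>p. norm (Bt p) \<le> CB"
      "AE p in lborel. p \<in> {0<..<T} \<times> ball 0 Rx \<longrightarrow> B p = Bt p"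
      by (rule W1inf_vector_lipschitz) (use W in auto)
    interpret P: vlasov_poisson Rx CK Rv mu_x mu_v f0 Bt by unfold_locales (rule dx)
    have "vlasov_existence field_of Rx CK zpad zpad (\<otimes>) Rv mu_x mu_v f0 (mx L) (mx F) (mx r) (mx q) r1 s1 T Bt LB CB"
    proof (unfold_locales)
      show "(mx L)-lipschitz_on UNIV (f0 s)" for s by (rule lipschitz_on_le[OF data(1) mx])
      show "\<bar>f0 s z\<bar> \<le> mx F" for s z by (rule order_trans[OF data(2) mx])
      show "norm x \<le> mx r \<and> norm v \<le> mx q" if "f0 s (x, v) \<noteq> 0" for s x v
        using data(7)[OF that] mx[of r s] mx[of q s] by auto
      show "sqrt (1 + (mx q)\<^sup>2) + T * (V.\<nu> * (CK * (2 * mx F * V.vol))) \<le> sqrt (1 + s1\<^sup>2)"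
        using T2 by (simp add: E0_def)
    qed (use r1 s1 q0 T T1 Bt in auto)
    from P.strong_solution_exists[OF this Bt(3)]
    obtain f where f: "strong_solution mu_x mu_v f0 T B f" "\<And>s t. t \<in> {0..T} \<Longrightarrow> supp (\<lambda>z. f s (t, z)) \<subseteq> closure (phase_domain Rx Rv)"
      by blast
    show "\<exists>f. (strong_solution mu_x mu_v f0 T B f \<and>
          (\<forall>s. \<forall>t\<in>{0..T}. supp (\<lambda>z. f s (t, z)) \<subseteq> closure (phase_domain Rx Rv))) \<and>
         (\<forall>g. strong_solution mu_x mu_v f0 T B g \<and>
              (\<forall>s. \<forall>t\<in>{0..T}. supp (\<lambda>z. g s (t, z)) \<subseteq> closure (phase_domain Rx Rv)) \<longrightarrow>
              (\<forall>s. \<forall>z\<in>{0..T} \<times> UNIV. g s z = f s z))"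
    proof (intro exI[of _ f] conjI allI impI ballI)
      fix g s and z :: "real \<times> (real ^ 'dx::{finite,linorder}) \<times> (real ^ 'dv::{finite,linorder})"
      assume g: "strong_solution mu_x mu_v f0 T B g \<and> (\<forall>s. \<forall>t\<in>{0..T}. supp (\<lambda>z. g s (t, z)) \<subseteq> closure (phase_domain Rx Rv))"
        and z: "z \<in> {0..T} \<times> UNIV"
      have "g s (fst z, snd z) = f s (fst z, snd z)"
        by (rule P.strong_solution_unique[OF T f(1) _ f(2) _ Bt(3,1,2)]) (use g z in auto)
      then show "g s z = f s z" by simp
    qed (use f in auto)
  qed
qed

end
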